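(* Let $M$ be an $m$-dimensional Hadamard manifold with sectional curvature satisfying $K\le-c^2$, for some constant $c\ge0$. Let $\lambda:M\to\mathbb R$ be a nonnegative $C^1$ function satisfying $$|\nabla\lambda|\le\frac{(m-1)c}{p}\lambda,$$ for some constant $p\ge1$. Then either $\lambda\equiv0$ or the rate of growth of $\int_M\lambda^s$ satisfies, for all $q\in M$, $$\liminf_{\mu\to\infty}\frac{\mu^{-1}}{\lambda^s(q)}\int_{B_\mu(q)}\lambda^s>0,$$ for all $1\le s\le p$. Moreover, this limit (the displayed $\liminf$) does not depend on $q$. In particular, either $\lambda\equiv0$ or the integral $\int_M\lambda^s$ is infinite, for all $1\le s\le p$.
   Context: A Hadamard manifold is a complete simply-connected Riemannian manifold of nonpositive sectional curvature. $\nabla\lambda$ is the gradient of $\lambda$; $B_\mu(q)$ is the geodesic ball of $M$ of radius $\mu$ centered at $q$; integrals are with respect to the Riemannian measure of $M$.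
   Formalization: Independence of q is stated for the liminf of μ^{-1}∫_{B_μ(q)} λ^s without the factor 1/λ^s(q); with that factor it is false, e.g. on the hyperbolic plane with c=p=s=1, λ=exp(-√(1+r²)), where the displayed liminf is π/λ(q). *)

theory Defs
  imports "HOL-Analysis.Analysis"
begin

section \<open>Smooth functions on open subsets of Euclidean space\<close>

definition partial_deriv ::
  "'n::finite \<Rightarrow> (real^'n \<Rightarrow> 'b::real_normed_vector) \<Rightarrow> real^'n \<Rightarrow> 'b" where
  "partial_deriv i f x = frechet_derivative f (at x) (axis i 1)"

text \<open>Only meaningful for open \<open>S\<close>.\<close>
primrec Ck_on ::
  "nat \<Rightarrow> (real^'n::finite) set \<Rightarrow> (real^'n \<Rightarrow> 'b::real_normed_vector) \<Rightarrow> bool" where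
  "Ck_on 0 S f \<longleftrightarrow> continuous_on S f"
| "Ck_on (Suc k) S f \<longleftrightarrow>
     (\<forall>x\<in>S. f differentiable (at x)) \<and> (\<forall>i. Ck_on k S (partial_deriv i f))"

definition smooth_fun_on ::
  "(real^'n::finite) set \<Rightarrow> (real^'n \<Rightarrow> 'b::real_normed_vector) \<Rightarrow> bool" where
  "smooth_fun_on S f \<longleftrightarrow> (\<forall>k. Ck_on k S f)"


section \<open>Riemannian manifolds\<close>

text \<open>
  The underlying manifold is the whole type \<open>'a\<close>, and its dimension is \<open>CARD('n)\<close> (so at
  least 1). A chart is its domain together with a coordinate map, whose values outside the domain
  are irrelevant. The atlas need not be maximal. The Riemannian metric is given classically, by
  its coefficient matrix in each chart of the atlas: \<open>gmat M C x\<close> is the matrix of the metric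
  at the point with coordinates \<open>x\<close>, so that it is a function on the image of the chart.
\<close>

type_synonym ('a, 'n) chart = "'a set \<times> ('a \<Rightarrow> real^'n)"

record ('a, 'n::finite) riemannian =
  atlas :: "('a, 'n) chart set"
  gmat :: "('a, 'n) chart \<Rightarrow> real^'n \<Rightarrow> real^'n^'n"

abbreviation chart_dom :: "('a, 'n::finite) chart \<Rightarrow> 'a set" where
  "chart_dom C \<equiv> fst C"

abbreviation chart_map :: "('a, 'n::finite) chart \<Rightarrow> 'a \<Rightarrow> real^'n" where
  "chart_map C \<equiv> snd C"

definition chart_img :: "('a, 'n::finite) chart \<Rightarrow> (real^'n) set" where
  "chart_img C = chart_map C ` chart_dom C"

definition chart_inv :: "('a, 'n::finite) chart \<Rightarrow> real^'n \<Rightarrow> 'a" where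
  "chart_inv C = inv_into (chart_dom C) (chart_map C)"

definition is_chart :: "('a::topological_space, 'n::finite) chart \<Rightarrow> bool" where
  "is_chart C \<longleftrightarrow> open (chart_dom C) \<and> open (chart_img C) \<and>
     homeomorphism (chart_dom C) (chart_img C) (chart_map C) (chart_inv C)"

definition transition :: "('a, 'n::finite) chart \<Rightarrow> ('a, 'n) chart \<Rightarrow> real^'n \<Rightarrow> real^'n" where
  "transition C D = chart_map D \<circ> chart_inv C"

definition ginner ::
  "('a, 'n::finite) riemannian \<Rightarrow> ('a, 'n) chart \<Rightarrow> real^'n \<Rightarrow> real^'n \<Rightarrow> real^'n \<Rightarrow> real" where
  "ginner M C x v w = v \<bullet> (gmat M C x *v w)"

definition riemannian_manifold ::
  "('a::{t2_space,second_countable_topology}, 'n::finite) riemannian \<Rightarrow> bool" where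
  "riemannian_manifold M \<longleftrightarrow>
     (\<forall>C\<in>atlas M. is_chart C) \<and>
     (\<Union>C\<in>atlas M. chart_dom C) = UNIV \<and>
     (\<forall>C\<in>atlas M. \<forall>D\<in>atlas M.
        smooth_fun_on (chart_map C ` (chart_dom C \<inter> chart_dom D)) (transition C D)) \<and>
     (\<forall>C\<in>atlas M. smooth_fun_on (chart_img C) (gmat M C)) \<and>
     (\<forall>C\<in>atlas M. \<forall>x\<in>chart_img C.
        (\<forall>v w. ginner M C x v w = ginner M C x w v) \<and>
        (\<forall>v. v \<noteq> 0 \<longrightarrow> ginner M C x v v > 0)) \<and>
     (\<forall>C\<in>atlas M. \<forall>D\<in>atlas M. \<forall>x\<in>chart_map C ` (chart_dom C \<inter> chart_dom D). \<forall>v w.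
        ginner M C x v w =
        ginner M D (transition C D x)
          (frechet_derivative (transition C D) (at x) v)
          (frechet_derivative (transition C D) (at x) w))"

text \<open>An arbitrary chart around a point, used below for notions that are independent of
  the choice of coordinates.\<close>
definition chart_at :: "('a, 'n::finite) riemannian \<Rightarrow> 'a \<Rightarrow> ('a, 'n) chart" where
  "chart_at M q = (SOME C. C \<in> atlas M \<and> q \<in> chart_dom C)"


section \<open>Riemannian distance and geodesic balls\<close>

definition piecewise_C1_curve ::
  "('a::topological_space, 'n::finite) riemannian \<Rightarrow> (real \<Rightarrow> 'a) \<Rightarrow> bool" where
  "piecewise_C1_curve M \<gamma> \<longleftrightarrow> path \<gamma> \<and>
     (\<exists>S. finite S \<and>
       (\<forall>C\<in>atlas M. \<forall>a b. 0 \<le> a \<and> a < b \<and> b \<le> 1 \<and> {a<..<b} \<inter> S = {} \<and> \<gamma> ` {a..b} \<subseteq> chart_dom C \<longrightarrow>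
          (\<exists>D. continuous_on {a..b} D \<and>
             (\<forall>t\<in>{a..b}. ((chart_map C \<circ> \<gamma>) has_vector_derivative D t) (at t within {a..b})))))"

text \<open>The velocity is not defined at the finitely many break points, which do not contribute to
  the length.\<close>
definition speed ::
  "('a, 'n::finite) riemannian \<Rightarrow> (real \<Rightarrow> 'a) \<Rightarrow> real \<Rightarrow> real" where
  "speed M \<gamma> t =
     (let C = chart_at M (\<gamma> t); v = vector_derivative (chart_map C \<circ> \<gamma>) (at t)
      in sqrt (ginner M C (chart_map C (\<gamma> t)) v v))"

definition curve_length ::
  "('a, 'n::finite) riemannian \<Rightarrow> (real \<Rightarrow> 'a) \<Rightarrow> ennreal" where
  "curve_length M \<gamma> = (\<integral>\<^sup>+ t\<in>{0..1}. ennreal (speed M \<gamma> t) \<partial>lborel)"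

definition rdist ::
  "('a::topological_space, 'n::finite) riemannian \<Rightarrow> 'a \<Rightarrow> 'a \<Rightarrow> real" where
  "rdist M x y = enn2real (INF \<gamma> \<in> {\<gamma>. piecewise_C1_curve M \<gamma> \<and> pathstart \<gamma> = x \<and> pathfinish \<gamma> = y}.
     curve_length M \<gamma>)"

definition gball ::
  "('a::topological_space, 'n::finite) riemannian \<Rightarrow> 'a \<Rightarrow> real \<Rightarrow> 'a set" where
  "gball M q r = {x. rdist M q x < r}"

definition complete_riemannian ::
  "('a::topological_space, 'n::finite) riemannian \<Rightarrow> bool" where
  "complete_riemannian M \<longleftrightarrow> Metric_space.mcomplete UNIV (rdist M)"


section \<open>Riemannian measure\<close>

text \<open>The unique Borel measure that has density \<open>sqrt (det g)\<close> with respect to Lebesgue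
  measure in every chart.\<close>
definition riemannian_measure ::
  "('a::topological_space, 'n::finite) riemannian \<Rightarrow> 'a measure" where
  "riemannian_measure M = (THE \<nu>. sets \<nu> = sets borel \<and>
     (\<forall>C\<in>atlas M. \<forall>A\<in>sets borel. A \<subseteq> chart_dom C \<longrightarrow>
        emeasure \<nu> A =
          (\<integral>\<^sup>+ x \<in> chart_map C ` A. ennreal (sqrt (det (gmat M C x))) \<partial>lborel)))"


section \<open>Gradient\<close>

definition C1_function ::
  "('a, 'n::finite) riemannian \<Rightarrow> ('a \<Rightarrow> real) \<Rightarrow> bool" where
  "C1_function M f \<longleftrightarrow> (\<forall>C\<in>atlas M. Ck_on 1 (chart_img C) (f \<circ> chart_inv C))"

text \<open>The components \<open>g\<^sup>i\<^sup>j \<partial>\<^sub>j f\<close> of the gradient in the chart \<open>C\<close>, at the point with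
  coordinates \<open>x\<close>.\<close>
definition gradient ::
  "('a, 'n::finite) riemannian \<Rightarrow> ('a, 'n) chart \<Rightarrow> ('a \<Rightarrow> real) \<Rightarrow> real^'n \<Rightarrow> real^'n" where
  "gradient M C f x =
     matrix_inv (gmat M C x) *v (\<chi> j. partial_deriv j (f \<circ> chart_inv C) x)"

definition gradient_norm ::
  "('a, 'n::finite) riemannian \<Rightarrow> ('a \<Rightarrow> real) \<Rightarrow> 'a \<Rightarrow> real" where
  "gradient_norm M f q =
     (let C = chart_at M q; x = chart_map C q; v = gradient M C f x
      in sqrt (ginner M C x v v))"


section \<open>Sectional curvature\<close>

text \<open>\<open>christoffel M C k i j\<close> is the component along \<open>\<partial>\<^sub>k\<close> of \<open>\<nabla>\<^bsub>\<partial>i\<^esub> \<partial>\<^sub>j\<close>.\<close>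
definition christoffel ::
  "('a, 'n::finite) riemannian \<Rightarrow> ('a, 'n) chart \<Rightarrow> 'n \<Rightarrow> 'n \<Rightarrow> 'n \<Rightarrow> real^'n \<Rightarrow> real" where
  "christoffel M C k i j x =
     (\<Sum>l\<in>UNIV. matrix_inv (gmat M C x) $ k $ l *
        (partial_deriv i (\<lambda>y. gmat M C y $ j $ l) x
         + partial_deriv j (\<lambda>y. gmat M C y $ i $ l) x
         - partial_deriv l (\<lambda>y. gmat M C y $ i $ j) x)) / 2"

text \<open>\<open>riemann_coeff M C l i j k\<close> is the component along \<open>\<partial>\<^sub>l\<close> of \<open>R(\<partial>\<^sub>i, \<partial>\<^sub>j) \<partial>\<^sub>k\<close>, with the sign
  convention \<open>R(X, Y) Z = \<nabla>\<^sub>X \<nabla>\<^sub>Y Z - \<nabla>\<^sub>Y \<nabla>\<^sub>X Z - \<nabla>\<^bsub>[X, Y]\<^esub> Z\<close>.\<close>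
definition riemann_coeff ::
  "('a, 'n::finite) riemannian \<Rightarrow> ('a, 'n) chart \<Rightarrow> 'n \<Rightarrow> 'n \<Rightarrow> 'n \<Rightarrow> 'n \<Rightarrow> real^'n \<Rightarrow> real" where
  "riemann_coeff M C l i j k x =
     partial_deriv i (christoffel M C l j k) x - partial_deriv j (christoffel M C l i k) x
     + (\<Sum>m\<in>UNIV. christoffel M C m j k x * christoffel M C l i m x
                 - christoffel M C m i k x * christoffel M C l j m x)"

definition riemann_tensor ::
  "('a, 'n::finite) riemannian \<Rightarrow> ('a, 'n) chart \<Rightarrow> real^'n \<Rightarrow> real^'n \<Rightarrow> real^'n \<Rightarrow> real^'n \<Rightarrow> real^'n" where
  "riemann_tensor M C x u v w =
     (\<chi> l. \<Sum>i\<in>UNIV. \<Sum>j\<in>UNIV. \<Sum>k\<in>UNIV. riemann_coeff M C l i j k x * u $ i * v $ j * w $ k)"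

definition sectional_curvature ::
  "('a, 'n::finite) riemannian \<Rightarrow> ('a, 'n) chart \<Rightarrow> real^'n \<Rightarrow> real^'n \<Rightarrow> real^'n \<Rightarrow> real" where
  "sectional_curvature M C x u v =
     ginner M C x (riemann_tensor M C x u v v) u /
     (ginner M C x u u * ginner M C x v v - (ginner M C x u v)\<^sup>2)"

text \<open>Vacuous in dimension 1, where there are no tangent planes.\<close>
definition sectional_curvature_le ::
  "('a, 'n::finite) riemannian \<Rightarrow> real \<Rightarrow> bool" where
  "sectional_curvature_le M \<kappa> \<longleftrightarrow>
     (\<forall>C\<in>atlas M. \<forall>x\<in>chart_img C. \<forall>u v. u \<noteq> v \<and> independent {u, v} \<longrightarrow>
        sectional_curvature M C x u v \<le> \<kappa>)"

definition hadamard_manifold ::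
  "('a::{t2_space,second_countable_topology}, 'n::finite) riemannian \<Rightarrow> bool" where
  "hadamard_manifold M \<longleftrightarrow>
     riemannian_manifold M \<and> complete_riemannian M \<and> simply_connected (UNIV :: 'a set) \<and>
     sectional_curvature_le M 0"

end

(*
  Let E be the exponential map at q, precomposed with a linear isometry from R^m to the tangent space
  at q. Along a ray t theta, a Jacobi field splits by the Gauss lemma into a radial part that grows
  like t and an orthogonal part Y. From K <= -c^2 and Cauchy-Schwarz, h = <Y', Y> satisfies
  h^2 <= |Y|^2 (h' - c^2 |Y|^2), so |Y| grows at least by the factor exp(c (t1 - t0)) between t0 and t1,
  and |Y| >= t |Y'(0)|. Hence E expands lengths; as M is complete and simply connected, paths and
  homotopies lift along E, which is therefore a diffeomorphism.
  Its Jacobian J satisfies t1^(m-1) J(t1 theta) >= exp((m-1) c (t1 - t0)) t0^(m-1) J(t0 theta),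
  whereas lambda^s decays along a ray at most by exp(-(m-1) c (t1 - t0)), since s <= p. So
  t^(m-1) J lambda^s is nondecreasing along rays, and its integral over the ball of radius mu is at
  least mu times the integral over the unit ball.
*)
theory Submission
 imports Defs
begin

section \<open>Calculus on open subsets of Euclidean space\<close>

text \<open>Jacobi fields arise by differentiating the geodesic flow in its initial data, so the
  flow is first shown to depend in a C^1 way on them, and completeness continues whole families of
  geodesics, not single ones. Path lifting along E rests on expansion: a coordinate segment has
  finite length, so its lift is Lipschitz and converges in R^m; simple connectedness then gives
  injectivity. The Jacobians at t0 theta and t1 theta are compared without following a basis of
  Jacobi fields: the length estimates say that a linear map of known determinant is a contraction
  between the two pulled-back inner products, and a contraction has determinant at most 1 in
  absolute value. Integration along rays is replaced by the substitution of a xi for xi: Lebesgue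
  measure contributes a^m, the monotonicity along rays costs a^(m-1), and the factor a that remains
  is the linear growth. A zero of lambda spreads along all rays that start from it, so lambda is
  either identically 0 or positive everywhere. The growth rate is the same at q and q' because the
  balls of radius r about one point lie in those of radius r + d(q, q') about the other.\<close>

lemma Ck_on_Suc0:
 "Ck_on (Suc 0) S f \<longleftrightarrow> (\<forall>x\<in>S. f differentiable at x) \<and> (\<forall>i. continuous_on S (partial_deriv i f))"
 by simp

lemma frechet_derivative_partial:
 fixes f :: "real^'n \<Rightarrow> 'b::real_normed_vector"
 assumes "f differentiable at x"
 shows "frechet_derivative f (at x) h = (\<Sum>i\<in>UNIV. h $ i *\<^sub>R partial_deriv i f x)"
proof -
 interpret bounded_linear "frechet_derivative f (at x)"
  using assms[unfolded frechet_derivative_works] by (rule has_derivative_bounded_linear)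
 have "h = (\<Sum>i\<in>UNIV. h $ i *\<^sub>R axis i 1)"
  by (simp add: vec_eq_iff axis_def if_distrib cong: if_cong)
 then have "frechet_derivative f (at x) h = frechet_derivative f (at x) (\<Sum>i\<in>UNIV. h $ i *\<^sub>R axis i 1)" by simp
 then show ?thesis by (simp add: sum scaleR partial_deriv_def)
qed

lemma has_derivative_partial:
 fixes f :: "real^'n \<Rightarrow> 'b::real_normed_vector"
 assumes "f differentiable at x"
 shows "(f has_derivative (\<lambda>h. \<Sum>i\<in>UNIV. h $ i *\<^sub>R partial_deriv i f x)) (at x)"
proof -
 have "frechet_derivative f (at x) = (\<lambda>h. \<Sum>i\<in>UNIV. h $ i *\<^sub>R partial_deriv i f x)"
  using frechet_derivative_partial[OF assms] by blast
 then show ?thesis using assms unfolding frechet_derivative_works by simp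
qed

lemma partial_deriv_eq:
 assumes "(f has_derivative f') (at x)"
 shows "partial_deriv i f x = f' (axis i 1)"
 using frechet_derivative_at[OF assms] by (simp add: partial_deriv_def)

lemma Ck_on_cong:
 assumes "open S" "\<And>x. x \<in> S \<Longrightarrow> f x = g x" "Ck_on k S f"
 shows "Ck_on k S g"
 using assms(2,3)
proof (induction k arbitrary: f g)
 case 0
 then show ?case using continuous_on_eq by auto
next
 case (Suc k)
 have d: "(g has_derivative f') (at x)" if "x \<in> S" "(f has_derivative f') (at x)" for x f'
  using has_derivative_transform_within_open[OF that(2) assms(1) that(1)] Suc.prems(1) by auto
 have "partial_deriv i f x = partial_deriv i g x" if "x \<in> S" for x i
  using Suc.prems(2) that d partial_deriv_eq unfolding differentiable_def by (metis Ck_on.simps(2) differentiable_def)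
 then show ?case using Suc.IH Suc.prems d unfolding Ck_on.simps differentiable_def by metis
qed

text \<open>Passes smoothness from the matrix-valued \<open>gmat\<close> to its entries, and from
  vector-valued maps to their components.\<close>

lemma Ck_on_bounded_linear:
 assumes "bounded_linear L" "open S" "Ck_on k S f"
 shows "Ck_on k S (\<lambda>x. L (f x))"
 using assms(3)
proof (induction k arbitrary: f)
 case 0
 then show ?case using bounded_linear.continuous_on[OF assms(1)] by auto
next
 case (Suc k)
 have d: "((\<lambda>x. L (f x)) has_derivative (\<lambda>h. L (f' h))) (at x)" if "(f has_derivative f') (at x)" for x f'
  using bounded_linear.has_derivative[OF assms(1) that] .
 have "partial_deriv i (\<lambda>x. L (f x)) x = L (partial_deriv i f x)" if "x \<in> S" for x i
  using Suc.prems that d partial_deriv_eq unfolding Ck_on.simps differentiable_def by metis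
 moreover have "Ck_on k S (\<lambda>x. L (partial_deriv i f x))" for i using Suc by auto
 ultimately have "Ck_on k S (partial_deriv i (\<lambda>x. L (f x)))" for i
  using Ck_on_cong[OF assms(2), of "\<lambda>x. L (partial_deriv i f x)"] by metis
 then show ?case using Suc.prems d unfolding Ck_on.simps differentiable_def by blast
qed

lemma Ck_on_continuous: "Ck_on k S f \<Longrightarrow> continuous_on S f"
 by (cases k) (auto intro!: continuous_at_imp_continuous_on differentiable_imp_continuous_within)

text \<open>Lets the closure properties below be proved by exhibiting a derivative: its values on
  the coordinate vectors are the partial derivatives.\<close>

lemma C1_on_intro:
 fixes f :: "real^'n \<Rightarrow> 'b::real_normed_vector"
 assumes "\<And>x. x \<in> S \<Longrightarrow> (f has_derivative f' x) (at x)" "\<And>i. continuous_on S (\<lambda>x. f' x (axis i 1))"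
 shows "Ck_on (Suc 0) S f"
proof -
 have "continuous_on S (partial_deriv i f)" for i
  using assms(2)[of i] by (rule continuous_on_eq) (metis assms(1) partial_deriv_eq)
 then show ?thesis using assms(1) unfolding Ck_on_Suc0 differentiable_def by blast
qed

lemma C1_onD:
 assumes "Ck_on (Suc 0) S f"
 shows "\<And>x. x \<in> S \<Longrightarrow> (f has_derivative frechet_derivative f (at x)) (at x)"
  "\<And>i. continuous_on S (\<lambda>x. frechet_derivative f (at x) (axis i 1))"
 using assms by (auto simp: frechet_derivative_works[symmetric] partial_deriv_def[abs_def])

section \<open>Closure properties of C^1 functions\<close>

lemma C1_on_const: "Ck_on (Suc 0) S (\<lambda>x. c)"
 by (rule C1_on_intro[of _ _ "\<lambda>x h. 0"]) auto

lemma C1_on_add: "Ck_on (Suc 0) S f \<Longrightarrow> Ck_on (Suc 0) S g \<Longrightarrow> Ck_on (Suc 0) S (\<lambda>x. f x + g x)"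
 by (rule C1_on_intro[of _ _ "\<lambda>x h. frechet_derivative f (at x) h + frechet_derivative g (at x) h"])
   (intro has_derivative_add continuous_intros C1_onD; assumption)+

lemma C1_on_diff: "Ck_on (Suc 0) S f \<Longrightarrow> Ck_on (Suc 0) S g \<Longrightarrow> Ck_on (Suc 0) S (\<lambda>x. f x - g x)"
 by (rule C1_on_intro[of _ _ "\<lambda>x h. frechet_derivative f (at x) h - frechet_derivative g (at x) h"])
   (intro has_derivative_diff continuous_intros C1_onD; assumption)+

lemma C1_on_mult:
 fixes f g :: "real^'n \<Rightarrow> real"
 assumes "Ck_on (Suc 0) S f" "Ck_on (Suc 0) S g"
 shows "Ck_on (Suc 0) S (\<lambda>x. f x * g x)"
proof (rule C1_on_intro[of _ _ "\<lambda>x h. f x * frechet_derivative g (at x) h + frechet_derivative f (at x) h * g x"])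
 show "((\<lambda>x. f x * g x) has_derivative (\<lambda>h. f x * frechet_derivative g (at x) h + frechet_derivative f (at x) h * g x)) (at x)" if "x \<in> S" for x
  by (rule has_derivative_mult) (rule C1_onD(1)[OF assms(1) that] C1_onD(1)[OF assms(2) that])+
 show "continuous_on S (\<lambda>x. f x * frechet_derivative g (at x) (axis i 1) + frechet_derivative f (at x) (axis i 1) * g x)" for i
  using C1_onD(2)[OF assms(1)] C1_onD(2)[OF assms(2)] Ck_on_continuous[OF assms(1)] Ck_on_continuous[OF assms(2)]
  by (intro continuous_intros)
qed

lemma C1_on_inverse:
 fixes f :: "real^'n \<Rightarrow> real"
 assumes "Ck_on (Suc 0) S f" "\<And>x. x \<in> S \<Longrightarrow> f x \<noteq> 0"
 shows "Ck_on (Suc 0) S (\<lambda>x. inverse (f x))"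
proof (rule C1_on_intro[of _ _ "\<lambda>x h. - (inverse (f x) * frechet_derivative f (at x) h * inverse (f x))"])
 show "((\<lambda>x. inverse (f x)) has_derivative (\<lambda>h. - (inverse (f x) * frechet_derivative f (at x) h * inverse (f x)))) (at x)" if "x \<in> S" for x
  by (rule Deriv.has_derivative_inverse[OF assms(2)[OF that] C1_onD(1)[OF assms(1) that]])
 show "continuous_on S (\<lambda>x. - (inverse (f x) * frechet_derivative f (at x) (axis i 1) * inverse (f x)))" for i
  using C1_onD(2)[OF assms(1)] Ck_on_continuous[OF assms(1)] assms(2) by (intro continuous_intros) auto
qed

lemma C1_on_sum:
 "finite I \<Longrightarrow> (\<And>i. i \<in> I \<Longrightarrow> Ck_on (Suc 0) S (f i)) \<Longrightarrow> Ck_on (Suc 0) S (\<lambda>x. \<Sum>i\<in>I. f i x)"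
 by (induction I rule: finite_induct) (auto intro!: C1_on_const C1_on_add simp del: Ck_on.simps)

lemma C1_on_prod:
 fixes f :: "'i \<Rightarrow> real^'n \<Rightarrow> real"
 shows "finite I \<Longrightarrow> (\<And>i. i \<in> I \<Longrightarrow> Ck_on (Suc 0) S (f i)) \<Longrightarrow> Ck_on (Suc 0) S (\<lambda>x. \<Prod>i\<in>I. f i x)"
 by (induction I rule: finite_induct) (auto intro!: C1_on_const C1_on_mult simp del: Ck_on.simps)

lemma C1_on_det:
 fixes A :: "real^'n::finite \<Rightarrow> real^'m::finite^'m"
 assumes "\<And>i j. Ck_on (Suc 0) S (\<lambda>x. A x $ i $ j)"
 shows "Ck_on (Suc 0) S (\<lambda>x. det (A x))"
 unfolding det_def
 by (intro C1_on_sum C1_on_mult C1_on_prod C1_on_const assms) (auto simp: finite_permutations)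

section \<open>Inverses of matrices that depend on a parameter\<close>

lemma matrix_mul_matrix_inv:
 fixes A :: "real^'m::finite^'m"
 assumes "det A \<noteq> 0"
 shows "A ** matrix_inv A = mat 1" "matrix_inv A ** A = mat 1"
 using someI_ex[of "\<lambda>A'. A ** A' = mat 1 \<and> A' ** A = mat 1"] assms
 by (auto simp: matrix_inv_def invertible_det_nz[symmetric] invertible_def)

text \<open>Cramer's rule shows the entries of the inverse as quotients of determinants, hence as
  rational functions of the entries; the C^1 regularity of the Christoffel symbols comes from
  this.\<close>

lemma matrix_inv_cramer:
 fixes A :: "real^'m::finite^'m"
 assumes "det A \<noteq> 0"
 shows "matrix_inv A $ k $ l = det (\<chi> i j. if j = k then axis l 1 $ i else A $ i $ j) / det A"
proof -
 have "A *v (matrix_inv A *v axis l 1) = axis l 1"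
  using assms by (simp add: matrix_vector_mul_assoc matrix_mul_matrix_inv)
 then have "matrix_inv A *v axis l 1 = (\<chi> k. det (\<chi> i j. if j = k then axis l 1 $ i else A $ i $ j) / det A)"
  using cramer[OF assms] by blast
 moreover have "(matrix_inv A *v axis l 1) $ k = matrix_inv A $ k $ l"
  by (simp add: matrix_vector_mult_basis column_def)
 ultimately show ?thesis by simp
qed

lemma C1_on_matrix_inv:
 fixes A :: "real^'n::finite \<Rightarrow> real^'m::finite^'m"
 assumes S: "open S" and A: "\<And>i j. Ck_on (Suc 0) S (\<lambda>x. A x $ i $ j)" and nz: "\<And>x. x \<in> S \<Longrightarrow> det (A x) \<noteq> 0"
 shows "Ck_on (Suc 0) S (\<lambda>x. matrix_inv (A x) $ k $ l)"
proof (rule Ck_on_cong[OF S])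
 show "Ck_on (Suc 0) S (\<lambda>x. det (\<chi> i j. if j = k then axis l 1 $ i else A x $ i $ j) * inverse (det (A x)))"
 proof (intro C1_on_mult C1_on_inverse C1_on_det nz A)
  show "Ck_on (Suc 0) S (\<lambda>x. (\<chi> i j. if j = k then axis l 1 $ i else A x $ i $ j) $ i $ j)" for i j
   by (cases "j = k") (simp_all add: A C1_on_const del: Ck_on.simps)
 qed
qed (auto simp: matrix_inv_cramer nz divide_inverse)

text \<open>The mean value theorem is used twice: in direction \<open>i\<close> for the increment of
  \<open>f\<close> in direction \<open>j\<close>, then in direction \<open>j\<close> for the partial
  derivative in direction \<open>i\<close>. The second difference on the left is symmetric in
  \<open>i\<close> and \<open>j\<close>.\<close>

lemma second_difference_mvt:
 fixes f :: "real^'n::finite \<Rightarrow> real"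
 assumes f: "Ck_on 2 S f" and S: "\<And>s t. 0 \<le> s \<Longrightarrow> s \<le> h \<Longrightarrow> 0 \<le> t \<Longrightarrow> t \<le> h \<Longrightarrow> x + s *\<^sub>R axis i 1 + t *\<^sub>R axis j 1 \<in> S"
  and h: "0 < h"
 obtains s t where "0 \<le> s" "s \<le> h" "0 \<le> t" "t \<le> h"
  "f (x + h *\<^sub>R axis i 1 + h *\<^sub>R axis j 1) - f (x + h *\<^sub>R axis i 1) - f (x + h *\<^sub>R axis j 1) + f x
    = h * h * partial_deriv j (partial_deriv i f) (x + s *\<^sub>R axis i 1 + t *\<^sub>R axis j 1)"
proof -
 let ?p = "\<lambda>s t. x + s *\<^sub>R axis i 1 + t *\<^sub>R axis j (1::real)"
 have d1: "f differentiable at y" if "y \<in> S" for y using f that by (simp add: numeral_2_eq_2)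
 have d2: "partial_deriv i f differentiable at y" if "y \<in> S" for y using f that by (simp add: numeral_2_eq_2)
 have D: "((\<lambda>s. g (c + s *\<^sub>R axis k 1)) has_real_derivative partial_deriv k g (c + s *\<^sub>R axis k 1)) (at s)"
  if "g differentiable at (c + s *\<^sub>R axis k 1)" for g :: "real^'n \<Rightarrow> real" and c s k
 proof -
  have "((\<lambda>s. c + s *\<^sub>R axis k 1) has_derivative (\<lambda>r. r *\<^sub>R axis k 1)) (at s)" by (auto intro!: derivative_eq_intros)
  from has_derivative_compose[OF this has_derivative_partial[OF that]]
  moreover have "(\<Sum>i\<in>UNIV. (r *\<^sub>R axis k 1) $ i *\<^sub>R partial_deriv i g y) = partial_deriv k g y * r" for r y
   by (simp add: axis_def if_distrib if_distribR cong: if_cong)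
  ultimately show ?thesis by (simp add: has_field_derivative_def)
 qed
 have "\<exists>s. 0 < s \<and> s < h \<and> (f (?p h h) - f (?p h 0)) - (f (?p 0 h) - f (?p 0 0)) = (h - 0) * (partial_deriv i f (?p s h) - partial_deriv i f (?p s 0))"
 proof (rule MVT2[OF h])
  fix s assume s: "0 \<le> s" "s \<le> h"
  have *: "(\<lambda>s. f (?p s t)) = (\<lambda>s. f ((x + t *\<^sub>R axis j 1) + s *\<^sub>R axis i 1))" for t by (simp add: algebra_simps)
  have "((\<lambda>s. f (?p s t)) has_real_derivative partial_deriv i f (?p s t)) (at s)" if "t \<in> {0,h}" for t
   unfolding * using D[of f "x + t *\<^sub>R axis j 1" s i] d1[OF S[of s t]] s h that by (auto simp: algebra_simps)
  from this[of h] this[of 0] show "((\<lambda>s. f (?p s h) - f (?p s 0)) has_real_derivative partial_deriv i f (?p s h) - partial_deriv i f (?p s 0)) (at s)"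
   by (auto intro!: DERIV_diff)
 qed
 then obtain s where s: "0 < s" "s < h" and e1: "(f (?p h h) - f (?p h 0)) - (f (?p 0 h) - f (?p 0 0)) = h * (partial_deriv i f (?p s h) - partial_deriv i f (?p s 0))" by auto
 have "\<exists>t. 0 < t \<and> t < h \<and> partial_deriv i f (?p s h) - partial_deriv i f (?p s 0) = (h - 0) * partial_deriv j (partial_deriv i f) (?p s t)"
  by (rule MVT2[OF h]) (use s in \<open>intro D d2 S; simp\<close>)
 then obtain t where "0 < t" "t < h" "partial_deriv i f (?p s h) - partial_deriv i f (?p s 0) = h * partial_deriv j (partial_deriv i f) (?p s t)" by auto
 then show ?thesis using that[of s t] s e1 by simp
qed

text \<open>The second difference, divided by \<open>h * h\<close>, is a value of either mixed
  derivative at some point near \<open>x\<close>. By continuity both derivatives take almost their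
  values at \<open>x\<close> there, so a gap between these two values is impossible.\<close>

lemma partial_deriv_commute_real:
 fixes f :: "real^'n::finite \<Rightarrow> real"
 assumes S: "open S" "x \<in> S" and f: "Ck_on 2 S f"
 shows "partial_deriv i (partial_deriv j f) x = partial_deriv j (partial_deriv i f) x"
proof (rule ccontr)
 assume ne: "\<not> ?thesis"
 define a b where "a = partial_deriv i (partial_deriv j f)" and "b = partial_deriv j (partial_deriv i f)"
 define e where "e = \<bar>a x - b x\<bar> / 2"
 have e: "e > 0" using ne by (simp add: e_def a_def b_def)
 have "continuous_on S a" "continuous_on S b" using f by (auto simp: a_def b_def numeral_2_eq_2)
 then have "isCont a x" "isCont b x" using S by (auto simp: continuous_on_eq_continuous_at)
 then obtain d1 d2 where d: "d1 > 0" "\<And>y. dist y x < d1 \<Longrightarrow> dist (a y) (a x) < e" "d2 > 0" "\<And>y. dist y x < d2 \<Longrightarrow> dist (b y) (b x) < e"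
  using e unfolding continuous_at_eps_delta by metis
 obtain d3 where d3: "d3 > 0" "ball x d3 \<subseteq> S" using S openE by blast
 \<comment> \<open>The evaluation points lie within \<open>2 * h\<close> of \<open>x\<close>; the
   division by 3 keeps this below all three radii.\<close>
 define h where "h = min d1 (min d2 d3) / 3"
 have h: "0 < h" "2 * h < d1" "2 * h < d2" "2 * h < d3" using d d3 by (auto simp: h_def)
 have nr: "dist (x + s *\<^sub>R axis k 1 + t *\<^sub>R axis l 1) x \<le> 2 * h" if "0 \<le> s" "s \<le> h" "0 \<le> t" "t \<le> h" for s t k l
  using norm_triangle_ineq[of "s *\<^sub>R axis k (1::real) :: real^'n" "t *\<^sub>R axis l 1"] that by (simp add: dist_norm)
 have inS: "x + s *\<^sub>R axis k 1 + t *\<^sub>R axis l 1 \<in> S" if "0 \<le> s" "s \<le> h" "0 \<le> t" "t \<le> h" for s t k l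
  using nr[OF that, of k l] h d3 by (force simp: dist_commute)
 obtain s t where 1: "0 \<le> s" "s \<le> h" "0 \<le> t" "t \<le> h"
  "f (x + h *\<^sub>R axis i 1 + h *\<^sub>R axis j 1) - f (x + h *\<^sub>R axis i 1) - f (x + h *\<^sub>R axis j 1) + f x
    = h * h * b (x + s *\<^sub>R axis i 1 + t *\<^sub>R axis j 1)"
  unfolding b_def by (rule second_difference_mvt[OF f, of h x i j]) (use inS h in auto)
 obtain s' t' where 2: "0 \<le> s'" "s' \<le> h" "0 \<le> t'" "t' \<le> h"
  "f (x + h *\<^sub>R axis j 1 + h *\<^sub>R axis i 1) - f (x + h *\<^sub>R axis j 1) - f (x + h *\<^sub>R axis i 1) + f x
    = h * h * a (x + s' *\<^sub>R axis j 1 + t' *\<^sub>R axis i 1)"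
  unfolding a_def by (rule second_difference_mvt[OF f, of h x j i]) (use inS h in auto)
 have "h * h * b (x + s *\<^sub>R axis i 1 + t *\<^sub>R axis j 1) = h * h * a (x + s' *\<^sub>R axis j 1 + t' *\<^sub>R axis i 1)"
  using 1(5) 2(5) by (simp add: algebra_simps)
 then have "b (x + s *\<^sub>R axis i 1 + t *\<^sub>R axis j 1) = a (x + s' *\<^sub>R axis j 1 + t' *\<^sub>R axis i 1)" using h by simp
 moreover have "dist (b (x + s *\<^sub>R axis i 1 + t *\<^sub>R axis j 1)) (b x) < e" using nr[OF 1(1-4), of i j] h by (intro d) auto
 moreover have "dist (a (x + s' *\<^sub>R axis j 1 + t' *\<^sub>R axis i 1)) (a x) < e" using nr[OF 2(1-4), of j i] h by (intro d) auto
 ultimately have "\<bar>a x - b x\<bar> < 2 * e" unfolding dist_real_def by linarith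
 then show False by (simp add: e_def)
qed

lemma partial_deriv_commute:
 fixes f :: "real^'n::finite \<Rightarrow> real^'m::finite"
 assumes S: "open S" "x \<in> S" and f: "Ck_on 2 S f"
 shows "partial_deriv i (partial_deriv j f) x = partial_deriv j (partial_deriv i f) x"
proof -
 have C: "Ck_on 2 S (\<lambda>x. f x $ k)" for k by (rule Ck_on_bounded_linear[OF bounded_linear_vec_nth S(1) f])
 have pn: "partial_deriv i (\<lambda>x. g x $ k) y = partial_deriv i g y $ k" if "g differentiable at y" for g :: "real^'n \<Rightarrow> real^'m" and i k y
  using that partial_deriv_eq[OF bounded_linear.has_derivative[OF bounded_linear_vec_nth]] partial_deriv_eq
  unfolding differentiable_def by metis
 have "partial_deriv i (partial_deriv j (\<lambda>x. f x $ k)) x = partial_deriv i (partial_deriv j f) x $ k" for i j k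
 proof -
  have "partial_deriv i (partial_deriv j (\<lambda>x. f x $ k)) x = partial_deriv i (\<lambda>x. partial_deriv j f x $ k) x"
  proof -
   have "((\<lambda>x. partial_deriv j f x $ k) has_derivative D) (at x)"
    if "(partial_deriv j (\<lambda>x. f x $ k) has_derivative D) (at x)" for D
    by (rule has_derivative_transform_within_open[OF that S]) (use f pn in \<open>simp add: numeral_2_eq_2\<close>)
   moreover have "partial_deriv j (\<lambda>x. f x $ k) differentiable at x" using C S by (simp add: numeral_2_eq_2)
   ultimately show ?thesis unfolding differentiable_def using partial_deriv_eq by metis
  qed
  also have "\<dots> = partial_deriv i (partial_deriv j f) x $ k"
   by (rule pn) (use f S in \<open>simp add: numeral_2_eq_2\<close>)
  finally show ?thesis .
 qed
 then show ?thesis using partial_deriv_commute_real[OF S C] by (simp add: vec_eq_iff)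
qed

subsection \<open>Bilinear forms with variable coefficients\<close>

text \<open>Covers the metric, with coefficients \<open>gcoef\<close>, and each component of the
  Christoffel symbols alike, so that linearity, continuity and the derivative are treated
  once.\<close>

definition bform :: "('n::finite \<Rightarrow> 'n \<Rightarrow> real^'n \<Rightarrow> real) \<Rightarrow> real^'n \<Rightarrow> real^'n \<Rightarrow> real^'n \<Rightarrow> real" where
 "bform a x v w = (\<Sum>i\<in>UNIV. \<Sum>j\<in>UNIV. a i j x * v $ i * w $ j)"

text \<open>The part of the derivative of \<open>bform\<close> that is due to moving the base point
  in direction \<open>h\<close>.\<close>

definition dbform :: "('n::finite \<Rightarrow> 'n \<Rightarrow> real^'n \<Rightarrow> real) \<Rightarrow> real^'n \<Rightarrow> real^'n \<Rightarrow> real^'n \<Rightarrow> real^'n \<Rightarrow> real" where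
 "dbform a x h v w = (\<Sum>i\<in>UNIV. \<Sum>j\<in>UNIV. (\<Sum>k\<in>UNIV. h $ k * partial_deriv k (a i j) x) * v $ i * w $ j)"

lemma has_derivative_bform:
 assumes a: "\<And>i j. a i j differentiable at (x z)"
  and x: "(x has_derivative x') (at z within Z)" and v: "(v has_derivative v') (at z within Z)" and w: "(w has_derivative w') (at z within Z)"
 shows "((\<lambda>z. bform a (x z) (v z) (w z)) has_derivative
  (\<lambda>h. dbform a (x z) (x' h) (v z) (w z) + bform a (x z) (v' h) (w z) + bform a (x z) (v z) (w' h))) (at z within Z)"
proof -
 have 1: "((\<lambda>z. a i j (x z)) has_derivative (\<lambda>h. \<Sum>k\<in>UNIV. x' h $ k * partial_deriv k (a i j) (x z))) (at z within Z)" for i j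
  using has_derivative_compose[OF x has_derivative_partial[OF a]] by simp
 have 2: "((\<lambda>z. v z $ i) has_derivative (\<lambda>h. v' h $ i)) (at z within Z)" "((\<lambda>z. w z $ i) has_derivative (\<lambda>h. w' h $ i)) (at z within Z)" for i
  using bounded_linear.has_derivative[OF bounded_linear_vec_nth v] bounded_linear.has_derivative[OF bounded_linear_vec_nth w] .
 have "((\<lambda>z. bform a (x z) (v z) (w z)) has_derivative
   (\<lambda>h. \<Sum>i\<in>UNIV. \<Sum>j\<in>UNIV. a i j (x z) * v z $ i * w' h $ j
    + (a i j (x z) * v' h $ i + (\<Sum>k\<in>UNIV. x' h $ k * partial_deriv k (a i j) (x z)) * v z $ i) * w z $ j)) (at z within Z)"
  unfolding bform_def by (intro has_derivative_sum has_derivative_mult 1 2)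
 then show ?thesis
  by (rule has_derivative_eq_rhs) (simp add: bform_def dbform_def fun_eq_iff sum.distrib algebra_simps)
qed

lemma bform_linear:
 "bform a x (v + v') w = bform a x v w + bform a x v' w" "bform a x v (w + w') = bform a x v w + bform a x v w'"
 "bform a x (v - v') w = bform a x v w - bform a x v' w" "bform a x v (w - w') = bform a x v w - bform a x v w'"
 "bform a x (r *\<^sub>R v) w = r * bform a x v w" "bform a x v (r *\<^sub>R w) = r * bform a x v w"
 "bform a x (- v) w = - bform a x v w" "bform a x v (- w) = - bform a x v w"
 "bform a x 0 w = 0" "bform a x v 0 = 0"
 by (simp_all add: bform_def algebra_simps sum.distrib sum_distrib_left sum_subtractf sum_negf)

lemma continuous_on_bform:
 assumes "\<And>i j. continuous_on X (\<lambda>z. a i j (x z))" "continuous_on X v" "continuous_on X w"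
 shows "continuous_on X (\<lambda>z. bform a (x z) (v z) (w z))"
 unfolding bform_def by (intro continuous_intros assms)

lemma continuous_on_dbform:
 assumes "\<And>i j k. continuous_on X (\<lambda>z. partial_deriv k (a i j) (x z))" "continuous_on X h" "continuous_on X v" "continuous_on X w"
 shows "continuous_on X (\<lambda>z. dbform a (x z) (h z) (v z) (w z))"
 unfolding dbform_def by (intro continuous_intros assms)

section \<open>Ordinary differential equations with parameters\<close>

text \<open>The integral from 0 to \<open>t\<close>, rescaled to the fixed interval from 0 to 1. In
  this form it makes sense for \<open>t\<close> of either sign, and its continuity in parameters is
  that of an integral over a fixed interval.\<close>

lemma scaled_integral_has_vector_derivative:
 fixes g :: "real \<Rightarrow> 'b::banach"
 assumes "continuous_on UNIV g"
 shows "((\<lambda>t. t *\<^sub>R integral {0..1} (\<lambda>u. g (t * u))) has_vector_derivative g t) (at t)"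
proof -
 define N where "N = \<bar>t\<bar> + 1"
 obtain G where G: "\<And>x. x \<in> {-N..N} \<Longrightarrow> (G has_vector_derivative g x) (at x within {-N..N})"
  using antiderivative_continuous[of "-N" N g] assms continuous_on_subset by (metis subset_UNIV)
 have eq: "s *\<^sub>R integral {0..1} (\<lambda>u. g (s * u)) = G s - G 0" if s: "\<bar>s\<bar> < N" for s
 proof -
  have sub: "(\<lambda>u. s * u) ` {0..1} \<subseteq> {-N..N}"
  proof -
   have "s * u \<in> {-N..N}" if "u \<in> {0..1}" for u
   proof -
    have "\<bar>s * u\<bar> \<le> N * 1" unfolding abs_mult by (rule mult_mono) (use s that in auto)
    then show ?thesis by (auto simp: abs_le_iff)
   qed
   then show ?thesis by (rule image_subsetI)
  qed
  have "((\<lambda>u. G (s * u)) has_vector_derivative s *\<^sub>R g (s * u)) (at u within {0..1})"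
   if u: "u \<in> {0..1}" for u
  proof -
   have 1: "((\<lambda>u. s * u) has_vector_derivative s) (at u within {0..1})"
    by (auto intro!: derivative_eq_intros simp: has_real_derivative_iff_has_vector_derivative[symmetric])
   have 2: "(G has_vector_derivative g (s * u)) (at (s * u) within (\<lambda>u. s * u) ` {0..1})"
    by (rule has_vector_derivative_within_subset[OF G sub]) (use sub u in \<open>auto simp del: mem_Collect_eq atLeastAtMost_iff\<close>)
   show ?thesis using vector_diff_chain_within[OF 1 2] by (simp add: o_def)
  qed
  then have "((\<lambda>u. s *\<^sub>R g (s * u)) has_integral (G (s * 1) - G (s * 0))) {0..1}"
   by (intro fundamental_theorem_of_calculus) auto
  then show ?thesis by (simp add: integral_unique flip: integral_cmul)
 qed
 have "(G has_vector_derivative g t) (at t within {-N..N})" by (rule G) (auto simp: N_def)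
 then have "(G has_vector_derivative g t) (at t)"
  by (subst (asm) at_within_Icc_at) (auto simp: N_def)
 then have "((\<lambda>t. G t - G 0) has_vector_derivative g t) (at t)"
  by (auto intro!: derivative_eq_intros)
 then show ?thesis
  by (rule has_vector_derivative_transform_within_open[where S="{-N<..<N}"])
    (auto simp: N_def eq[unfolded N_def])
qed

text \<open>The contraction principle is applied to bounded continuous functions of parameter and
  time together, so the solution is jointly continuous by construction. The unknown is the
  displacement from the initial value \<open>\<iota> k\<close>, since the solution itself may be
  unbounded in \<open>k\<close>.\<close>

lemma picard_parameter:
 fixes f :: "'k::metric_space \<Rightarrow> real \<Rightarrow> 'x::banach \<Rightarrow> 'x" and \<iota> :: "'k \<Rightarrow> 'x"
 assumes cf: "continuous_on UNIV (\<lambda>(k,t,z). f k t z)" and ci: "continuous_on UNIV \<iota>"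
  and lip: "\<And>k t z w. norm (f k t z - f k t w) \<le> L * norm (z - w)"
  and bd: "\<And>k t. norm (f k t (\<iota> k)) \<le> B" and e: "0 < e" and L: "0 \<le> L" "L * e < 1"
 obtains \<phi> :: "'k \<Rightarrow> real \<Rightarrow> 'x" where "continuous_on UNIV (\<lambda>(k,t). \<phi> k t)" "\<And>k. \<phi> k 0 = \<iota> k"
  "\<And>k t. \<bar>t\<bar> < e \<Longrightarrow> (\<phi> k has_vector_derivative f k t (\<phi> k t)) (at t)"
  "\<And>k t B'. (\<And>s z. norm (f k s z) \<le> B') \<Longrightarrow> norm (\<phi> k t - \<iota> k) \<le> e * B'"
proof -
 \<comment> \<open>Time is clamped to the interval from \<open>- e\<close> to \<open>e\<close>, so
   that the displacement is defined and bounded for all times while the equation is preserved inside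
   the interval.\<close>
 define c where "c t = max (- e) (min e t)" for t
 have c_le: "\<bar>c t\<bar> \<le> e" for t using e by (auto simp: c_def)
 have c_eq: "c t = t" if "\<bar>t\<bar> \<le> e" for t using that by (auto simp: c_def)
 have cc: "continuous_on S c" for S unfolding c_def by (intro continuous_intros)
 \<comment> \<open>The Picard operator: the integral of the field along the candidate solution from
   0 to \<open>c t\<close>, rescaled.\<close>
 define I where "I d = (\<lambda>(k,t). c t *\<^sub>R integral {0..1} (\<lambda>u. f k (c t * u) (\<iota> k + d (k, c t * u))))" for d :: "'k \<times> real \<Rightarrow> 'x"
 have ci2: "continuous_on S (\<lambda>y. \<iota> (h y))" if "continuous_on S h" for S and h :: "'y::topological_space \<Rightarrow> 'k"
  using continuous_on_compose2[OF ci that] by auto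
 have cint: "continuous_on UNIV (\<lambda>(k,t). integral {0..1} (\<lambda>u. f k (c t * u) (\<iota> k + d (k, c t * u))))"
  if d: "continuous_on UNIV d" for d
 proof -
  have "continuous_on (UNIV \<times> cbox 0 1) (\<lambda>(p,u). f (fst p) (c (snd p) * u) (\<iota> (fst p) + d (fst p, c (snd p) * u)))"
   unfolding split_beta
   by (rule continuous_on_compose2[OF cf, of _ "\<lambda>q. (fst (fst q), c (snd (fst q)) * snd q, \<iota> (fst (fst q)) + d (fst (fst q), c (snd (fst q)) * snd q))", simplified])
     (intro continuous_intros continuous_on_compose2[OF cc[of UNIV]] ci2 continuous_on_compose2[OF d]; simp)
  then have "continuous_on UNIV (\<lambda>p. integral (cbox 0 1) (\<lambda>u. f (fst p) (c (snd p) * u) (\<iota> (fst p) + d (fst p, c (snd p) * u))))"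
   by (rule integral_continuous_on_param)
  then show ?thesis by (simp add: split_beta)
 qed
 have cg: "continuous_on UNIV (\<lambda>s. f k s (\<iota> k + d (k, s)))" if d: "continuous_on UNIV d" for d k
  by (rule continuous_on_compose2[OF cf, of _ "\<lambda>s. (k, s, \<iota> k + d (k, s))", simplified])
    (intro continuous_intros continuous_on_compose2[OF d]; simp)
 have cg2: "continuous_on S (\<lambda>u. f k (c t * u) (\<iota> k + d (k, c t * u)))" if d: "continuous_on UNIV d" for d k t S
  by (rule continuous_on_compose2[OF cg[OF d]]) (auto intro: continuous_intros)
 have itg: "(\<lambda>u. f k (c t * u) (\<iota> k + d (k, c t * u))) integrable_on {0..1}" if d: "continuous_on UNIV d" for d k t
  by (rule integrable_continuous_real[OF cg2[OF d]])
 have nI: "norm (I d (k,t)) \<le> e * C" if d: "continuous_on UNIV d" and C: "\<And>u. norm (f k (c t * u) (\<iota> k + d (k, c t * u))) \<le> C" for d k t C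
 proof -
  have "norm (integral {0..1} (\<lambda>u. f k (c t * u) (\<iota> k + d (k, c t * u)))) \<le> C * (1 - 0)"
   by (rule integral_bound) (auto intro: cg2[OF d] C)
  then show ?thesis unfolding I_def using c_le[of t] e by (auto intro!: mult_mono)
 qed
 have bI: "I d \<in> bcontfun" if d: "continuous_on UNIV d" "\<And>p. norm (d p) \<le> M" for d M
 unfolding bcontfun_def mem_Collect_eq bounded_iff
 proof (intro conjI exI[of _ "e * (B + L * M)"] ballI)
  show "continuous_on UNIV (I d)" unfolding I_def split_beta
   using cint[OF d(1)] continuous_on_compose2[OF cc[of UNIV] continuous_on_snd[OF continuous_on_id], of UNIV]
   by (intro continuous_on_scaleR) (auto simp: split_beta)
  fix y assume "y \<in> range (I d)"
  then obtain k t where p: "y = I d (k,t)" by auto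
  have "norm (f k s (\<iota> k + d (k, s))) \<le> B + L * M" for s
  proof -
   have "norm (f k s (\<iota> k + d (k, s))) \<le> norm (f k s (\<iota> k)) + norm (f k s (\<iota> k + d (k, s)) - f k s (\<iota> k))"
    by (metis add.commute diff_add_cancel norm_triangle_ineq)
   also have "\<dots> \<le> B + L * norm (d (k,s))" using bd[of k s] lip[of k s "\<iota> k + d (k,s)" "\<iota> k"] by simp
   also have "\<dots> \<le> B + L * M" using d(2) L by (simp add: mult_left_mono)
   finally show ?thesis .
  qed
  then show "norm y \<le> e * (B + L * M)" unfolding p by (intro nI[OF d(1)])
 qed
 define T where "T d = Bcontfun (I (apply_bcontfun d))" for d
 have Tapp: "apply_bcontfun (T d) = I (apply_bcontfun d)" for d
  unfolding T_def by (rule Bcontfun_inverse, rule bI[of _ "norm d"]) (auto simp: norm_bounded)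
 have "dist (T d) (T d') \<le> (L * e) * dist d d'" for d d'
 proof (rule dist_bound)
  fix p :: "'k \<times> real" obtain k t where p: "p = (k,t)" by force
  let ?g = "\<lambda>d u. f k (c t * u) (\<iota> k + apply_bcontfun d (k, c t * u))"
  have "norm (integral {0..1} (?g d) - integral {0..1} (?g d')) = norm (integral {0..1} (\<lambda>u. ?g d u - ?g d' u))"
   by (subst integral_diff) (auto intro: itg)
  also have "\<dots> \<le> (L * dist d d') * (1 - 0)"
  proof (rule integral_bound)
   fix u :: real
   have "norm (?g d u - ?g d' u) \<le> L * dist (d (k, c t * u)) (d' (k, c t * u))"
    using lip[of k "c t * u" "\<iota> k + apply_bcontfun d (k, c t * u)" "\<iota> k + apply_bcontfun d' (k, c t * u)"] by (simp add: dist_norm)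
   also have "\<dots> \<le> L * dist d d'" by (intro mult_left_mono dist_bounded L)
   finally show "norm (?g d u - ?g d' u) \<le> L * dist d d'" .
  qed (auto intro!: continuous_intros cg2)
  finally have "\<bar>c t\<bar> * norm (integral {0..1} (?g d) - integral {0..1} (?g d')) \<le> e * (L * dist d d')"
   using c_le[of t] e by (intro mult_mono) auto
  then show "dist (apply_bcontfun (T d) p) (apply_bcontfun (T d') p) \<le> (L * e) * dist d d'"
   unfolding Tapp p I_def by (simp add: dist_norm ac_simps flip: scaleR_diff_right)
 qed
 then obtain d where d: "T d = d"
  using banach_fix_type[of "L * e" T] L e by auto
 then have dI: "apply_bcontfun d p = I (apply_bcontfun d) p" for p by (metis Tapp)
 define \<phi> where "\<phi> k t = \<iota> k + d (k, t)" for k t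
 have cd: "continuous_on UNIV (apply_bcontfun d)" by simp
 show ?thesis
 proof (rule that[of \<phi>])
  show "continuous_on UNIV (\<lambda>(k, t). \<phi> k t)" unfolding \<phi>_def split_beta
   by (intro continuous_intros ci2 continuous_on_compose2[OF cd]) auto
  show "\<phi> k 0 = \<iota> k" for k
   using dI[of "(k,0)"] e by (simp add: \<phi>_def I_def c_eq)
  show "norm (\<phi> k t - \<iota> k) \<le> e * B'" if "\<And>s z. norm (f k s z) \<le> B'" for k t B'
   using nI[OF cd, of k t B'] that by (simp add: \<phi>_def flip: dI)
  show "(\<phi> k has_vector_derivative f k t (\<phi> k t)) (at t)" if t: "\<bar>t\<bar> < e" for k t
  proof -
   let ?g = "\<lambda>s. f k s (\<iota> k + d (k, s))"
   have "d (k,s) = s *\<^sub>R integral {0..1} (\<lambda>u. ?g (s * u))" if "s \<in> {-e<..<e}" for s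
    using c_eq[of s] that by (subst dI) (simp add: I_def abs_le_iff)
   note deq = this
   have "((\<lambda>t. t *\<^sub>R integral {0..1} (\<lambda>u. ?g (t * u))) has_vector_derivative ?g t) (at t)"
    by (rule scaled_integral_has_vector_derivative) (rule cg[OF cd])
   then have "((\<lambda>t. d (k,t)) has_vector_derivative ?g t) (at t)"
    by (rule has_vector_derivative_transform_within_open[where S="{-e<..<e}"]) (use t deq in auto)
   then show ?thesis unfolding \<phi>_def by (auto intro!: derivative_eq_intros)
  qed
 qed
qed

text \<open>The derivative of the squared norm of \<open>u\<close> is at most \<open>2 * L\<close>
  times the squared norm, so that the squared norm times \<open>exp (- (2 * L * s))\<close> is
  nonincreasing; it starts at 0.\<close>

lemma gronwall_zero_forward:
 fixes u :: "real \<Rightarrow> 'x::real_inner"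
 assumes "\<And>s. t0 \<le> s \<Longrightarrow> s \<le> t \<Longrightarrow> (u has_vector_derivative u' s) (at s)"
  and "\<And>s. t0 \<le> s \<Longrightarrow> s \<le> t \<Longrightarrow> norm (u' s) \<le> L * norm (u s)" and "u t0 = 0" "t0 \<le> t"
 shows "u t = 0"
proof -
 let ?q = "\<lambda>s. (u s \<bullet> u s) * exp (- (2 * L * s))"
 have "?q t \<le> ?q t0"
 proof (rule DERIV_nonpos_imp_nonincreasing[OF assms(4)])
  fix s assume s: "t0 \<le> s" "s \<le> t"
  have "((\<lambda>s. u s \<bullet> u s) has_real_derivative 2 * (u s \<bullet> u' s)) (at s)"
   unfolding has_real_derivative_iff_has_vector_derivative has_vector_derivative_def
   by (rule has_derivative_eq_rhs, rule has_derivative_inner)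
     (use assms(1)[OF s] in \<open>auto simp: has_vector_derivative_def inner_commute fun_eq_iff\<close>)
  then have "(?q has_real_derivative (2 * (u s \<bullet> u' s) - 2 * L * (u s \<bullet> u s)) * exp (- (2 * L * s))) (at s)"
   by (auto intro!: derivative_eq_intros simp: algebra_simps)
  moreover have "u s \<bullet> u' s \<le> L * (u s \<bullet> u s)"
   using norm_cauchy_schwarz[of "u s" "u' s"] mult_left_mono[OF assms(2)[OF s], of "norm (u s)"]
   by (simp add: dot_square_norm power2_eq_square algebra_simps)
  ultimately show "\<exists>y. (?q has_real_derivative y) (at s) \<and> y \<le> 0"
   by (auto intro!: exI mult_nonpos_nonneg)
 qed
 then have "(u t \<bullet> u t) * exp (- (2 * L * t)) \<le> 0" using assms(3) by simp
 then show ?thesis using inner_ge_zero[of "u t"] inner_eq_zero_iff[of "u t"]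
  by (auto simp: mult_le_0_iff)
qed

lemma gronwall_zero:
 fixes u :: "real \<Rightarrow> 'x::real_inner"
 assumes "\<And>s. \<bar>s - t0\<bar> < e \<Longrightarrow> (u has_vector_derivative u' s) (at s)"
  and "\<And>s. \<bar>s - t0\<bar> < e \<Longrightarrow> norm (u' s) \<le> L * norm (u s)" and "u t0 = 0" "\<bar>t - t0\<bar> < e"
 shows "u t = 0"
proof (cases "t0 \<le> t")
 case True
 then show ?thesis using assms by (intro gronwall_zero_forward[of t0 t u u' L]) auto
next
 case False
 \<comment> \<open>Reflection at \<open>t0\<close> turns earlier times into later ones.\<close>
 let ?v = "\<lambda>s. u (2 * t0 - s)"
 have "?v (2 * t0 - t) = 0"
 proof (rule gronwall_zero_forward[of t0 "2 * t0 - t" ?v "\<lambda>s. - u' (2 * t0 - s)" L])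
  fix s assume s: "t0 \<le> s" "s \<le> 2 * t0 - t"
  have "((u \<circ> (\<lambda>s. 2 * t0 - s)) has_vector_derivative (- 1) *\<^sub>R u' (2 * t0 - s)) (at s)"
   by (rule vector_diff_chain_at)
     (use s assms(4) in \<open>auto intro!: derivative_eq_intros assms(1) simp: has_real_derivative_iff_has_vector_derivative[symmetric]\<close>)
  then show "(?v has_vector_derivative - u' (2 * t0 - s)) (at s)" by (simp add: o_def)
  show "norm (- u' (2 * t0 - s)) \<le> L * norm (u (2 * t0 - s))" using s assms(4) by (auto intro!: assms(2))
 qed (use assms False in auto)
 then show ?thesis by simp
qed

lemma C1_lipschitz_cball:
 fixes F :: "'x::euclidean_space \<Rightarrow> 'y::real_normed_vector"
 assumes D: "cball z0 \<rho> \<subseteq> S"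
  and dF: "\<And>z. z \<in> S \<Longrightarrow> (F has_derivative blinfun_apply (F' z)) (at z)" and cF: "continuous_on S F'"
 obtains L where "0 \<le> L" "\<And>z. z \<in> cball z0 \<rho> \<Longrightarrow> norm (F' z) \<le> L"
  "\<And>z w. z \<in> cball z0 \<rho> \<Longrightarrow> w \<in> cball z0 \<rho> \<Longrightarrow> norm (F z - F w) \<le> L * norm (z - w)"
proof -
 have "compact (F' ` cball z0 \<rho>)"
  by (rule compact_continuous_image[OF continuous_on_subset[OF cF D] compact_cball])
 then obtain L where L: "\<And>z. z \<in> cball z0 \<rho> \<Longrightarrow> norm (F' z) \<le> L" "0 < L"
  by (force simp: bounded_pos dest!: compact_imp_bounded)
 show ?thesis
 proof (rule that[of L])
  fix z w assume "z \<in> cball z0 \<rho>" "w \<in> cball z0 \<rho>"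
  then show "norm (F z - F w) \<le> L * norm (z - w)"
   by (intro differentiable_bound[of "cball z0 \<rho>" F "\<lambda>z. blinfun_apply (F' z)"])
     (use D L in \<open>auto intro!: has_derivative_at_withinI dF simp flip: norm_blinfun.rep_eq\<close>)
 qed (use L in auto)
qed

text \<open>As long as both solutions stay in a ball on which the field is Lipschitz, their
  difference satisfies the bound of \<open>gronwall_zero\<close>.\<close>

lemma ode_unique_local:
 fixes F :: "'x::euclidean_space \<Rightarrow> 'x"
 assumes "open S" and dF: "\<And>z. z \<in> S \<Longrightarrow> (F has_derivative blinfun_apply (F' z)) (at z)" and cF: "continuous_on S F'"
  and "0 < e" and x: "\<And>s. \<bar>s - t0\<bar> < e \<Longrightarrow> (x has_vector_derivative F (x s)) (at s)"
  and y: "\<And>s. \<bar>s - t0\<bar> < e \<Longrightarrow> (y has_vector_derivative F (y s)) (at s)"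
  and "x t0 = y t0" "x t0 \<in> S"
 obtains d where "0 < d" "\<And>s. \<bar>s - t0\<bar> < d \<Longrightarrow> x s = y s"
proof -
 obtain \<rho> where \<rho>: "0 < \<rho>" "cball (x t0) \<rho> \<subseteq> S" using assms(1,8) open_contains_cball by blast
 obtain L where L: "0 \<le> L" "\<And>z w. z \<in> cball (x t0) \<rho> \<Longrightarrow> w \<in> cball (x t0) \<rho> \<Longrightarrow> norm (F z - F w) \<le> L * norm (z - w)"
  using C1_lipschitz_cball[OF \<rho>(2) dF cF] by metis
 have "isCont x t0" "isCont y t0"
  using x[of t0] y[of t0] \<open>0 < e\<close> has_vector_derivative_continuous by force+
 then have "\<exists>d>0. \<forall>s. dist s t0 < d \<longrightarrow> dist (x s) (x t0) < \<rho>" "\<exists>d>0. \<forall>s. dist s t0 < d \<longrightarrow> dist (y s) (y t0) < \<rho>"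
  using \<rho>(1) unfolding continuous_at_eps_delta by metis+
 then obtain d1 d2 where d: "0 < d1" "0 < d2" "\<And>s. \<bar>s - t0\<bar> < d1 \<Longrightarrow> dist (x s) (x t0) < \<rho>"
   "\<And>s. \<bar>s - t0\<bar> < d2 \<Longrightarrow> dist (y s) (y t0) < \<rho>" by (auto simp: dist_real_def)
 let ?d = "min e (min d1 d2)"
 have "x s - y s = 0" if s: "\<bar>s - t0\<bar> < ?d" for s
 proof (rule gronwall_zero[of t0 ?d "\<lambda>s. x s - y s" "\<lambda>s. F (x s) - F (y s)" L s])
  fix s assume s: "\<bar>s - t0\<bar> < ?d"
  show "((\<lambda>s. x s - y s) has_vector_derivative F (x s) - F (y s)) (at s)"
   using s by (auto intro!: derivative_eq_intros x y)
  show "norm (F (x s) - F (y s)) \<le> L * norm (x s - y s)"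
   using s d(3)[of s] d(4)[of s] assms(7) by (intro L(2)) (auto simp: dist_commute)
 qed (use assms s in auto)
 then show ?thesis using d \<open>0 < e\<close> by (intro that[of ?d]) auto
qed

text \<open>Caratheodory's form of differentiability: an increment operator that is continuous at
  the point. It suits the flow, whose increments in the initial value are given by the solution of a
  linear equation.\<close>

lemma caratheodory_has_derivative:
 fixes f :: "'x::real_normed_vector \<Rightarrow> 'y::real_normed_vector" and Z :: "'x \<Rightarrow> 'x \<Rightarrow>\<^sub>L 'y"
 assumes "open S" "x \<in> S" "\<And>y. y \<in> S \<Longrightarrow> f y - f x = Z y (y - x)" "isCont Z x"
 shows "(f has_derivative blinfun_apply (Z x)) (at x)"
 unfolding has_derivative_at_alt
proof (intro conjI allI impI)
 show "bounded_linear (blinfun_apply (Z x))" by (rule blinfun.bounded_linear_right)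
 fix e :: real assume "0 < e"
 obtain d1 where d1: "0 < d1" "ball x d1 \<subseteq> S" using assms(1,2) openE by blast
 obtain d2 where d2: "0 < d2" "\<And>y. dist y x < d2 \<Longrightarrow> dist (Z y) (Z x) < e"
  using assms(4) \<open>0 < e\<close> unfolding continuous_at_eps_delta by metis
 show "\<exists>d>0. \<forall>y. norm (y - x) < d \<longrightarrow> norm (f y - f x - blinfun_apply (Z x) (y - x)) \<le> e * norm (y - x)"
 proof (intro exI[of _ "min d1 d2"] conjI allI impI)
  fix y assume y: "norm (y - x) < min d1 d2"
  then have "y \<in> S" using d1 by (auto simp: subset_eq dist_norm norm_minus_commute)
  then have "f y - f x - blinfun_apply (Z x) (y - x) = blinfun_apply (Z y - Z x) (y - x)"
   using assms(3) by (simp add: blinfun.diff_left)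
  then show "norm (f y - f x - blinfun_apply (Z x) (y - x)) \<le> e * norm (y - x)"
   using norm_blinfun[of "Z y - Z x" "y - x"] mult_right_mono[of "norm (Z y - Z x)" e "norm (y - x)"] d2(2)[of y] y
   by (simp add: dist_norm)
 qed (use d1 d2 in auto)
qed

text \<open>Composing the field with the nearest-point projection \<open>pr\<close> onto a ball
  makes it globally Lipschitz. The difference of two solutions satisfies a linear equation whose
  coefficient is the mean of \<open>F'\<close> on the segment between them; the solution operator of
  this equation is the increment operator of the flow, and for equal initial values it becomes the
  derivative \<open>W\<close>.\<close>

lemma local_flow:
 fixes F :: "'x::euclidean_space \<Rightarrow> 'x"
 assumes "open S" "z0 \<in> S"
  and dF: "\<And>z. z \<in> S \<Longrightarrow> (F has_derivative blinfun_apply (F' z)) (at z)" and cF: "continuous_on S F'"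
 obtains r e \<Phi> W where "0 < r" "0 < e"
  "\<And>z t. z \<in> ball z0 r \<Longrightarrow> \<bar>t\<bar> < e \<Longrightarrow> \<Phi> z t \<in> S"
  "\<And>z. z \<in> ball z0 r \<Longrightarrow> \<Phi> z 0 = z"
  "\<And>z t. z \<in> ball z0 r \<Longrightarrow> \<bar>t\<bar> < e \<Longrightarrow> (\<Phi> z has_vector_derivative F (\<Phi> z t)) (at t)"
  "\<And>z t. z \<in> ball z0 r \<Longrightarrow> \<bar>t\<bar> < e \<Longrightarrow> ((\<lambda>z. \<Phi> z t) has_derivative blinfun_apply (W z t)) (at z)"
  "\<And>z t. z \<in> ball z0 r \<Longrightarrow> \<bar>t\<bar> < e \<Longrightarrow> (W z has_vector_derivative F' (\<Phi> z t) o\<^sub>L W z t) (at t)"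
  "continuous_on UNIV (\<lambda>(z,t). \<Phi> z t)" "continuous_on UNIV (\<lambda>(z,t). W z t)"
proof -
 obtain \<rho> where \<rho>: "0 < \<rho>" "cball z0 \<rho> \<subseteq> S" using assms(1,2) open_contains_cball by blast
 let ?D = "cball z0 \<rho>"
 obtain L where L: "0 \<le> L" "\<And>z. z \<in> ?D \<Longrightarrow> norm (F' z) \<le> L"
   "\<And>z w. z \<in> ?D \<Longrightarrow> w \<in> ?D \<Longrightarrow> norm (F z - F w) \<le> L * norm (z - w)"
  using C1_lipschitz_cball[OF \<rho>(2) dF cF] by metis
 have contF: "continuous_on ?D F"
  by (intro continuous_at_imp_continuous_on ballI) (use dF \<rho> has_derivative_continuous in blast)
 obtain B where B: "\<And>z. z \<in> ?D \<Longrightarrow> norm (F z) \<le> B" "0 < B"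
  using compact_imp_bounded[OF compact_continuous_image[OF contF compact_cball]] by (force simp: bounded_pos)
 define pr where "pr = closest_point ?D"
 have prD: "pr w \<in> ?D" for w unfolding pr_def by (rule closest_point_in_set) (use \<rho> in auto)
 have pr_id: "pr w = w" if "w \<in> ?D" for w unfolding pr_def using that by (rule closest_point_self)
 have pr_lip: "dist (pr v) (pr w) \<le> dist v w" for v w
  unfolding pr_def by (rule closest_point_lipschitz) (use \<rho> in auto)
 have cpr: "continuous_on A pr" for A unfolding pr_def
  by (rule continuous_on_closest_point) (use \<rho> in auto)
 \<comment> \<open>The first bound makes the Picard operator a contraction; the second keeps
   solutions that start in the ball of radius \<open>\<rho>/2\<close> inside the ball of radius
   \<open>\<rho>\<close>.\<close>
 define e where "e = min (1 / (2 * (L + 1))) (\<rho> / (4 * B))"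
 have e: "0 < e" "L * e < 1" "e * B < \<rho> / 2"
 proof -
  show "0 < e" using L B \<rho> by (simp add: e_def)
  have "L * e \<le> L * (1 / (2 * (L + 1)))" using L by (intro mult_left_mono) (auto simp: e_def)
  also have "\<dots> < 1" using L by (simp add: field_simps)
  finally show "L * e < 1" .
  have "e * B \<le> \<rho> / (4 * B) * B" using B by (intro mult_right_mono) (auto simp: e_def)
  then show "e * B < \<rho> / 2" using B \<rho> by simp
 qed
 obtain \<phi> :: "'x \<Rightarrow> real \<Rightarrow> 'x" where \<phi>: "continuous_on UNIV (\<lambda>(k,t). \<phi> k t)" "\<And>k. \<phi> k 0 = k"
  "\<And>k t. \<bar>t\<bar> < e \<Longrightarrow> (\<phi> k has_vector_derivative F (pr (\<phi> k t))) (at t)"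
  "\<And>k t B'. (\<And>s z. norm (F (pr z)) \<le> B') \<Longrightarrow> norm (\<phi> k t - k) \<le> e * B'"
 proof (rule picard_parameter[of "\<lambda>k t z. F (pr z)" "\<lambda>k. k" L B e])
  show "continuous_on UNIV (\<lambda>(k::'x, t::real, z). F (pr z))"
   unfolding split_beta by (intro continuous_on_compose2[OF contF] continuous_on_compose2[OF cpr[of UNIV]] continuous_intros) (use prD in auto)
  show "norm (F (pr z) - F (pr w)) \<le> L * norm (z - w)" for z w
   using L(3)[OF prD prD, of z w] mult_left_mono[OF pr_lip[of z w] L(1)] by (simp add: dist_norm)
 qed (use e L B prD in auto)
 have near: "\<phi> z t \<in> ball z0 \<rho>" if "z \<in> ball z0 (\<rho>/2)" for z t
 proof -
  have "dist z (\<phi> z t) < \<rho>/2" using \<phi>(4)[of B z t] e B prD by (auto simp: dist_norm norm_minus_commute)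
  then show ?thesis using that dist_triangle[of z0 "\<phi> z t" z] by auto
 qed
 \<comment> \<open>The mean of \<open>F'\<close> over the segment from \<open>a\<close> to
   \<open>b\<close>, so that \<open>F b - F a = A a b (b - a)\<close> on the ball.\<close>
 define A where "A a b = integral {0..1} (\<lambda>s. F' (pr (a + s *\<^sub>R (b - a))))" for a b
 have cF': "continuous_on X (\<lambda>x. F' (pr (h x)))" if "continuous_on X h" for X and h :: "'p::topological_space \<Rightarrow> 'x"
  by (rule continuous_on_compose2[OF continuous_on_subset[OF cF \<rho>(2)]])
    (use prD continuous_on_compose2[OF cpr[of UNIV] that] in auto)
 have cA: "continuous_on UNIV (\<lambda>(a,b). A a b)"
 proof -
  have "continuous_on (UNIV \<times> cbox 0 1) (\<lambda>(p, s). F' (pr (fst p + s *\<^sub>R (snd p - fst p))))"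
   unfolding split_beta by (rule cF') (intro continuous_intros)
  from integral_continuous_on_param[OF this] show ?thesis by (simp add: A_def split_beta)
 qed
 have nA: "norm (A a b) \<le> L" for a b
 proof -
  have "norm (A a b) \<le> L * (1 - 0)" unfolding A_def
   by (rule integral_bound) (auto intro!: cF' L prD continuous_intros)
  then show ?thesis by simp
 qed
 have AF: "F b - F a = A a b (b - a)" if ab: "a \<in> ?D" "b \<in> ?D" for a b
 proof -
  have inD: "a + s *\<^sub>R (b - a) \<in> ?D" if "s \<in> {0..1}" for s
   using convexD_alt[OF convex_cball ab, of s] that by (simp add: algebra_simps)
  have "((\<lambda>s. F (a + s *\<^sub>R (b - a))) has_vector_derivative F' (pr (a + s *\<^sub>R (b - a))) (b - a)) (at s within {0..1})" if s: "s \<in> {0..1}" for s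
  proof -
   have 1: "((\<lambda>s. a + s *\<^sub>R (b - a)) has_derivative (\<lambda>h. h *\<^sub>R (b - a))) (at s within {0..1})"
    by (auto intro!: derivative_eq_intros)
   have "(F has_derivative F' (pr (a + s *\<^sub>R (b - a)))) (at (a + s *\<^sub>R (b - a)))"
    using inD[OF s] \<rho> by (auto simp: pr_id intro!: dF)
   from has_derivative_compose[OF 1 this] show ?thesis
    by (simp add: has_vector_derivative_def blinfun.scaleR_right)
  qed
  then have "((\<lambda>s. F' (pr (a + s *\<^sub>R (b - a))) (b - a)) has_integral F (a + 1 *\<^sub>R (b - a)) - F (a + 0 *\<^sub>R (b - a))) {0..1}"
   by (intro fundamental_theorem_of_calculus) auto
  note h1 = this
  have "((\<lambda>s. F' (pr (a + s *\<^sub>R (b - a)))) has_integral A a b) {0..1}"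
   unfolding A_def by (intro integrable_integral integrable_continuous_real cF' continuous_intros)
  from has_integral_linear[OF this bounded_bilinear.bounded_linear_left[OF bounded_bilinear_blinfun_apply, of "b - a"]]
  have "((\<lambda>s. F' (pr (a + s *\<^sub>R (b - a))) (b - a)) has_integral A a b (b - a)) {0..1}" by (simp add: o_def)
  from has_integral_unique[OF h1 this] show ?thesis by simp
 qed
 have AA: "A a a = F' (pr a)" for a by (simp add: A_def)
 \<comment> \<open>The parameter is now a pair of initial values and the unknown an operator;
   \<open>Z\<close> solves the linear equation that governs the difference of the two
   solutions.\<close>
 obtain Z :: "'x \<times> 'x \<Rightarrow> real \<Rightarrow> 'x \<Rightarrow>\<^sub>L 'x" where Z: "continuous_on UNIV (\<lambda>(k,t). Z k t)" "\<And>k. Z k 0 = id_blinfun"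
  "\<And>k t. \<bar>t\<bar> < e \<Longrightarrow> (Z k has_vector_derivative A (\<phi> (fst k) t) (\<phi> (snd k) t) o\<^sub>L Z k t) (at t)"
 proof (rule picard_parameter[of "\<lambda>k t z. A (\<phi> (fst k) t) (\<phi> (snd k) t) o\<^sub>L z" "\<lambda>k. id_blinfun" L L e])
  have 1: "continuous_on UNIV (\<lambda>y::('x \<times> 'x) \<times> real \<times> ('x \<Rightarrow>\<^sub>L 'x). A (\<phi> (fst (fst y)) (fst (snd y))) (\<phi> (snd (fst y)) (fst (snd y))))"
   using continuous_on_compose2[OF cA continuous_on_Pair[OF
    continuous_on_compose2[OF \<phi>(1), of UNIV "\<lambda>y::('x \<times> 'x) \<times> real \<times> ('x \<Rightarrow>\<^sub>L 'x). (fst (fst y), fst (snd y))"]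
    continuous_on_compose2[OF \<phi>(1), of UNIV "\<lambda>y::('x \<times> 'x) \<times> real \<times> ('x \<Rightarrow>\<^sub>L 'x). (snd (fst y), fst (snd y))"]]]
   by (simp add: continuous_intros)
  show "continuous_on UNIV (\<lambda>(k, t, z::'x \<Rightarrow>\<^sub>L 'x). A (\<phi> (fst k) t) (\<phi> (snd k) t) o\<^sub>L z)"
   unfolding split_beta by (intro bounded_bilinear.continuous_on[OF bounded_bilinear_blinfun_compose] 1 continuous_intros)
  show "norm ((A (\<phi> (fst k) t) (\<phi> (snd k) t) o\<^sub>L z) - (A (\<phi> (fst k) t) (\<phi> (snd k) t) o\<^sub>L w)) \<le> L * norm (z - w)" for k t and z w :: "'x \<Rightarrow>\<^sub>L 'x"
  proof -
   let ?A = "A (\<phi> (fst k) t) (\<phi> (snd k) t)"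
   have "(?A o\<^sub>L z) - (?A o\<^sub>L w) = ?A o\<^sub>L (z - w)" by (rule blinfun_eqI) (simp add: blinfun.diff_left blinfun.diff_right)
   then show ?thesis using norm_blinfun_compose[of ?A "z - w"] mult_right_mono[OF nA, of "norm (z - w)"]
    by (metis norm_ge_zero order_trans)
  qed
  show "norm (A (\<phi> (fst k) t) (\<phi> (snd k) t) o\<^sub>L id_blinfun) \<le> L" for k t
  proof -
   have "A (\<phi> (fst k) t) (\<phi> (snd k) t) o\<^sub>L id_blinfun = A (\<phi> (fst k) t) (\<phi> (snd k) t)" by (rule blinfun_eqI) simp
   then show ?thesis by (simp add: nA)
  qed
 qed (use e L in auto)
 \<comment> \<open>Both sides solve the same linear equation in \<open>t\<close> and agree at time
   0.\<close>
 have diff: "\<phi> \<eta> t - \<phi> \<xi> t = Z (\<xi>, \<eta>) t (\<eta> - \<xi>)" if \<xi>: "\<xi> \<in> ball z0 (\<rho>/2)" and \<eta>: "\<eta> \<in> ball z0 (\<rho>/2)" and t: "\<bar>t\<bar> < e" for \<xi> \<eta> t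
 proof -
  let ?u = "\<lambda>t. \<phi> \<eta> t - \<phi> \<xi> t - Z (\<xi>, \<eta>) t (\<eta> - \<xi>)"
  let ?A = "\<lambda>t. A (\<phi> \<xi> t) (\<phi> \<eta> t)"
  have "?u t = 0"
  proof (rule gronwall_zero[of 0 e ?u "\<lambda>t. ?A t (?u t)" L])
   fix s assume s: "\<bar>s - 0\<bar> < e"
   have dZ: "((\<lambda>t. Z (\<xi>, \<eta>) t (\<eta> - \<xi>)) has_vector_derivative ?A s (Z (\<xi>, \<eta>) s (\<eta> - \<xi>))) (at s)"
    using bounded_linear.has_vector_derivative[OF bounded_bilinear.bounded_linear_left[OF bounded_bilinear_blinfun_apply] Z(3)[of s "(\<xi>, \<eta>)"], of "\<eta> - \<xi>"] s by simp
   have "F (pr (\<phi> \<eta> s)) - F (pr (\<phi> \<xi> s)) = ?A s (\<phi> \<eta> s - \<phi> \<xi> s)"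
    using AF[of "\<phi> \<xi> s" "\<phi> \<eta> s"] near[OF \<xi>, of s] near[OF \<eta>, of s] by (simp add: pr_id)
   moreover have "(?u has_vector_derivative F (pr (\<phi> \<eta> s)) - F (pr (\<phi> \<xi> s)) - ?A s (Z (\<xi>, \<eta>) s (\<eta> - \<xi>))) (at s)"
    by (intro has_vector_derivative_diff dZ \<phi>(3)) (use s in auto)
   ultimately show "(?u has_vector_derivative ?A s (?u s)) (at s)"
    by (simp add: blinfun.diff_right)
   show "norm (?A s (?u s)) \<le> L * norm (?u s)"
    using norm_blinfun[of "?A s" "?u s"] mult_right_mono[OF nA, of "norm (?u s)"] by (meson norm_ge_zero order_trans)
  qed (use t \<phi>(2) Z(2) in auto)
  then show ?thesis by simp
 qed
 have cZ: "continuous_on UNIV (\<lambda>y. Z (h y) (l y))" if "continuous_on UNIV h" "continuous_on UNIV l" for h and l :: "'p::topological_space \<Rightarrow> real"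
  using continuous_on_compose2[OF Z(1) continuous_on_Pair[OF that]] by simp
 show ?thesis
 proof (rule that[of "\<rho>/2" e \<phi> "\<lambda>z t. Z (z,z) t"])
  fix z t assume z: "z \<in> ball z0 (\<rho>/2)" and t: "\<bar>t\<bar> < (e::real)"
  have pz: "pr (\<phi> z t) = \<phi> z t" using near[OF z, of t] by (simp add: pr_id)
  show "\<phi> z t \<in> S" using near[OF z, of t] \<rho> by auto
  show "(\<phi> z has_vector_derivative F (\<phi> z t)) (at t)" using \<phi>(3)[OF t, of z] pz by simp
  show "((\<lambda>z. \<phi> z t) has_derivative blinfun_apply (Z (z,z) t)) (at z)"
  proof (rule caratheodory_has_derivative[of "ball z0 (\<rho>/2)" z "\<lambda>z. \<phi> z t" "\<lambda>y. Z (z,y) t"])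
   have "continuous_on UNIV (\<lambda>y. Z (z,y) t)" by (intro cZ continuous_intros)
   then show "isCont (\<lambda>y. Z (z,y) t) z" by (simp add: continuous_on_eq_continuous_at)
  qed (use z t in \<open>auto intro!: diff\<close>)
  show "((\<lambda>t. Z (z,z) t) has_vector_derivative F' (\<phi> z t) o\<^sub>L Z (z,z) t) (at t)"
   using Z(3)[OF t, of "(z,z)"] pz by (simp add: AA)
 next
  have "continuous_on UNIV (\<lambda>p::'x \<times> real. Z (fst p, fst p) (snd p))" by (intro cZ continuous_intros)
  then show "continuous_on UNIV (\<lambda>(z, t). Z (z, z) t)" by (simp add: split_beta)
 qed (use \<rho> e in \<open>simp_all add: \<phi>(1,2)\<close>)
qed

section \<open>Metrics and Christoffel symbols in charts\<close>

lemma frechet_derivative_eq: "(f has_derivative f') (at x) \<Longrightarrow> frechet_derivative f (at x) = f'"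
 by (rule frechet_derivative_at[symmetric])

lemma sum_swap3:
 fixes F :: "'i::finite \<Rightarrow> 'j::finite \<Rightarrow> 'k::finite \<Rightarrow> 'b::comm_monoid_add"
 shows "(\<Sum>k\<in>UNIV. \<Sum>i\<in>UNIV. \<Sum>j\<in>UNIV. F i j k) = (\<Sum>i\<in>UNIV. \<Sum>j\<in>UNIV. \<Sum>k\<in>UNIV. F i j k)"
proof -
 have "(\<Sum>k\<in>UNIV. \<Sum>i\<in>UNIV. \<Sum>j\<in>UNIV. F i j k) = (\<Sum>i\<in>UNIV. \<Sum>k\<in>UNIV. \<Sum>j\<in>UNIV. F i j k)"
  by (rule sum.swap)
 also have "\<dots> = (\<Sum>i\<in>UNIV. \<Sum>j\<in>UNIV. \<Sum>k\<in>UNIV. F i j k)"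
  by (intro sum.cong refl sum.swap)
 finally show ?thesis .
qed

section \<open>Contractions of the metric and of the Christoffel symbols in a chart\<close>

definition gcoef :: "('a, 'n::finite) riemannian \<Rightarrow> ('a, 'n) chart \<Rightarrow> 'n \<Rightarrow> 'n \<Rightarrow> real^'n \<Rightarrow> real" where
 "gcoef M C i j x = gmat M C x $ i $ j"

lemma gcoef_abs: "gcoef M C i j = (\<lambda>x. gmat M C x $ i $ j)"
 by (simp add: gcoef_def fun_eq_iff)

lemma ginner_bform: "ginner M C x v w = bform (gcoef M C) x v w"
 unfolding ginner_def bform_def gcoef_def inner_vec_def matrix_vector_mult_def
 by (simp add: sum_distrib_left mult.assoc mult.left_commute)

definition dginner :: "('a, 'n::finite) riemannian \<Rightarrow> ('a, 'n) chart \<Rightarrow> real^'n \<Rightarrow> real^'n \<Rightarrow> real^'n \<Rightarrow> real^'n \<Rightarrow> real" where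
 "dginner M C x = dbform (gcoef M C) x"

text \<open>In a chart, the covariant derivative of a field \<open>w\<close> along a curve with
  velocity \<open>v\<close> is \<open>w' + gam v w\<close>, and the geodesic equation is
  \<open>v' = - gam v v\<close>.\<close>

definition gam :: "('a, 'n::finite) riemannian \<Rightarrow> ('a, 'n) chart \<Rightarrow> real^'n \<Rightarrow> real^'n \<Rightarrow> real^'n \<Rightarrow> real^'n" where
 "gam M C x v w = (\<chi> k. bform (christoffel M C k) x v w)"

definition dgam :: "('a, 'n::finite) riemannian \<Rightarrow> ('a, 'n) chart \<Rightarrow> real^'n \<Rightarrow> real^'n \<Rightarrow> real^'n \<Rightarrow> real^'n \<Rightarrow> real^'n" where
 "dgam M C x h v w = (\<chi> k. dbform (christoffel M C k) x h v w)"

lemma ginner_linear: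
 "ginner M C x (v + v') w = ginner M C x v w + ginner M C x v' w" "ginner M C x v (w + w') = ginner M C x v w + ginner M C x v w'"
 "ginner M C x (v - v') w = ginner M C x v w - ginner M C x v' w" "ginner M C x v (w - w') = ginner M C x v w - ginner M C x v w'"
 "ginner M C x (r *\<^sub>R v) w = r * ginner M C x v w" "ginner M C x v (r *\<^sub>R w) = r * ginner M C x v w"
 "ginner M C x (- v) w = - ginner M C x v w" "ginner M C x v (- w) = - ginner M C x v w"
 "ginner M C x 0 w = 0" "ginner M C x v 0 = 0"
 by (simp_all add: ginner_bform bform_linear)

lemma gam_linear:
 "gam M C x (v + v') w = gam M C x v w + gam M C x v' w" "gam M C x v (w + w') = gam M C x v w + gam M C x v w'"
 "gam M C x (r *\<^sub>R v) w = r *\<^sub>R gam M C x v w" "gam M C x v (r *\<^sub>R w) = r *\<^sub>R gam M C x v w"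
 "gam M C x 0 w = 0" "gam M C x v 0 = 0"
 by (simp_all add: gam_def bform_linear vec_eq_iff)

text \<open>Meaningful where \<open>H\<close> is continuous and differentiable in charts;
  \<open>pullback_metric_chart\<close> shows that any chart around \<open>H z\<close> gives the same
  value.\<close>

definition pullback_metric :: "('a, 'n::finite) riemannian \<Rightarrow> ('v::real_normed_vector \<Rightarrow> 'a) \<Rightarrow> 'v \<Rightarrow> 'v \<Rightarrow> 'v \<Rightarrow> real" where
 "pullback_metric M H z a b =
   (let C = chart_at M (H z); L = frechet_derivative (chart_map C \<circ> H) (at z)
   in ginner M C (chart_map C (H z)) (L a) (L b))"

definition d2_transition :: "('a, 'n::finite) chart \<Rightarrow> ('a, 'n) chart \<Rightarrow> real^'n \<Rightarrow> real^'n \<Rightarrow> real^'n \<Rightarrow> real^'n" where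
 "d2_transition C D x h k = (\<Sum>i\<in>UNIV. \<Sum>j\<in>UNIV. (h $ i * k $ j) *\<^sub>R partial_deriv i (partial_deriv j (transition C D)) x)"

locale riemannian_mfd =
 fixes M :: "('a::{t2_space,second_countable_topology}, 'n::finite) riemannian"
 assumes riem: "riemannian_manifold M"
begin

lemma is_chart: "C \<in> atlas M \<Longrightarrow> is_chart C"
 using riem by (auto simp: riemannian_manifold_def)

lemma chartD:
 assumes "C \<in> atlas M"
 shows "open (chart_dom C)" "open (chart_img C)" "continuous_on (chart_dom C) (chart_map C)" "continuous_on (chart_img C) (chart_inv C)"
  "\<And>p. p \<in> chart_dom C \<Longrightarrow> chart_inv C (chart_map C p) = p" "\<And>x. x \<in> chart_img C \<Longrightarrow> chart_map C (chart_inv C x) = x"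
  "\<And>x. x \<in> chart_img C \<Longrightarrow> chart_inv C x \<in> chart_dom C" "\<And>p. p \<in> chart_dom C \<Longrightarrow> chart_map C p \<in> chart_img C"
 using is_chart[OF assms] unfolding is_chart_def homeomorphism_def by auto

lemma chart_at: "chart_at M p \<in> atlas M" "p \<in> chart_dom (chart_at M p)"
proof -
 have "\<exists>C. C \<in> atlas M \<and> p \<in> chart_dom C"
  using riem unfolding riemannian_manifold_def by blast
 then show "chart_at M p \<in> atlas M" "p \<in> chart_dom (chart_at M p)"
  unfolding chart_at_def using someI_ex[of "\<lambda>C. C \<in> atlas M \<and> p \<in> chart_dom C"] by auto
qed

lemma open_overlap: "C \<in> atlas M \<Longrightarrow> D \<in> atlas M \<Longrightarrow> open (chart_map C ` (chart_dom C \<inter> chart_dom D))"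
proof -
 assume C: "C \<in> atlas M" and D: "D \<in> atlas M"
 have eq: "chart_map C ` (chart_dom C \<inter> chart_dom D) = chart_img C \<inter> chart_inv C -` chart_dom D"
  using chartD[OF C] by (auto simp: chart_img_def)
 show ?thesis unfolding eq
  by (rule continuous_open_preimage) (use chartD[OF C] chartD(1)[OF D] in auto)
qed

lemma transition_smooth: "C \<in> atlas M \<Longrightarrow> D \<in> atlas M \<Longrightarrow> Ck_on k (chart_map C ` (chart_dom C \<inter> chart_dom D)) (transition C D)"
 using riem unfolding riemannian_manifold_def smooth_fun_on_def by blast

lemma transition_map: "C \<in> atlas M \<Longrightarrow> p \<in> chart_dom C \<Longrightarrow> transition C D (chart_map C p) = chart_map D p"
 by (simp add: transition_def chartD)

lemma transition_has_derivative:
 assumes "C \<in> atlas M" "D \<in> atlas M" "x \<in> chart_map C ` (chart_dom C \<inter> chart_dom D)"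
 shows "(transition C D has_derivative frechet_derivative (transition C D) (at x)) (at x)"
 by (rule C1_onD(1)[OF transition_smooth[OF assms(1,2)] assms(3)])

lemma ginner_transition:
 assumes "C \<in> atlas M" "D \<in> atlas M" "x \<in> chart_map C ` (chart_dom C \<inter> chart_dom D)"
 shows "ginner M C x v w = ginner M D (transition C D x) (frechet_derivative (transition C D) (at x) v) (frechet_derivative (transition C D) (at x) w)"
 using riem assms unfolding riemannian_manifold_def by blast

lemma ginner_sym: "C \<in> atlas M \<Longrightarrow> x \<in> chart_img C \<Longrightarrow> ginner M C x v w = ginner M C x w v"
 using riem unfolding riemannian_manifold_def by blast

lemma ginner_pos: "C \<in> atlas M \<Longrightarrow> x \<in> chart_img C \<Longrightarrow> v \<noteq> 0 \<Longrightarrow> ginner M C x v v > 0"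
 using riem unfolding riemannian_manifold_def by blast

lemma ginner_nonneg: "C \<in> atlas M \<Longrightarrow> x \<in> chart_img C \<Longrightarrow> ginner M C x v v \<ge> 0"
 using ginner_pos[of C x v] by (cases "v = 0") (auto simp: ginner_linear)

lemma ginner_eq0: "C \<in> atlas M \<Longrightarrow> x \<in> chart_img C \<Longrightarrow> ginner M C x v v = 0 \<longleftrightarrow> v = 0"
 using ginner_pos[of C x v] by (cases "v = 0") (auto simp: ginner_linear)

lemma ginner_cauchy_schwarz:
 assumes C: "C \<in> atlas M" "x \<in> chart_img C"
 shows "(ginner M C x v w)\<^sup>2 \<le> ginner M C x v v * ginner M C x w w"
proof (cases "v = 0")
 case False
 let ?a = "ginner M C x v v" and ?b = "ginner M C x v w" and ?c = "ginner M C x w w"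
 have a: "?a > 0" using ginner_pos[OF C False] .
 have "0 \<le> ginner M C x (w - (?b / ?a) *\<^sub>R v) (w - (?b / ?a) *\<^sub>R v)" by (rule ginner_nonneg[OF C])
 also have "\<dots> = ?c - ?b\<^sup>2 / ?a"
  using a ginner_sym[OF C, of w v] by (simp add: ginner_linear field_simps power2_eq_square)
 finally show ?thesis using a by (simp add: field_simps)
qed (simp add: ginner_linear)

lemma gcoef_smooth: "C \<in> atlas M \<Longrightarrow> Ck_on k (chart_img C) (gcoef M C i j)"
proof -
 assume C: "C \<in> atlas M"
 have 1: "Ck_on k (chart_img C) (gmat M C)"
  using riem C unfolding riemannian_manifold_def smooth_fun_on_def by blast
 have 2: "bounded_linear (\<lambda>A::real^'n^'n. A $ i $ j)"
  by (rule bounded_linear_compose[OF bounded_linear_vec_nth bounded_linear_vec_nth])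
 show ?thesis unfolding gcoef_abs by (rule Ck_on_bounded_linear[OF 2 chartD(2)[OF C] 1])
qed

lemma gcoef_differentiable: "C \<in> atlas M \<Longrightarrow> x \<in> chart_img C \<Longrightarrow> gcoef M C i j differentiable at x"
 using gcoef_smooth[of C "Suc 0"] by simp

lemma gcoef_sym: "C \<in> atlas M \<Longrightarrow> x \<in> chart_img C \<Longrightarrow> gcoef M C i j x = gcoef M C j i x"
 using ginner_sym[of C x "axis i 1" "axis j 1"]
 by (simp add: ginner_def gcoef_def inner_axis' matrix_vector_mult_basis column_def)

lemma partial_gcoef_sym: "C \<in> atlas M \<Longrightarrow> x \<in> chart_img C \<Longrightarrow> partial_deriv k (gcoef M C i j) x = partial_deriv k (gcoef M C j i) x"
proof -
 assume C: "C \<in> atlas M" "x \<in> chart_img C"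
 have "(gcoef M C j i has_derivative (\<lambda>h. \<Sum>k\<in>UNIV. h $ k *\<^sub>R partial_deriv k (gcoef M C i j) x)) (at x)"
  by (rule has_derivative_transform_within_open[OF has_derivative_partial[OF gcoef_differentiable[OF C]] chartD(2)[OF C(1)] C(2)])
    (use gcoef_sym C in auto)
 from partial_deriv_eq[OF this] show ?thesis by (simp add: axis_def if_distrib if_distribR cong: if_cong)
qed

lemma det_gmat_nz: "C \<in> atlas M \<Longrightarrow> x \<in> chart_img C \<Longrightarrow> det (gmat M C x) \<noteq> 0"
proof -
 assume C: "C \<in> atlas M" "x \<in> chart_img C"
 have "\<forall>v. gmat M C x *v v = 0 \<longrightarrow> v = 0"
 proof (intro allI impI)
  fix v assume "gmat M C x *v v = 0"
  then have "ginner M C x v v = 0" unfolding ginner_def by simp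
  then show "v = 0" using ginner_eq0[OF C] by blast
 qed
 then show ?thesis
  unfolding invertible_det_nz[symmetric] invertible_left_inverse matrix_left_invertible_ker .
qed

lemma C1_on_partial_gcoef: "C \<in> atlas M \<Longrightarrow> Ck_on (Suc 0) (chart_img C) (partial_deriv k (gcoef M C i j))"
 using gcoef_smooth[of C "Suc (Suc 0)" i j] by simp

lemma christoffel_C1: "C \<in> atlas M \<Longrightarrow> Ck_on (Suc 0) (chart_img C) (christoffel M C k i j)"
proof -
 assume C: "C \<in> atlas M"
 have "Ck_on (Suc 0) (chart_img C) (\<lambda>x. (\<Sum>l\<in>UNIV. matrix_inv (gmat M C x) $ k $ l *
    (partial_deriv i (gcoef M C j l) x + partial_deriv j (gcoef M C i l) x - partial_deriv l (gcoef M C i j) x)) * (1/2))"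
  by (intro C1_on_mult C1_on_sum C1_on_const C1_on_add C1_on_diff C1_on_matrix_inv chartD(2)[OF C] det_gmat_nz[OF C] C1_on_partial_gcoef[OF C])
    (use gcoef_smooth[OF C, of "Suc 0"] in \<open>simp_all add: gcoef_abs del: Ck_on.simps\<close>)
 then show ?thesis by (rule Ck_on_cong[OF chartD(2)[OF C], rotated]) (simp add: christoffel_def gcoef_abs)
qed

lemma christoffel_differentiable: "C \<in> atlas M \<Longrightarrow> x \<in> chart_img C \<Longrightarrow> christoffel M C k i j differentiable at x"
 using christoffel_C1[of C] by simp

lemma christoffel_sym: "C \<in> atlas M \<Longrightarrow> x \<in> chart_img C \<Longrightarrow> christoffel M C k i j x = christoffel M C k j i x"
 using partial_gcoef_sym[of C x] unfolding christoffel_def gcoef_abs[symmetric]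
 by (simp add: add.commute)

lemma gam_sym: "C \<in> atlas M \<Longrightarrow> x \<in> chart_img C \<Longrightarrow> gam M C x v w = gam M C x w v"
 unfolding gam_def bform_def vec_eq_iff
 by (subst sum.swap) (simp add: christoffel_sym[of C x] mult.commute mult.left_commute)

lemma dginner_sym: "C \<in> atlas M \<Longrightarrow> x \<in> chart_img C \<Longrightarrow> dginner M C x h v w = dginner M C x h w v"
 unfolding dginner_def dbform_def
 by (subst sum.swap) (simp add: partial_gcoef_sym[of C x] mult.commute mult.left_commute)

text \<open>The Koszul formula for fields with constant coefficients, whose brackets vanish.
  Lowering the index cancels the inverse matrix in the definition of the Christoffel
  symbols.\<close>

lemma koszul:
 assumes C: "C \<in> atlas M" "x \<in> chart_img C"
 shows "ginner M C x (gam M C x v w) e = (dginner M C x v w e + dginner M C x w v e - dginner M C x e v w) / 2"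
proof -
 let ?G = "gmat M C x"
 let ?p = "\<lambda>k i j. partial_deriv k (gcoef M C i j) x"
 define T where "T i j l = ?p i j l + ?p j i l - ?p l i j" for i j l
 define r :: real where "r = 1 / 2"
 \<comment> \<open>Half of the Koszul combination with the last slot left free, so that
   \<open>gam\<close> is the inverse metric applied to \<open>b\<close>.\<close>
 define b :: "real^'n" where "b = (\<chi> l. \<Sum>i\<in>UNIV. \<Sum>j\<in>UNIV. T i j l * v $ i * w $ j * r)"
 have ch: "christoffel M C k i j x = (\<Sum>l\<in>UNIV. matrix_inv ?G $ k $ l * T i j l) * r" for k i j
  by (simp add: christoffel_def T_def gcoef_abs[symmetric] r_def)
 have "gam M C x v w $ k = (matrix_inv ?G *v b) $ k" for k
 proof -
  have "(matrix_inv ?G *v b) $ k = (\<Sum>l\<in>UNIV. \<Sum>i\<in>UNIV. \<Sum>j\<in>UNIV. matrix_inv ?G $ k $ l * (T i j l * v $ i * w $ j * r))"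
   by (simp add: matrix_vector_mult_def b_def sum_distrib_left)
  also have "\<dots> = (\<Sum>i\<in>UNIV. \<Sum>j\<in>UNIV. \<Sum>l\<in>UNIV. matrix_inv ?G $ k $ l * (T i j l * v $ i * w $ j * r))"
   by (rule sum_swap3)
  also have "\<dots> = gam M C x v w $ k"
   unfolding gam_def bform_def ch vec_lambda_beta sum_distrib_right by (intro sum.cong refl) (simp only: mult_ac)
  finally show ?thesis by simp
 qed
 then have "gam M C x v w = matrix_inv ?G *v b" by (simp add: vec_eq_iff)
 then have Gb: "?G *v gam M C x v w = b"
  by (simp add: matrix_vector_mul_assoc matrix_mul_matrix_inv det_gmat_nz[OF C])
 have "ginner M C x (gam M C x v w) e = ginner M C x e (gam M C x v w)" by (rule ginner_sym[OF C])
 also have "\<dots> = (\<Sum>l\<in>UNIV. e $ l * (\<Sum>i\<in>UNIV. \<Sum>j\<in>UNIV. T i j l * v $ i * w $ j * r))"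
  unfolding ginner_def Gb inner_vec_def b_def by simp
 also have "\<dots> = (\<Sum>l\<in>UNIV. \<Sum>i\<in>UNIV. \<Sum>j\<in>UNIV. r * (?p i j l * v $ i * w $ j * e $ l) + r * (?p j i l * v $ i * w $ j * e $ l) - r * (?p l i j * v $ i * w $ j * e $ l))"
  unfolding sum_distrib_left T_def by (intro sum.cong refl) (simp only: algebra_simps)
 also have "\<dots> = r * (\<Sum>l\<in>UNIV. \<Sum>i\<in>UNIV. \<Sum>j\<in>UNIV. ?p i j l * v $ i * w $ j * e $ l) + r * (\<Sum>l\<in>UNIV. \<Sum>i\<in>UNIV. \<Sum>j\<in>UNIV. ?p j i l * v $ i * w $ j * e $ l)
   - r * (\<Sum>l\<in>UNIV. \<Sum>i\<in>UNIV. \<Sum>j\<in>UNIV. ?p l i j * v $ i * w $ j * e $ l)"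
  unfolding sum.distrib sum_subtractf sum_distrib_left ..
 also have "(\<Sum>l\<in>UNIV. \<Sum>i\<in>UNIV. \<Sum>j\<in>UNIV. ?p i j l * v $ i * w $ j * e $ l) = dginner M C x v w e"
 proof -
  have "(\<Sum>l\<in>UNIV. \<Sum>i\<in>UNIV. \<Sum>j\<in>UNIV. ?p i j l * v $ i * w $ j * e $ l) = (\<Sum>i\<in>UNIV. \<Sum>j\<in>UNIV. \<Sum>l\<in>UNIV. ?p i j l * v $ i * w $ j * e $ l)"
   by (rule sum_swap3)
  also have "\<dots> = (\<Sum>j\<in>UNIV. \<Sum>l\<in>UNIV. \<Sum>i\<in>UNIV. ?p i j l * v $ i * w $ j * e $ l)" by (rule sum_swap3)
  finally show ?thesis unfolding dginner_def dbform_def sum_distrib_right by (simp only: mult_ac)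
 qed
 also have "(\<Sum>l\<in>UNIV. \<Sum>i\<in>UNIV. \<Sum>j\<in>UNIV. ?p j i l * v $ i * w $ j * e $ l) = dginner M C x w v e"
 proof -
  have "(\<Sum>l\<in>UNIV. \<Sum>i\<in>UNIV. \<Sum>j\<in>UNIV. ?p j i l * v $ i * w $ j * e $ l) = (\<Sum>i\<in>UNIV. \<Sum>j\<in>UNIV. \<Sum>l\<in>UNIV. ?p j i l * v $ i * w $ j * e $ l)"
   by (rule sum_swap3)
  also have "\<dots> = (\<Sum>i\<in>UNIV. \<Sum>l\<in>UNIV. \<Sum>j\<in>UNIV. ?p j i l * v $ i * w $ j * e $ l)" by (intro sum.cong refl sum.swap)
  finally show ?thesis unfolding dginner_def dbform_def sum_distrib_right by (simp only: mult_ac)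
 qed
 also have "(\<Sum>l\<in>UNIV. \<Sum>i\<in>UNIV. \<Sum>j\<in>UNIV. ?p l i j * v $ i * w $ j * e $ l) = dginner M C x e v w"
 proof -
  have "(\<Sum>l\<in>UNIV. \<Sum>i\<in>UNIV. \<Sum>j\<in>UNIV. ?p l i j * v $ i * w $ j * e $ l) = (\<Sum>i\<in>UNIV. \<Sum>j\<in>UNIV. \<Sum>l\<in>UNIV. ?p l i j * v $ i * w $ j * e $ l)"
   by (rule sum_swap3)
  then show ?thesis unfolding dginner_def dbform_def sum_distrib_right by (simp only: mult_ac)
 qed
 finally show ?thesis by (simp add: r_def field_simps)
qed

text \<open>In the sum of the two Koszul formulas all terms cancel in pairs except the derivative in
  direction \<open>h\<close>, which occurs twice.\<close>

lemma metric_compatible: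
 assumes C: "C \<in> atlas M" "x \<in> chart_img C"
 shows "dginner M C x h v w = ginner M C x (gam M C x h v) w + ginner M C x v (gam M C x h w)"
 unfolding ginner_sym[OF C, of v] koszul[OF C] dginner_sym[OF C, of h w v]
 by (simp add: field_simps)

lemma ginner_has_derivative:
 assumes C: "C \<in> atlas M" "x z \<in> chart_img C"
  and d: "(x has_derivative x') (at z within Z)" "(v has_derivative v') (at z within Z)" "(w has_derivative w') (at z within Z)"
 shows "((\<lambda>z. ginner M C (x z) (v z) (w z)) has_derivative
  (\<lambda>h. dginner M C (x z) (x' h) (v z) (w z) + ginner M C (x z) (v' h) (w z) + ginner M C (x z) (v z) (w' h))) (at z within Z)"
 unfolding ginner_bform dginner_def by (rule has_derivative_bform[OF _ d]) (rule gcoef_differentiable[OF C])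

lemma gam_has_derivative:
 assumes C: "C \<in> atlas M" "x z \<in> chart_img C"
  and d: "(x has_derivative x') (at z within Z)" "(v has_derivative v') (at z within Z)" "(w has_derivative w') (at z within Z)"
 shows "((\<lambda>z. gam M C (x z) (v z) (w z)) has_derivative
  (\<lambda>h. dgam M C (x z) (x' h) (v z) (w z) + gam M C (x z) (v' h) (w z) + gam M C (x z) (v z) (w' h))) (at z within Z)"
proof (subst has_derivative_componentwise_within, rule ballI)
 fix b :: "real^'n" assume "b \<in> Basis"
 then obtain k where b: "b = axis k 1" by (auto simp: Basis_vec_def)
 show "((\<lambda>z. gam M C (x z) (v z) (w z) \<bullet> b) has_derivative
  (\<lambda>h. (dgam M C (x z) (x' h) (v z) (w z) + gam M C (x z) (v' h) (w z) + gam M C (x z) (v z) (w' h)) \<bullet> b)) (at z within Z)"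
  using has_derivative_bform[where a="christoffel M C k", OF christoffel_differentiable[OF C] d]
  unfolding b gam_def dgam_def inner_axis vector_add_component vec_lambda_beta inner_real_def mult_1_right .
qed

text \<open>Replaces the index sums of the definition by operator notation; the derivation of the
  Jacobi equation uses the curvature in this form only.\<close>

lemma riemann_tensor_gam:
 "riemann_tensor M C x u v w = dgam M C x u v w - dgam M C x v u w + gam M C x u (gam M C x v w) - gam M C x v (gam M C x u w)"
proof -
 let ?c = "\<lambda>l i j. christoffel M C l i j x" and ?d = "\<lambda>l i j k. partial_deriv i (christoffel M C l j k) x"
 have "riemann_tensor M C x u v w $ l = (dgam M C x u v w - dgam M C x v u w + gam M C x u (gam M C x v w) - gam M C x v (gam M C x u w)) $ l" for l
 proof -
  have 1: "dgam M C x u v w $ l = (\<Sum>i\<in>UNIV. \<Sum>j\<in>UNIV. \<Sum>k\<in>UNIV. ?d l i j k * u $ i * v $ j * w $ k)"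
   unfolding sum_swap3[where F="\<lambda>j k i. ?d l i j k * u $ i * v $ j * w $ k"]
    dgam_def dbform_def vec_lambda_beta sum_distrib_right by (simp only: mult_ac)
  have 2: "dgam M C x v u w $ l = (\<Sum>i\<in>UNIV. \<Sum>j\<in>UNIV. \<Sum>k\<in>UNIV. ?d l j i k * u $ i * v $ j * w $ k)"
  proof -
   have "(\<Sum>i\<in>UNIV. \<Sum>j\<in>UNIV. \<Sum>k\<in>UNIV. ?d l j i k * u $ i * v $ j * w $ k) = (\<Sum>i\<in>UNIV. \<Sum>k\<in>UNIV. \<Sum>j\<in>UNIV. ?d l j i k * u $ i * v $ j * w $ k)"
    by (intro sum.cong refl sum.swap)
   then show ?thesis unfolding dgam_def dbform_def vec_lambda_beta sum_distrib_right by (simp only: mult_ac)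
  qed
  have 3: "gam M C x u (gam M C x v w) $ l = (\<Sum>i\<in>UNIV. \<Sum>j\<in>UNIV. \<Sum>k\<in>UNIV. (\<Sum>m\<in>UNIV. ?c m j k * ?c l i m) * u $ i * v $ j * w $ k)" for u v w
  proof -
   have "gam M C x u (gam M C x v w) $ l = (\<Sum>i\<in>UNIV. \<Sum>m\<in>UNIV. \<Sum>j\<in>UNIV. \<Sum>k\<in>UNIV. ?c m j k * ?c l i m * u $ i * v $ j * w $ k)"
    unfolding gam_def bform_def vec_lambda_beta sum_distrib_left by (simp only: mult_ac)
   also have "\<dots> = (\<Sum>i\<in>UNIV. \<Sum>j\<in>UNIV. \<Sum>k\<in>UNIV. \<Sum>m\<in>UNIV. ?c m j k * ?c l i m * u $ i * v $ j * w $ k)"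
    by (intro sum.cong refl sum_swap3)
   finally show ?thesis by (simp only: sum_distrib_right)
  qed
  have 4: "gam M C x v (gam M C x u w) $ l = (\<Sum>i\<in>UNIV. \<Sum>j\<in>UNIV. \<Sum>k\<in>UNIV. (\<Sum>m\<in>UNIV. ?c m i k * ?c l j m) * u $ i * v $ j * w $ k)"
   unfolding 3 by (subst sum.swap) (simp only: mult_ac)
  show ?thesis unfolding vector_minus_component vector_add_component 1 2 3[of u v w] 4
   unfolding riemann_tensor_def riemann_coeff_def vec_lambda_beta sum_subtractf[symmetric] sum.distrib[symmetric]
   by (intro sum.cong refl) (simp add: sum_subtractf algebra_simps)
 qed
 then show ?thesis by (simp add: vec_eq_iff)
qed

section \<open>Differentials and velocities under a change of charts\<close>

lemma has_derivative_chart_change: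
 fixes H :: "'v::real_normed_vector \<Rightarrow> 'a"
 assumes C: "C \<in> atlas M" "H z \<in> chart_dom C" and D: "D \<in> atlas M" "H z \<in> chart_dom D"
  and H: "continuous (at z) H" and L: "(chart_map C \<circ> H has_derivative L) (at z)"
 shows "(chart_map D \<circ> H has_derivative (\<lambda>a. frechet_derivative (transition C D) (at (chart_map C (H z))) (L a))) (at z)"
  and "ginner M D (chart_map D (H z)) (frechet_derivative (transition C D) (at (chart_map C (H z))) (L a)) (frechet_derivative (transition C D) (at (chart_map C (H z))) (L b))
   = ginner M C (chart_map C (H z)) (L a) (L b)"
proof -
 have x: "chart_map C (H z) \<in> chart_map C ` (chart_dom C \<inter> chart_dom D)" using C D by auto
 have 1: "(transition C D \<circ> (chart_map C \<circ> H) has_derivative (\<lambda>a. frechet_derivative (transition C D) (at (chart_map C (H z))) (L a))) (at z)"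
  using has_derivative_compose[OF L, of "transition C D"] transition_has_derivative[OF C(1) D(1) x] unfolding o_def by blast
 obtain S where S: "open S" "z \<in> S" "\<And>y. y \<in> S \<Longrightarrow> H y \<in> chart_dom C"
  using H C(2) chartD(1)[OF C(1)] unfolding continuous_at_open by metis
 from has_derivative_transform_within_open[OF 1 S(1,2)]
 show "(chart_map D \<circ> H has_derivative (\<lambda>a. frechet_derivative (transition C D) (at (chart_map C (H z))) (L a))) (at z)"
  using S(3) transition_map[OF C(1), of _ D] by simp
 show "ginner M D (chart_map D (H z)) (frechet_derivative (transition C D) (at (chart_map C (H z))) (L a)) (frechet_derivative (transition C D) (at (chart_map C (H z))) (L b))
   = ginner M C (chart_map C (H z)) (L a) (L b)"
  unfolding ginner_transition[OF C(1) D(1) x] transition_map[OF C] ..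
qed

lemma pullback_metric_chart:
 fixes H :: "'v::real_normed_vector \<Rightarrow> 'a"
 assumes C: "C \<in> atlas M" "H z \<in> chart_dom C"
  and H: "continuous (at z) H" and L: "(chart_map C \<circ> H has_derivative L) (at z)"
 shows "pullback_metric M H z a b = ginner M C (chart_map C (H z)) (L a) (L b)"
 using has_derivative_chart_change[OF C chart_at H L] unfolding pullback_metric_def Let_def
 by (simp add: frechet_derivative_eq)

lemma speed_chart:
 assumes C: "C \<in> atlas M" "\<gamma> t \<in> chart_dom C"
  and H: "continuous (at t) \<gamma>" and L: "(chart_map C \<circ> \<gamma> has_vector_derivative v) (at t)"
 shows "speed M \<gamma> t = sqrt (ginner M C (chart_map C (\<gamma> t)) v v)"
proof -
 let ?D = "chart_at M (\<gamma> t)"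
 have "(chart_map ?D \<circ> \<gamma> has_derivative (\<lambda>a. frechet_derivative (transition C ?D) (at (chart_map C (\<gamma> t))) (a *\<^sub>R v))) (at t)"
  using has_derivative_chart_change(1)[OF C chart_at H L[unfolded has_vector_derivative_def]] .
 moreover have "linear (frechet_derivative (transition C ?D) (at (chart_map C (\<gamma> t))))"
  by (rule has_derivative_linear[OF transition_has_derivative]) (use C chart_at in auto)
 ultimately have "(chart_map ?D \<circ> \<gamma> has_vector_derivative frechet_derivative (transition C ?D) (at (chart_map C (\<gamma> t))) v) (at t)"
  unfolding has_vector_derivative_def by (simp add: linear_cmul)
 then have "vector_derivative (chart_map ?D \<circ> \<gamma>) (at t) = frechet_derivative (transition C ?D) (at (chart_map C (\<gamma> t))) v"
  by (rule vector_derivative_at)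
 then show ?thesis
  using has_derivative_chart_change(2)[OF C chart_at H L[unfolded has_vector_derivative_def], of 1 1] by (simp add: speed_def Let_def)
qed

text \<open>The second-kind coefficients do not transform as a tensor; the correction is the second
 derivative of the change of coordinates.\<close>
lemma gam_transition:
 assumes C: "C \<in> atlas M" and D: "D \<in> atlas M" and x: "x \<in> chart_map C ` (chart_dom C \<inter> chart_dom D)"
 defines "\<phi>' \<equiv> frechet_derivative (transition C D) (at x)"
 shows "gam M D (transition C D x) (\<phi>' v) (\<phi>' v) = \<phi>' (gam M C x v v) - d2_transition C D x v v"
  and "\<And>k. ((\<lambda>y. frechet_derivative (transition C D) (at y) k) has_derivative (\<lambda>h. d2_transition C D x h k)) (at x)"
proof -
 let ?W = "chart_map C ` (chart_dom C \<inter> chart_dom D)"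
 let ?\<phi> = "transition C D"
 let ?D = "\<lambda>y. frechet_derivative ?\<phi> (at y)"
 let ?d2 = "d2_transition C D x"
 have W: "open ?W" by (rule open_overlap[OF C D])
 have C2: "Ck_on 2 ?W ?\<phi>" by (rule transition_smooth[OF C D])
 obtain p where p: "x = chart_map C p" "p \<in> chart_dom C" "p \<in> chart_dom D" using x by blast
 have xC: "x \<in> chart_img C" and xD: "?\<phi> x \<in> chart_img D"
  unfolding p(1) transition_map[OF C p(2)] by (rule chartD(8)[OF C p(2)] chartD(8)[OF D p(3)])+
 have lin: "linear \<phi>'" unfolding \<phi>'_def by (rule has_derivative_linear[OF transition_has_derivative[OF C D x]])
 have pd: "?\<phi> differentiable at y" "partial_deriv j ?\<phi> differentiable at y" if "y \<in> ?W" for j y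
  using C2 that unfolding numeral_2_eq_2 Ck_on.simps by blast+
 have d2: "((\<lambda>y. ?D y k) has_derivative (\<lambda>h. ?d2 h k)) (at x)" for k
 proof -
  have "((\<lambda>y. \<Sum>j\<in>UNIV. k $ j *\<^sub>R partial_deriv j ?\<phi> y) has_derivative (\<lambda>h. \<Sum>j\<in>UNIV. k $ j *\<^sub>R (\<Sum>i\<in>UNIV. h $ i *\<^sub>R partial_deriv i (partial_deriv j ?\<phi>) x))) (at x)"
   by (intro has_derivative_sum bounded_linear.has_derivative[OF bounded_linear_scaleR_right] has_derivative_partial pd x)
  note 1 = this
  have 2: "(\<lambda>h. \<Sum>j\<in>UNIV. k $ j *\<^sub>R (\<Sum>i\<in>UNIV. h $ i *\<^sub>R partial_deriv i (partial_deriv j ?\<phi>) x)) = (\<lambda>h. ?d2 h k)"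
   unfolding d2_transition_def scaleR_sum_right by (subst sum.swap) (simp add: mult.commute)
  show ?thesis
   by (rule has_derivative_transform_within_open[OF 1[unfolded 2] W x]) (rule frechet_derivative_partial[symmetric], rule pd)
 qed
 then show "\<And>k. ((\<lambda>y. frechet_derivative (transition C D) (at y) k) has_derivative (\<lambda>h. d2_transition C D x h k)) (at x)" .
 have d2_sym: "?d2 h k = ?d2 k h" for h k
  unfolding d2_transition_def by (subst sum.swap) (simp add: partial_deriv_commute[OF W x C2] mult.commute)
 \<comment> \<open>Differentiates the invariance \<open>ginner_transition\<close> of the metric in
   the base point.\<close>
 have pull: "dginner M C x h a b = dginner M D (?\<phi> x) (\<phi>' h) (\<phi>' a) (\<phi>' b) + ginner M D (?\<phi> x) (?d2 h a) (\<phi>' b) + ginner M D (?\<phi> x) (\<phi>' a) (?d2 h b)" for h a b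
 proof -
  have 1: "((\<lambda>y. ginner M D (?\<phi> y) (?D y a) (?D y b)) has_derivative (\<lambda>h. dginner M D (?\<phi> x) (\<phi>' h) (\<phi>' a) (\<phi>' b) + ginner M D (?\<phi> x) (?d2 h a) (\<phi>' b) + ginner M D (?\<phi> x) (\<phi>' a) (?d2 h b))) (at x)"
   using ginner_has_derivative[where x="?\<phi>" and v="\<lambda>y. ?D y a" and w="\<lambda>y. ?D y b", OF D xD transition_has_derivative[OF C D x] d2 d2] by (simp add: \<phi>'_def)
  have "((\<lambda>y. ginner M C y a b) has_derivative (\<lambda>h. dginner M D (?\<phi> x) (\<phi>' h) (\<phi>' a) (\<phi>' b) + ginner M D (?\<phi> x) (?d2 h a) (\<phi>' b) + ginner M D (?\<phi> x) (\<phi>' a) (?d2 h b))) (at x)"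
   by (rule has_derivative_transform_within_open[OF 1 W x]) (rule ginner_transition[OF C D, symmetric])
  moreover have "((\<lambda>y. ginner M C y a b) has_derivative (\<lambda>h. dginner M C x h a b)) (at x)"
   using ginner_has_derivative[where x="\<lambda>y. y" and v="\<lambda>y. a" and w="\<lambda>y. b" and z=x, OF C xC has_derivative_ident has_derivative_const has_derivative_const]
   by (simp add: ginner_linear)
  ultimately have "(\<lambda>h. dginner M C x h a b) = (\<lambda>h. dginner M D (?\<phi> x) (\<phi>' h) (\<phi>' a) (\<phi>' b) + ginner M D (?\<phi> x) (?d2 h a) (\<phi>' b) + ginner M D (?\<phi> x) (\<phi>' a) (?d2 h b))"
   using has_derivative_unique by blast
  then show ?thesis by meson
 qed
 \<comment> \<open>The defect of the claimed formula. Since \<open>\<phi>'\<close> is bijective, the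
   defect is itself of the form \<open>\<phi>' u\<close>; pairing it with \<open>\<phi>' u\<close>
   by the Koszul formulas in both charts gives 0.\<close>
 let ?e = "gam M D (?\<phi> x) (\<phi>' v) (\<phi>' v) - (\<phi>' (gam M C x v v) - ?d2 v v)"
 have inj: "inj \<phi>'"
 proof (subst linear_injective_0[OF lin], intro allI impI)
  fix a assume "\<phi>' a = 0"
  then have "ginner M C x a a = 0" using ginner_transition[OF C D x, of a a] by (simp add: \<phi>'_def ginner_linear)
  then show "a = 0" using ginner_eq0[OF C xC] by simp
 qed
 then obtain u where u: "\<phi>' u = ?e" using linear_injective_imp_surjective[OF lin] by (metis surjD)
 have "ginner M D (?\<phi> x) ?e (\<phi>' u) = 0"
  using pull[of v v u] pull[of u v v] koszul[OF D xD, of "\<phi>' v" "\<phi>' v" "\<phi>' u"] koszul[OF C xC, of v v u]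
   ginner_transition[OF C D x, of "gam M C x v v" u] d2_sym[of u v] ginner_sym[OF D xD, of "\<phi>' v" "?d2 v u"]
  by (simp add: ginner_linear \<phi>'_def[symmetric])
 then have "ginner M D (?\<phi> x) ?e ?e = 0" using u by simp
 then show "gam M D (transition C D x) (\<phi>' v) (\<phi>' v) = \<phi>' (gam M C x v v) - d2_transition C D x v v"
  using ginner_eq0[OF D xD] by simp
qed

end

section \<open>Curves\<close>

text \<open>Regularity near one time in one chart; \<open>C1_at_chart\<close> moves it to every
  other chart. A piecewise C^1 curve has this property off finitely many times.\<close>

definition C1_at :: "('a::topological_space, 'n::finite) riemannian \<Rightarrow> (real \<Rightarrow> 'a) \<Rightarrow> real \<Rightarrow> bool" where
 "C1_at M \<gamma> t \<longleftrightarrow> (\<exists>C\<in>atlas M. \<exists>d>0. \<exists>V. (\<forall>s. \<bar>s - t\<bar> < d \<longrightarrow>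
   \<gamma> s \<in> chart_dom C \<and> ((chart_map C \<circ> \<gamma>) has_vector_derivative V s) (at s)) \<and> continuous_on (ball t d) V)"

lemma C1_atI:
 assumes "C \<in> atlas M" "0 < d" "\<And>s. \<bar>s - t\<bar> < d \<Longrightarrow> \<gamma> s \<in> chart_dom C"
  "\<And>s. \<bar>s - t\<bar> < d \<Longrightarrow> ((chart_map C \<circ> \<gamma>) has_vector_derivative V s) (at s)" "continuous_on (ball t d) V"
 shows "C1_at M \<gamma> t"
 unfolding C1_at_def using assms by (intro bexI[of _ C] exI[of _ d] exI[of _ V]) auto

lemma ball_real_abs: "s \<in> ball t d \<longleftrightarrow> \<bar>s - t\<bar> < (d::real)"
 by (auto simp: dist_real_def)

lemma piecewise_C1_curveE:
 assumes "piecewise_C1_curve M \<gamma>"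
 obtains S where "path \<gamma>" "finite S" "\<And>C a b. \<lbrakk>C\<in>atlas M; 0 \<le> a; a < b; b \<le> 1; {a<..<b} \<inter> S = {}; \<gamma> ` {a..b} \<subseteq> chart_dom C\<rbrakk> \<Longrightarrow>
     (\<exists>D. continuous_on {a..b} D \<and> (\<forall>t\<in>{a..b}. ((chart_map C \<circ> \<gamma>) has_vector_derivative D t) (at t within {a..b})))"
proof -
 obtain S where p: "path \<gamma>" and S: "finite S" and *: "\<forall>C\<in>atlas M. \<forall>a b. 0 \<le> a \<and> a < b \<and> b \<le> 1 \<and> {a<..<b} \<inter> S = {} \<and> \<gamma> ` {a..b} \<subseteq> chart_dom C \<longrightarrow>
     (\<exists>D. continuous_on {a..b} D \<and> (\<forall>t\<in>{a..b}. ((chart_map C \<circ> \<gamma>) has_vector_derivative D t) (at t within {a..b})))"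
  using assms unfolding piecewise_C1_curve_def by (elim conjE exE)
 show ?thesis by (rule that[OF p S], rule *[rule_format]) auto
qed

section \<open>Curves of class C^1, their speed and their length\<close>

context riemannian_mfd
begin

lemma chart_curve_continuous:
 fixes \<gamma> :: "real \<Rightarrow> 'a"
 assumes C: "C \<in> atlas M" and d: "\<And>s. \<bar>s - t\<bar> < d \<Longrightarrow> \<gamma> s \<in> chart_dom C"
  "\<And>s. \<bar>s - t\<bar> < d \<Longrightarrow> continuous (at s) (chart_map C \<circ> \<gamma>)"
  and s: "\<bar>s - t\<bar> < d"
 shows "continuous (at s) \<gamma>"
proof -
 have c: "continuous_on (ball t d) (chart_map C \<circ> \<gamma>)"
  by (rule continuous_at_imp_continuous_on) (use d in \<open>auto simp: ball_real_abs simp del: mem_ball\<close>)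
 have "continuous_on (ball t d) (\<lambda>s. chart_inv C ((chart_map C \<circ> \<gamma>) s))"
  by (rule continuous_on_compose2[OF chartD(4)[OF C] c]) (use d chartD(8)[OF C] in \<open>auto simp: ball_real_abs simp del: mem_ball\<close>)
 then have "continuous_on (ball t d) \<gamma>"
  by (rule continuous_on_eq) (use d chartD(5)[OF C] in \<open>auto simp: ball_real_abs simp del: mem_ball\<close>)
 then show ?thesis using s by (simp add: continuous_on_eq_continuous_at ball_real_abs[symmetric] del: mem_ball)
qed

lemma C1_at_continuous: "C1_at M \<gamma> t \<Longrightarrow> continuous (at t) \<gamma>"
 unfolding C1_at_def using chart_curve_continuous[of _ t _ \<gamma> t] has_vector_derivative_continuous by fastforce

lemma frechet_transition_continuous:
 assumes "C \<in> atlas M" "D \<in> atlas M" "continuous_on X x" "continuous_on X v"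
  "\<And>z. z \<in> X \<Longrightarrow> x z \<in> chart_map C ` (chart_dom C \<inter> chart_dom D)"
 shows "continuous_on X (\<lambda>z. frechet_derivative (transition C D) (at (x z)) (v z))"
proof -
 let ?W = "chart_map C ` (chart_dom C \<inter> chart_dom D)"
 have C1: "Ck_on (Suc 0) ?W (transition C D)" by (rule transition_smooth[OF assms(1,2)])
 have "continuous_on X (\<lambda>z. \<Sum>j\<in>UNIV. v z $ j *\<^sub>R partial_deriv j (transition C D) (x z))"
  by (intro continuous_on_sum continuous_on_scaleR continuous_intros assms continuous_on_compose2[OF _ assms(3), of ?W])
    (use C1 assms(5) in auto)
 moreover have "transition C D differentiable at (x z)" if "z \<in> X" for z
  using C1 assms(5)[OF that] unfolding Ck_on_Suc0 by blast
 ultimately show ?thesis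
  by (rule_tac continuous_on_eq) (auto simp: frechet_derivative_partial)
qed

lemma C1_at_chart:
 assumes "C1_at M \<gamma> t" and D: "D \<in> atlas M" "\<gamma> t \<in> chart_dom D"
 obtains d V where "0 < d" "\<And>s. \<bar>s - t\<bar> < d \<Longrightarrow> \<gamma> s \<in> chart_dom D"
  "\<And>s. \<bar>s - t\<bar> < d \<Longrightarrow> ((chart_map D \<circ> \<gamma>) has_vector_derivative V s) (at s)" "continuous_on (ball t d) V"
  "\<And>s. \<bar>s - t\<bar> < d \<Longrightarrow> continuous (at s) \<gamma>"
proof -
 obtain C d V where C: "C \<in> atlas M" "0 < d" and V: "\<And>s. \<bar>s - t\<bar> < d \<Longrightarrow> \<gamma> s \<in> chart_dom C"
  "\<And>s. \<bar>s - t\<bar> < d \<Longrightarrow> ((chart_map C \<circ> \<gamma>) has_vector_derivative V s) (at s)" "continuous_on (ball t d) V"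
  using assms(1) unfolding C1_at_def by blast
 have cont: "continuous (at s) \<gamma>" if "\<bar>s - t\<bar> < d" for s
  by (rule chart_curve_continuous[OF C(1) V(1) has_vector_derivative_continuous[OF V(2)] that])
 obtain S where S: "open S" "t \<in> S" "\<And>s. s \<in> S \<Longrightarrow> \<gamma> s \<in> chart_dom D"
  using cont[of t] C(2) D(2) chartD(1)[OF D(1)] unfolding continuous_at_open by (metis abs_zero diff_self)
 obtain d1 where d1: "0 < d1" "ball t d1 \<subseteq> S" using S openE by blast
 let ?d = "min d d1"
 have inD: "\<gamma> s \<in> chart_dom D" if "\<bar>s - t\<bar> < ?d" for s
  using that d1(2) by (intro S(3)) (auto simp: subset_eq dist_real_def)
 let ?V = "\<lambda>s. frechet_derivative (transition C D) (at ((chart_map C \<circ> \<gamma>) s)) (V s)"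
 show ?thesis
 proof (rule that[of ?d ?V])
  fix s assume s: "\<bar>s - t\<bar> < ?d"
  have "linear (frechet_derivative (transition C D) (at ((chart_map C \<circ> \<gamma>) s)))"
   by (rule has_derivative_linear[OF transition_has_derivative[OF C(1) D(1)]]) (use s V inD in auto)
  note lin = linear_cmul[OF this]
  have "\<bar>s - t\<bar> < d" using s by simp
  from has_derivative_chart_change(1)[OF C(1) V(1)[OF this] D(1) inD[OF s] cont[OF this] V(2)[OF this, unfolded has_vector_derivative_def]]
  show "((chart_map D \<circ> \<gamma>) has_vector_derivative ?V s) (at s)"
   unfolding has_vector_derivative_def lin[symmetric] by simp
 next
  have "continuous_on (ball t ?d) (chart_map C \<circ> \<gamma>)"
   by (rule continuous_at_imp_continuous_on) (use has_vector_derivative_continuous[OF V(2)] in \<open>auto simp: ball_real_abs simp del: mem_ball\<close>)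
  moreover have cV: "continuous_on (ball t ?d) V" by (rule continuous_on_subset[OF V(3)]) auto
  ultimately show "continuous_on (ball t ?d) ?V"
   by (rule_tac frechet_transition_continuous[OF C(1) D(1)])
     (use V(1) inD cV in \<open>auto simp: ball_real_abs simp del: mem_ball\<close>)
 qed (use C d1 inD cont in auto)
qed

lemma speed_continuous_at:
 assumes "C1_at M \<gamma> t"
 shows "continuous (at t) (speed M \<gamma>)"
proof -
 let ?C = "chart_at M (\<gamma> t)"
 obtain d V where d: "0 < d" and V: "\<And>s. \<bar>s - t\<bar> < d \<Longrightarrow> \<gamma> s \<in> chart_dom ?C"
  "\<And>s. \<bar>s - t\<bar> < d \<Longrightarrow> ((chart_map ?C \<circ> \<gamma>) has_vector_derivative V s) (at s)" "continuous_on (ball t d) V"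
  "\<And>s. \<bar>s - t\<bar> < d \<Longrightarrow> continuous (at s) \<gamma>"
  using C1_at_chart[OF assms chart_at(1) chart_at(2)] by blast
 have c: "continuous_on (ball t d) (chart_map ?C \<circ> \<gamma>)"
  by (rule continuous_at_imp_continuous_on) (use has_vector_derivative_continuous[OF V(2)] in \<open>auto simp: ball_real_abs simp del: mem_ball\<close>)
 have "continuous_on (ball t d) (\<lambda>s. sqrt (ginner M ?C ((chart_map ?C \<circ> \<gamma>) s) (V s) (V s)))"
  unfolding ginner_bform
  by (intro continuous_on_real_sqrt continuous_on_bform V(3) continuous_on_compose2[OF Ck_on_continuous[OF gcoef_smooth[OF chart_at(1)]] c])
    (use V(1) chartD(8)[OF chart_at(1)] in \<open>auto simp: ball_real_abs simp del: mem_ball\<close>)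
 then have "continuous_on (ball t d) (speed M \<gamma>)"
  by (rule continuous_on_eq) (simp add: speed_chart[OF chart_at(1) V(1) V(4) V(2)] ball_real_abs del: mem_ball)
 then show ?thesis using d by (simp add: continuous_on_eq_continuous_at)
qed

lemma speed_nonneg: "C1_at M \<gamma> t \<Longrightarrow> 0 \<le> speed M \<gamma> t"
proof -
 assume "C1_at M \<gamma> t"
 from C1_at_chart[OF this chart_at(1) chart_at(2)] obtain d V where "0 < (d::real)"
  "\<And>s. \<bar>s - t\<bar> < d \<Longrightarrow> ((chart_map (chart_at M (\<gamma> t)) \<circ> \<gamma>) has_vector_derivative V s) (at s)"
  "\<And>s. \<bar>s - t\<bar> < d \<Longrightarrow> continuous (at s) \<gamma>" by metis
 then have "speed M \<gamma> t = sqrt (ginner M (chart_at M (\<gamma> t)) (chart_map (chart_at M (\<gamma> t)) (\<gamma> t)) (V t) (V t))"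
  by (intro speed_chart chart_at) auto
 then show ?thesis by (simp add: ginner_nonneg chart_at chartD(8))
qed

text \<open>Around a time off the break points there is a closed interval that avoids them and is
  mapped into one chart; the derivatives within this interval are two-sided at its inner
  points.\<close>

lemma piecewise_C1_at:
 assumes "piecewise_C1_curve M \<gamma>"
 obtains S where "finite S" "continuous_on {0..1} \<gamma>" "\<And>t. t \<in> {0<..<1} - S \<Longrightarrow> C1_at M \<gamma> t"
proof -
 obtain S where p: "path \<gamma>" and S: "finite S" "\<And>C a b. \<lbrakk>C\<in>atlas M; 0 \<le> a; a < b; b \<le> 1; {a<..<b} \<inter> S = {}; \<gamma> ` {a..b} \<subseteq> chart_dom C\<rbrakk> \<Longrightarrow>
     (\<exists>D. continuous_on {a..b} D \<and> (\<forall>t\<in>{a..b}. ((chart_map C \<circ> \<gamma>) has_vector_derivative D t) (at t within {a..b})))"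
  by (fact piecewise_C1_curveE[OF assms])
 have c: "continuous_on {0..1} \<gamma>" using p by (simp add: path_def)
 have "C1_at M \<gamma> t" if t: "t \<in> {0<..<1} - S" for t
 proof -
  let ?C = "chart_at M (\<gamma> t)"
  have o: "open ({0<..<1} - S)" by (intro open_Diff finite_imp_closed S) auto
  have "continuous (at t) \<gamma>" using c t by (simp add: continuous_on_interior interior_atLeastAtMost_real)
  then obtain T where T: "open T" "t \<in> T" "\<And>s. s \<in> T \<Longrightarrow> \<gamma> s \<in> chart_dom ?C"
   using chart_at(2)[of "\<gamma> t"] chartD(1)[OF chart_at(1)[of "\<gamma> t"]] unfolding continuous_at_open by metis
  obtain d where d: "0 < d" "cball t d \<subseteq> ({0<..<1} - S) \<inter> T"
   using o T t by (meson IntI open_Int open_contains_cball)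
  have sub: "s \<in> {0<..<1} - S" "s \<in> T" if "\<bar>s - t\<bar> \<le> d" for s
   using d(2) that by (auto simp: subset_eq dist_real_def abs_minus_commute)
  obtain D where D: "continuous_on {t-d..t+d} D" "\<And>s. s \<in> {t-d..t+d} \<Longrightarrow> ((chart_map ?C \<circ> \<gamma>) has_vector_derivative D s) (at s within {t-d..t+d})"
  proof -
   have "\<exists>D. continuous_on {t-d..t+d} D \<and> (\<forall>s\<in>{t-d..t+d}. ((chart_map ?C \<circ> \<gamma>) has_vector_derivative D s) (at s within {t-d..t+d}))"
   proof (rule S(2))
    show "0 \<le> t - d" "t + d \<le> 1" using sub(1)[of "t-d"] sub(1)[of "t+d"] d(1) by auto
    show "{t - d<..<t + d} \<inter> S = {}" using sub(1) by (force simp: abs_le_iff)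
    show "\<gamma> ` {t - d..t + d} \<subseteq> chart_dom ?C" using sub(2) T(3) by (force simp: abs_le_iff)
   qed (use d chart_at in auto)
   then show ?thesis using that by blast
  qed
  have "((chart_map ?C \<circ> \<gamma>) has_vector_derivative D s) (at s)" if "\<bar>s - t\<bar> < d" for s
  proof -
   have "at s within {t-d..t+d} = at s" by (rule at_within_Icc_at) (use that in auto)
   moreover have "s \<in> {t-d..t+d}" using that by (auto simp: abs_less_iff)
   ultimately show ?thesis using D(2)[of s] by simp
  qed
  moreover have "continuous_on (ball t d) D" by (rule continuous_on_subset[OF D(1)]) (auto simp: dist_real_def)
  moreover have "\<gamma> s \<in> chart_dom ?C" if "\<bar>s - t\<bar> < d" for s using sub(2)[of s] T(3) that by auto
  ultimately show ?thesis using C1_atI[OF chart_at(1) d(1)] by blast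
 qed
 then show ?thesis using that S(1) c by blast
qed

text \<open>Break points and end points form a null set, and removing them makes the integrand
  measurable: on the remaining open set the speed is continuous.\<close>

lemma curve_length_integral:
 assumes "finite S" and C1: "\<And>t. t \<in> {0<..<1} - S \<Longrightarrow> C1_at M \<gamma> t"
 defines "f \<equiv> \<lambda>t. ennreal (indicator ({0<..<1} - S) t *\<^sub>R speed M \<gamma> t)"
 shows "f \<in> borel_measurable borel" "curve_length M \<gamma> = (\<integral>\<^sup>+t. f t \<partial>lborel)"
proof -
 have o: "open ({0<..<1} - S)" by (intro open_Diff finite_imp_closed assms) auto
 have "continuous_on ({0<..<1} - S) (speed M \<gamma>)"
  by (intro continuous_at_imp_continuous_on ballI speed_continuous_at C1)
 then have "(\<lambda>t. indicator ({0<..<1} - S) t *\<^sub>R speed M \<gamma> t) \<in> borel_measurable borel"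
  by (intro borel_measurable_continuous_on_indicator) (use o in auto)
 then show "f \<in> borel_measurable borel" unfolding f_def by simp
 have "AE t in lborel. t \<notin> insert 0 (insert 1 S)"
  by (rule AE_not_in) (use assms in \<open>auto intro!: finite_imp_null_set_lborel\<close>)
 then show "curve_length M \<gamma> = (\<integral>\<^sup>+t. f t \<partial>lborel)"
  unfolding curve_length_def f_def by (intro nn_integral_cong_AE, eventually_elim) (auto simp: indicator_def)
qed

lemma C1_at_affine:
 assumes "C1_at M \<gamma> (c * t + b)" "0 < d" "\<And>s. \<bar>s - t\<bar> < d \<Longrightarrow> \<gamma>' s = \<gamma> (c * s + b)"
 shows "C1_at M \<gamma>' t" "speed M \<gamma>' t = \<bar>c\<bar> * speed M \<gamma> (c * t + b)"
proof -
 let ?C = "chart_at M (\<gamma> (c * t + b))"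
 obtain e V where e: "0 < e" and V: "\<And>s. \<bar>s - (c * t + b)\<bar> < e \<Longrightarrow> \<gamma> s \<in> chart_dom ?C"
  "\<And>s. \<bar>s - (c * t + b)\<bar> < e \<Longrightarrow> ((chart_map ?C \<circ> \<gamma>) has_vector_derivative V s) (at s)" "continuous_on (ball (c * t + b) e) V"
  "\<And>s. \<bar>s - (c * t + b)\<bar> < e \<Longrightarrow> continuous (at s) \<gamma>"
  using C1_at_chart[OF assms(1) chart_at(1) chart_at(2)] by blast
 define d' where "d' = min d (e / (\<bar>c\<bar> + 1))"
 have d': "0 < d'" "d' \<le> d" using assms(2) e by (auto simp: d'_def)
 have near: "\<bar>(c * s + b) - (c * t + b)\<bar> < e" if "\<bar>s - t\<bar> < d'" for s
 proof -
  have "\<bar>(c * s + b) - (c * t + b)\<bar> = \<bar>c\<bar> * \<bar>s - t\<bar>" by (simp add: abs_mult[symmetric] algebra_simps)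
  also have "\<dots> \<le> (\<bar>c\<bar> + 1) * \<bar>s - t\<bar>" by (simp add: mult_right_mono)
  also have "\<dots> < (\<bar>c\<bar> + 1) * (e / (\<bar>c\<bar> + 1))" using that by (intro mult_strict_left_mono) (auto simp: d'_def)
  finally show ?thesis by simp
 qed
 have der: "((chart_map ?C \<circ> \<gamma>') has_vector_derivative c *\<^sub>R V (c * s + b)) (at s)" if s: "\<bar>s - t\<bar> < d'" for s
 proof -
  have "((\<lambda>s. c * s + b) has_vector_derivative c) (at s)"
   by (auto intro!: derivative_eq_intros simp: has_real_derivative_iff_has_vector_derivative[symmetric])
  from vector_diff_chain_at[OF this V(2)[OF near[OF s]]]
  have "((chart_map ?C \<circ> \<gamma> \<circ> (\<lambda>s. c * s + b)) has_vector_derivative c *\<^sub>R V (c * s + b)) (at s)" .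
  then show ?thesis
   by (rule has_vector_derivative_transform_within_open[where S="ball t d'"])
     (use s d' assms(3) in \<open>auto simp: ball_real_abs simp del: mem_ball\<close>)
 qed
 have dom: "\<gamma>' s \<in> chart_dom ?C" if s: "\<bar>s - t\<bar> < d'" for s using V(1)[OF near[OF s]] assms(3)[of s] s d' by simp
 have "continuous_on (ball t d') (\<lambda>s. c *\<^sub>R V (c * s + b))"
  by (intro continuous_intros continuous_on_compose2[OF V(3)]) (use near in \<open>auto simp: ball_real_abs simp del: mem_ball\<close>)
 then show C1: "C1_at M \<gamma>' t" using C1_atI[OF chart_at(1) d'(1) dom der] by blast
 have eq: "\<gamma>' t = \<gamma> (c * t + b)" using assms by simp
 have t0: "\<bar>t - t\<bar> < d'" and t1: "\<bar>(c * t + b) - (c * t + b)\<bar> < e" using d' e by auto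
 have "speed M \<gamma>' t = sqrt (ginner M ?C (chart_map ?C (\<gamma>' t)) (c *\<^sub>R V (c * t + b)) (c *\<^sub>R V (c * t + b)))"
  by (rule speed_chart[OF chart_at(1) dom[OF t0] C1_at_continuous[OF C1] der[OF t0]])
 moreover have "speed M \<gamma> (c * t + b) = sqrt (ginner M ?C (chart_map ?C (\<gamma> (c * t + b))) (V (c * t + b)) (V (c * t + b)))"
  by (rule speed_chart[OF chart_at(1) V(1)[OF t1] V(4)[OF t1] V(2)[OF t1]])
 ultimately show "speed M \<gamma>' t = \<bar>c\<bar> * speed M \<gamma> (c * t + b)"
  by (simp add: eq ginner_linear real_sqrt_mult)
qed

text \<open>The condition at the end points is what makes a curve of class \<open>C\<^sup>1\<close> near \<open>[0, 1]\<close> piecewise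
 \<open>C\<^sup>1\<close> in the sense of the definition, which asks for one-sided derivatives.\<close>
lemma C1_piecewise:
 assumes "\<And>t. t \<in> {0..1} \<Longrightarrow> C1_at M \<gamma> t"
 shows "piecewise_C1_curve M \<gamma>"
 unfolding piecewise_C1_curve_def
proof (intro conjI exI[of _ "{}"] ballI allI impI)
 show "path \<gamma>" unfolding path_def
  by (intro continuous_at_imp_continuous_on ballI C1_at_continuous assms)
 fix C and a b :: real assume C: "C \<in> atlas M" and ab: "0 \<le> a \<and> a < b \<and> b \<le> 1 \<and> {a<..<b} \<inter> {} = {} \<and> \<gamma> ` {a..b} \<subseteq> chart_dom C"
 let ?D = "\<lambda>t. vector_derivative (chart_map C \<circ> \<gamma>) (at t)"
 have loc: "continuous (at t) ?D \<and> ((chart_map C \<circ> \<gamma>) has_vector_derivative ?D t) (at t)" if t: "t \<in> {a..b}" for t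
 proof -
  have t1: "C1_at M \<gamma> t" "\<gamma> t \<in> chart_dom C" using t ab assms by auto
  obtain d V where d: "0 < d" and V: "\<And>s. \<bar>s - t\<bar> < d \<Longrightarrow> ((chart_map C \<circ> \<gamma>) has_vector_derivative V s) (at s)" "continuous_on (ball t d) V"
   using C1_at_chart[OF t1(1) C t1(2)] by metis
  have "continuous_on (ball t d) ?D"
   by (rule continuous_on_eq[OF V(2)]) (simp add: vector_derivative_at[OF V(1)] ball_real_abs del: mem_ball)
  then show ?thesis using d V(1)[of t] vector_derivative_at[OF V(1)[of t]] by (simp add: continuous_on_eq_continuous_at)
 qed
 then show "\<exists>D. continuous_on {a..b} D \<and> (\<forall>t\<in>{a..b}. ((chart_map C \<circ> \<gamma>) has_vector_derivative D t) (at t within {a..b}))"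
  by (intro exI[of _ ?D] conjI ballI continuous_at_imp_continuous_on) (auto intro: has_vector_derivative_at_within)
qed auto

lemma C1_length_finite:
 assumes "\<And>t. t \<in> {0..1} \<Longrightarrow> C1_at M \<gamma> t" "\<And>t. t \<in> {0..1} \<Longrightarrow> speed M \<gamma> t \<le> B"
 shows "curve_length M \<gamma> \<le> ennreal B"
proof -
 have "curve_length M \<gamma> \<le> (\<integral>\<^sup>+t. ennreal B * indicator {0..1::real} t \<partial>lborel)" unfolding curve_length_def
  by (rule nn_integral_mono) (use assms in \<open>auto simp: indicator_def intro!: ennreal_leI\<close>)
 also have "\<dots> = ennreal B" by (subst nn_integral_cmult_indicator) auto
 finally show ?thesis .
qed

lemma piecewise_C1_reverse:
 assumes "piecewise_C1_curve M \<gamma>"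
 shows "piecewise_C1_curve M (reversepath \<gamma>)" "curve_length M (reversepath \<gamma>) = curve_length M \<gamma>"
proof -
 obtain S where p: "path \<gamma>" and S: "finite S" "\<And>C a b. \<lbrakk>C\<in>atlas M; 0 \<le> a; a < b; b \<le> 1; {a<..<b} \<inter> S = {}; \<gamma> ` {a..b} \<subseteq> chart_dom C\<rbrakk> \<Longrightarrow>
     (\<exists>D. continuous_on {a..b} D \<and> (\<forall>t\<in>{a..b}. ((chart_map C \<circ> \<gamma>) has_vector_derivative D t) (at t within {a..b})))"
  by (fact piecewise_C1_curveE[OF assms])
 show "piecewise_C1_curve M (reversepath \<gamma>)" unfolding piecewise_C1_curve_def
 proof (intro conjI exI[of _ "(\<lambda>s. 1 - s) ` S"] ballI allI impI)
  show "path (reversepath \<gamma>)" using p by simp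
  fix C and a b :: real assume C: "C \<in> atlas M" and ab: "0 \<le> a \<and> a < b \<and> b \<le> 1 \<and> {a<..<b} \<inter> (\<lambda>s. 1 - s) ` S = {} \<and> reversepath \<gamma> ` {a..b} \<subseteq> chart_dom C"
  have img: "(\<lambda>s. 1 - s) ` {a..b} = {1-b..1-a}" by (rule image_diff_atLeastAtMost)
  have im2: "\<gamma> ` {1-b..1-a} \<subseteq> chart_dom C"
   using ab unfolding img[symmetric] image_image by (simp add: reversepath_def)
  have "{1-b<..<1-a} \<inter> S = {}"
  proof (rule ccontr)
   assume "{1-b<..<1-a} \<inter> S \<noteq> {}"
   then obtain s where "s \<in> S" "1 - b < s" "s < 1 - a" by auto
   then have "1 - s \<in> {a<..<b} \<inter> (\<lambda>s. 1 - s) ` S" by auto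
   then show False using ab by blast
  qed
  then obtain D where D: "continuous_on {1-b..1-a} D" "\<And>t. t\<in>{1-b..1-a} \<Longrightarrow> ((chart_map C \<circ> \<gamma>) has_vector_derivative D t) (at t within {1-b..1-a})"
   using S(2)[OF C, of "1-b" "1-a"] ab im2 by (metis diff_ge_0_iff_ge diff_left_mono diff_strict_left_mono diff_zero)
  show "\<exists>D. continuous_on {a..b} D \<and> (\<forall>t\<in>{a..b}. ((chart_map C \<circ> reversepath \<gamma>) has_vector_derivative D t) (at t within {a..b}))"
  proof (intro exI[of _ "\<lambda>t. (-1) *\<^sub>R D (1 - t)"] conjI ballI)
   show "continuous_on {a..b} (\<lambda>t. (-1) *\<^sub>R D (1 - t))"
    by (intro continuous_intros continuous_on_compose2[OF D(1)]) auto
   fix t assume t: "t \<in> {a..b}"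
   have "((\<lambda>s. 1 - s) has_vector_derivative -1) (at t within {a..b})"
    by (auto intro!: derivative_eq_intros simp: has_real_derivative_iff_has_vector_derivative[symmetric])
   from vector_diff_chain_within[OF this, of "chart_map C \<circ> \<gamma>" "D (1 - t)"] D(2)[of "1 - t"] t
   show "((chart_map C \<circ> reversepath \<gamma>) has_vector_derivative (-1) *\<^sub>R D (1 - t)) (at t within {a..b})"
    unfolding img by (simp add: o_def reversepath_def)
  qed
 qed (use S in auto)
 obtain S where S: "finite S" "\<And>t. t \<in> {0<..<1} - S \<Longrightarrow> C1_at M \<gamma> t" using piecewise_C1_at[OF assms] by blast
 let ?S = "(\<lambda>s. 1 - s) ` S"
 have in_iff: "t \<in> {0<..<1} - ?S \<longleftrightarrow> 1 - t \<in> {0<..<1} - S" for t :: real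
  by (auto simp: image_iff)
 have r: "C1_at M (reversepath \<gamma>) t" "speed M (reversepath \<gamma>) t = speed M \<gamma> (1 - t)" if "t \<in> {0<..<1} - ?S" for t
  using C1_at_affine[of \<gamma> "-1" t 1 1 "reversepath \<gamma>"] S(2)[of "1 - t"] in_iff[of t] that by (auto simp: reversepath_def)
 have "curve_length M \<gamma> = (\<integral>\<^sup>+t. ennreal (indicator ({0<..<1} - S) t *\<^sub>R speed M \<gamma> t) \<partial>lborel)"
  by (rule curve_length_integral[OF S])
 also have "\<dots> = (\<integral>\<^sup>+t. ennreal (indicator ({0<..<1} - S) (1 + (-1) * t) *\<^sub>R speed M \<gamma> (1 + (-1) * t)) \<partial>lborel)"
  using nn_integral_real_affine[OF curve_length_integral(1)[OF S], of "-1" 1] by simp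
 also have "\<dots> = (\<integral>\<^sup>+t. ennreal (indicator ({0<..<1} - ?S) t *\<^sub>R speed M (reversepath \<gamma>) t) \<partial>lborel)"
  using r(2) in_iff by (intro nn_integral_cong) (auto simp: indicator_def)
 also have "\<dots> = curve_length M (reversepath \<gamma>)"
  using curve_length_integral(2)[of ?S "reversepath \<gamma>"] S(1) r(1) by simp
 finally show "curve_length M (reversepath \<gamma>) = curve_length M \<gamma>" by simp
qed

end

section \<open>The Riemannian distance\<close>

lemma has_vector_derivative_affine_within:
 assumes "(f has_vector_derivative D (c * t + k)) (at (c * t + k) within J)" "(\<lambda>s. c * s + k) ` I \<subseteq> J" "t \<in> I"
  "\<And>s. s \<in> I \<Longrightarrow> g s = f (c * s + k)"
 shows "(g has_vector_derivative c *\<^sub>R D (c * t + k)) (at t within I)"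
proof -
 have 1: "((\<lambda>s. c * s + k) has_vector_derivative c) (at t within I)"
  by (auto intro!: derivative_eq_intros simp: has_real_derivative_iff_has_vector_derivative[symmetric])
 have "((f \<circ> (\<lambda>s. c * s + k)) has_vector_derivative c *\<^sub>R D (c * t + k)) (at t within I)"
  by (rule vector_diff_chain_within[OF 1]) (rule has_vector_derivative_within_subset[OF assms(1,2)])
 then show ?thesis
  by (rule has_vector_derivative_transform[rotated 2]) (use assms in auto)
qed

section \<open>Joining curves, and comparison of lengths with coordinate distances\<close>

context riemannian_mfd
begin

lemma piecewise_C1_join:
 assumes "piecewise_C1_curve M \<gamma>1" "piecewise_C1_curve M \<gamma>2" and eq: "pathfinish \<gamma>1 = pathstart \<gamma>2"
 shows "piecewise_C1_curve M (\<gamma>1 +++ \<gamma>2)" "curve_length M (\<gamma>1 +++ \<gamma>2) = curve_length M \<gamma>1 + curve_length M \<gamma>2"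
proof -
 let ?g = "\<gamma>1 +++ \<gamma>2"
 have g1: "?g s = \<gamma>1 (2 * s + 0)" if "s \<le> 1/2" for s using that by (simp add: joinpaths_def)
 have g2: "?g s = \<gamma>2 (2 * s + (-1))" if "1/2 \<le> s" for s
 proof (cases "s = 1/2")
  case True
  show ?thesis using eq unfolding True by (simp add: joinpaths_def pathfinish_def pathstart_def)
 qed (use that in \<open>simp add: joinpaths_def\<close>)
 obtain S1 where p1: "path \<gamma>1" and S1: "finite S1" "\<And>C a b. \<lbrakk>C\<in>atlas M; 0 \<le> a; a < b; b \<le> 1; {a<..<b} \<inter> S1 = {}; \<gamma>1 ` {a..b} \<subseteq> chart_dom C\<rbrakk> \<Longrightarrow>
     (\<exists>D. continuous_on {a..b} D \<and> (\<forall>t\<in>{a..b}. ((chart_map C \<circ> \<gamma>1) has_vector_derivative D t) (at t within {a..b})))"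
  by (fact piecewise_C1_curveE[OF assms(1)])
 obtain S2 where p2: "path \<gamma>2" and S2: "finite S2" "\<And>C a b. \<lbrakk>C\<in>atlas M; 0 \<le> a; a < b; b \<le> 1; {a<..<b} \<inter> S2 = {}; \<gamma>2 ` {a..b} \<subseteq> chart_dom C\<rbrakk> \<Longrightarrow>
     (\<exists>D. continuous_on {a..b} D \<and> (\<forall>t\<in>{a..b}. ((chart_map C \<circ> \<gamma>2) has_vector_derivative D t) (at t within {a..b})))"
  by (fact piecewise_C1_curveE[OF assms(2)])
 \<comment> \<open>The joint at \<open>1/2\<close> counts as a break point, so an interval between
   break points lies in one of the two halves.\<close>
 let ?S = "(\<lambda>s. s / 2) ` S1 \<union> (\<lambda>s. (s + 1) / 2) ` S2 \<union> {1/2}"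
 have aff: "\<exists>D. continuous_on {a..b} D \<and> (\<forall>t\<in>{a..b}. ((chart_map C \<circ> ?g) has_vector_derivative D t) (at t within {a..b}))"
  if D: "continuous_on {2*a+k..2*b+k} D" "\<And>t. t \<in> {2*a+k..2*b+k} \<Longrightarrow> ((chart_map C \<circ> \<gamma>) has_vector_derivative D t) (at t within {2*a+k..2*b+k})"
   and g: "\<And>s. s \<in> {a..b} \<Longrightarrow> ?g s = \<gamma> (2 * s + k)" for C \<gamma> a b k D
 proof (intro exI[of _ "\<lambda>t. 2 *\<^sub>R D (2 * t + k)"] conjI ballI)
  show "continuous_on {a..b} (\<lambda>t. 2 *\<^sub>R D (2 * t + k))"
   by (intro continuous_intros continuous_on_compose2[OF D(1)]) auto
  show "((chart_map C \<circ> ?g) has_vector_derivative 2 *\<^sub>R D (2 * t + k)) (at t within {a..b})" if t: "t \<in> {a..b}" for t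
   by (rule has_vector_derivative_affine_within[of "chart_map C \<circ> \<gamma>" D 2 t k "{2*a+k..2*b+k}" "{a..b}" "chart_map C \<circ> ?g"])
     (use t g D(2) in auto)
 qed
 show "piecewise_C1_curve M ?g" unfolding piecewise_C1_curve_def
 proof (intro conjI exI[of _ ?S] ballI allI impI)
  show "path ?g" using p1 p2 eq by (rule path_join_imp)
  fix C and a b :: real assume C: "C \<in> atlas M" and ab: "0 \<le> a \<and> a < b \<and> b \<le> 1 \<and> {a<..<b} \<inter> ?S = {} \<and> ?g ` {a..b} \<subseteq> chart_dom C"
  have "1/2 \<notin> {a<..<b}" using ab by blast
  then consider "b \<le> 1/2" | "1/2 \<le> a" by force
  then show "\<exists>D. continuous_on {a..b} D \<and> (\<forall>t\<in>{a..b}. ((chart_map C \<circ> ?g) has_vector_derivative D t) (at t within {a..b}))"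
  proof cases
   case 1
   have g: "?g s = \<gamma>1 (2 * s + 0)" if "s \<in> {a..b}" for s using that 1 by (intro g1) auto
   have im: "{2*a+0..2*b+0} = (\<lambda>s. 2 * s + 0) ` {a..b}" by (auto simp: image_iff intro!: bexI[of _ "_/2"])
   have "s / 2 \<in> {a<..<b}" if "s \<in> {2*a+0<..<2*b+0}" for s using that by auto
   then have no: "{2*a+0<..<2*b+0} \<inter> S1 = {}" using ab by blast
   have "\<gamma>1 ` {2*a+0..2*b+0} \<subseteq> chart_dom C" unfolding im image_image using ab g by auto
   then obtain D where D: "continuous_on {2*a+0..2*b+0} D" "\<forall>t\<in>{2*a+0..2*b+0}. ((chart_map C \<circ> \<gamma>1) has_vector_derivative D t) (at t within {2*a+0..2*b+0})"
    using S1(2)[OF C _ _ _ no] ab 1 by auto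
   show ?thesis using aff[OF D(1) D(2)[rule_format] g] by blast
  next
   case 2
   have g: "?g s = \<gamma>2 (2 * s + (-1))" if "s \<in> {a..b}" for s using that 2 by (intro g2) auto
   have im: "{2*a+(-1)..2*b+(-1)} = (\<lambda>s. 2 * s + (-1)) ` {a..b}" by (auto simp: image_iff, rule_tac x="(x + 1) / 2" in bexI, auto simp: field_simps)
   have "(s + 1) / 2 \<in> {a<..<b}" if "s \<in> {2*a+(-1)<..<2*b+(-1)}" for s using that by auto
   then have no: "{2*a+(-1)<..<2*b+(-1)} \<inter> S2 = {}" using ab by blast
   have "\<gamma>2 ` {2*a+(-1)..2*b+(-1)} \<subseteq> chart_dom C" unfolding im image_image using ab g by auto
   then obtain D where D: "continuous_on {2*a+(-1)..2*b+(-1)} D" "\<forall>t\<in>{2*a+(-1)..2*b+(-1)}. ((chart_map C \<circ> \<gamma>2) has_vector_derivative D t) (at t within {2*a+(-1)..2*b+(-1)})"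
    using S2(2)[OF C _ _ _ no] ab 2 by auto
   show ?thesis using aff[OF D(1) D(2)[rule_format] g] by blast
  qed
 qed (use S1 S2 in auto)
 obtain T1 where T1: "finite T1" "\<And>t. t \<in> {0<..<1} - T1 \<Longrightarrow> C1_at M \<gamma>1 t" using piecewise_C1_at[OF assms(1)] by blast
 obtain T2 where T2: "finite T2" "\<And>t. t \<in> {0<..<1} - T2 \<Longrightarrow> C1_at M \<gamma>2 t" using piecewise_C1_at[OF assms(2)] by blast
 let ?T = "(\<lambda>s. s / 2) ` T1 \<union> (\<lambda>s. (s + 1) / 2) ` T2 \<union> {1/2}"
 have T: "finite ?T" using T1 T2 by auto
 have h1: "C1_at M ?g t \<and> speed M ?g t = 2 * speed M \<gamma>1 (2 * t) \<and> 2 * t \<in> {0<..<1} - T1" if "t \<in> {0<..<1} - ?T" "t < 1/2" for t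
 proof -
  have "2 * t \<notin> T1"
  proof
   assume "2 * t \<in> T1"
   then have "t \<in> (\<lambda>s. s / 2) ` T1" by (intro image_eqI[of _ _ "2 * t"]) auto
   then show False using that(1) by blast
  qed
  then have t: "2 * t \<in> {0<..<1} - T1" using that by auto
  have "C1_at M \<gamma>1 (2 * t + 0)" "0 < 1/2 - t" using T1(2)[OF t] that by auto
  note C1_at_affine[OF this, of ?g]
  then show ?thesis using g1 t by (auto simp: abs_less_iff)
 qed
 have h2: "C1_at M ?g t \<and> speed M ?g t = 2 * speed M \<gamma>2 (2 * t - 1) \<and> 2 * t - 1 \<in> {0<..<1} - T2" if "t \<in> {0<..<1} - ?T" "1/2 < t" for t
 proof -
  have "2 * t - 1 \<notin> T2"
  proof
   assume "2 * t - 1 \<in> T2"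
   then have "t \<in> (\<lambda>s. (s + 1) / 2) ` T2" by (intro image_eqI[of _ _ "2 * t - 1"]) auto
   then show False using that(1) by blast
  qed
  then have t: "2 * t - 1 \<in> {0<..<1} - T2" using that by auto
  have "C1_at M \<gamma>2 (2 * t + (-1))" "0 < t - 1/2" using T2(2)[OF t] that by auto
  note C1_at_affine[OF this, of ?g]
  then show ?thesis using g2 t by (auto simp: abs_less_iff)
 qed
 have C1: "C1_at M ?g t" if "t \<in> {0<..<1} - ?T" for t
  using h1[OF that] h2[OF that] that by (cases "t < 1/2") auto
 define f1 where "f1 t = ennreal (indicator ({0<..<1} - T1) t *\<^sub>R speed M \<gamma>1 t)" for t
 define f2 where "f2 t = ennreal (indicator ({0<..<1} - T2) t *\<^sub>R speed M \<gamma>2 t)" for t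
 have m: "f1 \<in> borel_measurable borel" "f2 \<in> borel_measurable borel"
  using curve_length_integral(1)[OF T1] curve_length_integral(1)[OF T2] unfolding f1_def f2_def by auto
 have "AE t in lborel. t \<notin> ?T"
  by (rule AE_not_in) (use T in \<open>auto intro!: finite_imp_null_set_lborel\<close>)
 \<comment> \<open>Each half is run through at double speed; the factors 2 disappear again in the
   affine substitutions below.\<close>
 then have AEeq: "AE t in lborel. ennreal (indicator ({0<..<1} - ?T) t *\<^sub>R speed M ?g t) = 2 * f1 (0 + 2 * t) + 2 * f2 (- 1 + 2 * t)"
 proof eventually_elim
  case (elim t)
  consider "t \<le> 0 \<or> 1 \<le> t" | "t \<in> {0<..<1} - ?T" "t < 1/2" | "t \<in> {0<..<1} - ?T" "1/2 < t" using elim by force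
  then show ?case
  proof cases
   case 1 then show ?thesis by (auto simp: f1_def f2_def indicator_def)
  next
   case 2
   note hh = 2(1) and h = h1[OF 2]
   have "f2 (- 1 + 2 * t) = 0" using 2 by (simp add: f2_def indicator_def)
   moreover have "f1 (0 + 2 * t) = ennreal (speed M \<gamma>1 (2 * t))" using h by (simp add: f1_def indicator_def)
   moreover have "ennreal (indicator ({0<..<1} - ?T) t *\<^sub>R speed M ?g t) = ennreal (2 * speed M \<gamma>1 (2 * t))"
    using h hh by (simp add: indicator_def)
   moreover have "0 \<le> speed M \<gamma>1 (2 * t)" using h by (intro speed_nonneg T1(2)) simp
   ultimately show ?thesis by (simp add: ennreal_mult)
  next
   case 3
   note hh = 3(1) and h = h2[OF 3]
   have "f1 (0 + 2 * t) = 0" using 3 by (simp add: f1_def indicator_def)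
   moreover have "f2 (- 1 + 2 * t) = ennreal (speed M \<gamma>2 (2 * t - 1))" using h by (simp add: f2_def indicator_def)
   moreover have "ennreal (indicator ({0<..<1} - ?T) t *\<^sub>R speed M ?g t) = ennreal (2 * speed M \<gamma>2 (2 * t - 1))"
    using h hh by (simp add: indicator_def)
   moreover have "0 \<le> speed M \<gamma>2 (2 * t - 1)" using h by (intro speed_nonneg T2(2)) simp
   ultimately show ?thesis by (simp add: ennreal_mult)
  qed
 qed
 have "curve_length M ?g = (\<integral>\<^sup>+t. ennreal (indicator ({0<..<1} - ?T) t *\<^sub>R speed M ?g t) \<partial>lborel)"
  by (rule curve_length_integral(2)[OF T C1])
 also have "\<dots> = (\<integral>\<^sup>+t. 2 * f1 (0 + 2 * t) + 2 * f2 (- 1 + 2 * t) \<partial>lborel)"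
  by (rule nn_integral_cong_AE[OF AEeq])
 also have "\<dots> = 2 * (\<integral>\<^sup>+t. f1 (0 + 2 * t) \<partial>lborel) + 2 * (\<integral>\<^sup>+t. f2 (- 1 + 2 * t) \<partial>lborel)"
  using m by (simp add: nn_integral_add nn_integral_cmult)
 also have "\<dots> = (\<integral>\<^sup>+t. f1 t \<partial>lborel) + (\<integral>\<^sup>+t. f2 t \<partial>lborel)"
  using nn_integral_real_affine[OF m(1), of 2 0] nn_integral_real_affine[OF m(2), of 2 "-1"] by simp
 also have "\<dots> = curve_length M \<gamma>1 + curve_length M \<gamma>2"
  unfolding f1_def f2_def using curve_length_integral(2)[OF T1] curve_length_integral(2)[OF T2] by simp
 finally show "curve_length M ?g = curve_length M \<gamma>1 + curve_length M \<gamma>2" .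
qed

text \<open>By homogeneity it is enough to bound the norm on unit vectors, and the product of
  \<open>X\<close> with the unit sphere is compact.\<close>

lemma ginner_bounds:
 assumes C: "C \<in> atlas M" and X: "compact X" "X \<subseteq> chart_img C"
 obtains \<kappa> K where "0 < \<kappa>" "0 < K" "\<And>x v. x \<in> X \<Longrightarrow> \<kappa> * norm v \<le> sqrt (ginner M C x v v)"
  "\<And>x v. x \<in> X \<Longrightarrow> sqrt (ginner M C x v v) \<le> K * norm v"
proof (cases "X = {}")
 case True then show ?thesis using that[of 1 1] by auto
next
 case False
 let ?f = "\<lambda>p. sqrt (ginner M C (fst p) (snd p) (snd p))" and ?Y = "X \<times> sphere (0::real^'n) 1"
 have c: "continuous_on ?Y ?f" unfolding ginner_bform
  by (intro continuous_on_real_sqrt continuous_on_bform continuous_intros continuous_on_compose2[OF Ck_on_continuous[OF gcoef_smooth[OF C]]]) (use X in auto)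
 have Y: "compact ?Y" "?Y \<noteq> {}" using X False by (auto intro: compact_Times)
 obtain p where p: "p \<in> ?Y" "\<And>y. y \<in> ?Y \<Longrightarrow> ?f p \<le> ?f y" using continuous_attains_inf[OF Y c] by blast
 obtain q where q: "q \<in> ?Y" "\<And>y. y \<in> ?Y \<Longrightarrow> ?f y \<le> ?f q" using continuous_attains_sup[OF Y c] by blast
 have pos: "0 < ?f p" "0 < ?f q" using p(1) q(1) X by (auto intro!: ginner_pos[OF C])
 have scale: "sqrt (ginner M C x v v) = norm v * ?f (x, v /\<^sub>R norm v)" if "v \<noteq> 0" for x v
  using that by (simp add: ginner_linear real_sqrt_mult power2_eq_square[symmetric] real_sqrt_divide)
 show ?thesis
 proof (rule that[OF pos])
  fix x v assume x: "x \<in> X"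
  show "?f p * norm v \<le> sqrt (ginner M C x v v)"
  proof (cases "v = 0")
   case False
   then show ?thesis unfolding scale[OF False] using p(2)[of "(x, v /\<^sub>R norm v)"] x by (simp add: mult.commute mult_left_mono)
  qed (simp add: ginner_linear)
  show "sqrt (ginner M C x v v) \<le> ?f q * norm v"
  proof (cases "v = 0")
   case False
   then show ?thesis unfolding scale[OF False] using q(2)[of "(x, v /\<^sub>R norm v)"] x by (simp add: mult.commute mult_left_mono)
  qed (simp add: ginner_linear)
 qed
qed

text \<open>The coordinate velocity is projected onto the direction of the total displacement: the
  integral of the projection is the norm of the displacement, while \<open>\<kappa>\<close> times
  the projection is at most the speed.\<close>

lemma curve_length_chart_ge:
 assumes C: "C \<in> atlas M" and X: "X \<subseteq> chart_img C" and \<kappa>: "0 < \<kappa>" "\<And>x v. x \<in> X \<Longrightarrow> \<kappa> * norm v \<le> sqrt (ginner M C x v v)"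
  and \<gamma>: "piecewise_C1_curve M \<gamma>" and t: "0 < t" "t \<le> 1" and in_X: "\<And>s. s \<in> {0..t} \<Longrightarrow> \<gamma> s \<in> chart_inv C ` X"
 shows "ennreal (\<kappa> * norm (chart_map C (\<gamma> t) - chart_map C (\<gamma> 0))) \<le> curve_length M \<gamma>"
proof (cases "curve_length M \<gamma> = \<infinity>")
 case False
 obtain S where S: "finite S" and cont: "continuous_on {0..1} \<gamma>" and C1: "\<And>t. t \<in> {0<..<1} - S \<Longrightarrow> C1_at M \<gamma> t"
  using piecewise_C1_at[OF \<gamma>] by blast
 define x where "x = chart_map C \<circ> \<gamma>"
 have dom: "\<gamma> s \<in> chart_dom C" and xX: "x s \<in> X" if "s \<in> {0..t}" for s
  using in_X[OF that] X chartD(6,7)[OF C] by (auto simp: x_def)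
 define d where "d = x t - x 0"
 \<comment> \<open>The unit direction of the displacement, or 0 if the displacement is 0; in both
   cases its norm is at most 1 and its product with \<open>d\<close> is
   \<open>norm d\<close>.\<close>
 define u where "u = d /\<^sub>R norm d"
 define F where "F s = indicator ({0<..<1} - S) s *\<^sub>R speed M \<gamma> s" for s
 have F0: "0 \<le> F s" for s using speed_nonneg[OF C1] by (auto simp: F_def indicator_def)
 have "(\<lambda>s. enn2real (ennreal (F s))) \<in> borel_measurable borel"
  unfolding F_def by (rule borel_measurable_enn2real[OF curve_length_integral(1)[OF S C1]])
 then have "F \<in> borel_measurable borel" using F0 by simp
 moreover have len: "curve_length M \<gamma> = (\<integral>\<^sup>+s. ennreal (F s) \<partial>lborel)" unfolding F_def by (rule curve_length_integral(2)[OF S C1])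
 ultimately have int: "integrable lborel F" using False F0 by (intro integrableI_nonneg) (auto simp: less_top)
 have I: "(F has_integral integral\<^sup>L lborel F) UNIV" by (rule has_integral_integral_lborel[OF int])
 define R where "R = {0..t} - (S \<union> {0,t})"
 have der: "(x has_vector_derivative vector_derivative x (at s)) (at s) \<and> speed M \<gamma> s = sqrt (ginner M C (x s) (vector_derivative x (at s)) (vector_derivative x (at s)))" if s: "s \<in> R" for s
 proof -
  have s1: "s \<in> {0<..<1} - S" "s \<in> {0..t}" using s t by (auto simp: R_def)
  obtain e V where e: "0 < e" "\<And>r. \<bar>r - s\<bar> < e \<Longrightarrow> ((chart_map C \<circ> \<gamma>) has_vector_derivative V r) (at r)"
   using C1_at_chart[OF C1[OF s1(1)] C dom[OF s1(2)]] by metis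
  have V: "(x has_vector_derivative V s) (at s)" using e(2)[of s] e(1) by (simp add: x_def)
  show ?thesis using V vector_derivative_at[OF V] speed_chart[OF C dom[OF s1(2)] C1_at_continuous[OF C1[OF s1(1)]] V[unfolded x_def]]
   by (simp add: x_def)
 qed
 have cx: "continuous_on {0..t} x" unfolding x_def o_def
  by (rule continuous_on_compose2[OF chartD(3)[OF C] continuous_on_subset[OF cont]]) (use dom t in auto)
 have "((\<lambda>s. u \<bullet> vector_derivative x (at s)) has_integral (u \<bullet> x t - u \<bullet> x 0)) {0..t}"
 proof (rule fundamental_theorem_of_calculus_strong[of "S \<union> {0,t}"])
  show "((\<lambda>s. u \<bullet> x s) has_vector_derivative u \<bullet> vector_derivative x (at s)) (at s)" if "s \<in> {0..t} - (S \<union> {0,t})" for s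
   using bounded_linear.has_vector_derivative[OF bounded_linear_inner_right] der that unfolding R_def by blast
  show "continuous_on {0..t} (\<lambda>s. u \<bullet> x s)" by (intro continuous_intros cx)
 qed (use S t in auto)
 then have "((\<lambda>s. \<kappa> *\<^sub>R (u \<bullet> vector_derivative x (at s))) has_integral \<kappa> *\<^sub>R (u \<bullet> x t - u \<bullet> x 0)) {0..t}"
  by (rule has_integral_cmul)
 then have "((\<lambda>s. if s \<in> R then \<kappa> * (u \<bullet> vector_derivative x (at s)) else 0) has_integral \<kappa> *\<^sub>R (u \<bullet> x t - u \<bullet> x 0)) {0..t}"
  by (rule has_integral_spike_finite[where S="S \<union> {0,t}", rotated 2]) (use S in \<open>auto simp: R_def\<close>)
 moreover have "u \<bullet> x t - u \<bullet> x 0 = norm d"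
  unfolding inner_diff_right[symmetric] d_def[symmetric] u_def
  by (cases "d = 0") (auto simp: dot_square_norm power2_eq_square divide_inverse)
 ultimately have "((\<lambda>s. if s \<in> R then \<kappa> * (u \<bullet> vector_derivative x (at s)) else 0) has_integral \<kappa> * norm d) {0..t}"
  by simp
 then have J: "((\<lambda>s. if s \<in> R then \<kappa> * (u \<bullet> vector_derivative x (at s)) else 0) has_integral \<kappa> * norm d) UNIV"
  by (rule has_integral_on_superset) (auto simp: R_def)
 have "\<kappa> * norm d \<le> integral\<^sup>L lborel F"
 proof (rule has_integral_le[OF J I])
  fix s
  show "(if s \<in> R then \<kappa> * (u \<bullet> vector_derivative x (at s)) else 0) \<le> F s"
  proof (cases "s \<in> R")
   case True
   have "norm u \<le> 1" by (cases "d = 0") (auto simp: u_def)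
   then have "u \<bullet> vector_derivative x (at s) \<le> norm (vector_derivative x (at s))"
    using norm_cauchy_schwarz[of u "vector_derivative x (at s)"] mult_right_mono[of "norm u" 1 "norm (vector_derivative x (at s))"] by simp
   then have "\<kappa> * (u \<bullet> vector_derivative x (at s)) \<le> \<kappa> * norm (vector_derivative x (at s))" using \<kappa>(1) by simp
   also have "\<dots> \<le> speed M \<gamma> s" using der[OF True] \<kappa>(2)[OF xX, of s "vector_derivative x (at s)"] True by (simp add: R_def)
   also have "\<dots> = F s" using True t by (auto simp: F_def R_def indicator_def)
   finally show ?thesis using True by simp
  qed (use F0 in auto)
 qed
 moreover have "curve_length M \<gamma> = ennreal (integral\<^sup>L lborel F)"
  unfolding len by (rule nn_integral_eq_integral[OF int]) (use F0 in auto)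
 ultimately show ?thesis unfolding d_def x_def by (simp add: ennreal_leI)
qed simp

lemma open_chart_image:
 assumes C: "C \<in> atlas M" and "open X" "X \<subseteq> chart_img C"
 shows "open (chart_inv C ` X)"
proof -
 have "chart_inv C ` X = chart_dom C \<inter> chart_map C -` X"
  using assms(3) chartD(5,6,7)[OF C] by (auto simp: image_iff) (metis chartD(5)[OF C])
 then show ?thesis using continuous_open_preimage[OF chartD(3)[OF C] chartD(1)[OF C] assms(2)] by simp
qed

text \<open>Suppose the curve is shorter. While it stays in the open ball,
  \<open>curve_length_chart_ge\<close> confines it to a strictly smaller closed ball; the image of
  that ball is closed, so at the first exit time \<open>\<tau>\<close> the curve would still be
  inside.\<close>

lemma curve_length_exit:
 assumes C: "C \<in> atlas M" and X: "cball x0 r \<subseteq> chart_img C" and \<rho>: "0 < \<rho>" "\<rho> \<le> r"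
  and \<kappa>: "0 < \<kappa>" "\<And>x v. x \<in> cball x0 r \<Longrightarrow> \<kappa> * norm v \<le> sqrt (ginner M C x v v)"
  and \<gamma>: "piecewise_C1_curve M \<gamma>" "\<gamma> 0 = chart_inv C x0" "\<gamma> 1 \<notin> chart_inv C ` ball x0 \<rho>"
 shows "ennreal (\<kappa> * \<rho>) \<le> curve_length M \<gamma>"
proof (rule ccontr)
 assume "\<not> ?thesis"
 then have less: "curve_length M \<gamma> < ennreal (\<kappa> * \<rho>)" by simp
 \<comment> \<open>The coordinate radius whose cost \<open>\<kappa> * \<rho>'\<close> is the whole
   length of the curve.\<close>
 define \<rho>' where "\<rho>' = enn2real (curve_length M \<gamma>) / \<kappa>"
 have len: "curve_length M \<gamma> = ennreal (\<kappa> * \<rho>')"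
  using less \<kappa>(1) by (simp add: \<rho>'_def) (metis ennreal_enn2real infinity_ennreal_def less_top order_less_trans top.not_eq_extremum)
 have \<rho>': "0 \<le> \<rho>'" "\<rho>' < \<rho>" using less \<kappa>(1) \<rho> unfolding len by (auto simp: \<rho>'_def ennreal_less_iff pos_divide_less_eq mult.commute)
 have cont: "continuous_on {0..1} \<gamma>" using piecewise_C1_at[OF \<gamma>(1)] by blast
 define V where "V = chart_inv C ` ball x0 \<rho>"
 define K where "K = chart_inv C ` cball x0 \<rho>'"
 have sub: "ball x0 \<rho> \<subseteq> cball x0 r" "cball x0 \<rho>' \<subseteq> ball x0 \<rho>" using \<rho> \<rho>' by auto
 have oV: "open V" unfolding V_def by (rule open_chart_image[OF C]) (use sub X in auto)
 have "compact K" unfolding K_def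
  by (rule compact_continuous_image[OF continuous_on_subset[OF chartD(4)[OF C]]]) (use sub X in auto)
 then have cK: "closed K" by (rule compact_imp_closed)
 have x0: "x0 \<in> chart_img C" using X \<rho> by auto
 have K: "\<gamma> t \<in> K" if t: "0 < t" "t \<le> 1" and inV: "\<And>s. s \<in> {0..t} \<Longrightarrow> \<gamma> s \<in> V" for t
 proof -
  have "ennreal (\<kappa> * norm (chart_map C (\<gamma> t) - chart_map C (\<gamma> 0))) \<le> ennreal (\<kappa> * \<rho>')"
   unfolding len[symmetric]
   by (rule curve_length_chart_ge[OF C X \<kappa> \<gamma>(1) t]) (use inV image_mono[OF sub(1), of "chart_inv C"] in \<open>auto simp: V_def\<close>)
  then have "\<kappa> * norm (chart_map C (\<gamma> t) - x0) \<le> \<kappa> * \<rho>'"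
   using \<kappa>(1) \<rho>' by (subst (asm) ennreal_le_iff) (auto simp: \<gamma>(2) chartD(6)[OF C x0])
  then have "norm (chart_map C (\<gamma> t) - x0) \<le> \<rho>'" using \<kappa>(1) by simp
  moreover have "\<gamma> t \<in> chart_dom C" using inV[of t] t X sub chartD(7)[OF C] by (auto simp: V_def)
  ultimately show ?thesis unfolding K_def using chartD(5)[OF C]
   by (intro image_eqI[of _ _ "chart_map C (\<gamma> t)"]) (auto simp: dist_norm norm_minus_commute)
 qed
 have 0: "\<gamma> 0 \<in> V" unfolding \<gamma>(2) V_def using \<rho> by auto
 define B where "B = {0..1} \<inter> \<gamma> -` (- V)"
 have "closed B" unfolding B_def
  by (rule continuous_closed_preimage[OF cont]) (use oV in auto)
 moreover have "1 \<in> B" using \<gamma>(3) by (auto simp: B_def V_def)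
 moreover have "bdd_below B" by (rule bdd_belowI[of _ 0]) (auto simp: B_def)
 ultimately have \<tau>B: "Inf B \<in> B" using closed_contains_Inf by blast
 define \<tau> where "\<tau> = Inf B"
 have \<tau>: "\<tau> \<in> {0..1}" "\<gamma> \<tau> \<notin> V" using \<tau>B by (auto simp: \<tau>_def B_def)
 have \<tau>0: "0 < \<tau>" using \<tau> 0 by (cases "\<tau> = 0") auto
 have before: "\<gamma> s \<in> V" if "s \<in> {0..<\<tau>}" for s
 proof (rule ccontr)
  assume "\<gamma> s \<notin> V"
  then have "s \<in> B" using that \<tau>(1) by (auto simp: B_def)
  then have "\<tau> \<le> s" unfolding \<tau>_def using \<open>bdd_below B\<close> by (rule cInf_lower)
  then show False using that by auto
 qed
 have "\<gamma> s \<in> K" if "s \<in> {0<..<\<tau>}" for s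
  by (rule K) (use that \<tau>(1) before in auto)
 then have "\<gamma> ` {0<..<\<tau>} \<subseteq> K" by blast
 moreover have "closure {0<..<\<tau>} = {0..\<tau>}" using \<tau>0 by simp
 ultimately have "\<gamma> ` {0..\<tau>} \<subseteq> K"
  using image_closure_subset[of "{0<..<\<tau>}" \<gamma> K] continuous_on_subset[OF cont, of "{0..\<tau>}"] cK \<tau>(1) by auto
 then have "\<gamma> \<tau> \<in> K" using \<tau>0 by auto
 then show False using \<tau>(2) sub(2) by (auto simp: K_def V_def)
qed

lemma chart_line:
 assumes C: "C \<in> atlas M" and B: "open B" "convex B" "B \<subseteq> chart_img C" and xy: "x \<in> B" "y \<in> B"
 defines "\<gamma> \<equiv> \<lambda>t. chart_inv C (x + t *\<^sub>R (y - x))"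
 assumes t: "t \<in> {0..1}"
 shows "C1_at M \<gamma> t" "speed M \<gamma> t = sqrt (ginner M C (x + t *\<^sub>R (y - x)) (y - x) (y - x))" "x + t *\<^sub>R (y - x) \<in> B"
  "((chart_map C \<circ> \<gamma>) has_vector_derivative (y - x)) (at t)"
proof -
 let ?l = "\<lambda>t. x + t *\<^sub>R (y - x)"
 show lB: "?l t \<in> B"
  using convexD_alt[OF B(2) xy, of t] t by (simp add: algebra_simps)
 have "open (?l -` B)" by (rule open_vimage[OF B(1)]) (intro continuous_intros)
 then obtain d where d: "0 < d" "ball t d \<subseteq> ?l -` B" using lB openE[of "?l -` B" t] by auto
 have near: "?l s \<in> B" if "\<bar>s - t\<bar> < d" for s using d(2) that unfolding ball_real_abs[symmetric] by blast
 have cm: "(chart_map C \<circ> \<gamma>) s = ?l s" if "\<bar>s - t\<bar> < d" for s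
 proof -
  have "?l s \<in> chart_img C" using near[OF that] B(3) by blast
  then show ?thesis using chartD(6)[OF C] by (simp add: \<gamma>_def)
 qed
 have der: "((chart_map C \<circ> \<gamma>) has_vector_derivative (y - x)) (at s)" if s: "\<bar>s - t\<bar> < d" for s
 proof -
  have "(?l has_vector_derivative (y - x)) (at s)" by (auto intro!: derivative_eq_intros)
  then show ?thesis
   by (rule has_vector_derivative_transform_within_open[where S="ball t d"])
     (simp_all add: s cm ball_real_abs del: mem_ball o_apply)
 qed
 then show "((chart_map C \<circ> \<gamma>) has_vector_derivative (y - x)) (at t)" using d(1) by simp
 have dom: "\<gamma> s \<in> chart_dom C" if "\<bar>s - t\<bar> < d" for s
  using near[OF that] B(3) chartD(7)[OF C] by (auto simp: \<gamma>_def)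
 show C1: "C1_at M \<gamma> t" by (rule C1_atI[OF C d(1) dom der]) auto
 have "speed M \<gamma> t = sqrt (ginner M C (chart_map C (\<gamma> t)) (y - x) (y - x))"
  by (rule speed_chart[OF C dom C1_at_continuous[OF C1] der]) (use d in auto)
 then show "speed M \<gamma> t = sqrt (ginner M C (?l t) (y - x) (y - x))"
  using lB B(3) chartD(6)[OF C] by (auto simp: \<gamma>_def)
qed

lemma chart_line_curve:
 assumes C: "C \<in> atlas M" and B: "open B" "convex B" "B \<subseteq> chart_img C" and xy: "x \<in> B" "y \<in> B"
 obtains \<gamma> where "piecewise_C1_curve M \<gamma>" "pathstart \<gamma> = chart_inv C x" "pathfinish \<gamma> = chart_inv C y" "curve_length M \<gamma> < \<infinity>"
proof -
 let ?\<gamma> = "\<lambda>t. chart_inv C (x + t *\<^sub>R (y - x))"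
 have C1: "C1_at M ?\<gamma> t" if "t \<in> {0..1}" for t by (rule chart_line(1)[OF C B xy that])
 have "continuous_on {0..1} (speed M ?\<gamma>)"
  by (intro continuous_at_imp_continuous_on ballI speed_continuous_at C1)
 from compact_imp_bounded[OF compact_continuous_image[OF this compact_Icc]]
 obtain L where L: "\<forall>x\<in>speed M ?\<gamma> ` {0..1}. norm x \<le> L" unfolding bounded_iff by blast
 have "speed M ?\<gamma> t \<le> L" if "t \<in> {0..1}" for t
  using L[rule_format, OF imageI[OF that]] by simp
 then have "curve_length M ?\<gamma> \<le> ennreal L" by (intro C1_length_finite C1)
 then have "curve_length M ?\<gamma> < \<infinity>" by (rule order_le_less_trans) simp
 then show ?thesis
  by (rule that[OF C1_piecewise, rotated 3]) (simp_all add: C1 pathstart_def pathfinish_def)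
qed

lemma rdist_le:
 assumes "piecewise_C1_curve M \<gamma>" "pathstart \<gamma> = x" "pathfinish \<gamma> = y" "curve_length M \<gamma> \<le> ennreal L" "0 \<le> L"
 shows "rdist M x y \<le> L"
 unfolding rdist_def by (rule enn2real_leI) (use assms in \<open>auto intro!: INF_lower2[of \<gamma>]\<close>)

lemma chart_ball:
 assumes "open U" "p \<in> U"
 obtains r where "0 < r" "cball (chart_map (chart_at M p) p) r \<subseteq> chart_img (chart_at M p)"
  "chart_inv (chart_at M p) ` cball (chart_map (chart_at M p) p) r \<subseteq> U"
proof -
 let ?C = "chart_at M p"
 let ?V = "chart_img ?C \<inter> chart_inv ?C -` U"
 have "open ?V" by (rule continuous_open_preimage) (use chartD[OF chart_at(1)] assms in auto)
 moreover have "chart_map ?C p \<in> ?V" using chartD(5,8)[OF chart_at(1) chart_at(2)] assms(2) by auto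
 ultimately obtain r where "0 < r" "cball (chart_map ?C p) r \<subseteq> ?V" using open_contains_cball by metis
 then show ?thesis using that by blast
qed

end

section \<open>The Riemannian distance is a metric\<close>

locale connected_riemannian_mfd = riemannian_mfd M
 for M :: "('a::{t2_space,second_countable_topology}, 'n::finite) riemannian" +
 assumes conn: "connected (UNIV :: 'a set)"
begin

text \<open>The points that can be reached from \<open>x\<close> form an open and closed set, since
  any two points of a coordinate ball are joined by a coordinate segment. This makes the infimum in
  \<open>rdist\<close> finite; \<open>enn2real\<close> would turn an infinite one into 0.\<close>

lemma finite_length_curve:
 obtains \<gamma> where "piecewise_C1_curve M \<gamma>" "pathstart \<gamma> = x" "pathfinish \<gamma> = y" "curve_length M \<gamma> < \<infinity>"
proof -
 define R where "R = {y. \<exists>\<gamma>. piecewise_C1_curve M \<gamma> \<and> pathstart \<gamma> = x \<and> pathfinish \<gamma> = y \<and> curve_length M \<gamma> < \<infinity>}"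
 have loc: "\<exists>T. open T \<and> z \<in> T \<and> (\<forall>a\<in>T. \<forall>b\<in>T. a \<in> R \<longrightarrow> b \<in> R)" for z
 proof -
  let ?C = "chart_at M z"
  obtain r where r: "0 < r" "cball (chart_map ?C z) r \<subseteq> chart_img ?C" using chart_ball[of UNIV z] by auto
  let ?B = "ball (chart_map ?C z) r"
  have B: "?B \<subseteq> chart_img ?C" using r(2) by (auto simp: subset_eq)
  have "z \<in> chart_inv ?C ` ?B" using r(1) chartD(5)[OF chart_at(1) chart_at(2)]
   by (intro image_eqI[of _ _ "chart_map ?C z"]) auto
  moreover have "b \<in> R" if ab: "a \<in> chart_inv ?C ` ?B" "b \<in> chart_inv ?C ` ?B" "a \<in> R" for a b
  proof -
   obtain u where u: "a = chart_inv ?C u" "u \<in> ?B" using ab(1) by (rule imageE)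
   obtain v where v: "b = chart_inv ?C v" "v \<in> ?B" using ab(2) by (rule imageE)
   note uv = u(2) v(2) u(1) v(1)
   obtain g where g: "piecewise_C1_curve M g" "pathstart g = a" "pathfinish g = b" "curve_length M g < \<infinity>"
    using chart_line_curve[OF chart_at(1) open_ball convex_ball B uv(1,2)] uv(3,4) by metis
   obtain h where h: "piecewise_C1_curve M h" "pathstart h = x" "pathfinish h = a" "curve_length M h < \<infinity>"
    using ab(3) by (auto simp: R_def)
   show ?thesis unfolding R_def mem_Collect_eq
    using piecewise_C1_join[OF h(1) g(1)] h g by (intro exI[of _ "h +++ g"]) auto
  qed
  moreover have "open (chart_inv ?C ` ?B)" by (rule open_chart_image[OF chart_at(1) open_ball B])
  ultimately show ?thesis by blast
 qed
 have "open R"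
 proof (subst open_subopen, intro ballI)
  fix z assume "z \<in> R" then show "\<exists>T. open T \<and> z \<in> T \<and> T \<subseteq> R" using loc[of z] by blast
 qed
 moreover have "open (- R)"
 proof (subst open_subopen, intro ballI)
  fix z assume "z \<in> - R" then show "\<exists>T. open T \<and> z \<in> T \<and> T \<subseteq> - R" using loc[of z] by blast
 qed
 moreover have "x \<in> R"
 proof -
  let ?C = "chart_at M x"
  obtain r where r: "0 < r" "cball (chart_map ?C x) r \<subseteq> chart_img ?C" using chart_ball[of UNIV x] by auto
  have B: "ball (chart_map ?C x) r \<subseteq> chart_img ?C" using r(2) by (auto simp: subset_eq)
  have "chart_map ?C x \<in> ball (chart_map ?C x) r" using r(1) by simp
  then obtain g where g: "piecewise_C1_curve M g" "pathstart g = chart_inv ?C (chart_map ?C x)" "pathfinish g = chart_inv ?C (chart_map ?C x)" "curve_length M g < \<infinity>"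
   using chart_line_curve[OF chart_at(1) open_ball convex_ball B] by metis
  show ?thesis unfolding R_def mem_Collect_eq
   by (intro exI[of _ g]) (use g chartD(5)[OF chart_at(1) chart_at(2)] in simp)
 qed
 ultimately have "R = UNIV" using connectedD[OF conn, of R "- R"] by auto
 then have "y \<in> R" by simp
 then show ?thesis using that by (auto simp: R_def)
qed

lemma rdist_approx:
 assumes "0 < e"
 obtains \<gamma> where "piecewise_C1_curve M \<gamma>" "pathstart \<gamma> = x" "pathfinish \<gamma> = y" "curve_length M \<gamma> < ennreal (rdist M x y + e)"
proof -
 let ?A = "{\<gamma>. piecewise_C1_curve M \<gamma> \<and> pathstart \<gamma> = x \<and> pathfinish \<gamma> = y}"
 let ?I = "INF \<gamma>\<in>?A. curve_length M \<gamma>"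
 obtain \<gamma>0 where "\<gamma>0 \<in> ?A" "curve_length M \<gamma>0 < \<infinity>" using finite_length_curve by blast
 then have "?I < \<infinity>" by (metis (no_types, lifting) INF_lower order_le_less_trans)
 then have "?I = ennreal (rdist M x y)" unfolding rdist_def by (simp add: less_top)
 moreover have "0 \<le> rdist M x y" unfolding rdist_def by (rule enn2real_nonneg)
 ultimately have "?I < ennreal (rdist M x y + e)" using assms by (simp only: ennreal_less_iff)
 then show ?thesis using that by (auto simp: INF_less_iff)
qed

lemma rdist_nonneg: "0 \<le> rdist M x y" by (simp add: rdist_def)

lemma rdist_triangle: "rdist M x z \<le> rdist M x y + rdist M y z"
proof (rule field_le_epsilon)
 fix e :: real assume e: "0 < e"
 obtain g where g: "piecewise_C1_curve M g" "pathstart g = x" "pathfinish g = y" "curve_length M g < ennreal (rdist M x y + e/2)"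
  using rdist_approx[of "e/2" x y] e by auto
 obtain h where h: "piecewise_C1_curve M h" "pathstart h = y" "pathfinish h = z" "curve_length M h < ennreal (rdist M y z + e/2)"
  using rdist_approx[of "e/2" y z] e by auto
 have "curve_length M (g +++ h) \<le> ennreal (rdist M x y + e/2) + ennreal (rdist M y z + e/2)"
  using piecewise_C1_join(2)[OF g(1) h(1)] g h by (auto intro!: add_mono)
 also have "\<dots> = ennreal (rdist M x y + rdist M y z + e)"
  using rdist_nonneg e by (subst ennreal_plus[symmetric]) (auto intro!: add_nonneg_nonneg simp: algebra_simps)
 finally show "rdist M x z \<le> rdist M x y + rdist M y z + e"
  using piecewise_C1_join(1)[OF g(1) h(1)] g h rdist_nonneg e by (intro rdist_le[of "g +++ h"]) (auto intro!: add_nonneg_nonneg)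
qed

lemma rdist_commute_le: "rdist M x y \<le> rdist M y x"
proof (rule field_le_epsilon)
 fix e :: real assume e: "0 < e"
 obtain g where g: "piecewise_C1_curve M g" "pathstart g = y" "pathfinish g = x" "curve_length M g < ennreal (rdist M y x + e)"
  using rdist_approx[OF e] by auto
 then show "rdist M x y \<le> rdist M y x + e"
  using piecewise_C1_reverse[OF g(1)] rdist_nonneg e by (intro rdist_le[of "reversepath g"]) (auto intro!: add_nonneg_nonneg)
qed

lemma rdist_commute: "rdist M x y = rdist M y x"
 using rdist_commute_le by (rule antisym) (rule rdist_commute_le)

text \<open>Inside \<open>U\<close> there is a coordinate ball around \<open>p\<close>, and a curve
  from \<open>p\<close> to a point outside of \<open>U\<close> has to leave it, at the cost given by
  \<open>curve_length_exit\<close>.\<close>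

lemma rdist_nbhd:
 assumes "open U" "p \<in> U"
 obtains \<delta> where "0 < \<delta>" "\<And>y. rdist M p y < \<delta> \<Longrightarrow> y \<in> U"
proof -
 let ?C = "chart_at M p" let ?x = "chart_map ?C p"
 obtain r where r: "0 < r" "cball ?x r \<subseteq> chart_img ?C" "chart_inv ?C ` cball ?x r \<subseteq> U" using chart_ball[OF assms] by metis
 obtain \<kappa> where \<kappa>: "0 < \<kappa>" "\<And>x v. x \<in> cball ?x r \<Longrightarrow> \<kappa> * norm v \<le> sqrt (ginner M ?C x v v)"
  using ginner_bounds[OF chart_at(1) compact_cball r(2)] by metis
 show ?thesis
 proof (rule that[of "\<kappa> * r"])
  fix y assume y: "rdist M p y < \<kappa> * r"
  obtain g where g: "piecewise_C1_curve M g" "pathstart g = p" "pathfinish g = y" "curve_length M g < ennreal (rdist M p y + (\<kappa> * r - rdist M p y))"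
   using rdist_approx[of "\<kappa> * r - rdist M p y" p y] y by auto
  show "y \<in> U"
  proof (rule ccontr)
   assume "y \<notin> U"
   then have "g 1 \<notin> chart_inv ?C ` ball ?x r" using r(3) g(3) by (force simp: pathfinish_def)
   moreover have "g 0 = chart_inv ?C ?x" using g(2) chartD(5)[OF chart_at(1) chart_at(2)] by (simp add: pathstart_def)
   ultimately have "ennreal (\<kappa> * r) \<le> curve_length M g"
    by (intro curve_length_exit[OF chart_at(1) r(2) r(1) order_refl \<kappa> g(1)])
   then show False using g(4) by simp
  qed
 qed (use \<kappa> r in auto)
qed

lemma rdist_refl: "rdist M x x = 0"
proof -
 have "curve_length M (\<lambda>_. x) \<le> ennreal 0 \<and> piecewise_C1_curve M (\<lambda>_. x)"
 proof
  have C1: "C1_at M (\<lambda>_. x) t" for t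
   by (rule C1_atI[OF chart_at(1)[of x], of 1 _ _ "\<lambda>_. 0"]) (use chart_at(2) in \<open>auto simp: o_def\<close>)
  have "speed M (\<lambda>_. x) t = sqrt (ginner M (chart_at M x) (chart_map (chart_at M x) x) 0 0)" for t
   by (rule speed_chart[OF chart_at(1) chart_at(2)]) (auto simp: o_def)
  then show "curve_length M (\<lambda>_. x) \<le> ennreal 0" by (intro C1_length_finite C1) (simp add: ginner_linear)
  show "piecewise_C1_curve M (\<lambda>_. x)" by (intro C1_piecewise C1)
 qed
 then show ?thesis using rdist_le[of "\<lambda>_. x" x x 0] rdist_nonneg[of x x] by (simp add: pathstart_def pathfinish_def)
qed

lemma rdist_eq_0_iff: "rdist M x y = 0 \<longleftrightarrow> x = y"
proof
 assume 0: "rdist M x y = 0"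
 show "x = y"
 proof (rule ccontr)
  assume "x \<noteq> y"
  then have "open (- {y})" "x \<in> - {y}" by auto
  then show False using rdist_nbhd[of "- {y}" x] 0 by (metis ComplD singletonI)
 qed
qed (simp add: rdist_refl)

lemma Metric_space_rdist: "Metric_space UNIV (rdist M)"
 by unfold_locales (auto simp: rdist_nonneg rdist_eq_0_iff rdist_triangle intro: rdist_commute)

lemma complete_limit:
 assumes "complete_riemannian M" and "\<And>e. 0 < e \<Longrightarrow> \<exists>N. \<forall>m n. N \<le> m \<longrightarrow> N \<le> n \<longrightarrow> rdist M (\<sigma> m) (\<sigma> n) < e"
 obtains p where "\<And>e. 0 < e \<Longrightarrow> \<forall>\<^sub>F n in sequentially. rdist M p (\<sigma> n) < e"
proof -
 interpret d: Metric_space UNIV "rdist M" by (rule Metric_space_rdist)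
 have "d.MCauchy \<sigma>" unfolding d.MCauchy_def using assms(2) by auto
 from assms(1)[unfolded complete_riemannian_def d.mcomplete_def, rule_format, OF this]
 obtain p where "limitin d.mtopology \<sigma> p sequentially" ..
 then show ?thesis using that[of p] by (simp add: d.limitin_metric rdist_commute)
qed

end

section \<open>Geodesics\<close>

text \<open>The geodesic equation as a first-order system for position and velocity.\<close>

definition geo_field :: "('a, 'n::finite) riemannian \<Rightarrow> ('a, 'n) chart \<Rightarrow> (real^'n) \<times> (real^'n) \<Rightarrow> (real^'n) \<times> (real^'n)" where
 "geo_field M C z = (snd z, - gam M C (fst z) (snd z) (snd z))"

definition geo_field' :: "('a, 'n::finite) riemannian \<Rightarrow> ('a, 'n) chart \<Rightarrow> (real^'n) \<times> (real^'n) \<Rightarrow> (real^'n) \<times> (real^'n) \<Rightarrow> (real^'n) \<times> (real^'n)" where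
 "geo_field' M C z h = (snd h, - (dgam M C (fst z) (fst h) (snd z) (snd z) + gam M C (fst z) (snd h) (snd z) + gam M C (fst z) (snd z) (snd h)))"

text \<open>\<open>z\<close> is the position and velocity of the geodesic \<open>\<gamma>\<close> in the chart \<open>C\<close>, at times near \<open>t\<close>.\<close>
definition geo_rep :: "('a, 'n::finite) riemannian \<Rightarrow> ('a, 'n) chart \<Rightarrow> (real \<Rightarrow> 'a) \<Rightarrow> (real \<Rightarrow> (real^'n) \<times> (real^'n)) \<Rightarrow> real \<Rightarrow> real \<Rightarrow> bool" where
 "geo_rep M C \<gamma> z t d \<longleftrightarrow> C \<in> atlas M \<and> 0 < d \<and>
   (\<forall>s. \<bar>s - t\<bar> < d \<longrightarrow> \<gamma> s \<in> chart_dom C \<and> fst (z s) = chart_map C (\<gamma> s) \<and> (z has_vector_derivative geo_field M C (z s)) (at s))"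

definition geodesic_at :: "('a, 'n::finite) riemannian \<Rightarrow> (real \<Rightarrow> 'a) \<Rightarrow> real \<Rightarrow> bool" where
 "geodesic_at M \<gamma> t \<longleftrightarrow> (\<exists>C z d. geo_rep M C \<gamma> z t d)"

text \<open>A family of geodesics that depends differentiably on its parameter. \<open>W \<xi> s\<close> is the derivative of
 the state with respect to the parameter; it solves the linearized equation.\<close>
definition geo_family_rep :: "('a, 'n::finite) riemannian \<Rightarrow> ('a, 'n) chart \<Rightarrow> ('p::real_normed_vector \<Rightarrow> real \<Rightarrow> 'a) \<Rightarrow>
  ('p \<Rightarrow> real \<Rightarrow> (real^'n) \<times> (real^'n)) \<Rightarrow> ('p \<Rightarrow> real \<Rightarrow> 'p \<Rightarrow>\<^sub>L ((real^'n) \<times> (real^'n))) \<Rightarrow> 'p set \<Rightarrow> real \<Rightarrow> real \<Rightarrow> bool" where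
 "geo_family_rep M C \<Gamma> Z W N t d \<longleftrightarrow> open N \<and> (\<forall>\<xi>\<in>N. geo_rep M C (\<Gamma> \<xi>) (Z \<xi>) t d) \<and>
   (\<forall>\<xi>\<in>N. \<forall>s. \<bar>s - t\<bar> < d \<longrightarrow> ((\<lambda>\<xi>. Z \<xi> s) has_derivative blinfun_apply (W \<xi> s)) (at \<xi>) \<and>
    (\<forall>w. ((\<lambda>s. W \<xi> s w) has_vector_derivative geo_field' M C (Z \<xi> s) (W \<xi> s w)) (at s))) \<and>
   (\<forall>s. \<bar>s - t\<bar> < d \<longrightarrow> continuous_on N (\<lambda>\<xi>. W \<xi> s))"

lemma geo_repD:
 assumes "geo_rep M C \<gamma> z t d"
 shows "C \<in> atlas M" "0 < d" "\<And>s. \<bar>s - t\<bar> < d \<Longrightarrow> \<gamma> s \<in> chart_dom C" "\<And>s. \<bar>s - t\<bar> < d \<Longrightarrow> fst (z s) = chart_map C (\<gamma> s)"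
  "\<And>s. \<bar>s - t\<bar> < d \<Longrightarrow> (z has_vector_derivative geo_field M C (z s)) (at s)"
 using assms unfolding geo_rep_def by blast+

lemma geo_rep_sub: "geo_rep M C \<gamma> z t d \<Longrightarrow> \<bar>t' - t\<bar> + d' \<le> d \<Longrightarrow> 0 < d' \<Longrightarrow> geo_rep M C \<gamma> z t' d'"
 unfolding geo_rep_def by auto

lemma geo_rep_cong:
 assumes "geo_rep M C \<gamma> z t d" "\<And>s. \<bar>s - t\<bar> < d \<Longrightarrow> \<gamma>' s = \<gamma> s"
 shows "geo_rep M C \<gamma>' z t d"
 using assms unfolding geo_rep_def by simp

lemma geodesic_at_cong:
 assumes "geodesic_at M \<gamma> t" "0 < e" "\<And>s. \<bar>s - t\<bar> < e \<Longrightarrow> \<gamma>' s = \<gamma> s"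
 shows "geodesic_at M \<gamma>' t"
proof -
 obtain C z d where g: "geo_rep M C \<gamma> z t d" using assms(1) unfolding geodesic_at_def by blast
 have "geo_rep M C \<gamma> z t (min d e)" by (rule geo_rep_sub[OF g]) (use assms geo_repD(2)[OF g] in auto)
 from geo_rep_cong[OF this, of \<gamma>'] show ?thesis unfolding geodesic_at_def using assms(3) by (intro exI) simp
qed

section \<open>Geodesics as solutions of a differential equation\<close>

context riemannian_mfd
begin

lemma continuous_on_gam:
 assumes C: "C \<in> atlas M" and x: "continuous_on X x" "\<And>z. z \<in> X \<Longrightarrow> x z \<in> chart_img C" and "continuous_on X v" "continuous_on X w"
 shows "continuous_on X (\<lambda>z. gam M C (x z) (v z) (w z))"
 unfolding gam_def
 by (intro continuous_on_vec_lambda continuous_on_bform assms continuous_on_compose2[OF Ck_on_continuous[OF christoffel_C1[OF C]] x(1)])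
   (use x(2) in auto)

lemma continuous_on_dgam:
 assumes C: "C \<in> atlas M" and x: "continuous_on X x" "\<And>z. z \<in> X \<Longrightarrow> x z \<in> chart_img C" and "continuous_on X h" "continuous_on X v" "continuous_on X w"
 shows "continuous_on X (\<lambda>z. dgam M C (x z) (h z) (v z) (w z))"
proof -
 have "continuous_on (chart_img C) (partial_deriv k (christoffel M C l i j))" for k l i j
  using christoffel_C1[OF C] by simp
 then show ?thesis unfolding dgam_def
  by (intro continuous_on_vec_lambda continuous_on_dbform assms continuous_on_compose2[OF _ x(1)]) (use x(2) in auto)
qed

lemma geo_field_C1:
 assumes C: "C \<in> atlas M"
 obtains F' where "\<And>z. z \<in> chart_img C \<times> UNIV \<Longrightarrow> (geo_field M C has_derivative blinfun_apply (F' z)) (at z)"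
  "continuous_on (chart_img C \<times> UNIV) F'" "\<And>z h. z \<in> chart_img C \<times> UNIV \<Longrightarrow> blinfun_apply (F' z) h = geo_field' M C z h"
proof -
 have d: "(geo_field M C has_derivative geo_field' M C z) (at z)" if z: "z \<in> chart_img C \<times> UNIV" for z
 proof -
  have "((\<lambda>z. gam M C (fst z) (snd z) (snd z)) has_derivative
   (\<lambda>h. dgam M C (fst z) (fst h) (snd z) (snd z) + gam M C (fst z) (snd h) (snd z) + gam M C (fst z) (snd z) (snd h))) (at z)"
   by (rule gam_has_derivative[OF C]) (use z in \<open>auto intro: has_derivative_fst has_derivative_snd has_derivative_ident\<close>)
  then have "((\<lambda>z. (snd z, - gam M C (fst z) (snd z) (snd z))) has_derivative geo_field' M C z) (at z)"
   unfolding geo_field'_def by (intro has_derivative_Pair has_derivative_minus has_derivative_snd has_derivative_ident)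
  then show ?thesis by (simp add: geo_field_def[abs_def])
 qed
 define F' where "F' z = Blinfun (geo_field' M C z)" for z
 have app: "blinfun_apply (F' z) = geo_field' M C z" if "z \<in> chart_img C \<times> UNIV" for z
  unfolding F'_def by (rule bounded_linear_Blinfun_apply[OF has_derivative_bounded_linear[OF d[OF that]]])
 have "continuous_on (chart_img C \<times> UNIV) F'"
 proof (rule continuous_on_blinfun_componentwise)
  fix b :: "(real^'n) \<times> (real^'n)"
  have "continuous_on (chart_img C \<times> UNIV) (\<lambda>z. geo_field' M C z b)"
   unfolding geo_field'_def
   by (intro continuous_on_Pair continuous_on_minus continuous_on_add continuous_on_gam[OF C] continuous_on_dgam[OF C] continuous_intros) auto
  then show "continuous_on (chart_img C \<times> UNIV) (\<lambda>z. blinfun_apply (F' z) b)"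
   by (rule continuous_on_eq) (simp add: app)
 qed
 then show ?thesis using that[of F'] app d by auto
qed

lemma geo_rep_velocity:
 assumes g: "geo_rep M C \<gamma> z t d" and s: "\<bar>s - t\<bar> < d"
 shows "((chart_map C \<circ> \<gamma>) has_vector_derivative snd (z s)) (at s)" "continuous (at s) \<gamma>" "C1_at M \<gamma> s"
  "speed M \<gamma> s = sqrt (ginner M C (fst (z s)) (snd (z s)) (snd (z s)))" "fst (z s) \<in> chart_img C"
proof -
 note gD = geo_repD[OF g]
 have v: "((chart_map C \<circ> \<gamma>) has_vector_derivative snd (z r)) (at r)" if r: "\<bar>r - t\<bar> < d" for r
 proof -
  have "((\<lambda>s. fst (z s)) has_vector_derivative fst (geo_field M C (z r))) (at r)"
   by (rule bounded_linear.has_vector_derivative[OF bounded_linear_fst gD(5)[OF r]])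
  then show ?thesis unfolding geo_field_def fst_conv
   by (rule has_vector_derivative_transform_within_open[where S="ball t d"])
     (use r gD(4) in \<open>auto simp: ball_real_abs simp del: mem_ball\<close>)
 qed
 then show vs: "((chart_map C \<circ> \<gamma>) has_vector_derivative snd (z s)) (at s)" using s by blast
 show c: "continuous (at s) \<gamma>"
  by (rule chart_curve_continuous[OF gD(1) gD(3) has_vector_derivative_continuous[OF v] s])
 have cz: "continuous_on (ball t d) z"
  by (rule continuous_at_imp_continuous_on) (use has_vector_derivative_continuous[OF gD(5)] in \<open>auto simp: ball_real_abs simp del: mem_ball\<close>)
 show "C1_at M \<gamma> s"
 proof (rule C1_atI[OF gD(1), of "d - \<bar>s - t\<bar>" _ _ "\<lambda>s. snd (z s)"])
  show "continuous_on (ball s (d - \<bar>s - t\<bar>)) (\<lambda>s. snd (z s))"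
   by (intro continuous_on_snd continuous_on_subset[OF cz]) (auto simp: ball_real_abs simp del: mem_ball)
 qed (use s gD(3) v in auto)
 show "speed M \<gamma> s = sqrt (ginner M C (fst (z s)) (snd (z s)) (snd (z s)))"
  using speed_chart[OF gD(1) gD(3)[OF s] c vs] gD(4)[OF s] by simp
 show "fst (z s) \<in> chart_img C" using chartD(8)[OF gD(1) gD(3)[OF s]] gD(4)[OF s] by simp
qed

text \<open>The velocity is carried over by the differential of the transition. Differentiating it
  in time brings in the second derivative of the transition, which is the correction term of
  \<open>gam_transition\<close>.\<close>

lemma geo_rep_chart:
 assumes g: "geo_rep M C \<gamma> z t d" and D: "D \<in> atlas M" "\<gamma> t \<in> chart_dom D"
 obtains z' d' where "geo_rep M D \<gamma> z' t d'"
proof -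
 note gD = geo_repD[OF g]
 have C: "C \<in> atlas M" by (rule gD)
 let ?W = "chart_map C ` (chart_dom C \<inter> chart_dom D)"
 let ?\<phi> = "transition C D" let ?D = "\<lambda>y. frechet_derivative ?\<phi> (at y)"
 obtain S where S: "open S" "t \<in> S" "\<And>s. s \<in> S \<Longrightarrow> \<gamma> s \<in> chart_dom D"
  using geo_rep_velocity(2)[OF g, of t] gD(2) D(2) chartD(1)[OF D(1)] unfolding continuous_at_open by (metis abs_zero diff_self)
 obtain d1 where d1: "0 < d1" "ball t d1 \<subseteq> S" using S openE by blast
 define d' where "d' = min d d1"
 have d': "0 < d'" "d' \<le> d" using d1 gD by (auto simp: d'_def)
 have inD: "\<gamma> s \<in> chart_dom D" if "\<bar>s - t\<bar> < d'" for s
 proof (rule S(3))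
  have "s \<in> ball t d1" using that unfolding ball_real_abs d'_def by simp
  then show "s \<in> S" using d1 by blast
 qed
 define z' where "z' s = (?\<phi> (fst (z s)), ?D (fst (z s)) (snd (z s)))" for s
 have "geo_rep M D \<gamma> z' t d'" unfolding geo_rep_def
 proof (intro conjI allI impI)
  fix s assume s: "\<bar>s - t\<bar> < d'"
  then have sd: "\<bar>s - t\<bar> < d" using d' by simp
  show "\<gamma> s \<in> chart_dom D" by (rule inD[OF s])
  show "fst (z' s) = chart_map D (\<gamma> s)" using gD(3,4)[OF sd] transition_map[OF C, of "\<gamma> s" D] by (simp add: z'_def)
  define x v where "x = fst (z s)" and "v = snd (z s)"
  have xW: "fst (z r) \<in> ?W" if "\<bar>r - t\<bar> < d'" for r
   using gD(3,4)[of r] inD[OF that] that d' by auto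
  have xs: "x \<in> ?W" unfolding x_def by (rule xW[OF s])
  have C2: "Ck_on 2 ?W ?\<phi>" by (rule transition_smooth[OF C D(1)])
  have dx: "((\<lambda>s. fst (z s)) has_derivative (\<lambda>h. h *\<^sub>R v)) (at s)"
   using bounded_linear.has_vector_derivative[OF bounded_linear_fst gD(5)[OF sd]] by (simp add: has_vector_derivative_def geo_field_def v_def)
  have dv: "((\<lambda>s. snd (z s)) has_derivative (\<lambda>h. h *\<^sub>R (- gam M C x v v))) (at s)"
   using bounded_linear.has_vector_derivative[OF bounded_linear_snd gD(5)[OF sd]] by (simp add: has_vector_derivative_def geo_field_def v_def x_def)
  have lin: "linear (?D x)" by (rule has_derivative_linear[OF transition_has_derivative[OF C D(1) xs]])
  have 1: "((\<lambda>s. ?\<phi> (fst (z s))) has_derivative (\<lambda>h. h *\<^sub>R ?D x v)) (at s)"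
   using has_derivative_compose[OF dx transition_has_derivative[OF C D(1) xs, unfolded x_def]] linear_cmul[OF lin, unfolded x_def]
   unfolding x_def by simp
  have pd: "?\<phi> differentiable at y" "partial_deriv j ?\<phi> differentiable at y" if "y \<in> ?W" for j y
   using C2 that unfolding numeral_2_eq_2 Ck_on.simps by blast+
  have "((\<lambda>s. \<Sum>j\<in>UNIV. snd (z s) $ j *\<^sub>R partial_deriv j ?\<phi> (fst (z s))) has_derivative
    (\<lambda>h. \<Sum>j\<in>UNIV. snd (z s) $ j *\<^sub>R (\<Sum>i\<in>UNIV. (h *\<^sub>R v) $ i *\<^sub>R partial_deriv i (partial_deriv j ?\<phi>) x) + (h *\<^sub>R (- gam M C x v v)) $ j *\<^sub>R partial_deriv j ?\<phi> (fst (z s)))) (at s)"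
   by (intro has_derivative_sum has_derivative_scaleR bounded_linear.has_derivative[OF bounded_linear_vec_nth dv]
      has_derivative_compose[OF dx has_derivative_partial, unfolded x_def[symmetric]] pd xs)
  moreover have "(\<Sum>j\<in>UNIV. snd (z s) $ j *\<^sub>R (\<Sum>i\<in>UNIV. (h *\<^sub>R v) $ i *\<^sub>R partial_deriv i (partial_deriv j ?\<phi>) x) + (h *\<^sub>R (- gam M C x v v)) $ j *\<^sub>R partial_deriv j ?\<phi> (fst (z s)))
    = h *\<^sub>R (d2_transition C D x v v - ?D x (gam M C x v v))" for h
  proof -
   have "?D x (gam M C x v v) = (\<Sum>j\<in>UNIV. gam M C x v v $ j *\<^sub>R partial_deriv j ?\<phi> x)"
    by (rule frechet_derivative_partial[OF pd(1)[OF xs]])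
   moreover have "d2_transition C D x v v = (\<Sum>j\<in>UNIV. \<Sum>i\<in>UNIV. (v $ i * v $ j) *\<^sub>R partial_deriv i (partial_deriv j ?\<phi>) x)"
    unfolding d2_transition_def by (rule sum.swap)
   ultimately show ?thesis unfolding x_def[symmetric] v_def[symmetric]
    by (simp add: sum.distrib sum_negf sum_subtractf scaleR_sum_right scaleR_diff_right mult_ac)
  qed
  ultimately have 2: "((\<lambda>s. \<Sum>j\<in>UNIV. snd (z s) $ j *\<^sub>R partial_deriv j ?\<phi> (fst (z s))) has_derivative
    (\<lambda>h. h *\<^sub>R (- gam M D (?\<phi> x) (?D x v) (?D x v)))) (at s)"
   using gam_transition(1)[OF C D(1) xs, of v] by simp
  have 3: "((\<lambda>s. ?D (fst (z s)) (snd (z s))) has_derivative (\<lambda>h. h *\<^sub>R (- gam M D (?\<phi> x) (?D x v) (?D x v)))) (at s)"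
   by (rule has_derivative_transform_within_open[OF 2, of "ball t d'"])
     (use s in \<open>auto simp: ball_real_abs frechet_derivative_partial[OF pd(1)[OF xW]] simp del: mem_ball\<close>)
  show "(z' has_vector_derivative geo_field M D (z' s)) (at s)"
   unfolding z'_def[abs_def] has_vector_derivative_def geo_field_def
   using has_derivative_Pair[OF 1 3] by (simp add: x_def v_def)
 qed (use D d' in auto)
 then show ?thesis using that by blast
qed

lemma geodesic_at_chart:
 assumes "geodesic_at M \<gamma> t" "D \<in> atlas M" "\<gamma> t \<in> chart_dom D"
 obtains z d where "geo_rep M D \<gamma> z t d"
 using assms geo_rep_chart unfolding geodesic_at_def by metis

text \<open>In a chart the derivative of \<open>ginner v v\<close> vanishes by metric compatibility
  and \<open>v' = - gam v v\<close>. As the speed does not depend on the chart, the local statements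
  combine.\<close>

lemma geodesic_speed_constant:
 assumes "\<And>t. t \<in> {a<..<b} \<Longrightarrow> geodesic_at M \<gamma> t" "s \<in> {a<..<b}" "t \<in> {a<..<b}"
 shows "speed M \<gamma> s = speed M \<gamma> t"
proof -
 have D: "((\<lambda>r. (speed M \<gamma> r)\<^sup>2) has_derivative (\<lambda>h. 0)) (at r within {a<..<b})" if r: "r \<in> {a<..<b}" for r
 proof -
  obtain C z d where g: "geo_rep M C \<gamma> z r d" using assms(1)[OF r] unfolding geodesic_at_def by blast
  note gD = geo_repD[OF g]
  have r0: "\<bar>r - r\<bar> < d" using gD by simp
  let ?x = "fst (z r)" and ?v = "snd (z r)"
  have dz: "(z has_derivative (\<lambda>h. h *\<^sub>R geo_field M C (z r))) (at r)" using gD(5)[OF r0] by (simp add: has_vector_derivative_def)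
  note xi = geo_rep_velocity(5)[OF g r0]
  have "((\<lambda>s. ginner M C (fst (z s)) (snd (z s)) (snd (z s))) has_derivative
    (\<lambda>h. dginner M C ?x (fst (h *\<^sub>R geo_field M C (z r))) ?v ?v + ginner M C ?x (snd (h *\<^sub>R geo_field M C (z r))) ?v + ginner M C ?x ?v (snd (h *\<^sub>R geo_field M C (z r))))) (at r)"
   by (rule ginner_has_derivative[where x="\<lambda>s. fst (z s)", OF gD(1) xi has_derivative_fst[OF dz] has_derivative_snd[OF dz] has_derivative_snd[OF dz]])
  moreover have "dginner M C ?x (fst (h *\<^sub>R geo_field M C (z r))) ?v ?v + ginner M C ?x (snd (h *\<^sub>R geo_field M C (z r))) ?v + ginner M C ?x ?v (snd (h *\<^sub>R geo_field M C (z r))) = 0" for h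
   unfolding metric_compatible[OF gD(1) xi] by (simp add: geo_field_def ginner_linear gam_linear)
  ultimately have "((\<lambda>s. ginner M C (fst (z s)) (snd (z s)) (snd (z s))) has_derivative (\<lambda>h. 0)) (at r)" by simp
  then have "((\<lambda>r. (speed M \<gamma> r)\<^sup>2) has_derivative (\<lambda>h. 0)) (at r)"
   by (rule has_derivative_transform_within_open[of _ _ _ _ "ball r d"])
     (use gD(2) geo_rep_velocity(4,5)[OF g] ginner_nonneg[OF gD(1)] in \<open>auto simp: ball_real_abs simp del: mem_ball\<close>)
  then show ?thesis by (rule has_derivative_at_withinI)
 qed
 have "\<exists>c. \<forall>r\<in>{a<..<b}. (speed M \<gamma> r)\<^sup>2 = c"
  by (rule has_derivative_zero_constant[OF convex_real_interval(8)]) (use D in auto)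
 then have "(speed M \<gamma> s)\<^sup>2 = (speed M \<gamma> t)\<^sup>2" using assms(2,3) by auto
 moreover have "0 \<le> speed M \<gamma> r" if r: "r \<in> {a<..<b}" for r
 proof -
  obtain C z d where g: "geo_rep M C \<gamma> z r d" using assms(1)[OF r] unfolding geodesic_at_def by blast
  then show ?thesis using geo_repD(2)[OF g] by (intro speed_nonneg geo_rep_velocity(3)[OF g]) simp
 qed
 ultimately show ?thesis using assms(2,3) power2_eq_iff_nonneg by blast
qed

text \<open>The times near which the two curves agree form an open set, and this set is relatively
  closed: at a limit time the positions agree because the space is Hausdorff, the velocities agree
  by continuity in a common chart, and uniqueness for the differential equation gives agreement
  nearby.\<close>

lemma geodesic_unique:
 assumes g: "\<And>t. t \<in> {a<..<b} \<Longrightarrow> geodesic_at M \<gamma> t" "\<And>t. t \<in> {a<..<b} \<Longrightarrow> geodesic_at M \<gamma>' t"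
  and t0: "t0 \<in> {a<..<b}" "\<gamma> t0 = \<gamma>' t0" and C0: "C0 \<in> atlas M" "\<gamma> t0 \<in> chart_dom C0"
  and v: "((chart_map C0 \<circ> \<gamma>) has_vector_derivative v) (at t0)" "((chart_map C0 \<circ> \<gamma>') has_vector_derivative v) (at t0)"
  and t: "t \<in> {a<..<b}"
 shows "\<gamma> t = \<gamma>' t"
proof -
 define same where "same s \<longleftrightarrow> s \<in> {a<..<b} \<and> (\<exists>e>0. \<forall>r. \<bar>r - s\<bar> < e \<longrightarrow> \<gamma> r = \<gamma>' r)" for s
 have local_same: "same s" if s: "s \<in> {a<..<b}" and C: "geo_rep M C \<gamma> z s d" "geo_rep M C \<gamma>' z' s d'" and eq: "z s = z' s" for s C z z' d d'
 proof -
  note gD = geo_repD[OF C(1)] note gD' = geo_repD[OF C(2)]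
  obtain F' where F: "\<And>z. z \<in> chart_img C \<times> UNIV \<Longrightarrow> (geo_field M C has_derivative blinfun_apply (F' z)) (at z)"
   "continuous_on (chart_img C \<times> UNIV) F'" using geo_field_C1[OF gD(1)] by metis
  have "open (chart_img C \<times> (UNIV :: (real^'n) set))" by (intro open_Times chartD(2)[OF gD(1)]) auto
  moreover have "z s \<in> chart_img C \<times> UNIV" using geo_rep_velocity(5)[OF C(1), of s] gD(2) by (simp add: mem_Times_iff)
  ultimately obtain e where e: "0 < e" "\<And>r. \<bar>r - s\<bar> < e \<Longrightarrow> z r = z' r"
   using ode_unique_local[of "chart_img C \<times> UNIV" "geo_field M C" F' "min d d'" s z z'] F gD(2,5) gD'(2,5) eq by auto
  have "\<gamma> r = \<gamma>' r" if "\<bar>r - s\<bar> < min e (min d d')" for r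
  proof -
   have "chart_map C (\<gamma> r) = chart_map C (\<gamma>' r)" using e(2)[of r] gD(4)[of r] gD'(4)[of r] that by simp
   then show ?thesis using chartD(5)[OF gD(1)] gD(3)[of r] gD'(3)[of r] that by (metis min_less_iff_conj)
  qed
  then show ?thesis unfolding same_def using s e gD(2) gD'(2) by (intro conjI exI[of _ "min e (min d d')"]) auto
 qed
 have "same t0"
 proof -
  obtain z d where 1: "geo_rep M C0 \<gamma> z t0 d" using geodesic_at_chart[OF g(1)[OF t0(1)] C0] by blast
  obtain z' d' where 2: "geo_rep M C0 \<gamma>' z' t0 d'" using geodesic_at_chart[OF g(2)[OF t0(1)] C0(1)] C0(2) t0(2) by auto
  have "snd (z t0) = v" using geo_rep_velocity(1)[OF 1, of t0] geo_repD(2)[OF 1] v(1) vector_derivative_unique_at by fastforce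
  moreover have "snd (z' t0) = v" using geo_rep_velocity(1)[OF 2, of t0] geo_repD(2)[OF 2] v(2) vector_derivative_unique_at by fastforce
  moreover have "fst (z t0) = fst (z' t0)" using geo_repD(2,4)[OF 1] geo_repD(2,4)[OF 2] t0(2) by simp
  ultimately show ?thesis by (intro local_same[OF t0(1) 1 2]) (simp add: prod_eq_iff)
 qed
 define A where "A = {s. same s}"
 have oA: "open A"
 proof (subst open_subopen, intro ballI)
  fix s assume "s \<in> A"
  then obtain e where s: "s \<in> {a<..<b}" and e: "0 < e" "\<And>r. \<bar>r - s\<bar> < e \<Longrightarrow> \<gamma> r = \<gamma>' r" by (auto simp: A_def same_def)
  have "same r" if "r \<in> ball s e \<inter> {a<..<b}" for r
   unfolding same_def using that e(2) by (intro conjI exI[of _ "e - \<bar>r - s\<bar>"]) (auto simp: dist_real_def)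
  then show "\<exists>T. open T \<and> s \<in> T \<and> T \<subseteq> A" using s e(1) by (intro exI[of _ "ball s e \<inter> {a<..<b}"]) (auto simp: A_def)
 qed
 have closed: "s \<in> A" if s: "s \<in> {a<..<b}" and lim: "\<And>e. 0 < e \<Longrightarrow> \<exists>r\<in>A. \<bar>r - s\<bar> < e" for s
 proof -
  obtain C z d where 1: "geo_rep M C \<gamma> z s d" using g(1)[OF s] unfolding geodesic_at_def by blast
  note gD = geo_repD[OF 1]
  obtain D y d2 where 2: "geo_rep M D \<gamma>' y s d2" using g(2)[OF s] unfolding geodesic_at_def by blast
  have c: "continuous (at s) \<gamma>" "continuous (at s) \<gamma>'"
   using geo_rep_velocity(2)[OF 1, of s] geo_rep_velocity(2)[OF 2, of s] gD(2) geo_repD(2)[OF 2] by auto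
  \<comment> \<open>Disjoint neighbourhoods of the two positions would separate the curves at nearby
    times, at some of which they agree.\<close>
  have "\<gamma> s = \<gamma>' s"
  proof (rule ccontr)
   assume "\<gamma> s \<noteq> \<gamma>' s"
   from hausdorff[OF this] obtain U V where UV: "open U" "open V" "\<gamma> s \<in> U" "\<gamma>' s \<in> V" "U \<inter> V = {}" by (elim exE conjE)
   obtain S1 where S1: "open S1" "s \<in> S1" "\<And>r. r \<in> S1 \<Longrightarrow> \<gamma> r \<in> U" using c(1) UV unfolding continuous_at_open by metis
   obtain S2 where S2: "open S2" "s \<in> S2" "\<And>r. r \<in> S2 \<Longrightarrow> \<gamma>' r \<in> V" using c(2) UV unfolding continuous_at_open by metis
   obtain e where e: "0 < e" "ball s e \<subseteq> S1 \<inter> S2" using openE[of "S1 \<inter> S2" s] S1 S2 by blast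
   obtain r where r: "r \<in> A" "\<bar>r - s\<bar> < e" using lim[OF e(1)] by blast
   have "r \<in> S1 \<inter> S2" using e(2) r(2) unfolding ball_real_abs[symmetric] by blast
   moreover have "\<gamma> r = \<gamma>' r" using r(1) by (force simp: A_def same_def)
   ultimately show False using S1(3) S2(3) UV(5) by force
  qed
  then have "\<gamma>' s \<in> chart_dom C" using gD(3)[of s] gD(2) by simp
  then obtain z' d' where 3: "geo_rep M C \<gamma>' z' s d'" by (rule geodesic_at_chart[OF g(2)[OF s] gD(1)])
  note gD' = geo_repD[OF 3]
  have zeq: "z r = z' r" if r: "r \<in> A" "\<bar>r - s\<bar> < min d d'" for r
  proof -
   obtain e where e: "0 < e" "\<And>q. \<bar>q - r\<bar> < e \<Longrightarrow> \<gamma> q = \<gamma>' q" using r(1) by (auto simp: A_def same_def)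
   have "((chart_map C \<circ> \<gamma>') has_vector_derivative snd (z r)) (at r)"
    by (rule has_vector_derivative_transform_within_open[OF geo_rep_velocity(1)[OF 1], of r "ball r e"])
      (use r e in \<open>auto simp: ball_real_abs simp del: mem_ball\<close>)
   then have "snd (z r) = snd (z' r)" using geo_rep_velocity(1)[OF 3, of r] r(2) vector_derivative_unique_at by fastforce
   moreover have "fst (z r) = fst (z' r)" using gD(4)[of r] gD'(4)[of r] r(2) e by simp
   ultimately show ?thesis by (simp add: prod_eq_iff)
  qed
  have cz: "continuous (at s) z" "continuous (at s) z'"
   using has_vector_derivative_continuous[OF gD(5)[of s]] has_vector_derivative_continuous[OF gD'(5)[of s]] gD(2) gD'(2) by auto
  have "z s = z' s"
  proof (rule ccontr)
   assume ne: "z s \<noteq> z' s"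
   define \<epsilon> where "\<epsilon> = dist (z s) (z' s) / 2"
   have "0 < \<epsilon>" using ne by (simp add: \<epsilon>_def)
   then obtain e1 e2 where e: "0 < e1" "0 < e2" "\<And>r. dist r s < e1 \<Longrightarrow> dist (z r) (z s) < \<epsilon>" "\<And>r. dist r s < e2 \<Longrightarrow> dist (z' r) (z' s) < \<epsilon>"
    using cz unfolding continuous_at_eps_delta by metis
   obtain r where r: "r \<in> A" "\<bar>r - s\<bar> < min (min d d') (min e1 e2)"
    using lim[of "min (min d d') (min e1 e2)"] e gD(2) gD'(2) by auto
   have "dist (z r) (z s) < \<epsilon>" "dist (z r) (z' s) < \<epsilon>" using e(3)[of r] e(4)[of r] r zeq[OF r(1)] by (auto simp: dist_real_def)
   then have "dist (z s) (z' s) < 2 * \<epsilon>" using dist_triangle[of "z s" "z' s" "z r"] by (simp add: dist_commute)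
   then show False by (simp add: \<epsilon>_def)
  qed
  then show ?thesis using local_same[OF s 1 3] by (simp add: A_def)
 qed
 define B where "B = {a<..<b} - A"
 have oB: "open B"
 proof (subst open_subopen, intro ballI)
  fix s assume s: "s \<in> B"
  then obtain e where e: "0 < e" "\<And>r. r \<in> A \<Longrightarrow> \<not> \<bar>r - s\<bar> < e" using closed unfolding B_def by blast
  have "ball s e \<inter> {a<..<b} \<subseteq> B" using e(2) unfolding B_def by (auto simp: ball_real_abs simp del: mem_ball)
  then show "\<exists>T. open T \<and> s \<in> T \<and> T \<subseteq> B" using s e(1) by (intro exI[of _ "ball s e \<inter> {a<..<b}"]) (auto simp: B_def)
 qed
 have "A \<inter> {a<..<b} = {} \<or> B \<inter> {a<..<b} = {}"
  by (rule connectedD[OF connected_Ioo oA oB]) (auto simp: B_def)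
 then have "t \<in> A" using t t0(1) \<open>same t0\<close> by (auto simp: A_def B_def)
 then show ?thesis by (force simp: A_def same_def)
qed

end

section \<open>Families of geodesics\<close>

text \<open>The time interval is common to all parameters, whereas the chart and the parameter
  neighbourhood of a local representation may change from time to time.\<close>

definition geo_family :: "('a::topological_space, 'n::finite) riemannian \<Rightarrow> 'a \<Rightarrow> ('p::real_normed_vector \<Rightarrow> real^'n) \<Rightarrow> 'p set \<Rightarrow> real \<Rightarrow> real \<Rightarrow> ('p \<Rightarrow> real \<Rightarrow> 'a) \<Rightarrow> bool" where
 "geo_family M q u N a b \<Gamma> \<longleftrightarrow> open N \<and> a < 0 \<and> 0 < b \<and>
   (\<forall>\<xi>\<in>N. \<Gamma> \<xi> 0 = q \<and> ((chart_map (chart_at M q) \<circ> \<Gamma> \<xi>) has_vector_derivative u \<xi>) (at 0)) \<and>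
   (\<forall>\<xi>\<in>N. \<forall>t\<in>{a<..<b}. \<exists>C Z W N' d. \<xi> \<in> N' \<and> N' \<subseteq> N \<and> geo_family_rep M C \<Gamma> Z W N' t d)"

lemma geo_family_repD:
 assumes "geo_family_rep M C \<Gamma> Z W N t d"
 shows "open N" "\<And>\<xi>. \<xi> \<in> N \<Longrightarrow> geo_rep M C (\<Gamma> \<xi>) (Z \<xi>) t d"
  "\<And>\<xi> s. \<xi> \<in> N \<Longrightarrow> \<bar>s - t\<bar> < d \<Longrightarrow> ((\<lambda>\<xi>. Z \<xi> s) has_derivative blinfun_apply (W \<xi> s)) (at \<xi>)"
  "\<And>\<xi> s w. \<xi> \<in> N \<Longrightarrow> \<bar>s - t\<bar> < d \<Longrightarrow> ((\<lambda>s. W \<xi> s w) has_vector_derivative geo_field' M C (Z \<xi> s) (W \<xi> s w)) (at s)"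
  "\<And>s. \<bar>s - t\<bar> < d \<Longrightarrow> continuous_on N (\<lambda>\<xi>. W \<xi> s)"
 using assms unfolding geo_family_rep_def by auto

lemma geo_familyD:
 assumes "geo_family M q u N a b \<Gamma>"
 shows "open N" "a < 0" "0 < b" "\<And>\<xi>. \<xi> \<in> N \<Longrightarrow> \<Gamma> \<xi> 0 = q"
  "\<And>\<xi>. \<xi> \<in> N \<Longrightarrow> ((chart_map (chart_at M q) \<circ> \<Gamma> \<xi>) has_vector_derivative u \<xi>) (at 0)"
  "\<And>\<xi> t. \<xi> \<in> N \<Longrightarrow> t \<in> {a<..<b} \<Longrightarrow> \<exists>C Z W N' d. \<xi> \<in> N' \<and> N' \<subseteq> N \<and> geo_family_rep M C \<Gamma> Z W N' t d"
 using assms unfolding geo_family_def by blast+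

lemma geo_family_rep_restrict:
 assumes "geo_family_rep M C \<Gamma> Z W N t d" "open N'" "N' \<subseteq> N" "0 < d'" "d' \<le> d"
  "\<And>\<xi> s. \<xi> \<in> N' \<Longrightarrow> \<bar>s - t\<bar> < d' \<Longrightarrow> \<Gamma>' \<xi> s = \<Gamma> \<xi> s"
 shows "geo_family_rep M C \<Gamma>' Z W N' t d'"
 unfolding geo_family_rep_def
proof (intro conjI ballI allI impI)
 fix \<xi> assume \<xi>: "\<xi> \<in> N'"
 have "geo_rep M C (\<Gamma> \<xi>) (Z \<xi>) t d'"
  by (rule geo_rep_sub[OF geo_family_repD(2)[OF assms(1)]]) (use \<xi> assms in auto)
 then show "geo_rep M C (\<Gamma>' \<xi>) (Z \<xi>) t d'" by (rule geo_rep_cong) (use \<xi> assms(6) in auto)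
 fix s assume s: "\<bar>s - t\<bar> < d'"
 show "((\<lambda>\<xi>. Z \<xi> s) has_derivative blinfun_apply (W \<xi> s)) (at \<xi>)"
  by (rule geo_family_repD(3)[OF assms(1)]) (use s \<xi> assms in auto)
 show "((\<lambda>s. W \<xi> s w) has_vector_derivative geo_field' M C (Z \<xi> s) (W \<xi> s w)) (at s)" for w
  by (rule geo_family_repD(4)[OF assms(1)]) (use s \<xi> assms in auto)
next
 fix s assume s: "\<bar>s - t\<bar> < d'"
 show "continuous_on N' (\<lambda>\<xi>. W \<xi> s)"
  by (rule continuous_on_subset[OF geo_family_repD(5)[OF assms(1)] assms(3)]) (use s assms in auto)
qed (rule assms)

lemma geo_family_geodesic:
 assumes "geo_family M q u N a b \<Gamma>" "\<xi> \<in> N" "t \<in> {a<..<b}"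
 shows "geodesic_at M (\<Gamma> \<xi>) t"
 using geo_familyD(6)[OF assms] geo_family_repD(2) unfolding geodesic_at_def by blast

context riemannian_mfd
begin

text \<open>One flow box around \<open>z0\<close>, whose time \<open>e\<close> serves for every
  differentiable family of initial states in the box and every starting time \<open>t1\<close>. This
  uniformity is what carries geodesics past a limit time in
  \<open>geo_family_exists\<close>.\<close>

lemma geodesic_flow:
 assumes C: "C \<in> atlas M" and z0: "z0 \<in> chart_img C \<times> UNIV"
 obtains r e \<Phi> where "0 < r" "0 < e" "\<And>z. z \<in> ball z0 r \<Longrightarrow> \<Phi> z 0 = z"
  "\<And>N (\<zeta> :: 'p::real_normed_vector \<Rightarrow> (real^'n) \<times> (real^'n)) \<zeta>' t1 t. \<lbrakk>open N; \<And>\<xi>. \<xi> \<in> N \<Longrightarrow> \<zeta> \<xi> \<in> ball z0 r;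
    \<And>\<xi>. \<xi> \<in> N \<Longrightarrow> (\<zeta> has_derivative blinfun_apply (\<zeta>' \<xi>)) (at \<xi>); continuous_on N \<zeta>'; \<bar>t - t1\<bar> < e\<rbrakk>
   \<Longrightarrow> \<exists>W. geo_family_rep M C (\<lambda>\<xi> t. chart_inv C (fst (\<Phi> (\<zeta> \<xi>) (t - t1)))) (\<lambda>\<xi> t. \<Phi> (\<zeta> \<xi>) (t - t1)) W N t (e - \<bar>t - t1\<bar>)"
proof -
 obtain F' where F: "\<And>z. z \<in> chart_img C \<times> UNIV \<Longrightarrow> (geo_field M C has_derivative blinfun_apply (F' z)) (at z)"
  "continuous_on (chart_img C \<times> UNIV) F'" "\<And>z h. z \<in> chart_img C \<times> UNIV \<Longrightarrow> blinfun_apply (F' z) h = geo_field' M C z h"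
  using geo_field_C1[OF C] by metis
 have o: "open (chart_img C \<times> (UNIV :: (real^'n) set))" by (intro open_Times chartD(2)[OF C]) auto
 obtain r e \<Phi> W where re: "0 < r" "0 < e"
  and \<Phi>: "\<And>z t. z \<in> ball z0 r \<Longrightarrow> \<bar>t\<bar> < e \<Longrightarrow> \<Phi> z t \<in> chart_img C \<times> UNIV"
  "\<And>z. z \<in> ball z0 r \<Longrightarrow> \<Phi> z 0 = z"
  "\<And>z t. z \<in> ball z0 r \<Longrightarrow> \<bar>t\<bar> < e \<Longrightarrow> (\<Phi> z has_vector_derivative geo_field M C (\<Phi> z t)) (at t)"
  "\<And>z t. z \<in> ball z0 r \<Longrightarrow> \<bar>t\<bar> < e \<Longrightarrow> ((\<lambda>z. \<Phi> z t) has_derivative blinfun_apply (W z t)) (at z)"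
  "\<And>z t. z \<in> ball z0 r \<Longrightarrow> \<bar>t\<bar> < e \<Longrightarrow> (W z has_vector_derivative F' (\<Phi> z t) o\<^sub>L W z t) (at t)"
  "continuous_on UNIV (\<lambda>(z,t). \<Phi> z t)" "continuous_on UNIV (\<lambda>(z,t). W z t)"
  proof -
  show ?thesis by (rule local_flow[OF o z0 F(1,2)]) (assumption | fact that)+
 qed
 show ?thesis
 proof (rule that[OF re, of \<Phi>])
  fix N and \<zeta> :: "'p \<Rightarrow> (real^'n) \<times> (real^'n)" and \<zeta>' t1 t
  assume N: "open N" and \<zeta>: "\<And>\<xi>. \<xi> \<in> N \<Longrightarrow> \<zeta> \<xi> \<in> ball z0 r"
    "\<And>\<xi>. \<xi> \<in> N \<Longrightarrow> (\<zeta> has_derivative blinfun_apply (\<zeta>' \<xi>)) (at \<xi>)" "continuous_on N \<zeta>'" and t: "\<bar>t - t1\<bar> < e"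
  have near: "\<bar>s - t1\<bar> < e" if "\<bar>s - t\<bar> < e - \<bar>t - t1\<bar>" for s using that by linarith
  have c\<zeta>: "continuous_on N \<zeta>"
   by (rule continuous_at_imp_continuous_on) (use has_derivative_continuous[OF \<zeta>(2)] in auto)
  have shift: "((\<lambda>s. g (s - t1)) has_vector_derivative g') (at s)" if "(g has_vector_derivative g') (at (s - t1))"
   for g :: "real \<Rightarrow> 'z::real_normed_vector" and g' s
  proof -
   have "((\<lambda>s. s - t1) has_vector_derivative 1) (at s)" by (auto intro!: derivative_eq_intros simp: has_real_derivative_iff_has_vector_derivative[symmetric])
   from vector_diff_chain_at[OF this that] show ?thesis by (simp add: o_def)
  qed
  define W' where "W' \<xi> s = W (\<zeta> \<xi>) (s - t1) o\<^sub>L \<zeta>' \<xi>" for \<xi> s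
  have "geo_family_rep M C (\<lambda>\<xi> t. chart_inv C (fst (\<Phi> (\<zeta> \<xi>) (t - t1)))) (\<lambda>\<xi> t. \<Phi> (\<zeta> \<xi>) (t - t1)) W' N t (e - \<bar>t - t1\<bar>)"
   unfolding geo_family_rep_def geo_rep_def
  proof (intro conjI ballI allI impI N C)
   show "0 < e - \<bar>t - t1\<bar>" using t by simp
   fix \<xi> s assume \<xi>: "\<xi> \<in> N" and s: "\<bar>s - t\<bar> < e - \<bar>t - t1\<bar>"
   have im: "fst (\<Phi> (\<zeta> \<xi>) (s - t1)) \<in> chart_img C" using \<Phi>(1)[OF \<zeta>(1)[OF \<xi>] near[OF s]] by (simp add: mem_Times_iff)
   show "chart_inv C (fst (\<Phi> (\<zeta> \<xi>) (s - t1))) \<in> chart_dom C" by (rule chartD(7)[OF C im])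
   show "fst (\<Phi> (\<zeta> \<xi>) (s - t1)) = chart_map C (chart_inv C (fst (\<Phi> (\<zeta> \<xi>) (s - t1))))" using chartD(6)[OF C im] by simp
   show "((\<lambda>t. \<Phi> (\<zeta> \<xi>) (t - t1)) has_vector_derivative geo_field M C (\<Phi> (\<zeta> \<xi>) (s - t1))) (at s)"
    by (rule shift[OF \<Phi>(3)[OF \<zeta>(1)[OF \<xi>] near[OF s]]])
   show "((\<lambda>\<xi>. \<Phi> (\<zeta> \<xi>) (s - t1)) has_derivative blinfun_apply (W' \<xi> s)) (at \<xi>)"
    using has_derivative_compose[OF \<zeta>(2)[OF \<xi>] \<Phi>(4)[OF \<zeta>(1)[OF \<xi>] near[OF s]]] by (simp add: W'_def blinfun_compose.rep_eq o_def)
   show "((\<lambda>s. W' \<xi> s w) has_vector_derivative geo_field' M C (\<Phi> (\<zeta> \<xi>) (s - t1)) (W' \<xi> s w)) (at s)" for w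
   proof -
    have "((\<lambda>s. W (\<zeta> \<xi>) (s - t1)) has_vector_derivative F' (\<Phi> (\<zeta> \<xi>) (s - t1)) o\<^sub>L W (\<zeta> \<xi>) (s - t1)) (at s)"
     by (rule shift[OF \<Phi>(5)[OF \<zeta>(1)[OF \<xi>] near[OF s]]])
    from bounded_linear.has_vector_derivative[OF bounded_bilinear.bounded_linear_left[OF bounded_bilinear_blinfun_apply] this, of "\<zeta>' \<xi> w"]
    show ?thesis using F(3)[OF \<Phi>(1)[OF \<zeta>(1)[OF \<xi>] near[OF s]]] by (simp add: W'_def)
   qed
  next
   fix s assume s: "\<bar>s - t\<bar> < e - \<bar>t - t1\<bar>"
   have "continuous_on N (\<lambda>\<xi>. W (\<zeta> \<xi>) (s - t1))"
    using continuous_on_compose2[OF \<Phi>(7) continuous_on_Pair[OF c\<zeta> continuous_on_const[of N "s - t1"]]] by simp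
   then show "continuous_on N (\<lambda>\<xi>. W' \<xi> s)" unfolding W'_def
    by (intro bounded_bilinear.continuous_on[OF bounded_bilinear_blinfun_compose] \<zeta>(3))
  qed
  then show "\<exists>W. geo_family_rep M C (\<lambda>\<xi> t. chart_inv C (fst (\<Phi> (\<zeta> \<xi>) (t - t1)))) (\<lambda>\<xi> t. \<Phi> (\<zeta> \<xi>) (t - t1)) W N t (e - \<bar>t - t1\<bar>)" by blast
 qed (rule \<Phi>(2))
qed

lemma geo_family_start:
 fixes u :: "'p::euclidean_space \<Rightarrow> real^'n"
 assumes u: "bounded_linear u"
 obtains N a b \<Gamma> where "\<theta> \<in> N" "geo_family M q u N a b \<Gamma>"
proof -
 let ?C = "chart_at M q" let ?x = "chart_map ?C q"
 have x: "?x \<in> chart_img ?C" by (rule chartD(8)[OF chart_at])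
 have z0: "(?x, u \<theta>) \<in> chart_img ?C \<times> UNIV" using x by simp
 obtain r e \<Phi> where re: "0 < r" "0 < e" and \<Phi>0: "\<And>z. z \<in> ball (?x, u \<theta>) r \<Longrightarrow> \<Phi> z 0 = z"
  and \<Phi>: "\<And>N (\<zeta> :: 'p \<Rightarrow> (real^'n) \<times> (real^'n)) \<zeta>' t1 t. \<lbrakk>open N; \<And>\<xi>. \<xi> \<in> N \<Longrightarrow> \<zeta> \<xi> \<in> ball (?x, u \<theta>) r;
    \<And>\<xi>. \<xi> \<in> N \<Longrightarrow> (\<zeta> has_derivative blinfun_apply (\<zeta>' \<xi>)) (at \<xi>); continuous_on N \<zeta>'; \<bar>t - t1\<bar> < e\<rbrakk>
   \<Longrightarrow> \<exists>W. geo_family_rep M ?C (\<lambda>\<xi> t. chart_inv ?C (fst (\<Phi> (\<zeta> \<xi>) (t - t1)))) (\<lambda>\<xi> t. \<Phi> (\<zeta> \<xi>) (t - t1)) W N t (e - \<bar>t - t1\<bar>)"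
  by (fact geodesic_flow[OF chart_at(1) z0, where ?'p='p])
 let ?\<zeta> = "\<lambda>\<xi>. (?x, u \<xi>)"
 have cu: "continuous_on UNIV ?\<zeta>" by (intro continuous_intros bounded_linear.continuous_on[OF u])
 define N where "N = ?\<zeta> -` ball (?x, u \<theta>) r"
 have N: "open N" unfolding N_def by (rule open_vimage[OF open_ball cu])
 have "bounded_linear (\<lambda>h. (0 :: real^'n, u h))" by (intro bounded_linear_Pair bounded_linear_zero u)
 then have app: "blinfun_apply (Blinfun (\<lambda>h. (0 :: real^'n, u h))) = (\<lambda>h. (0, u h))" by (rule bounded_linear_Blinfun_apply)
 have d\<zeta>: "(?\<zeta> has_derivative blinfun_apply (Blinfun (\<lambda>h. (0, u h)))) (at \<xi>)" for \<xi>
  unfolding app by (intro has_derivative_Pair has_derivative_const bounded_linear.has_derivative[OF u] has_derivative_ident)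
 define \<Gamma> where "\<Gamma> \<xi> t = chart_inv ?C (fst (\<Phi> (?\<zeta> \<xi>) (t - 0)))" for \<xi> t
 have rep: "\<exists>W. geo_family_rep M ?C \<Gamma> (\<lambda>\<xi> t. \<Phi> (?\<zeta> \<xi>) (t - 0)) W N t (e - \<bar>t - 0\<bar>)" if "\<bar>t\<bar> < e" for t
  unfolding \<Gamma>_def[abs_def] by (rule \<Phi>[OF N _ d\<zeta>]) (use that in \<open>auto simp: N_def\<close>)
 have "geo_family M q u N (- e) e \<Gamma>" unfolding geo_family_def
 proof (intro conjI ballI)
  fix \<xi> assume \<xi>: "\<xi> \<in> N"
  then have 0: "\<Phi> (?\<zeta> \<xi>) 0 = (?x, u \<xi>)" by (intro \<Phi>0) (auto simp: N_def)
  show "\<Gamma> \<xi> 0 = q" using 0 chartD(5)[OF chart_at] by (simp add: \<Gamma>_def)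
  obtain W where W: "geo_family_rep M ?C \<Gamma> (\<lambda>\<xi> t. \<Phi> (?\<zeta> \<xi>) (t - 0)) W N 0 (e - \<bar>0 - 0\<bar>)" using rep[of 0] re by auto
  show "((chart_map ?C \<circ> \<Gamma> \<xi>) has_vector_derivative u \<xi>) (at 0)"
   using geo_rep_velocity(1)[OF geo_family_repD(2)[OF W \<xi>], of 0] re 0 by simp
  show "\<exists>C Z W N' d. \<xi> \<in> N' \<and> N' \<subseteq> N \<and> geo_family_rep M C \<Gamma> Z W N' t d" if "t \<in> {-e<..<e}" for t
  proof -
   have "\<bar>t\<bar> < e" using that by auto
   then obtain W where "geo_family_rep M ?C \<Gamma> (\<lambda>\<xi> t. \<Phi> (?\<zeta> \<xi>) (t - 0)) W N t (e - \<bar>t - 0\<bar>)" using rep by blast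
   then show ?thesis using \<xi> by (intro exI conjI) auto
  qed
 qed (use N re in auto)
 moreover have "\<theta> \<in> N" using re by (simp add: N_def)
 ultimately show ?thesis using that by blast
qed

text \<open>Only the state at a single time is moved to another chart: transforming the linearized equation
 as well would need third derivatives of the change of coordinates.\<close>
lemma geo_family_state:
 fixes \<Gamma> :: "'p::euclidean_space \<Rightarrow> real \<Rightarrow> 'a"
 assumes rep: "geo_family_rep M C \<Gamma> Z W N t d" and \<theta>: "\<theta> \<in> N" and D: "D \<in> atlas M" "\<Gamma> \<theta> t \<in> chart_dom D"
 obtains N' \<zeta> \<zeta>' where "open N'" "\<theta> \<in> N'" "N' \<subseteq> N" "\<And>\<xi>. \<xi> \<in> N' \<Longrightarrow> \<Gamma> \<xi> t \<in> chart_dom D \<and> fst (\<zeta> \<xi>) = chart_map D (\<Gamma> \<xi> t)"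
  "\<And>\<xi>. \<xi> \<in> N' \<Longrightarrow> ((chart_map D \<circ> \<Gamma> \<xi>) has_vector_derivative snd (\<zeta> \<xi>)) (at t)"
  "\<And>\<xi>. \<xi> \<in> N' \<Longrightarrow> (\<zeta> has_derivative blinfun_apply (\<zeta>' \<xi>)) (at \<xi>)" "continuous_on N' \<zeta>'"
proof -
 note R = geo_family_repD[OF rep]
 have C: "C \<in> atlas M" and d: "0 < d" using geo_repD(1,2)[OF R(2)[OF \<theta>]] by auto
 then have t0: "\<bar>t - t\<bar> < d" by simp
 let ?W = "chart_map C ` (chart_dom C \<inter> chart_dom D)"
 let ?\<phi> = "transition C D" let ?D = "\<lambda>y. frechet_derivative ?\<phi> (at y)"
 have W: "open ?W" by (rule open_overlap[OF C D(1)])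
 have cZ: "continuous_on N (\<lambda>\<xi>. Z \<xi> t)"
  by (rule continuous_at_imp_continuous_on) (use has_derivative_continuous[OF R(3)[OF _ t0]] in auto)
 define N' where "N' = N \<inter> (\<lambda>\<xi>. fst (Z \<xi> t)) -` ?W"
 have N': "open N'" unfolding N'_def by (rule continuous_open_preimage[OF continuous_on_fst[OF cZ] R(1) W])
 have \<theta>': "\<theta> \<in> N'" using \<theta> geo_repD(3,4)[OF R(2)[OF \<theta>] t0] D(2) by (auto simp: N'_def)
 have Zdom: "\<Gamma> \<xi> t \<in> chart_dom C" "fst (Z \<xi> t) = chart_map C (\<Gamma> \<xi> t)" if "\<xi> \<in> N'" for \<xi>
  using geo_repD(3,4)[OF R(2) t0] that by (auto simp: N'_def)
 have domD: "\<Gamma> \<xi> t \<in> chart_dom D" if \<xi>: "\<xi> \<in> N'" for \<xi>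
 proof -
  obtain p where "fst (Z \<xi> t) = chart_map C p" "p \<in> chart_dom C" "p \<in> chart_dom D" using \<xi> by (auto simp: N'_def)
  then show ?thesis using Zdom[OF \<xi>] chartD(5)[OF C] by metis
 qed
 define T where "T z = (?\<phi> (fst z), ?D (fst z) (snd z))" for z
 define T' where "T' z h = (?D (fst z) (fst h), d2_transition C D (fst z) (fst h) (snd z) + ?D (fst z) (snd h))" for z h
 have C2: "Ck_on 2 ?W ?\<phi>" by (rule transition_smooth[OF C D(1)])
 have pd: "?\<phi> differentiable at y" "partial_deriv j ?\<phi> differentiable at y" if "y \<in> ?W" for j y
  using C2 that unfolding numeral_2_eq_2 Ck_on.simps by blast+
 have dT: "(T has_derivative T' z) (at z)" if z: "fst z \<in> ?W" for z
 proof -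
  have 1: "((\<lambda>z. ?\<phi> (fst z)) has_derivative (\<lambda>h. ?D (fst z) (fst h))) (at z)"
   by (rule has_derivative_compose[OF has_derivative_fst[OF has_derivative_ident] transition_has_derivative[OF C D(1) z]])
  have "((\<lambda>z. \<Sum>j\<in>UNIV. snd z $ j *\<^sub>R partial_deriv j ?\<phi> (fst z)) has_derivative
    (\<lambda>h. \<Sum>j\<in>UNIV. snd z $ j *\<^sub>R (\<Sum>i\<in>UNIV. fst h $ i *\<^sub>R partial_deriv i (partial_deriv j ?\<phi>) (fst z)) + snd h $ j *\<^sub>R partial_deriv j ?\<phi> (fst z))) (at z)"
   by (intro has_derivative_sum has_derivative_scaleR bounded_linear.has_derivative[OF bounded_linear_vec_nth] has_derivative_snd[OF has_derivative_ident]
      has_derivative_compose[OF has_derivative_fst[OF has_derivative_ident] has_derivative_partial] pd z)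
  moreover have "(\<Sum>j\<in>UNIV. snd z $ j *\<^sub>R (\<Sum>i\<in>UNIV. fst h $ i *\<^sub>R partial_deriv i (partial_deriv j ?\<phi>) (fst z)) + snd h $ j *\<^sub>R partial_deriv j ?\<phi> (fst z))
    = d2_transition C D (fst z) (fst h) (snd z) + ?D (fst z) (snd h)" for h
  proof -
   have "?D (fst z) (snd h) = (\<Sum>j\<in>UNIV. snd h $ j *\<^sub>R partial_deriv j ?\<phi> (fst z))"
    by (rule frechet_derivative_partial[OF pd(1)[OF z]])
   moreover have "d2_transition C D (fst z) (fst h) (snd z) = (\<Sum>j\<in>UNIV. \<Sum>i\<in>UNIV. (fst h $ i * snd z $ j) *\<^sub>R partial_deriv i (partial_deriv j ?\<phi>) (fst z))"
    unfolding d2_transition_def by (rule sum.swap)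
   ultimately show ?thesis by (simp add: sum.distrib scaleR_sum_right mult_ac)
  qed
  ultimately have 2: "((\<lambda>z. \<Sum>j\<in>UNIV. snd z $ j *\<^sub>R partial_deriv j ?\<phi> (fst z)) has_derivative (\<lambda>h. d2_transition C D (fst z) (fst h) (snd z) + ?D (fst z) (snd h))) (at z)"
   by simp
  have "open (fst -` ?W :: ((real^'n) \<times> (real^'n)) set)" by (rule open_vimage[OF W]) (intro continuous_intros)
  from has_derivative_transform_within_open[OF 2 this]
  have 3: "((\<lambda>z. ?D (fst z) (snd z)) has_derivative (\<lambda>h. d2_transition C D (fst z) (fst h) (snd z) + ?D (fst z) (snd h))) (at z)"
   using z frechet_derivative_partial[OF pd(1)] by simp
  show ?thesis using has_derivative_Pair[OF 1 3] unfolding T_def[abs_def] T'_def[abs_def] .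
 qed
 define \<zeta>' where "\<zeta>' \<xi> = Blinfun (T' (Z \<xi> t)) o\<^sub>L W \<xi> t" for \<xi>
 have app: "blinfun_apply (Blinfun (T' z)) = T' z" if "fst z \<in> ?W" for z
  by (rule bounded_linear_Blinfun_apply[OF has_derivative_bounded_linear[OF dT[OF that]]])
 have c1: "continuous_on N' (\<lambda>\<xi>. Blinfun (T' (Z \<xi> t)))"
 proof (rule continuous_on_blinfun_componentwise)
  fix b :: "(real^'n) \<times> (real^'n)"
  have cZ': "continuous_on N' (\<lambda>\<xi>. Z \<xi> t)" by (rule continuous_on_subset[OF cZ]) (auto simp: N'_def)
  have cW: "continuous_on ?W (partial_deriv i (partial_deriv j ?\<phi>))" for i j using C2 by (simp add: numeral_2_eq_2)
  have "continuous_on N' (\<lambda>\<xi>. partial_deriv i (partial_deriv j ?\<phi>) (fst (Z \<xi> t)))" for i j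
   by (rule continuous_on_compose2[OF cW continuous_on_fst[OF cZ']]) (auto simp: N'_def)
  then have 1: "continuous_on N' (\<lambda>\<xi>. d2_transition C D (fst (Z \<xi> t)) (fst b) (snd (Z \<xi> t)))"
   unfolding d2_transition_def by (intro continuous_intros cZ')
  have 2: "continuous_on N' (\<lambda>\<xi>. ?D (fst (Z \<xi> t)) k)" for k
   by (rule frechet_transition_continuous[OF C D(1) continuous_on_fst[OF cZ'] continuous_on_const]) (auto simp: N'_def)
  have "continuous_on N' (\<lambda>\<xi>. T' (Z \<xi> t) b)" unfolding T'_def
   by (intro continuous_on_Pair continuous_on_add 1 2)
  then show "continuous_on N' (\<lambda>\<xi>. blinfun_apply (Blinfun (T' (Z \<xi> t))) b)"
   by (rule continuous_on_eq) (simp add: app N'_def)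
 qed
 show ?thesis
 proof (rule that[OF N' \<theta>', of "\<lambda>\<xi>. T (Z \<xi> t)" \<zeta>'])
  show "N' \<subseteq> N" by (auto simp: N'_def)
  fix \<xi> assume \<xi>: "\<xi> \<in> N'"
  then have \<xi>N: "\<xi> \<in> N" and xW: "fst (Z \<xi> t) \<in> ?W" by (auto simp: N'_def)
  note g = R(2)[OF \<xi>N]
  show "\<Gamma> \<xi> t \<in> chart_dom D \<and> fst (T (Z \<xi> t)) = chart_map D (\<Gamma> \<xi> t)"
   using domD[OF \<xi>] Zdom[OF \<xi>] transition_map[OF C, of "\<Gamma> \<xi> t" D] by (simp add: T_def)
  have lin: "linear (?D (chart_map C (\<Gamma> \<xi> t)))"
   by (rule has_derivative_linear[OF transition_has_derivative[OF C D(1)]]) (use domD[OF \<xi>] Zdom[OF \<xi>] in auto)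
  have "(chart_map C \<circ> \<Gamma> \<xi> has_derivative (\<lambda>h. h *\<^sub>R snd (Z \<xi> t))) (at t)"
   using geo_rep_velocity(1)[OF g t0] by (simp add: has_vector_derivative_def)
  from has_derivative_chart_change(1)[OF C Zdom(1)[OF \<xi>] D(1) domD[OF \<xi>] geo_rep_velocity(2)[OF g t0] this]
  show "((chart_map D \<circ> \<Gamma> \<xi>) has_vector_derivative snd (T (Z \<xi> t))) (at t)"
   unfolding has_vector_derivative_def linear_cmul[OF lin] by (simp add: T_def Zdom[OF \<xi>])
  show "((\<lambda>\<xi>. T (Z \<xi> t)) has_derivative blinfun_apply (\<zeta>' \<xi>)) (at \<xi>)"
   using has_derivative_compose[OF R(3)[OF \<xi>N t0] dT[OF xW]] by (simp add: \<zeta>'_def blinfun_compose.rep_eq o_def app[OF xW])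
 next
  show "continuous_on N' \<zeta>'" unfolding \<zeta>'_def
   by (intro bounded_bilinear.continuous_on[OF bounded_bilinear_blinfun_compose] c1 continuous_on_subset[OF R(5)[OF t0]]) (auto simp: N'_def)
 qed
qed

lemma geo_family_unique:
 assumes 1: "geo_family M q u N a b \<Gamma>" "\<xi> \<in> N" "t \<in> {a<..<b}" and 2: "geo_family M q u N' a' b' \<Gamma>'" "\<xi> \<in> N'" "t \<in> {a'<..<b'}"
 shows "\<Gamma> \<xi> t = \<Gamma>' \<xi> t"
proof (rule geodesic_unique[of "max a a'" "min b b'" "\<Gamma> \<xi>" "\<Gamma>' \<xi>" 0 "chart_at M q" "u \<xi>"])
 note F = geo_familyD[OF 1(1)] and F' = geo_familyD[OF 2(1)]
 show "geodesic_at M (\<Gamma> \<xi>) s" if "s \<in> {max a a'<..<min b b'}" for s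
  by (rule geo_family_geodesic[OF 1(1,2)]) (use that in auto)
 show "geodesic_at M (\<Gamma>' \<xi>) s" if "s \<in> {max a a'<..<min b b'}" for s
  by (rule geo_family_geodesic[OF 2(1,2)]) (use that in auto)
 show "\<Gamma> \<xi> 0 = \<Gamma>' \<xi> 0" "\<Gamma> \<xi> 0 \<in> chart_dom (chart_at M q)"
  using F(4)[OF 1(2)] F'(4)[OF 2(2)] chart_at by auto
 show "0 \<in> {max a a'<..<min b b'}" using F(2,3) F'(2,3) by auto
 show "t \<in> {max a a'<..<min b b'}" using 1(3) 2(3) by auto
qed (rule chart_at geo_familyD(5)[OF 1(1,2)] geo_familyD(5)[OF 2(1,2)])+

lemma geo_family_speed:
 assumes f: "geo_family M q u N a b \<Gamma>" "\<xi> \<in> N" "t \<in> {a<..<b}"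
 shows "speed M (\<Gamma> \<xi>) t = sqrt (ginner M (chart_at M q) (chart_map (chart_at M q) q) (u \<xi>) (u \<xi>))"
proof -
 note F = geo_familyD[OF f(1)]
 have 0: "0 \<in> {a<..<b}" using F by auto
 have "speed M (\<Gamma> \<xi>) t = speed M (\<Gamma> \<xi>) 0"
  by (rule geodesic_speed_constant[OF geo_family_geodesic[OF f(1,2)] f(3) 0])
 also have "\<dots> = sqrt (ginner M (chart_at M q) (chart_map (chart_at M q) (\<Gamma> \<xi> 0)) (u \<xi>) (u \<xi>))"
 proof (rule speed_chart[OF chart_at(1)])
  obtain C z d where g: "geo_rep M C (\<Gamma> \<xi>) z 0 d" using geo_family_geodesic[OF f(1,2) 0] unfolding geodesic_at_def by blast
  then show "continuous (at 0) (\<Gamma> \<xi>)" using geo_rep_velocity(2)[OF g, of 0] geo_repD(2)[OF g] by simp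
 qed (use F(4,5)[OF f(2)] chart_at in auto)
 finally show ?thesis using F(4)[OF f(2)] by simp
qed

text \<open>The old family is kept before \<open>t1\<close> and replaced by the flow restarted at
  \<open>t1\<close> from then on. By uniqueness the two agree on a whole neighbourhood of
  \<open>t1\<close>, so the glued family is again a family of geodesics there.\<close>

lemma geo_family_extend:
 fixes u :: "'p::euclidean_space \<Rightarrow> real^'n"
 assumes f: "geo_family M q u N a b \<Gamma>" and t1: "t1 \<in> {0<..<b}" and N1: "open N1" "\<theta> \<in> N1" "N1 \<subseteq> N"
  and C: "C \<in> atlas M" and \<zeta>: "\<And>\<xi>. \<xi> \<in> N1 \<Longrightarrow> \<Gamma> \<xi> t1 \<in> chart_dom C \<and> fst (\<zeta> \<xi>) = chart_map C (\<Gamma> \<xi> t1)"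
  "\<And>\<xi>. \<xi> \<in> N1 \<Longrightarrow> ((chart_map C \<circ> \<Gamma> \<xi>) has_vector_derivative snd (\<zeta> \<xi>)) (at t1)"
  and e: "0 < e" and \<Phi>0: "\<And>\<xi>. \<xi> \<in> N1 \<Longrightarrow> \<Phi> (\<zeta> \<xi>) 0 = \<zeta> \<xi>"
  and \<Phi>: "\<And>t. \<bar>t - t1\<bar> < e \<Longrightarrow> \<exists>W. geo_family_rep M C (\<lambda>\<xi> t. chart_inv C (fst (\<Phi> (\<zeta> \<xi>) (t - t1)))) (\<lambda>\<xi> t. \<Phi> (\<zeta> \<xi>) (t - t1)) W N1 t (e - \<bar>t - t1\<bar>)"
 obtains \<Gamma>' where "geo_family M q u N1 a (t1 + e) \<Gamma>'"
proof -
 note F = geo_familyD[OF f]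
 define G where "G \<xi> t = chart_inv C (fst (\<Phi> (\<zeta> \<xi>) (t - t1)))" for \<xi> t
 \<comment> \<open>Within \<open>\<delta>\<close> of \<open>t1\<close> both families are defined and
   the times are positive.\<close>
 define \<delta> where "\<delta> = min e (min t1 (b - t1))"
 have \<delta>: "0 < \<delta>" "\<delta> \<le> e" "\<delta> \<le> t1" "\<delta> \<le> b - t1" using e t1 by (auto simp: \<delta>_def)
 define \<Gamma>' where "\<Gamma>' \<xi> t = (if t < t1 then \<Gamma> \<xi> t else G \<xi> t)" for \<xi> t
 have gG: "geodesic_at M (G \<xi>) t" if \<xi>: "\<xi> \<in> N1" and te: "\<bar>t - t1\<bar> < e" for \<xi> t
 proof -
  obtain W where "geo_family_rep M C G (\<lambda>\<xi> t. \<Phi> (\<zeta> \<xi>) (t - t1)) W N1 t (e - \<bar>t - t1\<bar>)"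
   using \<Phi>[OF te] unfolding G_def[abs_def] by blast
  from geo_family_repD(2)[OF this \<xi>] show ?thesis unfolding geodesic_at_def by blast
 qed
 have eq: "\<Gamma> \<xi> s = G \<xi> s" if \<xi>: "\<xi> \<in> N1" and s: "s \<in> {t1 - \<delta><..<t1 + \<delta>}" for \<xi> s
 proof (rule geodesic_unique[of "t1 - \<delta>" "t1 + \<delta>" "\<Gamma> \<xi>" "G \<xi>" t1 C "snd (\<zeta> \<xi>)"])
  have \<xi>N: "\<xi> \<in> N" using \<xi> N1 by blast
  show "geodesic_at M (\<Gamma> \<xi>) t" if "t \<in> {t1 - \<delta><..<t1 + \<delta>}" for t
   by (rule geo_family_geodesic[OF f \<xi>N]) (use that \<delta> F(2) in auto)
  show "geodesic_at M (G \<xi>) t" if "t \<in> {t1 - \<delta><..<t1 + \<delta>}" for t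
   by (rule gG[OF \<xi>]) (use that \<delta> in auto)
  show "\<Gamma> \<xi> t1 = G \<xi> t1" using \<Phi>0[OF \<xi>] \<zeta>(1)[OF \<xi>] chartD(5)[OF C] by (simp add: G_def)
  show "((chart_map C \<circ> \<Gamma> \<xi>) has_vector_derivative snd (\<zeta> \<xi>)) (at t1)" by (rule \<zeta>(2)[OF \<xi>])
  obtain W where "geo_family_rep M C G (\<lambda>\<xi> t. \<Phi> (\<zeta> \<xi>) (t - t1)) W N1 t1 (e - \<bar>t1 - t1\<bar>)"
   using \<Phi>[of t1] e unfolding G_def[abs_def] by auto
  from geo_rep_velocity(1)[OF geo_family_repD(2)[OF this \<xi>], of t1]
  show "((chart_map C \<circ> G \<xi>) has_vector_derivative snd (\<zeta> \<xi>)) (at t1)" using e \<Phi>0[OF \<xi>] by simp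
 qed (use s \<delta> C \<zeta>(1)[OF \<xi>] in auto)
 have "geo_family M q u N1 a (t1 + e) \<Gamma>'" unfolding geo_family_def
 proof (intro conjI ballI)
  fix \<xi> assume \<xi>: "\<xi> \<in> N1"
  then have \<xi>N: "\<xi> \<in> N" using N1 by blast
  show "\<Gamma>' \<xi> 0 = q" using t1 F(4)[OF \<xi>N] by (simp add: \<Gamma>'_def)
  show "((chart_map (chart_at M q) \<circ> \<Gamma>' \<xi>) has_vector_derivative u \<xi>) (at 0)"
   by (rule has_vector_derivative_transform_within_open[OF F(5)[OF \<xi>N], of "{..<t1}"]) (use t1 in \<open>auto simp: \<Gamma>'_def\<close>)
  fix t assume t: "t \<in> {a<..<t1 + e}"
  show "\<exists>C Z W N' d. \<xi> \<in> N' \<and> N' \<subseteq> N1 \<and> geo_family_rep M C \<Gamma>' Z W N' t d"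
  proof (cases "t < t1")
   case True
   then have "t \<in> {a<..<b}" using t t1 by auto
   from F(6)[OF \<xi>N this] obtain C2 Z2 W2 N2 d2 where 2: "\<xi> \<in> N2" "N2 \<subseteq> N" "geo_family_rep M C2 \<Gamma> Z2 W2 N2 t d2"
    by (elim exE conjE)
   have d2: "0 < d2" using geo_repD(2)[OF geo_family_repD(2)[OF 2(3,1)]] .
   have "geo_family_rep M C2 \<Gamma>' Z2 W2 (N2 \<inter> N1) t (min d2 (t1 - t))"
    by (rule geo_family_rep_restrict[OF 2(3)]) (use geo_family_repD(1)[OF 2(3)] N1 d2 True in \<open>auto simp: \<Gamma>'_def\<close>)
   then show ?thesis using 2(1) \<xi> by (intro exI[of _ C2] exI[of _ Z2] exI[of _ W2] exI[of _ "N2 \<inter> N1"] exI conjI) auto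
  next
   case False
   then have te: "\<bar>t - t1\<bar> < e" using t by auto
   obtain W where W: "geo_family_rep M C G (\<lambda>\<xi> t. \<Phi> (\<zeta> \<xi>) (t - t1)) W N1 t (e - \<bar>t - t1\<bar>)"
    using \<Phi>[OF te] unfolding G_def[abs_def] by blast
   have "geo_family_rep M C \<Gamma>' (\<lambda>\<xi> t. \<Phi> (\<zeta> \<xi>) (t - t1)) W N1 t (min (e - \<bar>t - t1\<bar>) (t - (t1 - \<delta>)))"
    by (rule geo_family_rep_restrict[OF W]) (use N1 te False \<delta> eq in \<open>auto simp: \<Gamma>'_def abs_less_iff\<close>)
   then show ?thesis using \<xi> by (intro exI conjI) auto
  qed
 qed (use N1 F(2) t1 e in auto)
 then show ?thesis using that by blast
qed

end

context connected_riemannian_mfd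
begin

lemma geodesic_rdist:
 assumes "\<And>t. t \<in> {a<..<b} \<Longrightarrow> geodesic_at M \<gamma> t" "\<And>t. t \<in> {a<..<b} \<Longrightarrow> speed M \<gamma> t = v" "s \<in> {a<..<b}" "t \<in> {a<..<b}" "0 \<le> v"
 shows "rdist M (\<gamma> s) (\<gamma> t) \<le> v * \<bar>t - s\<bar>"
proof -
 let ?g = "\<lambda>r. \<gamma> ((t - s) * r + s)"
 have inI: "(t - s) * r + s \<in> {a<..<b}" if "r \<in> {0..1}" for r
  using convexD_alt[OF convex_real_interval(8) assms(3,4), of r] that by (simp add: algebra_simps)
 have C1: "C1_at M \<gamma> r" if r: "r \<in> {a<..<b}" for r
 proof -
  obtain C z d where g: "geo_rep M C \<gamma> z r d" using assms(1)[OF r] unfolding geodesic_at_def by blast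
  then show ?thesis using geo_repD(2)[OF g] by (intro geo_rep_velocity(3)[OF g]) simp
 qed
 have g: "C1_at M ?g r" "speed M ?g r = \<bar>t - s\<bar> * v" if "r \<in> {0..1}" for r
  using C1_at_affine[OF C1[OF inI[OF that]], of 1 ?g] assms(2)[OF inI[OF that]] by auto
 have "curve_length M ?g \<le> ennreal (v * \<bar>t - s\<bar>)"
 proof (rule C1_length_finite[OF g(1)])
  show "speed M ?g r \<le> v * \<bar>t - s\<bar>" if "r \<in> {0..1}" for r unfolding g(2)[OF that] by (simp add: mult.commute)
 qed
 then show ?thesis by (intro rdist_le[of ?g] C1_piecewise g(1)) (auto simp: pathstart_def pathfinish_def assms(5))
qed

end

section \<open>Existence of geodesics for all positive times\<close>

context connected_riemannian_mfd
begin

text \<open>If all families around \<open>\<theta>\<close> ended by time \<open>T\<close>, let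
  \<open>S\<close> be the supremum of their end times. At times tending to \<open>S\<close> the
  positions form a Cauchy sequence, as the speed is constant, so they converge to some
  \<open>p\<close>; in a chart at \<open>p\<close> the velocities are bounded, hence converge along
  a subsequence. A flow box around the limit state restarts the family shortly before
  \<open>S\<close> and carries it beyond \<open>S\<close>.\<close>

lemma geo_family_exists:
 fixes u :: "'p::euclidean_space \<Rightarrow> real^'n"
 assumes compl: "complete_riemannian M" and u: "bounded_linear u"
 obtains N a b \<Gamma> where "\<theta> \<in> N" "T < b" "geo_family M q u N a b \<Gamma>"
proof (rule ccontr)
 assume "\<not> thesis"
 then have bad: "b \<le> T" if "\<theta> \<in> N" "geo_family M q u N a b \<Gamma>" for N a b \<Gamma>
  using that(1) that(2) \<open>\<And>N b a \<Gamma>. \<lbrakk>\<theta> \<in> N; T < b; geo_family M q u N a b \<Gamma>\<rbrakk> \<Longrightarrow> thesis\<close> by (meson not_le)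
 define B where "B = {b. \<exists>N a \<Gamma>. \<theta> \<in> N \<and> geo_family M q u N a b \<Gamma>}"
 obtain N0 a0 b0 \<Gamma>0 where F0: "\<theta> \<in> N0" "geo_family M q u N0 a0 b0 \<Gamma>0" using geo_family_start[OF u] by blast
 have b0: "b0 \<in> B" "0 < b0" using F0 geo_familyD(3)[OF F0(2)] by (auto simp: B_def)
 have bdd: "bdd_above B" by (rule bdd_aboveI[of _ T]) (use bad in \<open>auto simp: B_def\<close>)
 define S where "S = Sup B"
 have S: "0 < S" "\<And>b. b \<in> B \<Longrightarrow> b \<le> S" using cSup_upper[OF _ bdd] b0 unfolding S_def by force+
 \<comment> \<open>Times tending to \<open>S\<close> from below; the summand 2 keeps the first one
   positive.\<close>
 define t where "t n = S - S / (n + 2)" for n :: nat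
 have "S / (real n + 2) < S / 1" for n using S(1) by (intro divide_strict_left_mono) auto
 then have t: "0 < t n" "t n < S" for n using S(1) by (auto simp: t_def add.commute)
 have "\<exists>N a b \<Gamma>. \<theta> \<in> N \<and> geo_family M q u N a b \<Gamma> \<and> t n < b" for n
  using less_cSup_iff[of B "t n"] bdd b0 t(2)[of n] unfolding S_def B_def by blast
 then obtain N a b \<Gamma> where F: "\<And>n. \<theta> \<in> N n" "\<And>n. geo_family M q u (N n) (a n) (b n) (\<Gamma> n)" "\<And>n. t n < b n"
  by metis
 define \<sigma> where "\<sigma> n = \<Gamma> n \<theta> (t n)" for n
 define v where "v = sqrt (ginner M (chart_at M q) (chart_map (chart_at M q) q) (u \<theta>) (u \<theta>))"
 have v0: "0 \<le> v" using ginner_nonneg[OF chart_at(1) chartD(8)[OF chart_at]] by (simp add: v_def)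
 have dist: "rdist M (\<sigma> m) (\<sigma> n) \<le> v * (t n - t m)" if "t m \<le> t n" for m n
 proof -
  note D = geo_familyD(2)[OF F(2)]
  have "\<sigma> m = \<Gamma> n \<theta> (t m)" unfolding \<sigma>_def
   by (rule geo_family_unique[OF F(2) F(1) _ F(2) F(1)]) (use D[of n] D[of m] t(1)[of m] F(3)[of m] F(3)[of n] that in auto)
  moreover have "rdist M (\<Gamma> n \<theta> (t m)) (\<Gamma> n \<theta> (t n)) \<le> v * \<bar>t n - t m\<bar>"
   by (rule geodesic_rdist[OF geo_family_geodesic[OF F(2,1)] geo_family_speed[OF F(2,1), folded v_def] _ _ v0])
     (use D[of n] t(1)[of m] t(1)[of n] F(3)[of n] that in auto)
  ultimately show ?thesis using that by (simp add: \<sigma>_def)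
 qed
 have t_lim: "\<forall>\<^sub>F n in sequentially. S - e < t n" if "0 < e" for e
 proof -
  obtain m :: nat where m: "S / e < m" using reals_Archimedean2 by blast
  have "S - e < t n" if "n \<ge> m" for n
  proof -
   have "S / e < real n + 2" using m that by linarith
   then have "S / (real n + 2) < e" using \<open>0 < e\<close> by (simp add: pos_divide_less_eq mult.commute)
   then show ?thesis by (simp add: t_def add.commute)
  qed
  then show ?thesis by (auto simp: eventually_sequentially)
 qed
 have cauchy: "\<exists>K. \<forall>m n. K \<le> m \<longrightarrow> K \<le> n \<longrightarrow> rdist M (\<sigma> m) (\<sigma> n) < e" if e: "0 < e" for e
 proof -
  \<comment> \<open>Division by \<open>v + 1\<close> also covers the geodesic of speed 0.\<close>
  have "0 < e / (v + 1)" using e v0 by simp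
  from t_lim[OF this] obtain K where K: "\<And>n. K \<le> n \<Longrightarrow> S - e / (v + 1) < t n" by (auto simp: eventually_sequentially)
  have "rdist M (\<sigma> m) (\<sigma> n) < e" if "K \<le> m" "t m \<le> t n" for m n
  proof -
   have "rdist M (\<sigma> m) (\<sigma> n) \<le> v * (t n - t m)" by (rule dist[OF that(2)])
   also have "\<dots> \<le> (v + 1) * (t n - t m)" using that by (simp add: mult_right_mono)
   also have "\<dots> < (v + 1) * (e / (v + 1))" using K[OF that(1)] t(2)[of n] v0 by (intro mult_strict_left_mono) auto
   finally show ?thesis using v0 by simp
  qed
  then show ?thesis by (metis linear rdist_commute)
 qed
 obtain p where p: "\<And>e. 0 < e \<Longrightarrow> \<forall>\<^sub>F n in sequentially. rdist M p (\<sigma> n) < e" using complete_limit[OF compl cauchy] by metis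
 let ?C = "chart_at M p" let ?x = "chart_map ?C p"
 obtain r where r: "0 < r" "cball ?x r \<subseteq> chart_img ?C" using chart_ball[of UNIV p] by auto
 obtain \<kappa> where \<kappa>: "0 < \<kappa>" "\<And>x v. x \<in> cball ?x r \<Longrightarrow> \<kappa> * norm v \<le> sqrt (ginner M ?C x v v)"
  using ginner_bounds[OF chart_at(1) compact_cball r(2)] by metis
 define x where "x n = chart_map ?C (\<sigma> n)" for n
 have x_lim: "\<forall>\<^sub>F n in sequentially. \<sigma> n \<in> chart_dom ?C \<and> x n \<in> ball ?x e" if e: "0 < e" "e \<le> r" for e
 proof -
  have sub: "ball ?x e \<subseteq> chart_img ?C" using r(2) e by auto
  have "p \<in> chart_inv ?C ` ball ?x e" using e chartD(5)[OF chart_at] by (intro image_eqI[of _ _ ?x]) auto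
  then obtain \<delta> where \<delta>: "0 < \<delta>" "\<And>y. rdist M p y < \<delta> \<Longrightarrow> y \<in> chart_inv ?C ` ball ?x e"
   using rdist_nbhd[OF open_chart_image[OF chart_at(1) open_ball sub]] by metis
  show ?thesis using p[OF \<delta>(1)]
  proof eventually_elim
   case (elim n)
   then show ?case using \<delta>(2)[OF elim] sub chartD(6,7)[OF chart_at(1)] by (auto simp: x_def)
  qed
 qed
 have in_r: "\<forall>\<^sub>F n in sequentially. \<sigma> n \<in> chart_dom ?C \<and> x n \<in> ball ?x r" by (rule x_lim[OF r(1) order_refl])
 then obtain K where K: "\<And>n. K \<le> n \<Longrightarrow> \<sigma> n \<in> chart_dom ?C \<and> x n \<in> ball ?x r" by (auto simp: eventually_sequentially)
 have tI: "t n \<in> {a n<..<b n}" for n using t(1)[of n] F(3)[of n] geo_familyD(2)[OF F(2), of n] by auto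
 have state: "\<exists>N1 \<zeta> \<zeta>'. open N1 \<and> \<theta> \<in> N1 \<and> N1 \<subseteq> N n \<and> (\<forall>\<xi>\<in>N1. \<Gamma> n \<xi> (t n) \<in> chart_dom ?C \<and> fst (\<zeta> \<xi>) = chart_map ?C (\<Gamma> n \<xi> (t n)) \<and>
   ((chart_map ?C \<circ> \<Gamma> n \<xi>) has_vector_derivative snd (\<zeta> \<xi>)) (at (t n)) \<and> (\<zeta> has_derivative blinfun_apply (\<zeta>' \<xi>)) (at \<xi>)) \<and> continuous_on N1 \<zeta>'"
  if n: "K \<le> n" for n
 proof -
  from geo_familyD(6)[OF F(2)[of n] F(1) tI] obtain C Z W N' d where rep: "\<theta> \<in> N'" "N' \<subseteq> N n" "geo_family_rep M C (\<Gamma> n) Z W N' (t n) d"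
   by (elim exE conjE)
  have "\<Gamma> n \<theta> (t n) \<in> chart_dom ?C" using K[OF n] by (simp add: \<sigma>_def)
  from geo_family_state[OF rep(3,1) chart_at(1) this] obtain N1 \<zeta> \<zeta>' where
   1: "open N1" "\<theta> \<in> N1" "N1 \<subseteq> N'" "\<And>\<xi>. \<xi> \<in> N1 \<Longrightarrow> \<Gamma> n \<xi> (t n) \<in> chart_dom ?C \<and> fst (\<zeta> \<xi>) = chart_map ?C (\<Gamma> n \<xi> (t n))"
   "\<And>\<xi>. \<xi> \<in> N1 \<Longrightarrow> ((chart_map ?C \<circ> \<Gamma> n \<xi>) has_vector_derivative snd (\<zeta> \<xi>)) (at (t n))"
   "\<And>\<xi>. \<xi> \<in> N1 \<Longrightarrow> (\<zeta> has_derivative blinfun_apply (\<zeta>' \<xi>)) (at \<xi>)" "continuous_on N1 \<zeta>'" by metis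
  show ?thesis by (rule exI[of _ N1], rule exI[of _ \<zeta>], rule exI[of _ \<zeta>']) (use 1 rep(2) in auto)
 qed
 obtain N1 \<zeta> \<zeta>' where st: "\<And>n. K \<le> n \<Longrightarrow> open (N1 n) \<and> \<theta> \<in> N1 n \<and> N1 n \<subseteq> N n \<and> (\<forall>\<xi>\<in>N1 n. \<Gamma> n \<xi> (t n) \<in> chart_dom ?C \<and> fst (\<zeta> n \<xi>) = chart_map ?C (\<Gamma> n \<xi> (t n)) \<and>
   ((chart_map ?C \<circ> \<Gamma> n \<xi>) has_vector_derivative snd (\<zeta> n \<xi>)) (at (t n)) \<and> (\<zeta> n has_derivative blinfun_apply (\<zeta>' n \<xi>)) (at \<xi>)) \<and> continuous_on (N1 n) (\<zeta>' n)"
  using state by metis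
 \<comment> \<open>The shift by \<open>K\<close> leaves only indices whose positions lie in the
   chart at \<open>p\<close>.\<close>
 define w where "w n = snd (\<zeta> (n + K) \<theta>)" for n
 have \<zeta>x: "fst (\<zeta> n \<theta>) = x n" if "K \<le> n" for n using st[OF that] by (auto simp: x_def \<sigma>_def)
 have "norm (w n) \<le> v / \<kappa>" for n
 proof -
  have n: "K \<le> n + K" by simp
  obtain C z d where g: "geo_rep M C (\<Gamma> (n+K) \<theta>) z (t (n+K)) d"
   using geo_family_geodesic[OF F(2)[of "n+K"] F(1) tI] unfolding geodesic_at_def by blast
  have "continuous (at (t (n+K))) (\<Gamma> (n+K) \<theta>)" using geo_rep_velocity(2)[OF g, of "t (n+K)"] geo_repD(2)[OF g] by simp
  from speed_chart[OF chart_at(1) _ this, of p "w n"] st[OF n]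
  have "speed M (\<Gamma> (n+K) \<theta>) (t (n+K)) = sqrt (ginner M ?C (x (n+K)) (w n) (w n))" by (auto simp: w_def x_def \<sigma>_def)
  then have "v = sqrt (ginner M ?C (x (n+K)) (w n) (w n))" using geo_family_speed[OF F(2,1) tI, of "n+K"] by (simp add: v_def)
  moreover have "\<kappa> * norm (w n) \<le> sqrt (ginner M ?C (x (n+K)) (w n) (w n))"
   using K[OF n] by (intro \<kappa>(2)) auto
  ultimately show ?thesis using \<kappa>(1) by (simp add: pos_le_divide_eq mult.commute)
 qed
 then have "bounded (range w)" by (auto simp: bounded_iff)
 then obtain w0 \<rho> where \<rho>: "strict_mono \<rho>" "(w \<circ> \<rho>) \<longlonglongrightarrow> w0" using bounded_imp_convergent_subsequence by blast
 have z0: "(?x, w0) \<in> chart_img ?C \<times> UNIV" using chartD(8)[OF chart_at] by simp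
 obtain r' e \<Phi> where re: "0 < r'" "0 < e" and \<Phi>0: "\<And>z. z \<in> ball (?x, w0) r' \<Longrightarrow> \<Phi> z 0 = z"
  and \<Phi>: "\<And>N (\<zeta> :: 'p \<Rightarrow> (real^'n) \<times> (real^'n)) \<zeta>' t1 t. \<lbrakk>open N; \<And>\<xi>. \<xi> \<in> N \<Longrightarrow> \<zeta> \<xi> \<in> ball (?x, w0) r';
    \<And>\<xi>. \<xi> \<in> N \<Longrightarrow> (\<zeta> has_derivative blinfun_apply (\<zeta>' \<xi>)) (at \<xi>); continuous_on N \<zeta>'; \<bar>t - t1\<bar> < e\<rbrakk>
   \<Longrightarrow> \<exists>W. geo_family_rep M ?C (\<lambda>\<xi> t. chart_inv ?C (fst (\<Phi> (\<zeta> \<xi>) (t - t1)))) (\<lambda>\<xi> t. \<Phi> (\<zeta> \<xi>) (t - t1)) W N t (e - \<bar>t - t1\<bar>)"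
  by (fact geodesic_flow[OF chart_at(1) z0, where ?'p='p])
 have seq: "filterlim (\<lambda>k. \<rho> k + K) sequentially sequentially"
  by (rule filterlim_compose[OF filterlim_add_const_nat_at_top filterlim_subseq[OF \<rho>(1)]])
 have "\<forall>\<^sub>F k in sequentially. dist ((w \<circ> \<rho>) k) w0 < r' / 2" by (rule tendstoD[OF \<rho>(2)]) (use re in simp)
 moreover have "\<forall>\<^sub>F k in sequentially. x (\<rho> k + K) \<in> ball ?x (min r (r'/2))"
  using eventually_compose_filterlim[OF x_lim[of "min r (r'/2)"] seq] r(1) re(1) by (auto elim: eventually_mono)
 moreover have "\<forall>\<^sub>F k in sequentially. S - e < t (\<rho> k + K)" by (rule eventually_compose_filterlim[OF t_lim[OF re(2)] seq])
 ultimately have "\<forall>\<^sub>F k in sequentially. dist ((w \<circ> \<rho>) k) w0 < r' / 2 \<and> x (\<rho> k + K) \<in> ball ?x (min r (r'/2)) \<and> S - e < t (\<rho> k + K)"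
  by eventually_elim auto
 \<comment> \<open>Late enough that the state lies in the flow box and fewer than \<open>e\<close>
   units of time are left before \<open>S\<close>.\<close>
 then obtain k where k: "dist ((w \<circ> \<rho>) k) w0 < r' / 2" "x (\<rho> k + K) \<in> ball ?x (min r (r'/2))" "S - e < t (\<rho> k + K)"
  using eventually_happens'[OF sequentially_bot] by blast
 define n where "n = \<rho> k + K"
 have nK: "K \<le> n" by (simp add: n_def)
 note st = st[OF nK]
 have "dist (?x, w0) (\<zeta> n \<theta>) \<le> dist ?x (x n) + dist w0 (w (\<rho> k))"
  using sqrt_sum_squares_le_sum[of "dist ?x (x n)" "dist w0 (w (\<rho> k))"] \<zeta>x[OF nK] by (simp add: dist_prod_def w_def n_def)
 also have "\<dots> < r'" using k(1,2) by (simp add: n_def dist_commute)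
 finally have in_ball: "\<zeta> n \<theta> \<in> ball (?x, w0) r'" by simp
 have c\<zeta>: "continuous_on (N1 n) (\<zeta> n)"
  by (rule continuous_at_imp_continuous_on) (use st in \<open>auto intro: has_derivative_continuous\<close>)
 define N2 where "N2 = N1 n \<inter> \<zeta> n -` ball (?x, w0) r'"
 have N2: "open N2" "\<theta> \<in> N2" "N2 \<subseteq> N n" "N2 \<subseteq> N1 n"
  using continuous_open_preimage[OF c\<zeta> _ open_ball] st in_ball by (auto simp: N2_def)
 obtain \<Gamma>' where "geo_family M q u N2 (a n) (t n + e) \<Gamma>'"
 proof (rule geo_family_extend[OF F(2)[of n] _ N2(1-3) chart_at(1)[of p], of "t n" "\<zeta> n" e \<Phi>])
  show "t n \<in> {0<..<b n}" using t(1) F(3) by auto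
  show "\<Gamma> n \<xi> (t n) \<in> chart_dom ?C \<and> fst (\<zeta> n \<xi>) = chart_map ?C (\<Gamma> n \<xi> (t n))" if "\<xi> \<in> N2" for \<xi>
   using st that N2(4) by auto
  show "((chart_map ?C \<circ> \<Gamma> n \<xi>) has_vector_derivative snd (\<zeta> n \<xi>)) (at (t n))" if "\<xi> \<in> N2" for \<xi>
   using st that N2(4) by auto
  show "\<Phi> (\<zeta> n \<xi>) 0 = \<zeta> n \<xi>" if "\<xi> \<in> N2" for \<xi> by (rule \<Phi>0) (use that in \<open>auto simp: N2_def\<close>)
  show "\<exists>W. geo_family_rep M ?C (\<lambda>\<xi> ta. chart_inv ?C (fst (\<Phi> (\<zeta> n \<xi>) (ta - t n)))) (\<lambda>\<xi> ta. \<Phi> (\<zeta> n \<xi>) (ta - t n)) W N2 s (e - \<bar>s - t n\<bar>)"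
   if "\<bar>s - t n\<bar> < e" for s
  proof (rule \<Phi>[OF N2(1) _ _ _ that])
   show "\<zeta> n \<xi> \<in> ball (?x, w0) r'" if "\<xi> \<in> N2" for \<xi> using that by (auto simp: N2_def)
   show "(\<zeta> n has_derivative blinfun_apply (\<zeta>' n \<xi>)) (at \<xi>)" if "\<xi> \<in> N2" for \<xi> using st that N2(4) by auto
   show "continuous_on N2 (\<zeta>' n)" using st continuous_on_subset[OF _ N2(4)] by auto
  qed
 qed (use re in auto)
 then have "t n + e \<in> B" using N2(2) by (auto simp: B_def)
 then have "t n + e \<le> S" by (rule S(2))
 then show False using k(3) by (simp add: n_def)
qed

end

section \<open>Jacobi fields and the Riccati comparison\<close>

text \<open>Let n be the square root of \<open>f\<close>. Then n' = h/n, and the inequality says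
  that n'' is at least c^2 n. Hence t n' - n (called \<open>K\<close>) and exp(c t) (n' - c n)
  (called \<open>G\<close>) are nondecreasing, their derivatives being t n'' and exp(c t) (n'' - c^2
  n). Both are bounded below near 0 by functions that tend to 0, so they are nonnegative, which
  yields the two bounds on \<open>h\<close>.\<close>

lemma sqrt_riccati_comparison:
 fixes f h k :: "real \<Rightarrow> real"
 assumes df: "\<And>t. 0 < t \<Longrightarrow> (f has_real_derivative 2 * h t) (at t)" and dh: "\<And>t. 0 < t \<Longrightarrow> (h has_real_derivative k t) (at t)"
  and k0: "\<And>t. 0 < t \<Longrightarrow> 0 \<le> k t" and ineq: "\<And>t. 0 < t \<Longrightarrow> (h t)\<^sup>2 \<le> f t * (k t - c\<^sup>2 * f t)" and c: "0 \<le> c"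
  and f0: "(f \<longlongrightarrow> 0) (at_right 0)" and h0: "(h \<longlongrightarrow> 0) (at_right 0)" and fpos: "\<forall>\<^sub>F t in at_right 0. 0 < f t"
  and t: "0 < t"
 shows "0 < f t" "f t \<le> t * h t" "c * f t \<le> h t"
proof -
 have ev: "\<forall>\<^sub>F s in at_right 0. 0 < s \<and> s < r" if "0 < r" for r :: real
  using that by (auto simp: eventually_at_right)
 have hnn: "0 \<le> h r" if r: "0 < r" for r
 proof (rule tendsto_upperbound[OF h0])
  show "\<forall>\<^sub>F s in at_right 0. h s \<le> h r" using ev[OF r]
  proof eventually_elim
   case (elim s)
   show ?case
   proof (rule DERIV_nonneg_imp_nondecreasing[of s r h])
    show "\<exists>y. (h has_real_derivative y) (at x) \<and> 0 \<le> y" if "s \<le> x" for x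
     using dh[of x] k0[of x] elim that by (intro exI[of _ "k x"]) auto
   qed (use elim in simp)
  qed
 qed simp
 have fp: "0 < f r" if r: "0 < r" for r
 proof -
  obtain s where s: "0 < s" "s < r" "0 < f s"
   using eventually_happens'[OF trivial_limit_at_right_real eventually_conj[OF fpos ev[OF r]]] by blast
  have "f s \<le> f r"
  proof (rule DERIV_nonneg_imp_nondecreasing[of s r f])
   show "\<exists>y. (f has_real_derivative y) (at x) \<and> 0 \<le> y" if "s \<le> x" for x
    using df[of x] hnn[of x] s that by (intro exI[of _ "2 * h x"]) auto
  qed (use s in simp)
  then show ?thesis using s by simp
 qed
 then show "0 < f t" using t by blast
 define n where "n s = sqrt (f s)" for s
 have np: "0 < n s" "n s * n s = f s" if "0 < s" for s using fp[OF that] by (auto simp: n_def)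
 have dn: "(n has_real_derivative h s / n s) (at s)" if s: "0 < s" for s
  unfolding n_def[abs_def] using fp[OF s] df[OF s]
  by (auto intro!: derivative_eq_intros DERIV_real_sqrt[THEN DERIV_chain2] simp: field_simps)
 \<comment> \<open>\<open>m\<close> is the second derivative of \<open>n\<close>, as
   \<open>dm\<close> shows.\<close>
 define m where "m s = (k s - (h s)\<^sup>2 / f s) / n s" for s
 have dm: "((\<lambda>s. h s / n s) has_real_derivative m s) (at s)" if s: "0 < s" for s
 proof -
  have "((\<lambda>s. h s / n s) has_real_derivative (k s * n s - h s * (h s / n s)) / (n s * n s)) (at s)"
   by (rule DERIV_divide) (use dh[OF s] dn[OF s] np(1)[OF s] in auto)
  moreover have "(k s * n s - h s * (h s / n s)) / (n s * n s) = m s"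
   using np[OF s] unfolding m_def np(2)[OF s, symmetric] by (simp add: field_simps power2_eq_square)
  ultimately show ?thesis by simp
 qed
 have mge: "c\<^sup>2 * n s \<le> m s" if s: "0 < s" for s
 proof -
  have "(h s)\<^sup>2 / f s \<le> k s - c\<^sup>2 * f s" using ineq[OF s] fp[OF s] by (simp add: pos_divide_le_eq mult.commute)
  then have "c\<^sup>2 * (n s * n s) \<le> k s - (h s)\<^sup>2 / f s" using np(2)[OF s] by simp
  then show ?thesis unfolding m_def using np(1)[OF s] by (simp add: pos_le_divide_eq mult.assoc)
 qed
 have n0: "(n \<longlongrightarrow> 0) (at_right 0)" unfolding n_def using tendsto_real_sqrt[OF f0] by simp
 have idt: "((\<lambda>s. s) \<longlongrightarrow> 0) (at_right (0::real))" by (rule tendsto_ident_at)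
 define K where "K s = s * (h s / n s) - n s" for s
 have "0 \<le> K t"
 proof (rule tendsto_upperbound)
  show "((\<lambda>s. - n s) \<longlongrightarrow> 0) (at_right 0)" using tendsto_minus[OF n0] by simp
  show "\<forall>\<^sub>F s in at_right 0. - n s \<le> K t" using ev[OF t]
  proof eventually_elim
   case (elim s)
   have "K s \<le> K t"
   proof (rule DERIV_nonneg_imp_nondecreasing[of s t K])
    fix r assume r: "s \<le> r" "r \<le> t"
    then have r0: "0 < r" using elim by simp
    have "(K has_real_derivative (1 * (h r / n r) + m r * r) - h r / n r) (at r)" unfolding K_def[abs_def]
     by (intro DERIV_diff DERIV_mult DERIV_ident dm[OF r0] dn[OF r0])
    moreover have "0 \<le> m r * r" using mge[OF r0] np(1)[OF r0] r0 by (intro mult_nonneg_nonneg) (auto intro: order_trans[rotated])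
    ultimately show "\<exists>y. (K has_real_derivative y) (at r) \<and> 0 \<le> y" by (intro exI conjI) auto
   qed (use elim in simp)
   moreover have "- n s \<le> K s" using hnn[of s] np[of s] elim by (simp add: K_def)
   ultimately show ?case by simp
  qed
 qed simp
 then have "n t * n t \<le> t * h t" using np(1)[OF t] by (simp add: K_def field_simps)
 then show "f t \<le> t * h t" using np(2)[OF t] by simp
 define G where "G s = (h s / n s - c * n s) * exp (c * s)" for s
 have "0 \<le> G t"
 proof (rule tendsto_upperbound)
  have "((\<lambda>s. - c * n s * exp (c * s)) \<longlongrightarrow> - c * 0 * exp (c * 0)) (at_right 0)"
   by (intro tendsto_intros n0 idt)
  then show "((\<lambda>s. - c * n s * exp (c * s)) \<longlongrightarrow> 0) (at_right 0)" by simp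
  show "\<forall>\<^sub>F s in at_right 0. - c * n s * exp (c * s) \<le> G t" using ev[OF t]
  proof eventually_elim
   case (elim s)
   have "G s \<le> G t"
   proof (rule DERIV_nonneg_imp_nondecreasing[of s t G])
    fix r assume r: "s \<le> r" "r \<le> t"
    then have r0: "0 < r" using elim by simp
    have "(G has_real_derivative (m r - c * (h r / n r)) * exp (c * r) + exp (c * r) * c * (h r / n r - c * n r)) (at r)" unfolding G_def[abs_def]
     by (intro DERIV_mult DERIV_diff DERIV_cmult dm[OF r0] dn[OF r0]) (auto intro!: derivative_eq_intros)
    moreover have "(m r - c * (h r / n r)) * exp (c * r) + exp (c * r) * c * (h r / n r - c * n r) = (m r - c\<^sup>2 * n r) * exp (c * r)"
     by (simp add: algebra_simps power2_eq_square)
    ultimately show "\<exists>y. (G has_real_derivative y) (at r) \<and> 0 \<le> y" using mge[OF r0] by (intro exI conjI) auto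
   qed (use elim in simp)
   moreover have "- c * n s * exp (c * s) \<le> G s"
    unfolding G_def using hnn[of s] np[of s] elim by (intro mult_right_mono) auto
   ultimately show ?case by simp
  qed
 qed simp
 then have "0 \<le> h t / n t - c * n t" by (simp add: G_def zero_le_mult_iff)
 then have "c * (n t * n t) \<le> h t" using np(1)[OF t] by (simp add: field_simps)
 then show "c * f t \<le> h t" using np(2)[OF t] by simp
qed

text \<open>The bounds \<open>f t \<le> t * h t\<close> and \<open>c * f t \<le> h t\<close> say
  that the derivatives of f/t^2 and of f exp(-2 c t) are nonnegative.\<close>

lemma sqrt_riccati_growth:
 fixes f h k :: "real \<Rightarrow> real"
 assumes df: "\<And>t. 0 < t \<Longrightarrow> (f has_real_derivative 2 * h t) (at t)" and dh: "\<And>t. 0 < t \<Longrightarrow> (h has_real_derivative k t) (at t)"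
  and k0: "\<And>t. 0 < t \<Longrightarrow> 0 \<le> k t" and ineq: "\<And>t. 0 < t \<Longrightarrow> (h t)\<^sup>2 \<le> f t * (k t - c\<^sup>2 * f t)" and c: "0 \<le> c"
  and f0: "(f \<longlongrightarrow> 0) (at_right 0)" and h0: "(h \<longlongrightarrow> 0) (at_right 0)" and fpos: "\<forall>\<^sub>F t in at_right 0. 0 < f t"
  and t: "0 < t0" "t0 \<le> t1"
 shows "f t0 / t0\<^sup>2 \<le> f t1 / t1\<^sup>2" "exp (2 * c * (t1 - t0)) * f t0 \<le> f t1"
proof -
 have C: "f r \<le> r * h r" if r: "0 < r" for r
  by (rule sqrt_riccati_comparison(2)[OF df dh k0 ineq c f0 h0 fpos r])
 have C': "c * f r \<le> h r" if r: "0 < r" for r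
  by (rule sqrt_riccati_comparison(3)[OF df dh k0 ineq c f0 h0 fpos r])
 show "f t0 / t0\<^sup>2 \<le> f t1 / t1\<^sup>2"
 proof (rule DERIV_nonneg_imp_nondecreasing[OF t(2)])
  fix r assume "t0 \<le> r" "r \<le> t1"
  then have r: "0 < r" using t by simp
  have "((\<lambda>t. f t / t\<^sup>2) has_real_derivative (2 * h r * r\<^sup>2 - f r * (2 * r)) / (r\<^sup>2 * r\<^sup>2)) (at r)"
   by (rule DERIV_divide) (use df[OF r] r in \<open>auto intro!: derivative_eq_intros\<close>)
  moreover have "2 * h r * r\<^sup>2 - f r * (2 * r) = 2 * r * (r * h r - f r)" by (simp add: algebra_simps power2_eq_square)
  then have "0 \<le> (2 * h r * r\<^sup>2 - f r * (2 * r)) / (r\<^sup>2 * r\<^sup>2)" using C[OF r] r by simp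
  ultimately show "\<exists>y. ((\<lambda>t. f t / t\<^sup>2) has_real_derivative y) (at r) \<and> 0 \<le> y" by blast
 qed
 have "f t0 * exp (- (2 * c * t0)) \<le> f t1 * exp (- (2 * c * t1))"
 proof (rule DERIV_nonneg_imp_nondecreasing[OF t(2)])
  fix r assume "t0 \<le> r" "r \<le> t1"
  then have r: "0 < r" using t by simp
  have "((\<lambda>t. f t * exp (- (2 * c * t))) has_real_derivative 2 * (h r - c * f r) * exp (- (2 * c * r))) (at r)"
   by (rule derivative_eq_intros df[OF r] refl)+ (simp add: algebra_simps)
  moreover have "0 \<le> 2 * (h r - c * f r) * exp (- (2 * c * r))" using C'[OF r] by simp
  ultimately show "\<exists>y. ((\<lambda>t. f t * exp (- (2 * c * t))) has_real_derivative y) (at r) \<and> 0 \<le> y" by (intro exI conjI) auto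
 qed
 then have "exp (2 * c * t1) * (f t0 * exp (- (2 * c * t0))) \<le> exp (2 * c * t1) * (f t1 * exp (- (2 * c * t1)))"
  by (intro mult_left_mono) auto
 then show "exp (2 * c * (t1 - t0)) * f t0 \<le> f t1"
  by (simp add: exp_minus exp_diff right_diff_distrib field_simps)
qed

lemma partial_deriv_cong:
 assumes "open S" "x \<in> S" "\<And>y. y \<in> S \<Longrightarrow> f y = g y" "f differentiable at x"
 shows "partial_deriv i f x = partial_deriv i g x"
proof -
 obtain f' where f': "(f has_derivative f') (at x)" using assms(4) unfolding differentiable_def by blast
 have "(g has_derivative f') (at x)" by (rule has_derivative_transform_within_open[OF f' assms(1,2)]) (rule assms(3))
 then show ?thesis using f' partial_deriv_eq by metis
qed

lemma gam_minus: "gam M C x (- v) w = - gam M C x v w" "gam M C x v (- w) = - gam M C x v w"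
 by (simp_all add: gam_def bform_linear vec_eq_iff)

lemma dgam_scale:
 "dgam M C x (r *\<^sub>R h) v w = r *\<^sub>R dgam M C x h v w" "dgam M C x h (r *\<^sub>R v) w = r *\<^sub>R dgam M C x h v w"
 "dgam M C x h v (r *\<^sub>R w) = r *\<^sub>R dgam M C x h v w"
 by (simp_all add: dgam_def dbform_def vec_eq_iff sum_distrib_left mult_ac)

section \<open>Curvature and the Jacobi equation\<close>

context riemannian_mfd
begin

lemma dgam_sym: "C \<in> atlas M \<Longrightarrow> x \<in> chart_img C \<Longrightarrow> dgam M C x h v w = dgam M C x h w v"
proof -
 assume C: "C \<in> atlas M" "x \<in> chart_img C"
 have "partial_deriv k (christoffel M C l i j) x = partial_deriv k (christoffel M C l j i) x" for k l i j
  by (rule partial_deriv_cong[OF chartD(2)[OF C(1)] C(2) christoffel_sym[OF C(1)] christoffel_differentiable[OF C]])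
 then show ?thesis unfolding dgam_def dbform_def vec_eq_iff
  by (subst sum.swap) (simp add: mult.commute mult.left_commute)
qed

text \<open>Sectional curvature is bounded for independent pairs. For dependent pairs the curvature
  term and the Gram determinant both vanish, so that the product form of the bound holds for all
  pairs.\<close>

lemma curvature_bound:
 assumes curv: "sectional_curvature_le M (- (c\<^sup>2))" and C: "C \<in> atlas M" "x \<in> chart_img C"
 shows "ginner M C x (riemann_tensor M C x y v v) y \<le> - (c\<^sup>2) * (ginner M C x y y * ginner M C x v v - (ginner M C x y v)\<^sup>2)"
proof (cases "v = 0 \<or> (\<exists>k. y = k *\<^sub>R v)")
 case True
 then show ?thesis
 proof
  assume "v = 0"
  then have "riemann_tensor M C x y v v = 0" using dgam_scale(2)[of M C x y 0 0 0] dgam_scale(1)[of M C x 0 0 y 0]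
   by (simp add: riemann_tensor_gam gam_linear)
  then show ?thesis using \<open>v = 0\<close> by (simp add: ginner_linear)
 next
  assume "\<exists>k. y = k *\<^sub>R v"
  then obtain k where k: "y = k *\<^sub>R v" by blast
  have "riemann_tensor M C x y v v = 0" unfolding k by (simp add: riemann_tensor_gam gam_linear dgam_scale)
  then show ?thesis unfolding k by (simp add: ginner_linear power2_eq_square)
 qed
next
 case False
 have "y \<noteq> v" using False scaleR_one[of v] by metis
 have "y \<notin> span {v}" using False by (auto simp: span_singleton)
 then have ind: "independent {y, v}" using False \<open>y \<noteq> v\<close> by (simp add: independent_insert)
 define G where "G = ginner M C x y y * ginner M C x v v - (ginner M C x y v)\<^sup>2"
 have vv: "0 < ginner M C x v v" using ginner_pos[OF C] False by blast
 have "y - (ginner M C x y v / ginner M C x v v) *\<^sub>R v \<noteq> 0" using False by (metis eq_iff_diff_eq_0)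
 from ginner_pos[OF C this] have "0 < ginner M C x y y - (ginner M C x y v)\<^sup>2 / ginner M C x v v"
  using vv ginner_sym[OF C, of v y] by (simp add: ginner_linear field_simps power2_eq_square)
 then have G: "0 < G" using vv by (simp add: G_def field_simps)
 have "sectional_curvature M C x y v \<le> - (c\<^sup>2)"
  using curv ind \<open>y \<noteq> v\<close> C unfolding sectional_curvature_le_def by blast
 then have "ginner M C x (riemann_tensor M C x y v v) y / G \<le> - (c\<^sup>2)" unfolding sectional_curvature_def G_def .
 then show ?thesis using G by (simp add: G_def[symmetric] pos_divide_le_eq)
qed

text \<open>The product rule: by \<open>metric_compatible\<close> the derivative of the metric
  coefficients is absorbed into the covariant derivatives of the two fields.\<close>

lemma ginner_along_curve:
 assumes C: "C \<in> atlas M" "X t \<in> chart_img C"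
  and d: "(X has_vector_derivative V) (at t)" "(A has_vector_derivative A') (at t)" "(B has_vector_derivative B') (at t)"
 shows "((\<lambda>s. ginner M C (X s) (A s) (B s)) has_real_derivative
   (ginner M C (X t) (A' + gam M C (X t) V (A t)) (B t) + ginner M C (X t) (A t) (B' + gam M C (X t) V (B t)))) (at t)"
proof -
 have "((\<lambda>s. ginner M C (X s) (A s) (B s)) has_derivative
  (\<lambda>h. dginner M C (X t) (h *\<^sub>R V) (A t) (B t) + ginner M C (X t) (h *\<^sub>R A') (B t) + ginner M C (X t) (A t) (h *\<^sub>R B'))) (at t)"
  using d unfolding has_vector_derivative_def by (rule ginner_has_derivative[where x=X, OF C])
 moreover have "dginner M C (X t) (h *\<^sub>R V) (A t) (B t) + ginner M C (X t) (h *\<^sub>R A') (B t) + ginner M C (X t) (A t) (h *\<^sub>R B')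
   = (ginner M C (X t) (A' + gam M C (X t) V (A t)) (B t) + ginner M C (X t) (A t) (B' + gam M C (X t) V (B t))) * h" for h
  unfolding metric_compatible[OF C] by (simp add: ginner_linear gam_linear algebra_simps)
 ultimately show ?thesis unfolding has_field_derivative_def by simp
qed

text \<open>\<open>Y\<close> is the position part of a solution of the linearized geodesic equation, \<open>U\<close> its covariant
 derivative; the second formula is the Jacobi equation.\<close>
lemma jacobi_derivatives:
 assumes C: "C \<in> atlas M" "X t \<in> chart_img C" and tS: "open T" "t \<in> T"
  and dX: "\<And>s. s \<in> T \<Longrightarrow> (X has_vector_derivative V s) (at s)" and dV: "(V has_vector_derivative - gam M C (X t) (V t) (V t)) (at t)"
  and dY: "\<And>s. s \<in> T \<Longrightarrow> (Y has_vector_derivative Z s) (at s)"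
  and dZ: "(Z has_vector_derivative - (dgam M C (X t) (Y t) (V t) (V t) + gam M C (X t) (Z t) (V t) + gam M C (X t) (V t) (Z t))) (at t)"
 defines "U \<equiv> \<lambda>s. Z s + gam M C (X s) (V s) (Y s)"
 shows "((\<lambda>s. ginner M C (X s) (Y s) (Y s)) has_real_derivative 2 * ginner M C (X t) (U t) (Y t)) (at t)"
  and "((\<lambda>s. ginner M C (X s) (U s) (Y s)) has_real_derivative
     ginner M C (X t) (U t) (U t) - ginner M C (X t) (riemann_tensor M C (X t) (Y t) (V t) (V t)) (Y t)) (at t)"
  and "((\<lambda>s. ginner M C (X s) (Y s) (V s)) has_real_derivative ginner M C (X t) (U t) (V t)) (at t)"
proof -
 note dXt = dX[OF tS(2)] and dYt = dY[OF tS(2)]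
 note sym = ginner_sym[OF C] and gsym = gam_sym[OF C]
 show "((\<lambda>s. ginner M C (X s) (Y s) (Y s)) has_real_derivative 2 * ginner M C (X t) (U t) (Y t)) (at t)"
  using ginner_along_curve[OF C dXt dYt dYt] sym[of "Y t" "U t"] by (simp add: U_def)
 show "((\<lambda>s. ginner M C (X s) (Y s) (V s)) has_real_derivative ginner M C (X t) (U t) (V t)) (at t)"
  using ginner_along_curve[OF C dXt dYt dV] by (simp add: U_def ginner_linear)
 define U' where "U' = - (dgam M C (X t) (Y t) (V t) (V t) + gam M C (X t) (Z t) (V t) + gam M C (X t) (V t) (Z t))
   + (dgam M C (X t) (V t) (V t) (Y t) + gam M C (X t) (- gam M C (X t) (V t) (V t)) (Y t) + gam M C (X t) (V t) (Z t))"
 have "((\<lambda>s. gam M C (X s) (V s) (Y s)) has_derivative (\<lambda>h. dgam M C (X t) (h *\<^sub>R V t) (V t) (Y t)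
   + gam M C (X t) (h *\<^sub>R (- gam M C (X t) (V t) (V t))) (Y t) + gam M C (X t) (V t) (h *\<^sub>R Z t))) (at t)"
  using dXt dV dYt unfolding has_vector_derivative_def by (rule gam_has_derivative[where x=X, OF C])
 then have "((\<lambda>s. gam M C (X s) (V s) (Y s)) has_vector_derivative (dgam M C (X t) (V t) (V t) (Y t)
   + gam M C (X t) (- gam M C (X t) (V t) (V t)) (Y t) + gam M C (X t) (V t) (Z t))) (at t)"
  unfolding has_vector_derivative_def by (simp add: gam_linear gam_minus dgam_scale scaleR_add_right scaleR_diff_right)
 then have dU: "(U has_vector_derivative U') (at t)" unfolding U_def U'_def by (rule has_vector_derivative_add[OF dZ])
 \<comment> \<open>The left side is the second covariant derivative of \<open>Y\<close>; the terms
   with derivatives of the Christoffel symbols combine to the curvature by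
   \<open>riemann_tensor_gam\<close> and the symmetry of \<open>gam\<close>.\<close>
 have "U' + gam M C (X t) (V t) (U t) = - riemann_tensor M C (X t) (Y t) (V t) (V t)"
  unfolding U'_def U_def riemann_tensor_gam
  using gsym[of "Z t" "V t"] gsym[of "gam M C (X t) (V t) (V t)" "Y t"] gsym[of "Y t" "V t"] dgam_sym[OF C, of "V t" "V t" "Y t"]
  by (simp add: gam_linear gam_minus)
 then show "((\<lambda>s. ginner M C (X s) (U s) (Y s)) has_real_derivative
     ginner M C (X t) (U t) (U t) - ginner M C (X t) (riemann_tensor M C (X t) (Y t) (V t) (V t)) (Y t)) (at t)"
  using ginner_along_curve[OF C dXt dU dYt] by (simp add: U_def ginner_linear)
qed

text \<open>The position part of \<open>W \<xi> s\<close> is the differential of the map from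
  parameters to the points reached at time \<open>s\<close>, that is, a Jacobi field.\<close>

lemma geo_family_position:
 fixes \<Gamma> :: "'p::real_normed_vector \<Rightarrow> real \<Rightarrow> 'a"
 assumes rep: "geo_family_rep M C \<Gamma> Z W N t d" and \<xi>: "\<xi> \<in> N" and s: "\<bar>s - t\<bar> < d"
 shows "continuous (at \<xi>) (\<lambda>\<xi>. \<Gamma> \<xi> s)" "(chart_map C \<circ> (\<lambda>\<xi>. \<Gamma> \<xi> s) has_derivative (\<lambda>w. fst (W \<xi> s w))) (at \<xi>)"
  "pullback_metric M (\<lambda>\<xi>. \<Gamma> \<xi> s) \<xi> a b = ginner M C (fst (Z \<xi> s)) (fst (W \<xi> s a)) (fst (W \<xi> s b))"
proof -
 note R = geo_family_repD[OF rep]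
 have g: "geo_rep M C (\<Gamma> \<eta>) (Z \<eta>) t d" if "\<eta> \<in> N" for \<eta> by (rule R(2)[OF that])
 have C: "C \<in> atlas M" by (rule geo_repD(1)[OF g[OF \<xi>]])
 have cm: "chart_map C (\<Gamma> \<eta> s) = fst (Z \<eta> s)" and dom: "\<Gamma> \<eta> s \<in> chart_dom C" if "\<eta> \<in> N" for \<eta>
  using geo_repD(3,4)[OF g[OF that] s] by auto
 have dZ: "((\<lambda>\<eta>. fst (Z \<eta> s)) has_derivative (\<lambda>w. fst (W \<eta> s w))) (at \<eta>)" if "\<eta> \<in> N" for \<eta>
  by (rule has_derivative_fst[OF R(3)[OF that s]])
 show d: "(chart_map C \<circ> (\<lambda>\<xi>. \<Gamma> \<xi> s) has_derivative (\<lambda>w. fst (W \<xi> s w))) (at \<xi>)"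
  by (rule has_derivative_transform_within_open[OF dZ[OF \<xi>] R(1) \<xi>]) (simp add: cm)
 have "continuous_on N (\<lambda>\<eta>. chart_inv C (fst (Z \<eta> s)))"
  by (rule continuous_on_compose2[OF chartD(4)[OF C]])
    (use has_derivative_continuous[OF dZ] geo_rep_velocity(5)[OF g s] in \<open>auto intro!: continuous_at_imp_continuous_on\<close>)
 then have "continuous_on N (\<lambda>\<eta>. \<Gamma> \<eta> s)"
  by (rule continuous_on_eq) (use cm dom chartD(5)[OF C] in metis)
 then show c: "continuous (at \<xi>) (\<lambda>\<xi>. \<Gamma> \<xi> s)" using R(1) \<xi> by (simp add: continuous_on_eq_continuous_at)
 show "pullback_metric M (\<lambda>\<xi>. \<Gamma> \<xi> s) \<xi> a b = ginner M C (fst (Z \<xi> s)) (fst (W \<xi> s a)) (fst (W \<xi> s b))"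
  using pullback_metric_chart[OF C _ c d] dom[OF \<xi>] cm[OF \<xi>] by simp
qed

end

section \<open>The exponential map\<close>

locale exp_map = connected_riemannian_mfd M
 for M :: "('a::{t2_space,second_countable_topology}, 'n::finite) riemannian" +
 fixes q :: 'a and u :: "real^'n \<Rightarrow> real^'n" and c :: real
 assumes compl: "complete_riemannian M" and u: "bounded_linear u"
  and iso: "\<And>\<xi> \<eta>. ginner M (chart_at M q) (chart_map (chart_at M q) q) (u \<xi>) (u \<eta>) = \<xi> \<bullet> \<eta>"
  and c: "0 \<le> c" and curv: "sectional_curvature_le M (- (c\<^sup>2))"
begin

text \<open>Picks the value given by some family that reaches \<open>\<xi>\<close> and
  \<open>t\<close>; by \<open>geod_eq\<close> all such families give the same value.\<close>

definition geod :: "real^'n \<Rightarrow> real \<Rightarrow> 'a" where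
 "geod \<xi> t = (SOME p. \<exists>N a b \<Gamma>. \<xi> \<in> N \<and> geo_family M q u N a b \<Gamma> \<and> t \<in> {a<..<b} \<and> p = \<Gamma> \<xi> t)"

definition expo :: "real^'n \<Rightarrow> 'a" where "expo \<xi> = geod \<xi> 1"

lemma geod_eq:
 assumes "geo_family M q u N a b \<Gamma>" "\<xi> \<in> N" "t \<in> {a<..<b}"
 shows "geod \<xi> t = \<Gamma> \<xi> t"
proof -
 have "\<exists>N a b \<Gamma>'. \<xi> \<in> N \<and> geo_family M q u N a b \<Gamma>' \<and> t \<in> {a<..<b} \<and> \<Gamma> \<xi> t = \<Gamma>' \<xi> t"
  using assms by blast
 then have "\<exists>N a b \<Gamma>'. \<xi> \<in> N \<and> geo_family M q u N a b \<Gamma>' \<and> t \<in> {a<..<b} \<and> geod \<xi> t = \<Gamma>' \<xi> t"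
  unfolding geod_def by (rule someI)
 then obtain N' a' b' \<Gamma>' where f: "\<xi> \<in> N'" "geo_family M q u N' a' b' \<Gamma>'" "t \<in> {a'<..<b'}" "geod \<xi> t = \<Gamma>' \<xi> t"
  by (elim exE conjE)
 show ?thesis unfolding f(4) by (rule geo_family_unique[OF f(2,1,3) assms])
qed

lemma geod_rep:
 assumes "0 \<le> t"
 obtains C Z W N d where "\<xi> \<in> N" "geo_family_rep M C geod Z W N t d"
proof -
 obtain N a b \<Gamma> where f: "\<xi> \<in> N" "t < b" "geo_family M q u N a b \<Gamma>" by (rule geo_family_exists[OF compl u])
 have t: "t \<in> {a<..<b}" using assms f(2) geo_familyD(2)[OF f(3)] by auto
 from geo_familyD(6)[OF f(3,1) t] obtain C Z W N' d where r: "\<xi> \<in> N'" "N' \<subseteq> N" "geo_family_rep M C \<Gamma> Z W N' t d"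
  by (elim exE conjE)
 have d: "0 < d" using geo_repD(2)[OF geo_family_repD(2)[OF r(3,1)]] .
 have "geo_family_rep M C geod Z W N' t (min d (min (t - a) (b - t)))"
 proof (rule geo_family_rep_restrict[OF r(3) geo_family_repD(1)[OF r(3)] order_refl])
  show "geod \<eta> s = \<Gamma> \<eta> s" if "\<eta> \<in> N'" "\<bar>s - t\<bar> < min d (min (t - a) (b - t))" for \<eta> s
   by (rule geod_eq[OF f(3)]) (use that r(2) in auto)
 qed (use t d in auto)
 then show ?thesis using that r(1) by blast
qed

lemma geod_geodesic: "0 \<le> t \<Longrightarrow> geodesic_at M (geod \<xi>) t"
proof -
 assume "0 \<le> t"
 then obtain C Z W N d where "\<xi> \<in> N" "geo_family_rep M C geod Z W N t d" by (rule geod_rep)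
 then show ?thesis using geo_family_repD(2) unfolding geodesic_at_def by metis
qed

text \<open>The geodesic also exists for slightly negative times, so that the derivative at 0 is
  two-sided and \<open>geodesic_unique\<close> applies on an open interval around 0.\<close>

lemma geod_start:
 obtains a where "a < 0" "\<And>t. a < t \<Longrightarrow> geodesic_at M (geod \<xi>) t" "geod \<xi> 0 = q"
  "((chart_map (chart_at M q) \<circ> geod \<xi>) has_vector_derivative u \<xi>) (at 0)" "continuous (at 0) (geod \<xi>)"
proof -
 obtain N a b \<Gamma> where f: "\<xi> \<in> N" "0 < b" "geo_family M q u N a b \<Gamma>" by (rule geo_family_exists[OF compl u])
 note F = geo_familyD[OF f(3)]
 have eq: "geod \<xi> t = \<Gamma> \<xi> t" if "t \<in> {a<..<b}" for t by (rule geod_eq[OF f(3,1) that])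
 have neg: "geodesic_at M (geod \<xi>) t" if t: "a < t" for t
 proof (cases "0 \<le> t")
  case False
  then have tI: "t \<in> {a<..<b}" using t f(2) by auto
  show ?thesis
   by (rule geodesic_at_cong[OF geo_family_geodesic[OF f(3,1) tI], of "min (t - a) (b - t)"]) (use tI in \<open>auto intro!: eq simp: abs_less_iff\<close>)
 qed (rule geod_geodesic)
 obtain C z d where g: "geo_rep M C (geod \<xi>) z 0 d" using neg[of 0] F(2) unfolding geodesic_at_def by blast
 show ?thesis
 proof (rule that[OF F(2) neg])
  show "geod \<xi> 0 = q" using eq[of 0] F(2,4) f(1,2) by auto
  show "((chart_map (chart_at M q) \<circ> geod \<xi>) has_vector_derivative u \<xi>) (at 0)"
   by (rule has_vector_derivative_transform_within_open[OF F(5)[OF f(1)], of "{a<..<b}"]) (use eq F(2,3) in auto)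
  show "continuous (at 0) (geod \<xi>)" using geo_rep_velocity(2)[OF g, of 0] geo_repD(2)[OF g] by simp
 qed
qed

lemma geod_0: "geod \<xi> 0 = q"
 using geod_start[of \<xi>] by metis

lemma geod_speed:
 assumes t: "0 \<le> t"
 shows "speed M (geod \<xi>) t = norm \<xi>"
proof -
 obtain a where a: "a < 0" "\<And>t. a < t \<Longrightarrow> geodesic_at M (geod \<xi>) t" "geod \<xi> 0 = q"
  "((chart_map (chart_at M q) \<circ> geod \<xi>) has_vector_derivative u \<xi>) (at 0)" "continuous (at 0) (geod \<xi>)"
  by (fact geod_start[of \<xi>])
 have "speed M (geod \<xi>) t = speed M (geod \<xi>) 0"
  by (rule geodesic_speed_constant[of a "t + 1"]) (use a t in auto)
 also have "\<dots> = sqrt (ginner M (chart_at M q) (chart_map (chart_at M q) (geod \<xi> 0)) (u \<xi>) (u \<xi>))"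
  by (rule speed_chart[OF chart_at(1) _ a(5,4)]) (simp add: geod_0 chart_at)
 finally show ?thesis by (simp add: geod_0 iso norm_eq_sqrt_inner)
qed

lemma geod_rdist: "0 \<le> t \<Longrightarrow> rdist M q (geod \<xi> t) \<le> norm \<xi> * t"
proof -
 assume t: "0 \<le> t"
 obtain a where a: "a < 0" "\<And>t. a < t \<Longrightarrow> geodesic_at M (geod \<xi>) t" "geod \<xi> 0 = q"
  "((chart_map (chart_at M q) \<circ> geod \<xi>) has_vector_derivative u \<xi>) (at 0)" "continuous (at 0) (geod \<xi>)" by (fact geod_start[of \<xi>])
 have "speed M (geod \<xi>) s = norm \<xi>" if "s \<in> {a<..<t + 1}" for s
  using geodesic_speed_constant[of a "t + 1" "geod \<xi>" s 0] a that t geod_speed[of 0 \<xi>] by auto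
 then have "rdist M (geod \<xi> 0) (geod \<xi> t) \<le> norm \<xi> * \<bar>t - 0\<bar>"
  by (intro geodesic_rdist[of a "t + 1"]) (use a t in auto)
 then show ?thesis using t by (simp add: geod_0)
qed

text \<open>Speeding up the time by \<open>s\<close> multiplies the velocity by \<open>s\<close> and
  both sides of the geodesic equation by the square of \<open>s\<close>. So the right side is a
  geodesic with initial velocity \<open>u (s *\<^sub>R \<xi>)\<close>, and uniqueness
  applies.\<close>

lemma geod_scale:
 assumes s: "0 < s" and t: "0 \<le> t"
 shows "geod (s *\<^sub>R \<xi>) t = geod \<xi> (s * t)"
proof -
 obtain a where a: "a < 0" "\<And>t. a < t \<Longrightarrow> geodesic_at M (geod \<xi>) t" "geod \<xi> 0 = q"
  "((chart_map (chart_at M q) \<circ> geod \<xi>) has_vector_derivative u \<xi>) (at 0)" "continuous (at 0) (geod \<xi>)" by (fact geod_start[of \<xi>])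
 obtain b where b: "b < 0" "\<And>t. b < t \<Longrightarrow> geodesic_at M (geod (s *\<^sub>R \<xi>)) t" "geod (s *\<^sub>R \<xi>) 0 = q"
  "((chart_map (chart_at M q) \<circ> geod (s *\<^sub>R \<xi>)) has_vector_derivative u (s *\<^sub>R \<xi>)) (at 0)" "continuous (at 0) (geod (s *\<^sub>R \<xi>))" by (fact geod_start[of "s *\<^sub>R \<xi>"])
 let ?g = "\<lambda>t. geod \<xi> (s * t)"
 have g: "geodesic_at M ?g r" if r: "a / s < r" for r
 proof -
  have "a < s * r" using r s by (simp add: pos_divide_less_eq mult.commute)
  then obtain C z d where rep: "geo_rep M C (geod \<xi>) z (s * r) d" using a(2) unfolding geodesic_at_def by blast
  note R = geo_repD[OF rep]
  define z' where "z' r = (fst (z (s * r)), s *\<^sub>R snd (z (s * r)))" for r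
  have "geo_rep M C ?g z' r (d / s)" unfolding geo_rep_def
  proof (intro conjI allI impI)
   fix r' assume "\<bar>r' - r\<bar> < d / s"
   then have "s * \<bar>r' - r\<bar> < d" using s by (simp add: pos_less_divide_eq mult.commute)
   then have r': "\<bar>s * r' - s * r\<bar> < d" using s by (simp add: abs_mult flip: right_diff_distrib)
   show "geod \<xi> (s * r') \<in> chart_dom C" "fst (z' r') = chart_map C (geod \<xi> (s * r'))" using R(3,4)[OF r'] by (auto simp: z'_def)
   have "((\<lambda>r. s * r) has_vector_derivative s) (at r')"
    by (auto intro!: derivative_eq_intros simp: has_real_derivative_iff_has_vector_derivative[symmetric])
   from vector_diff_chain_at[OF this R(5)[OF r']]
   have dz: "((\<lambda>r. z (s * r)) has_vector_derivative s *\<^sub>R geo_field M C (z (s * r'))) (at r')" by (simp add: o_def)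
   have 1: "((\<lambda>r. fst (z (s * r))) has_vector_derivative s *\<^sub>R snd (z (s * r'))) (at r')"
    using bounded_linear.has_vector_derivative[OF bounded_linear_fst dz] by (simp add: geo_field_def)
   have "((\<lambda>r. snd (z (s * r))) has_vector_derivative s *\<^sub>R (- gam M C (fst (z (s * r'))) (snd (z (s * r'))) (snd (z (s * r'))))) (at r')"
    using bounded_linear.has_vector_derivative[OF bounded_linear_snd dz] by (simp add: geo_field_def)
   from bounded_linear.has_vector_derivative[OF bounded_linear_scaleR_right[of s] this]
   have 2: "((\<lambda>r. s *\<^sub>R snd (z (s * r))) has_vector_derivative - gam M C (fst (z' r')) (snd (z' r')) (snd (z' r'))) (at r')"
    by (simp add: z'_def gam_linear)
   show "(z' has_vector_derivative geo_field M C (z' r')) (at r')"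
    using has_vector_derivative_Pair[OF 1 2] unfolding z'_def[abs_def] geo_field_def by (simp add: gam_linear)
  qed (use R s in auto)
  then show ?thesis unfolding geodesic_at_def by blast
 qed
 show ?thesis
 proof (rule geodesic_unique[of "max b (a / s)" "t + 1" "geod (s *\<^sub>R \<xi>)" ?g 0 "chart_at M q" "u (s *\<^sub>R \<xi>)"])
  show "0 \<in> {max b (a / s)<..<t + 1}" "t \<in> {max b (a / s)<..<t + 1}"
   using a(1) b(1) s t divide_neg_pos[OF a(1) s] by auto
  have "((\<lambda>r. s * r) has_vector_derivative s) (at 0)"
   by (auto intro!: derivative_eq_intros simp: has_real_derivative_iff_has_vector_derivative[symmetric])
  from vector_diff_chain_at[OF this, of "chart_map (chart_at M q) \<circ> geod \<xi>" "u \<xi>"] a(4)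
  show "((chart_map (chart_at M q) \<circ> ?g) has_vector_derivative u (s *\<^sub>R \<xi>)) (at 0)"
   by (simp add: o_def linear_cmul[OF bounded_linear.linear[OF u]])
 qed (use b g a(3) chart_at in auto)
qed

lemma expo_ray: "0 < t \<Longrightarrow> expo (t *\<^sub>R \<xi>) = geod \<xi> t"
 using geod_scale[of t 1 \<xi>] by (simp add: expo_def)

lemma expo_rdist: "rdist M q (expo \<xi>) \<le> norm \<xi>"
 using geod_rdist[of 1 \<xi>] by (simp add: expo_def)

lemma expo_ray_C1:
 assumes t: "0 < t"
 shows "C1_at M (\<lambda>t. expo (t *\<^sub>R \<theta>)) t" "speed M (\<lambda>t. expo (t *\<^sub>R \<theta>)) t = norm \<theta>"
proof -
 obtain C z d where g: "geo_rep M C (geod \<theta>) z t d" using geod_geodesic[of t \<theta>] t unfolding geodesic_at_def by auto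
 have "C1_at M (geod \<theta>) (1 * t + 0)" using geo_rep_velocity(3)[OF g, of t] geo_repD(2)[OF g] by simp
 note A = C1_at_affine[OF this t, of "\<lambda>t. expo (t *\<^sub>R \<theta>)"]
 show "C1_at M (\<lambda>t. expo (t *\<^sub>R \<theta>)) t" by (rule A(1)) (use t in \<open>auto simp: expo_ray\<close>)
 have "speed M (\<lambda>t. expo (t *\<^sub>R \<theta>)) t = \<bar>1\<bar> * speed M (geod \<theta>) (1 * t + 0)"
  by (rule A(2)) (use t in \<open>auto simp: expo_ray\<close>)
 then show "speed M (\<lambda>t. expo (t *\<^sub>R \<theta>)) t = norm \<theta>" using geod_speed[of t \<theta>] t by simp
qed

lemma expo_C1:
 obtains C N E' where "C \<in> atlas M" "open N" "\<xi> \<in> N" "\<And>\<eta>. \<eta> \<in> N \<Longrightarrow> expo \<eta> \<in> chart_dom C"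
  "\<And>\<eta>. \<eta> \<in> N \<Longrightarrow> (chart_map C \<circ> expo has_derivative blinfun_apply (E' \<eta>)) (at \<eta>)" "continuous_on N E'"
  "\<And>\<eta>. \<eta> \<in> N \<Longrightarrow> continuous (at \<eta>) expo"
proof -
 obtain C Z W N d where r: "\<xi> \<in> N" "geo_family_rep M C geod Z W N 1 d" by (rule geod_rep[of 1 \<xi>]) simp
 note R = geo_family_repD[OF r(2)]
 have g: "geo_rep M C (geod \<eta>) (Z \<eta>) 1 d" if "\<eta> \<in> N" for \<eta> by (rule R(2)[OF that])
 have d: "\<bar>1 - 1\<bar> < d" using geo_repD(2)[OF g[OF r(1)]] by simp
 have e: "expo = (\<lambda>\<xi>. geod \<xi> 1)" by (simp add: expo_def fun_eq_iff)
 let ?F = "Blinfun fst :: ((real^'n) \<times> (real^'n)) \<Rightarrow>\<^sub>L (real^'n)"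
 have app: "blinfun_apply ?F = fst" by (rule bounded_linear_Blinfun_apply[OF bounded_linear_fst])
 show ?thesis
 proof (rule that[of C N "\<lambda>\<eta>. ?F o\<^sub>L W \<eta> 1"])
  fix \<eta> assume \<eta>: "\<eta> \<in> N"
  show "expo \<eta> \<in> chart_dom C" using geo_repD(3)[OF g[OF \<eta>] d] by (simp add: expo_def)
  show "(chart_map C \<circ> expo has_derivative blinfun_apply (?F o\<^sub>L W \<eta> 1)) (at \<eta>)"
   using geo_family_position(2)[OF r(2) \<eta> d] unfolding e by (simp add: blinfun_compose.rep_eq o_def app)
  show "continuous (at \<eta>) expo" using geo_family_position(1)[OF r(2) \<eta> d] unfolding e .
 next
  show "continuous_on N (\<lambda>\<eta>. ?F o\<^sub>L W \<eta> 1)"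
   by (intro bounded_bilinear.continuous_on[OF bounded_bilinear_blinfun_compose] continuous_on_const R(5)[OF d])
 qed (use geo_repD(1)[OF g[OF r(1)]] R(1) r(1) in auto)
qed

text \<open>The squared length of the Jacobi field along the ray \<open>\<theta>\<close> with initial derivative \<open>w\<close>, and its
 inner product with the velocity of the ray.\<close>
definition jsq :: "real^'n \<Rightarrow> real^'n \<Rightarrow> real \<Rightarrow> real" where
 "jsq \<theta> w t = pullback_metric M (\<lambda>\<xi>. geod \<xi> t) \<theta> w w"

definition jvel :: "real^'n \<Rightarrow> real^'n \<Rightarrow> real \<Rightarrow> real" where
 "jvel \<theta> w t = pullback_metric M (\<lambda>\<xi>. geod \<xi> t) \<theta> w \<theta> / t"

text \<open>With Y the Jacobi field, U its covariant derivative and V the velocity, \<open>h\<close>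
  is the product of U and Y, and its derivative \<open>k\<close> is |U|^2 minus the curvature term
  of Y and V. The bound on the square of \<open>h\<close> is Cauchy-Schwarz, with |U|^2 estimated by
  the curvature bound in the plane of Y and V. The last clause records the initial data: Y = 0 and
  |U| = |w|.\<close>

lemma jacobi_local:
 assumes t: "0 \<le> t"
 obtains d h k where "0 < d"
  "\<And>s. \<bar>s - t\<bar> < d \<Longrightarrow> (jsq \<theta> w has_real_derivative 2 * h s) (at s)"
  "\<And>s. \<bar>s - t\<bar> < d \<Longrightarrow> (h has_real_derivative k s) (at s)"
  "\<And>s. \<bar>s - t\<bar> < d \<Longrightarrow> 0 \<le> jsq \<theta> w s"
  "\<And>s. \<bar>s - t\<bar> < d \<Longrightarrow> 0 < s \<Longrightarrow> (h s)\<^sup>2 \<le> jsq \<theta> w s * (k s - c\<^sup>2 * (jsq \<theta> w s * (norm \<theta>)\<^sup>2 - (jvel \<theta> w s)\<^sup>2))"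
  "\<And>s. \<bar>s - t\<bar> < d \<Longrightarrow> 0 < s \<Longrightarrow> c\<^sup>2 * (jsq \<theta> w s * (norm \<theta>)\<^sup>2 - (jvel \<theta> w s)\<^sup>2) \<le> k s"
  "\<And>s. \<bar>s - t\<bar> < d \<Longrightarrow> 0 < s \<Longrightarrow> (jvel \<theta> w s)\<^sup>2 \<le> jsq \<theta> w s * (norm \<theta>)\<^sup>2"
  "\<And>s. \<bar>s - t\<bar> < d \<Longrightarrow> 0 < s \<Longrightarrow> (jvel \<theta> w has_real_derivative \<theta> \<bullet> w) (at s)"
  "\<And>s. \<bar>s - t\<bar> < d \<Longrightarrow> 0 < s \<Longrightarrow> pullback_metric M (\<lambda>\<xi>. geod \<xi> s) \<theta> \<theta> \<theta> = s\<^sup>2 * (norm \<theta>)\<^sup>2"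
  "t = 0 \<Longrightarrow> jsq \<theta> w 0 = 0 \<and> h 0 = 0 \<and> k 0 = (norm w)\<^sup>2 \<and> (jvel \<theta> w \<longlongrightarrow> 0) (at_right 0)"
proof -
 obtain C ZZ W N d where r: "\<theta> \<in> N" "geo_family_rep M C geod ZZ W N t d" by (rule geod_rep[OF t])
 note R = geo_family_repD[OF r(2)]
 have g: "geo_rep M C (geod \<xi>) (ZZ \<xi>) t d" if "\<xi> \<in> N" for \<xi> by (rule R(2)[OF that])
 have C: "C \<in> atlas M" and d: "0 < d" using geo_repD(1,2)[OF g[OF r(1)]] by auto
 define X where "X s = fst (ZZ \<theta> s)" for s
 define V where "V s = snd (ZZ \<theta> s)" for s
 define Y where "Y s = fst (W \<theta> s w)" for s
 define Z where "Z s = snd (W \<theta> s w)" for s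
 have img: "X s \<in> chart_img C" if "\<bar>s - t\<bar> < d" for s unfolding X_def by (rule geo_rep_velocity(5)[OF g[OF r(1)] that])
 have dX: "(X has_vector_derivative V s) (at s)" and dV: "(V has_vector_derivative - gam M C (X s) (V s) (V s)) (at s)" if "\<bar>s - t\<bar> < d" for s
  using bounded_linear.has_vector_derivative[OF bounded_linear_fst geo_repD(5)[OF g[OF r(1)] that]]
   bounded_linear.has_vector_derivative[OF bounded_linear_snd geo_repD(5)[OF g[OF r(1)] that]]
  unfolding X_def V_def by (simp_all add: geo_field_def)
 have dY: "(Y has_vector_derivative Z s) (at s)"
  and dZ: "(Z has_vector_derivative - (dgam M C (X s) (Y s) (V s) (V s) + gam M C (X s) (Z s) (V s) + gam M C (X s) (V s) (Z s))) (at s)" if "\<bar>s - t\<bar> < d" for s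
  using bounded_linear.has_vector_derivative[OF bounded_linear_fst R(4)[OF r(1) that]]
   bounded_linear.has_vector_derivative[OF bounded_linear_snd R(4)[OF r(1) that]]
  unfolding Y_def Z_def V_def X_def by (simp_all add: geo_field'_def)
 define U where "U s = Z s + gam M C (X s) (V s) (Y s)" for s
 define h where "h s = ginner M C (X s) (U s) (Y s)" for s
 define k where "k s = ginner M C (X s) (U s) (U s) - ginner M C (X s) (riemann_tensor M C (X s) (Y s) (V s) (V s)) (Y s)" for s
 note J = jacobi_derivatives[where T="ball t d" and X=X and V=V and Y=Y and Z=Z, OF C _ open_ball, folded U_def]
 have inb: "s \<in> ball t d" if "\<bar>s - t\<bar> < d" for s using that by (simp add: ball_real_abs del: mem_ball)
 have der: "((\<lambda>s. ginner M C (X s) (Y s) (Y s)) has_real_derivative 2 * h s) (at s)" "(h has_real_derivative k s) (at s)"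
   "((\<lambda>s. ginner M C (X s) (Y s) (V s)) has_real_derivative ginner M C (X s) (U s) (V s)) (at s)" if s: "\<bar>s - t\<bar> < d" for s
  unfolding h_def[abs_def] k_def
  by (rule J(1) J(2) J(3); use s img inb dX dV dY dZ in \<open>simp add: ball_real_abs del: mem_ball\<close>)+
 have jsq: "jsq \<theta> w s = ginner M C (X s) (Y s) (Y s)" if "\<bar>s - t\<bar> < d" for s
  unfolding jsq_def X_def Y_def by (rule geo_family_position(3)[OF r(2,1) that])
 \<comment> \<open>By \<open>geod_scale\<close> the geodesic with parameter
   \<open>x *\<^sub>R \<theta>\<close> at time \<open>s\<close> is at the point that the one with
   parameter \<open>\<theta>\<close> reaches at time \<open>x * s\<close>. Differentiation at
   \<open>x = 1\<close> shows that the Jacobi field of \<open>\<theta>\<close> is \<open>s\<close>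
   times the velocity.\<close>
 have Vel: "fst (W \<theta> s \<theta>) = s *\<^sub>R V s" if s: "\<bar>s - t\<bar> < d" "0 < s" for s
 proof -
  have 1: "((\<lambda>x. fst (ZZ (x *\<^sub>R \<theta>) s)) has_vector_derivative fst (W \<theta> s \<theta>)) (at 1)"
  proof -
   have "((\<lambda>x. x *\<^sub>R \<theta>) has_derivative (\<lambda>x. x *\<^sub>R \<theta>)) (at 1)" by (auto intro!: derivative_eq_intros)
   from has_derivative_compose[OF this, of "\<lambda>\<xi>. fst (ZZ \<xi> s)" "\<lambda>w. fst (W \<theta> s w)"] has_derivative_fst[OF R(3)[OF r(1) s(1)]]
   show ?thesis by (simp add: has_vector_derivative_def blinfun.scaleR_right)
  qed
  have 2: "((\<lambda>x. chart_map C (geod \<theta> (x * s))) has_vector_derivative s *\<^sub>R V s) (at 1)"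
  proof -
   have "((\<lambda>x. x * s) has_vector_derivative s) (at 1)"
    by (auto intro!: derivative_eq_intros simp: has_real_derivative_iff_has_vector_derivative[symmetric])
   from vector_diff_chain_at[OF this, of "chart_map C \<circ> geod \<theta>" "V s"] geo_rep_velocity(1)[OF g[OF r(1)] s(1)]
   show ?thesis by (simp add: o_def V_def)
  qed
  have oN: "open ((\<lambda>x. x *\<^sub>R \<theta>) -` N \<inter> {0<..})"
   by (intro open_Int open_vimage[OF R(1)] continuous_intros open_greaterThan)
  have "((\<lambda>x. chart_map C (geod \<theta> (x * s))) has_vector_derivative fst (W \<theta> s \<theta>)) (at 1)"
   by (rule has_vector_derivative_transform_within_open[OF 1 oN])
     (use r(1) s geo_repD(4)[OF g s(1)] geod_scale[of _ s \<theta>] in auto)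
  then show ?thesis using 2 vector_derivative_unique_at by blast
 qed
 have jvel: "jvel \<theta> w s = ginner M C (X s) (Y s) (V s)" if s: "\<bar>s - t\<bar> < d" "0 < s" for s
  unfolding jvel_def geo_family_position(3)[OF r(2,1) s(1)] Vel[OF s] using s by (simp add: ginner_linear X_def Y_def)
 have VV: "ginner M C (fst (ZZ \<xi> s)) (snd (ZZ \<xi> s)) (snd (ZZ \<xi> s)) = \<xi> \<bullet> \<xi>" if "\<xi> \<in> N" "\<bar>s - t\<bar> < d" "0 < s" for \<xi> s
  using geo_rep_velocity(4)[OF g that(2)] geod_speed[of s \<xi>] that by (simp add: norm_eq_sqrt_inner)
 \<comment> \<open>The squared speed of the geodesic with parameter \<open>\<xi>\<close> is
   \<open>\<xi> \<bullet> \<xi>\<close> at every positive time; it is differentiated in the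
   parameter instead of in time.\<close>
 have UV: "ginner M C (X s) (U s) (V s) = \<theta> \<bullet> w" if s: "\<bar>s - t\<bar> < d" "0 < s" for s
 proof -
  have "((\<lambda>\<xi>. ginner M C (fst (ZZ \<xi> s)) (snd (ZZ \<xi> s)) (snd (ZZ \<xi> s))) has_derivative
    (\<lambda>h. dginner M C (fst (ZZ \<theta> s)) (fst (W \<theta> s h)) (snd (ZZ \<theta> s)) (snd (ZZ \<theta> s)) + ginner M C (fst (ZZ \<theta> s)) (snd (W \<theta> s h)) (snd (ZZ \<theta> s))
     + ginner M C (fst (ZZ \<theta> s)) (snd (ZZ \<theta> s)) (snd (W \<theta> s h)))) (at \<theta>)" (is "(?f has_derivative ?L) _")
   by (rule ginner_has_derivative[where x="\<lambda>\<xi>. fst (ZZ \<xi> s)", OF C img[OF s(1), unfolded X_def] has_derivative_fst[OF R(3)[OF r(1) s(1)]]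
       has_derivative_snd[OF R(3)[OF r(1) s(1)]] has_derivative_snd[OF R(3)[OF r(1) s(1)]]])
  moreover have "(?f has_derivative (\<lambda>h. 2 * (\<theta> \<bullet> h))) (at \<theta>)"
  proof (rule has_derivative_transform_within_open[OF _ R(1) r(1)])
   show "((\<lambda>\<xi>. \<xi> \<bullet> \<xi>) has_derivative (\<lambda>h. 2 * (\<theta> \<bullet> h))) (at \<theta>)"
    by (rule has_derivative_eq_rhs, rule has_derivative_inner[OF has_derivative_ident has_derivative_ident]) (simp add: inner_commute)
  qed (use VV s in auto)
  ultimately have "?L w = 2 * (\<theta> \<bullet> w)" by (rule has_derivative_unique[THEN fun_cong])
  then have "dginner M C (X s) (Y s) (V s) (V s) + ginner M C (X s) (Z s) (V s) + ginner M C (X s) (V s) (Z s) = 2 * (\<theta> \<bullet> w)"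
   unfolding X_def Y_def Z_def V_def .
  then show ?thesis unfolding metric_compatible[OF C img[OF s(1)]] U_def
   using ginner_sym[OF C img[OF s(1)], of "V s"] gam_sym[OF C img[OF s(1)], of "Y s" "V s"] by (simp add: ginner_linear)
 qed
 have VVt: "ginner M C (X s) (V s) (V s) = (norm \<theta>)\<^sup>2" if "\<bar>s - t\<bar> < d" "0 < s" for s
  using VV[OF r(1) that] by (simp add: X_def V_def power2_norm_eq_inner)
 have U_le: "ginner M C (X s) (U s) (U s) \<le> k s - c\<^sup>2 * (jsq \<theta> w s * (norm \<theta>)\<^sup>2 - (jvel \<theta> w s)\<^sup>2)" if s: "\<bar>s - t\<bar> < d" "0 < s" for s
  using curvature_bound[OF curv C img[OF s(1)], of "Y s" "V s"] by (simp add: k_def jsq[OF s(1)] jvel[OF s] VVt[OF s])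
 have nn: "0 \<le> ginner M C (X s) a a" if "\<bar>s - t\<bar> < d" for s a by (rule ginner_nonneg[OF C img[OF that]])
 show ?thesis
 proof (rule that[OF d, of h k])
  fix s assume s: "\<bar>s - t\<bar> < d"
  show "(jsq \<theta> w has_real_derivative 2 * h s) (at s)"
   using has_field_derivative_transform_within_open[OF der(1)[OF s] open_ball inb[OF s]] jsq by (simp add: ball_real_abs del: mem_ball)
  show "(h has_real_derivative k s) (at s)" by (rule der(2)[OF s])
  show "0 \<le> jsq \<theta> w s" using nn[OF s] jsq[OF s] by simp
  assume s0: "0 < s"
  show "(h s)\<^sup>2 \<le> jsq \<theta> w s * (k s - c\<^sup>2 * (jsq \<theta> w s * (norm \<theta>)\<^sup>2 - (jvel \<theta> w s)\<^sup>2))"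
  proof -
   have "(h s)\<^sup>2 \<le> ginner M C (X s) (U s) (U s) * jsq \<theta> w s"
    unfolding h_def jsq[OF s] by (rule ginner_cauchy_schwarz[OF C img[OF s]])
   also have "\<dots> \<le> (k s - c\<^sup>2 * (jsq \<theta> w s * (norm \<theta>)\<^sup>2 - (jvel \<theta> w s)\<^sup>2)) * jsq \<theta> w s"
    by (rule mult_right_mono[OF U_le[OF s s0]]) (use nn[OF s] jsq[OF s] in simp)
   finally show ?thesis by (simp add: mult.commute)
  qed
  show "c\<^sup>2 * (jsq \<theta> w s * (norm \<theta>)\<^sup>2 - (jvel \<theta> w s)\<^sup>2) \<le> k s" using U_le[OF s s0] nn[OF s, of "U s"] by simp
  show "(jvel \<theta> w s)\<^sup>2 \<le> jsq \<theta> w s * (norm \<theta>)\<^sup>2"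
   unfolding jvel[OF s s0] jsq[OF s] VVt[OF s s0, symmetric] by (rule ginner_cauchy_schwarz[OF C img[OF s]])
  show "(jvel \<theta> w has_real_derivative \<theta> \<bullet> w) (at s)"
   unfolding UV[OF s s0, symmetric]
   by (rule has_field_derivative_transform_within_open[OF der(3)[OF s], of "ball t d \<inter> {0<..}"])
     (use inb[OF s] s0 jvel in \<open>auto simp: ball_real_abs simp del: mem_ball\<close>)
  show "pullback_metric M (\<lambda>\<xi>. geod \<xi> s) \<theta> \<theta> \<theta> = s\<^sup>2 * (norm \<theta>)\<^sup>2"
   unfolding geo_family_position(3)[OF r(2,1) s] Vel[OF s s0] using VVt[OF s s0] by (simp add: ginner_linear X_def power2_eq_square)
 next
  assume t0: "t = 0"
  have 0: "\<bar>0 - t\<bar> < d" using d t0 by simp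
  have dom: "q \<in> chart_dom C" using geo_repD(3)[OF g[OF r(1)] 0] geod_0 by simp
  let ?C0 = "chart_at M q" let ?T = "frechet_derivative (transition ?C0 C) (at (chart_map ?C0 q))"
  have x0: "chart_map ?C0 q \<in> chart_map ?C0 ` (chart_dom ?C0 \<inter> chart_dom C)" using chart_at(2) dom by blast
  have blT: "bounded_linear ?T" by (rule has_derivative_bounded_linear[OF transition_has_derivative[OF chart_at(1) C x0]])
  have fst0: "fst (ZZ \<xi> 0) = chart_map C q" and snd0: "snd (ZZ \<xi> 0) = ?T (u \<xi>)" if \<xi>: "\<xi> \<in> N" for \<xi>
  proof -
   show "fst (ZZ \<xi> 0) = chart_map C q" using geo_repD(4)[OF g[OF \<xi>] 0] geod_0 by simp
   obtain a where a: "a < 0" "\<And>t. a < t \<Longrightarrow> geodesic_at M (geod \<xi>) t" "geod \<xi> 0 = q"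
  "((chart_map (chart_at M q) \<circ> geod \<xi>) has_vector_derivative u \<xi>) (at 0)" "continuous (at 0) (geod \<xi>)"
    by (fact geod_start[of \<xi>])
   have "(chart_map C \<circ> geod \<xi> has_derivative (\<lambda>a. frechet_derivative (transition ?C0 C) (at (chart_map ?C0 (geod \<xi> 0))) (a *\<^sub>R u \<xi>))) (at 0)"
    by (rule has_derivative_chart_change(1)[OF chart_at(1) _ C _ a(5) a(4)[unfolded has_vector_derivative_def]])
      (use chart_at(2) dom in \<open>auto simp: geod_0\<close>)
   then have "((chart_map C \<circ> geod \<xi>) has_vector_derivative ?T (u \<xi>)) (at 0)"
    unfolding has_vector_derivative_def geod_0 by (simp add: linear_cmul[OF bounded_linear.linear[OF blT]])
   then show "snd (ZZ \<xi> 0) = ?T (u \<xi>)" using geo_rep_velocity(1)[OF g[OF \<xi>] 0] vector_derivative_unique_at by blast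
  qed
  \<comment> \<open>At time 0 every geodesic of the family is at \<open>q\<close>, so the position
    is constant in the parameter, while the velocity is the image of \<open>u \<xi>\<close> under
    the fixed linear map \<open>?T\<close>.\<close>
  have dY0: "((\<lambda>\<xi>. fst (ZZ \<xi> 0)) has_derivative (\<lambda>h. 0)) (at \<theta>)"
   by (rule has_derivative_transform_within_open[OF has_derivative_const[of "chart_map C q"] R(1) r(1)]) (simp add: fst0)
  have Y0: "Y 0 = 0" using fun_cong[OF has_derivative_unique[OF has_derivative_fst[OF R(3)[OF r(1) 0]] dY0], of w] by (simp add: Y_def)
  have dZ0: "((\<lambda>\<xi>. snd (ZZ \<xi> 0)) has_derivative (\<lambda>h. ?T (u h))) (at \<theta>)"
   by (rule has_derivative_transform_within_open[OF bounded_linear.has_derivative[OF blT bounded_linear.has_derivative[OF u has_derivative_ident]] R(1) r(1)])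
     (simp add: snd0)
  have Z0: "Z 0 = ?T (u w)" using fun_cong[OF has_derivative_unique[OF has_derivative_snd[OF R(3)[OF r(1) 0]] dZ0], of w] by (simp add: Z_def)
  have "ginner M C (X 0) (?T (u w)) (?T (u w)) = ginner M ?C0 (chart_map ?C0 q) (u w) (u w)"
   using ginner_transition[OF chart_at(1) C x0, of "u w" "u w"] transition_map[OF chart_at(1) chart_at(2), of q C] fst0[OF r(1)] by (simp add: X_def)
  then have ZZ0: "ginner M C (X 0) (Z 0) (Z 0) = (norm w)\<^sup>2" by (simp add: Z0 iso power2_norm_eq_inner)
  have "isCont (\<lambda>s. ginner M C (X s) (Y s) (V s)) 0" using der(3)[OF 0] DERIV_isCont by blast
  then have "((\<lambda>s. ginner M C (X s) (Y s) (V s)) \<longlongrightarrow> 0) (at_right 0)"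
   using tendsto_mono[OF at_le[OF subset_UNIV]] by (fastforce simp: Y0 ginner_linear isCont_def)
  moreover have "\<forall>\<^sub>F s in at_right 0. ginner M C (X s) (Y s) (V s) = jvel \<theta> w s"
   unfolding eventually_at_right[OF zero_less_one] using d jvel t0 by (intro exI[of _ d]) auto
  ultimately have "(jvel \<theta> w \<longlongrightarrow> 0) (at_right 0)" by (rule Lim_transform_eventually)
  then show "jsq \<theta> w 0 = 0 \<and> h 0 = 0 \<and> k 0 = (norm w)\<^sup>2 \<and> (jvel \<theta> w \<longlongrightarrow> 0) (at_right 0)"
   using jsq[OF 0] ZZ0 by (simp add: h_def k_def U_def Y0 ginner_linear gam_linear)
 qed
qed

end

section \<open>Growth of Jacobi fields along rays\<close>

context exp_map
begin

text \<open>The local functions \<open>h\<close> and \<open>k\<close> of \<open>jacobi_local\<close>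
  are determined by \<open>jsq\<close> through differentiation, so they are restrictions of global
  functions defined with \<open>deriv\<close>.\<close>

lemma jacobi_global:
 obtains h k where "\<And>t. 0 < t \<Longrightarrow> (jsq \<theta> w has_real_derivative 2 * h t) (at t)" "\<And>t. 0 < t \<Longrightarrow> (h has_real_derivative k t) (at t)"
  "\<And>t. 0 < t \<Longrightarrow> (h t)\<^sup>2 \<le> jsq \<theta> w t * (k t - c\<^sup>2 * (jsq \<theta> w t * (norm \<theta>)\<^sup>2 - (jvel \<theta> w t)\<^sup>2))"
  "\<And>t. 0 < t \<Longrightarrow> c\<^sup>2 * (jsq \<theta> w t * (norm \<theta>)\<^sup>2 - (jvel \<theta> w t)\<^sup>2) \<le> k t"
  "(jsq \<theta> w \<longlongrightarrow> 0) (at_right 0)" "(h \<longlongrightarrow> 0) (at_right 0)" "((\<lambda>t. jsq \<theta> w t / t\<^sup>2) \<longlongrightarrow> (norm w)\<^sup>2) (at_right 0)"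
proof -
 define h where "h t = deriv (jsq \<theta> w) t / 2" for t
 define k where "k t = deriv h t" for t
 have loc: "\<exists>h' k' d. 0 < d \<and> (\<forall>s. \<bar>s - t\<bar> < d \<longrightarrow> (jsq \<theta> w has_real_derivative 2 * h s) (at s) \<and> (h has_real_derivative k s) (at s) \<and> h s = h' s \<and> k s = k' s)
   \<and> (\<forall>s. \<bar>s - t\<bar> < d \<longrightarrow> 0 < s \<longrightarrow> (h' s)\<^sup>2 \<le> jsq \<theta> w s * (k' s - c\<^sup>2 * (jsq \<theta> w s * (norm \<theta>)\<^sup>2 - (jvel \<theta> w s)\<^sup>2))
     \<and> c\<^sup>2 * (jsq \<theta> w s * (norm \<theta>)\<^sup>2 - (jvel \<theta> w s)\<^sup>2) \<le> k' s)
   \<and> (t = 0 \<longrightarrow> jsq \<theta> w 0 = 0 \<and> h' 0 = 0 \<and> k' 0 = (norm w)\<^sup>2)" if t: "0 \<le> t" for t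
  using t
 proof (rule jacobi_local[of t \<theta> w])
  fix d h' k'
  assume d: "0 < d" and 1: "\<And>s. \<bar>s - t\<bar> < d \<Longrightarrow> (jsq \<theta> w has_real_derivative 2 * h' s) (at s)"
   and 2: "\<And>s. \<bar>s - t\<bar> < d \<Longrightarrow> (h' has_real_derivative k' s) (at s)"
   and 3: "\<And>s. \<bar>s - t\<bar> < d \<Longrightarrow> 0 < s \<Longrightarrow> (h' s)\<^sup>2 \<le> jsq \<theta> w s * (k' s - c\<^sup>2 * (jsq \<theta> w s * (norm \<theta>)\<^sup>2 - (jvel \<theta> w s)\<^sup>2))"
   and 4: "\<And>s. \<bar>s - t\<bar> < d \<Longrightarrow> 0 < s \<Longrightarrow> c\<^sup>2 * (jsq \<theta> w s * (norm \<theta>)\<^sup>2 - (jvel \<theta> w s)\<^sup>2) \<le> k' s"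
   and 5: "t = 0 \<Longrightarrow> jsq \<theta> w 0 = 0 \<and> h' 0 = 0 \<and> k' 0 = (norm w)\<^sup>2 \<and> (jvel \<theta> w \<longlongrightarrow> 0) (at_right 0)"
  have hh: "h s = h' s" if "\<bar>s - t\<bar> < d" for s using DERIV_imp_deriv[OF 1[OF that]] by (simp add: h_def)
  have dh: "(h has_real_derivative k' s) (at s)" if "\<bar>s - t\<bar> < d" for s
   by (rule has_field_derivative_transform_within_open[OF 2[OF that] open_ball, of t d])
     (use that hh in \<open>auto simp: ball_real_abs simp del: mem_ball\<close>)
  have kk: "k s = k' s" if "\<bar>s - t\<bar> < d" for s using DERIV_imp_deriv[OF dh[OF that]] by (simp add: k_def)
  have "\<forall>s. \<bar>s - t\<bar> < d \<longrightarrow> (jsq \<theta> w has_real_derivative 2 * h s) (at s) \<and> (h has_real_derivative k s) (at s) \<and> h s = h' s \<and> k s = k' s"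
   using 1 dh hh kk by simp
  note all = this
  show ?thesis
   by (rule exI[of _ h'], rule exI[of _ k'], rule exI[of _ d], intro conjI, rule d, rule all, use 3 4 in blast, use 5 in blast)
 qed
 obtain d where L0: "0 < d" "\<And>s. \<bar>s\<bar> < d \<Longrightarrow> (jsq \<theta> w has_real_derivative 2 * h s) (at s)"
   "\<And>s. \<bar>s\<bar> < d \<Longrightarrow> (h has_real_derivative k s) (at s)" "jsq \<theta> w 0 = 0" "h 0 = 0" "k 0 = (norm w)\<^sup>2"
 proof -
  from loc[of 0] obtain h' k' d where "0 < d" and 1: "\<forall>s. \<bar>s\<bar> < d \<longrightarrow> (jsq \<theta> w has_real_derivative 2 * h s) (at s) \<and> (h has_real_derivative k s) (at s) \<and> h s = h' s \<and> k s = k' s"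
   and 2: "jsq \<theta> w 0 = 0" "h' 0 = 0" "k' 0 = (norm w)\<^sup>2" by auto
  then show thesis using 1[rule_format, of 0] by (intro that[of d]) auto
 qed
 have f0: "(jsq \<theta> w \<longlongrightarrow> 0) (at_right 0)" and h0: "(h \<longlongrightarrow> 0) (at_right 0)"
  using DERIV_isCont[OF L0(2)[of 0]] DERIV_isCont[OF L0(3)[of 0]] L0(1,4,5)
  by (auto simp: isCont_def intro: tendsto_mono[OF at_le[OF subset_UNIV]])
 have "((\<lambda>s. h s / s) \<longlongrightarrow> (norm w)\<^sup>2) (at 0)"
  using L0(3)[of 0] L0(1,5,6) by (simp add: has_field_derivative_iff)
 then have hs: "((\<lambda>s. h s / s) \<longlongrightarrow> (norm w)\<^sup>2) (at_right 0)" by (rule tendsto_mono[OF at_le[OF subset_UNIV]])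
 have ev: "\<forall>\<^sub>F s in at_right 0. 0 < s \<and> \<bar>s\<bar> < d" unfolding eventually_at_right[OF zero_less_one] using L0(1) by (intro exI[of _ d]) auto
 \<comment> \<open>By l'Hospital's rule the limit is that of \<open>h s / s\<close>, which is the
   derivative of \<open>h\<close> at 0.\<close>
 have "((\<lambda>t. jsq \<theta> w t / t\<^sup>2) \<longlongrightarrow> (norm w)\<^sup>2) (at_right 0)"
 proof (rule lhopital_right_0[where f'="\<lambda>t. 2 * h t" and g'="\<lambda>t. 2 * t"])
  show "((\<lambda>t::real. t\<^sup>2) \<longlongrightarrow> 0) (at_right 0)" by (intro tendsto_eq_intros) auto
  show "\<forall>\<^sub>F s in at_right 0. (jsq \<theta> w has_real_derivative 2 * h s) (at s)" using ev by eventually_elim (auto intro: L0(2))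
  show "\<forall>\<^sub>F s::real in at_right 0. ((\<lambda>t. t\<^sup>2) has_real_derivative 2 * s) (at s)"
   by (intro always_eventually allI) (auto intro!: derivative_eq_intros)
  show "((\<lambda>s. 2 * h s / (2 * s)) \<longlongrightarrow> (norm w)\<^sup>2) (at_right 0)" using hs by simp
  show "\<forall>\<^sub>F s::real in at_right 0. s\<^sup>2 \<noteq> 0" "\<forall>\<^sub>F s::real in at_right 0. 2 * s \<noteq> 0" using ev by (eventually_elim, simp)+
 qed (rule f0)
 moreover have "(jsq \<theta> w has_real_derivative 2 * h t) (at t) \<and> (h has_real_derivative k t) (at t) \<and>
   (h t)\<^sup>2 \<le> jsq \<theta> w t * (k t - c\<^sup>2 * (jsq \<theta> w t * (norm \<theta>)\<^sup>2 - (jvel \<theta> w t)\<^sup>2)) \<and> c\<^sup>2 * (jsq \<theta> w t * (norm \<theta>)\<^sup>2 - (jvel \<theta> w t)\<^sup>2) \<le> k t" if t: "0 < t" for t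
 proof -
  from loc[OF less_imp_le[OF t]] obtain h' k' d where d: "0 < d"
   and L: "\<forall>s. \<bar>s - t\<bar> < d \<longrightarrow> (jsq \<theta> w has_real_derivative 2 * h s) (at s) \<and> (h has_real_derivative k s) (at s) \<and> h s = h' s \<and> k s = k' s"
   "\<forall>s. \<bar>s - t\<bar> < d \<longrightarrow> 0 < s \<longrightarrow> (h' s)\<^sup>2 \<le> jsq \<theta> w s * (k' s - c\<^sup>2 * (jsq \<theta> w s * (norm \<theta>)\<^sup>2 - (jvel \<theta> w s)\<^sup>2))
     \<and> c\<^sup>2 * (jsq \<theta> w s * (norm \<theta>)\<^sup>2 - (jvel \<theta> w s)\<^sup>2) \<le> k' s" by (elim exE conjE)
  have td: "\<bar>t - t\<bar> < d" using d by simp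
  from L(1)[rule_format, OF td] L(2)[rule_format, OF td t] show ?thesis by metis
 qed
 ultimately show ?thesis using that[of h k] f0 h0 by blast
qed

text \<open>The Gauss lemma: \<open>jvel\<close> has the constant derivative
  \<open>\<theta> \<bullet> w\<close> and tends to 0 at time 0.\<close>

lemma jvel_eq:
 assumes t: "0 < t"
 shows "jvel \<theta> w t = t * (\<theta> \<bullet> w)"
proof -
 have der: "(jvel \<theta> w has_real_derivative \<theta> \<bullet> w) (at t)" if "0 < t" for t
  using less_imp_le[OF that] by (rule jacobi_local[of t \<theta> w]) (use that in auto)
 have lim: "(jvel \<theta> w \<longlongrightarrow> 0) (at_right 0)" by (rule jacobi_local[of 0 \<theta> w]) auto
 have "\<exists>b. \<forall>t\<in>{0<..}. jvel \<theta> w t - t * (\<theta> \<bullet> w) = b"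
  by (rule has_field_derivative_zero_constant) (auto intro!: derivative_eq_intros der[THEN has_field_derivative_at_within])
 then obtain b where b: "\<And>t. 0 < t \<Longrightarrow> jvel \<theta> w t - t * (\<theta> \<bullet> w) = b" by auto
 have "((\<lambda>t. jvel \<theta> w t - t * (\<theta> \<bullet> w)) \<longlongrightarrow> 0 - 0 * (\<theta> \<bullet> w)) (at_right 0)" by (intro tendsto_intros lim)
 moreover have "\<forall>\<^sub>F t in at_right 0. jvel \<theta> w t - t * (\<theta> \<bullet> w) = b" using b by (auto simp: eventually_at_filter)
 ultimately have "((\<lambda>t. b) \<longlongrightarrow> 0) (at_right (0::real))" by (auto intro: Lim_transform_eventually)
 then have "b = 0" by (simp add: tendsto_const_iff)
 then show ?thesis using b[OF t] by simp
qed

lemma jsq_nonneg: "0 < t \<Longrightarrow> 0 \<le> jsq \<theta> w t"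
proof -
 assume t: "0 < t"
 show ?thesis using less_imp_le[OF t] by (rule jacobi_local[of t \<theta> w]) (use t in auto)
qed

lemma jsq_radial: "0 < t \<Longrightarrow> jsq \<theta> \<theta> t = t\<^sup>2 * (norm \<theta>)\<^sup>2"
proof -
 assume t: "0 < t"
 show ?thesis unfolding jsq_def using less_imp_le[OF t] by (rule jacobi_local[of t \<theta> \<theta>]) (use t in auto)
qed

lemma jvel_le: "0 < t \<Longrightarrow> (jvel \<theta> w t)\<^sup>2 \<le> jsq \<theta> w t * (norm \<theta>)\<^sup>2"
proof -
 assume t: "0 < t"
 show ?thesis using less_imp_le[OF t] by (rule jacobi_local[of t \<theta> w]) (use t in auto)
qed

text \<open>The Riccati comparison is used with constant 0 for arbitrary \<open>w\<close>, and with
  constant \<open>c\<close> for \<open>w\<close> orthogonal to a unit vector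
  \<open>\<theta>\<close>, where the term with \<open>jvel\<close> vanishes by the Gauss
  lemma.\<close>

lemma jsq_growth:
 assumes w: "w \<noteq> 0"
 shows jsq_growth_square: "\<lbrakk>0 < t0; t0 \<le> t1\<rbrakk> \<Longrightarrow> jsq \<theta> w t0 / t0\<^sup>2 \<le> jsq \<theta> w t1 / t1\<^sup>2"
  and jsq_growth_exp: "\<lbrakk>norm \<theta> = 1; \<theta> \<bullet> w = 0; 0 < t0; t0 \<le> t1\<rbrakk> \<Longrightarrow> exp (2 * c * (t1 - t0)) * jsq \<theta> w t0 \<le> jsq \<theta> w t1"
  and jsq_lower: "0 < t \<Longrightarrow> (norm w)\<^sup>2 \<le> jsq \<theta> w t / t\<^sup>2"
proof -
 obtain h k where J: "\<And>t. 0 < t \<Longrightarrow> (jsq \<theta> w has_real_derivative 2 * h t) (at t)" "\<And>t. 0 < t \<Longrightarrow> (h has_real_derivative k t) (at t)"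
  "\<And>t. 0 < t \<Longrightarrow> (h t)\<^sup>2 \<le> jsq \<theta> w t * (k t - c\<^sup>2 * (jsq \<theta> w t * (norm \<theta>)\<^sup>2 - (jvel \<theta> w t)\<^sup>2))"
  "\<And>t. 0 < t \<Longrightarrow> c\<^sup>2 * (jsq \<theta> w t * (norm \<theta>)\<^sup>2 - (jvel \<theta> w t)\<^sup>2) \<le> k t"
  "(jsq \<theta> w \<longlongrightarrow> 0) (at_right 0)" "(h \<longlongrightarrow> 0) (at_right 0)" "((\<lambda>t. jsq \<theta> w t / t\<^sup>2) \<longlongrightarrow> (norm w)\<^sup>2) (at_right 0)"
  by (fact jacobi_global[of \<theta> w])
 have cn: "0 \<le> c\<^sup>2 * (jsq \<theta> w t * (norm \<theta>)\<^sup>2 - (jvel \<theta> w t)\<^sup>2)" if "0 < t" for t using jvel_le[OF that] by simp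
 have k0: "0 \<le> k t" if "0 < t" for t using J(4)[OF that] cn[OF that] by linarith
 have fpos: "\<forall>\<^sub>F t in at_right 0. 0 < jsq \<theta> w t"
 proof -
  have "\<forall>\<^sub>F t in at_right 0. 0 < jsq \<theta> w t / t\<^sup>2" by (rule order_tendstoD(1)[OF J(7)]) (use w in simp)
  then show ?thesis by eventually_elim (auto simp: zero_less_divide_iff)
 qed
 \<comment> \<open>Drops the curvature term, which is nonnegative by \<open>jvel_le\<close>.\<close>
 have ineq0: "(h t)\<^sup>2 \<le> jsq \<theta> w t * (k t - 0\<^sup>2 * jsq \<theta> w t)" if "0 < t" for t
 proof -
  have "jsq \<theta> w t * (k t - c\<^sup>2 * (jsq \<theta> w t * (norm \<theta>)\<^sup>2 - (jvel \<theta> w t)\<^sup>2)) \<le> jsq \<theta> w t * (k t - 0\<^sup>2 * jsq \<theta> w t)"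
   by (rule mult_left_mono) (use cn[OF that] jsq_nonneg[OF that] in auto)
  then show ?thesis using J(3)[OF that] by linarith
 qed
 show sq: "jsq \<theta> w t0 / t0\<^sup>2 \<le> jsq \<theta> w t1 / t1\<^sup>2" if "0 < t0" "t0 \<le> t1" for t0 t1
  by (rule sqrt_riccati_growth(1)[OF J(1) J(2) k0 ineq0 order_refl J(5) J(6) fpos that])
 show "exp (2 * c * (t1 - t0)) * jsq \<theta> w t0 \<le> jsq \<theta> w t1" if th: "norm \<theta> = 1" "\<theta> \<bullet> w = 0" and t: "0 < t0" "t0 \<le> t1" for t0 t1
 proof (rule sqrt_riccati_growth(2)[OF J(1) J(2) k0 _ c J(5) J(6) fpos t])
  show "(h t)\<^sup>2 \<le> jsq \<theta> w t * (k t - c\<^sup>2 * jsq \<theta> w t)" if "0 < t" for t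
   using J(3)[OF that] jvel_eq[OF that, of \<theta> w] th by simp
 qed
 show "(norm w)\<^sup>2 \<le> jsq \<theta> w t / t\<^sup>2" if t: "0 < t" for t
 proof (rule tendsto_upperbound[OF J(7)])
  show "\<forall>\<^sub>F s in at_right 0. jsq \<theta> w s / s\<^sup>2 \<le> jsq \<theta> w t / t\<^sup>2"
   unfolding eventually_at_right[OF zero_less_one] using t sq by (intro exI[of _ t]) auto
 qed simp
qed

lemma expo_pullback:
 obtains C x A where "C \<in> atlas M" "x \<in> chart_img C" "bounded_linear A" "\<And>v w. pullback_metric M expo \<xi> v w = ginner M C x (A v) (A w)"
proof -
 obtain C N E' where C: "C \<in> atlas M" "open N" "\<xi> \<in> N" "\<And>\<eta>. \<eta> \<in> N \<Longrightarrow> expo \<eta> \<in> chart_dom C"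
  "\<And>\<eta>. \<eta> \<in> N \<Longrightarrow> (chart_map C \<circ> expo has_derivative blinfun_apply (E' \<eta>)) (at \<eta>)" "continuous_on N E'"
  "\<And>\<eta>. \<eta> \<in> N \<Longrightarrow> continuous (at \<eta>) expo" by (fact expo_C1[of \<xi>])
 show ?thesis
  by (rule that[OF C(1) _ blinfun.bounded_linear_right pullback_metric_chart[where H=expo, OF C(1) C(4)[OF C(3)] C(7)[OF C(3)] C(5)[OF C(3)]]])
    (use C(4)[OF C(3)] in \<open>auto simp: chart_img_def\<close>)
qed

lemma geod_pullback:
 assumes t: "0 < t"
 shows "pullback_metric M (\<lambda>\<xi>. geod \<xi> t) \<theta> v w = t\<^sup>2 * pullback_metric M expo (t *\<^sub>R \<theta>) v w"
proof -
 obtain C N E' where C: "C \<in> atlas M" "open N" "t *\<^sub>R \<theta> \<in> N" "\<And>\<eta>. \<eta> \<in> N \<Longrightarrow> expo \<eta> \<in> chart_dom C"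
  "\<And>\<eta>. \<eta> \<in> N \<Longrightarrow> (chart_map C \<circ> expo has_derivative blinfun_apply (E' \<eta>)) (at \<eta>)" "continuous_on N E'"
  "\<And>\<eta>. \<eta> \<in> N \<Longrightarrow> continuous (at \<eta>) expo" by (fact expo_C1[of "t *\<^sub>R \<theta>"])
 note p = C(4)[OF C(3)] C(7)[OF C(3)] C(5)[OF C(3)]
 have e: "(\<lambda>\<xi>. geod \<xi> t) = (\<lambda>\<xi>. expo (t *\<^sub>R \<xi>))" using expo_ray[OF t] by simp
 have c: "continuous (at \<theta>) (\<lambda>\<xi>. expo (t *\<^sub>R \<xi>))"
  by (rule isCont_o2[where f="\<lambda>\<xi>. t *\<^sub>R \<xi>" and g=expo, OF _ p(2)]) simp
 have d: "(chart_map C \<circ> (\<lambda>\<xi>. expo (t *\<^sub>R \<xi>)) has_derivative (\<lambda>h. E' (t *\<^sub>R \<theta>) (t *\<^sub>R h))) (at \<theta>)"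
  using diff_chain_at[OF has_derivative_scaleR_right[OF has_derivative_ident] p(3)] by (simp add: o_def)
 show ?thesis
  unfolding e using pullback_metric_chart[where H="\<lambda>\<xi>. expo (t *\<^sub>R \<xi>)", OF C(1) p(1) c d, of v w]
   pullback_metric_chart[where H=expo, OF C(1) p, of v w]
  by (simp add: blinfun.scaleR_right ginner_linear power2_eq_square)
qed

lemma jsq_expo: "0 < t \<Longrightarrow> jsq \<theta> w t = t\<^sup>2 * pullback_metric M expo (t *\<^sub>R \<theta>) w w"
 unfolding jsq_def by (rule geod_pullback)

text \<open>This estimate makes the differential of \<open>expo\<close> injective and bounds the
  velocity of a lifted curve by the speed of the curve below.\<close>

lemma expo_expanding: "(norm w)\<^sup>2 \<le> pullback_metric M expo \<xi> w w"
proof (cases "w = 0")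
 case False
 then show ?thesis using jsq_lower[of w 1 \<xi>] jsq_expo[of 1 \<xi> w] by simp
next
 case True
 then show ?thesis using jsq_nonneg[of 1 \<xi> w] jsq_expo[of 1 \<xi> w] by simp
qed

text \<open>By the Gauss lemma the radial part is an isometry orthogonal to the rest, which expands by
 at least \<open>exp (c * (t1 - t0))\<close>.\<close>
lemma expo_growth:
 assumes \<theta>: "norm \<theta> = 1" and t: "0 < t0" "t0 \<le> t1"
 shows "t0\<^sup>2 * pullback_metric M expo (t0 *\<^sub>R \<theta>) (exp (c * (t1 - t0)) *\<^sub>R (w - (\<theta> \<bullet> w) *\<^sub>R \<theta>) + (t1 / t0 * (\<theta> \<bullet> w)) *\<^sub>R \<theta>)
      (exp (c * (t1 - t0)) *\<^sub>R (w - (\<theta> \<bullet> w) *\<^sub>R \<theta>) + (t1 / t0 * (\<theta> \<bullet> w)) *\<^sub>R \<theta>)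
  \<le> t1\<^sup>2 * pullback_metric M expo (t1 *\<^sub>R \<theta>) w w"
proof -
 define p where "p = w - (\<theta> \<bullet> w) *\<^sub>R \<theta>"
 have \<theta>2: "\<theta> \<bullet> \<theta> = 1" using \<theta> by (simp add: norm_eq_1)
 have orth: "\<theta> \<bullet> p = 0" by (simp add: p_def inner_diff_right \<theta>2)
 have w: "w = 1 *\<^sub>R p + (\<theta> \<bullet> w) *\<^sub>R \<theta>" by (simp add: p_def)
 \<comment> \<open>Radial and orthogonal parts are orthogonal for the pulled-back metric as well, by
   \<open>jvel_eq\<close>, and the radial vector keeps its length, by
   \<open>jsq_radial\<close>.\<close>
 have split: "t\<^sup>2 * pullback_metric M expo (t *\<^sub>R \<theta>) (a *\<^sub>R p + b *\<^sub>R \<theta>) (a *\<^sub>R p + b *\<^sub>R \<theta>) = a\<^sup>2 * jsq \<theta> p t + b\<^sup>2 * t\<^sup>2" if t: "0 < t" for t a b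
 proof -
  obtain C x A where A: "C \<in> atlas M" "x \<in> chart_img C" "bounded_linear A" "\<And>v w. pullback_metric M expo (t *\<^sub>R \<theta>) v w = ginner M C x (A v) (A w)"
   by (fact expo_pullback[of "t *\<^sub>R \<theta>"])
  have lin: "A (a *\<^sub>R p + b *\<^sub>R \<theta>) = a *\<^sub>R A p + b *\<^sub>R A \<theta>"
   using A(3) by (simp add: linear_add[OF bounded_linear.linear] linear_cmul[OF bounded_linear.linear])
  have cross: "ginner M C x (A p) (A \<theta>) = 0"
   using jvel_eq[OF t, of \<theta> p] geod_pullback[OF t, of \<theta> p \<theta>] orth t by (simp add: jvel_def A(4))
  have rad: "ginner M C x (A \<theta>) (A \<theta>) = 1"
   using jsq_radial[OF t, of \<theta>] jsq_expo[OF t, of \<theta> \<theta>] \<theta> t by (simp add: A(4))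
  have "pullback_metric M expo (t *\<^sub>R \<theta>) (a *\<^sub>R p + b *\<^sub>R \<theta>) (a *\<^sub>R p + b *\<^sub>R \<theta>)
    = a\<^sup>2 * pullback_metric M expo (t *\<^sub>R \<theta>) p p + b\<^sup>2"
   unfolding A(4) lin using cross rad ginner_sym[OF A(1,2), of "A \<theta>" "A p"] by (simp add: ginner_linear power2_eq_square)
  then show ?thesis using jsq_expo[OF t, of \<theta> p] by (simp add: algebra_simps)
 qed
 have "exp (2 * c * (t1 - t0)) * jsq \<theta> p t0 \<le> jsq \<theta> p t1"
 proof (cases "p = 0")
  case False
  then show ?thesis using jsq_growth_exp[OF False \<theta> orth t] by simp
 next
  case True
  have z: "jsq \<theta> 0 t = 0" if "0 < t" for t using split[OF that, of 1 0] split[OF that, of 0 0] True jsq_expo[OF that, of \<theta> 0] by simp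
  show ?thesis using z t True by simp
 qed
 then have "(exp (c * (t1 - t0)))\<^sup>2 * jsq \<theta> p t0 + (t1 / t0 * (\<theta> \<bullet> w))\<^sup>2 * t0\<^sup>2 \<le> 1\<^sup>2 * jsq \<theta> p t1 + (\<theta> \<bullet> w)\<^sup>2 * t1\<^sup>2"
  using t by (simp add: power_mult_distrib power_divide exp_double[symmetric] mult.assoc)
 then show ?thesis
  unfolding p_def[symmetric] split[OF t(1), symmetric] using split[of t1 1 "\<theta> \<bullet> w"] t w by simp
qed

end

section \<open>Lifting along local homeomorphisms\<close>

locale local_homeo =
 fixes f :: "'x::t2_space \<Rightarrow> 'y::t2_space"
 assumes cont: "continuous_on UNIV f"
  and loc: "\<And>x. \<exists>U g. open U \<and> x \<in> U \<and> open (f ` U) \<and> continuous_on (f ` U) g \<and> (\<forall>u\<in>U. g (f u) = u)"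
begin

text \<open>Agreement of the two lifts is locally constant on the connected set \<open>S\<close>:
  where they agree, local injectivity of \<open>f\<close> forces agreement nearby; where they
  differ, the Hausdorff property keeps them apart nearby.\<close>

lemma lift_unique:
 fixes S :: "'z::topological_space set"
 assumes S: "connected S" "a \<in> S" "b \<in> S" and c: "continuous_on S \<eta>" "continuous_on S \<eta>'"
  and f: "\<And>s. s \<in> S \<Longrightarrow> f (\<eta> s) = f (\<eta>' s)" and a: "\<eta> a = \<eta>' a"
 shows "\<eta> b = \<eta>' b"
proof (rule connected_induction_simple[OF S, of "\<lambda>s. \<eta> s = \<eta>' s"])
 fix s assume s: "s \<in> S"
 have op: "openin (top_of_set S) (S \<inter> \<eta> -` U \<inter> (S \<inter> \<eta>' -` V))" if "open U" "open V" for U V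
  using that c by (intro openin_Int continuous_openin_preimage_gen) auto
 show "\<exists>T. openin (top_of_set S) T \<and> s \<in> T \<and> (\<forall>x\<in>T. \<forall>y\<in>T. \<eta> x = \<eta>' x \<longrightarrow> \<eta> y = \<eta>' y)"
 proof (cases "\<eta> s = \<eta>' s")
  case True
  obtain U g where U: "open U" "\<eta> s \<in> U" "\<And>u. u \<in> U \<Longrightarrow> g (f u) = u" using loc[of "\<eta> s"] by auto
  show ?thesis
  proof (intro exI conjI ballI impI)
   show "openin (top_of_set S) (S \<inter> \<eta> -` U \<inter> (S \<inter> \<eta>' -` U))" by (rule op[OF U(1,1)])
   show "s \<in> S \<inter> \<eta> -` U \<inter> (S \<inter> \<eta>' -` U)" using s U(2) True by auto
   fix x y assume "y \<in> S \<inter> \<eta> -` U \<inter> (S \<inter> \<eta>' -` U)"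
   then have y: "\<eta> y \<in> U" "\<eta>' y \<in> U" "y \<in> S" by auto
   have "g (f (\<eta> y)) = \<eta>' y" unfolding f[OF y(3)] by (rule U(3)[OF y(2)])
   then show "\<eta> y = \<eta>' y" unfolding U(3)[OF y(1)] .
  qed
 next
  case False
  then obtain U V where U: "open U" "open V" "\<eta> s \<in> U" "\<eta>' s \<in> V" "U \<inter> V = {}" using hausdorff by metis
  show ?thesis
  proof (intro exI conjI ballI impI)
   show "openin (top_of_set S) (S \<inter> \<eta> -` U \<inter> (S \<inter> \<eta>' -` V))" by (rule op[OF U(1,2)])
   show "s \<in> S \<inter> \<eta> -` U \<inter> (S \<inter> \<eta>' -` V)" using s U(3,4) by auto
   fix x y assume "x \<in> S \<inter> \<eta> -` U \<inter> (S \<inter> \<eta>' -` V)" "\<eta> x = \<eta>' x"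
   then show "\<eta> y = \<eta>' y" using U(5) by auto
  qed
 qed
qed (rule a)

text \<open>The assumption \<open>ext\<close> stands in for evenly covered neighbourhoods: a lift on
  a half-open interval has a limit at its end. Let \<open>S\<close> be the supremum of the times to
  which a lift exists; \<open>ext\<close> extends the lift to \<open>S\<close>, and a local inverse
  extends it beyond \<open>S\<close> if \<open>S < 1\<close>.\<close>

lemma lift_exists:
 assumes \<gamma>: "continuous_on {0..1::real} \<gamma>" and v: "f v = \<gamma> 0"
  and ext: "\<And>T \<eta>. \<lbrakk>0 < T; T \<le> 1; continuous_on {0..<T} \<eta>; \<And>t. t \<in> {0..<T} \<Longrightarrow> f (\<eta> t) = \<gamma> t\<rbrakk> \<Longrightarrow> \<exists>l. (\<eta> \<longlongrightarrow> l) (at_left T)"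
 obtains \<eta> where "continuous_on {0..1} \<eta>" "\<eta> 0 = v" "\<And>t. t \<in> {0..1} \<Longrightarrow> f (\<eta> t) = \<gamma> t"
proof -
 define L where "L T \<eta> \<longleftrightarrow> continuous_on {0..T} \<eta> \<and> \<eta> 0 = v \<and> (\<forall>t\<in>{0..T}. f (\<eta> t) = \<gamma> t)" for T \<eta>
 have extend: "\<exists>T' \<eta>'. T < T' \<and> T' \<le> 1 \<and> L T' \<eta>'" if T: "0 \<le> T" "T < 1" and l: "L T \<eta>" for T \<eta>
 proof -
  obtain U g where U: "open U" "\<eta> T \<in> U" "open (f ` U)" "continuous_on (f ` U) g" "\<And>u. u \<in> U \<Longrightarrow> g (f u) = u" using loc[of "\<eta> T"] by auto
  have gT: "\<gamma> T \<in> f ` U" using l U(2) T by (auto simp: L_def image_iff intro!: bexI[of _ "\<eta> T"])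
  have "openin (top_of_set {0..1}) ({0..1} \<inter> \<gamma> -` (f ` U))" using continuous_openin_preimage_gen[OF \<gamma> U(3)] .
  then obtain d where d: "0 < d" "\<And>t. t \<in> {0..1} \<Longrightarrow> dist t T < d \<Longrightarrow> \<gamma> t \<in> f ` U"
  proof -
   assume *: "openin (top_of_set {0..1}) ({0..1} \<inter> \<gamma> -` (f ` U))"
    and that: "\<And>d. 0 < d \<Longrightarrow> (\<And>t. t \<in> {0..1} \<Longrightarrow> dist t T < d \<Longrightarrow> \<gamma> t \<in> f ` U) \<Longrightarrow> thesis"
   have "T \<in> {0..1} \<inter> \<gamma> -` (f ` U)" using gT T by auto
   with * obtain e where e: "0 < e" "ball T e \<inter> {0..1} \<subseteq> {0..1} \<inter> \<gamma> -` (f ` U)" unfolding openin_contains_ball by blast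
   show thesis
   proof (rule that[OF e(1)])
    fix t assume "t \<in> {0..1}" "dist t T < e"
    then have "t \<in> ball T e \<inter> {0..1}" by (simp add: dist_commute)
    then show "\<gamma> t \<in> f ` U" using e(2) by blast
   qed
  qed
  define T' where "T' = min 1 (T + d / 2)"
  have T': "T < T'" "T' \<le> 1" "T' < T + d" using d T by (auto simp: T'_def)
  have gU: "\<gamma> t \<in> f ` U" if "t \<in> {T..T'}" for t using that T T' d by (auto simp: dist_real_def)
  have "continuous_on ({0..T} \<union> {T..T'}) (\<lambda>t. if t \<le> T then \<eta> t else g (\<gamma> t))"
  proof (rule continuous_on_cases)
   show "continuous_on {T..T'} (\<lambda>t. g (\<gamma> t))"
    by (rule continuous_on_compose2[OF U(4) continuous_on_subset[OF \<gamma>]]) (use gU T T' in auto)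
   have "g (\<gamma> T) = \<eta> T" using U(5)[OF U(2)] l T by (auto simp: L_def)
   then show "\<forall>t. (t \<in> {0..T} \<and> \<not> t \<le> T) \<or> (t \<in> {T..T'} \<and> t \<le> T) \<longrightarrow> \<eta> t = g (\<gamma> t)" by auto
  qed (use l in \<open>auto simp: L_def\<close>)
  moreover have "{0..T} \<union> {T..T'} = {0..T'}" using T T' by auto
  moreover have "f (g (\<gamma> t)) = \<gamma> t" if "t \<in> {T..T'}" for t using gU[OF that] U(5) by auto
  ultimately have "L T' (\<lambda>t. if t \<le> T then \<eta> t else g (\<gamma> t))" using l T by (auto simp: L_def)
  then show ?thesis using T' by blast
 qed
 have restr: "L T0 \<eta>" if "L T \<eta>" "T0 \<le> T" for T0 T \<eta>
  using that continuous_on_subset[of "{0..T}" \<eta> "{0..T0}"] by (auto simp: L_def)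
 define A where "A = {T \<in> {0..1}. \<exists>\<eta>. L T \<eta>}"
 have A0: "0 \<in> A" using v by (auto simp: A_def L_def intro!: exI[of _ "\<lambda>_. v"])
 have bdd: "bdd_above A" by (rule bdd_aboveI[of _ 1]) (auto simp: A_def)
 define S where "S = Sup A"
 have A01: "T \<le> 1" if "T \<in> A" for T using that by (simp add: A_def)
 have ne: "A \<noteq> {}" using A0 by blast
 have S: "0 \<le> S" "S \<le> 1" unfolding S_def by (rule cSup_upper[OF A0 bdd], rule cSup_least[OF ne A01])
 \<comment> \<open>The value at \<open>t\<close> of some lift on the interval up to
   \<open>t\<close>; by uniqueness these values fit together to a single lift before
   \<open>S\<close>.\<close>
 define e where "e t = (SOME \<eta>. L t \<eta>) t" for t
 have ex: "\<exists>\<eta>. L t \<eta>" if t: "t < S" for t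
 proof -
  have "\<exists>T\<in>A. t < T" by (rule less_cSupD[OF ne t[unfolded S_def]])
  then obtain T where "T \<in> A" "t < T" by blast
  then show ?thesis using restr[of T _ t] by (auto simp: A_def)
 qed
 have e: "e t = \<eta> t" if l: "L T \<eta>" "T < S" and t: "t \<in> {0..T}" for t T \<eta>
 proof -
  have "t < S" using t l(2) by simp
  then have 1: "L t (SOME \<eta>. L t \<eta>)" using someI_ex[OF ex] by blast
  have 2: "L t \<eta>" using restr[OF l(1)] t by auto
  show ?thesis unfolding e_def
   by (rule lift_unique[of "{0..t}" 0]) (use 1 2 t in \<open>auto simp: L_def\<close>)
 qed
 have LS: "\<exists>\<eta>. L S \<eta>"
 proof (cases "S = 0")
  case True then show ?thesis using A0 by (auto simp: A_def)
 next
  case False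
  then have S0: "0 < S" using S by simp
  have elift: "f (e t) = \<gamma> t" if "t \<in> {0..<S}" for t using ex[of t] e[of t _ t] that by (force simp: L_def)
  have "continuous_on {0..<S} e" unfolding continuous_on_eq_continuous_within
  proof
   fix t assume t: "t \<in> {0..<S}"
   define T where "T = (t + S) / 2"
   have T: "t < T" "T < S" using t by (auto simp: T_def)
   obtain \<eta> where l: "L T \<eta>" using ex[OF T(2)] by blast
   have "continuous_on {0..T} e"
    by (rule continuous_on_eq[of _ \<eta>]) (use l e[OF l T(2)] in \<open>auto simp: L_def\<close>)
   then have "continuous (at t within {0..T}) e" using t T by (auto simp: continuous_on_eq_continuous_within)
   moreover have "at t within {0..T} = at t within {0..<S}"
    by (rule at_within_nhd[of _ "{..<T}"]) (use t T in auto)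
   ultimately show "continuous (at t within {0..<S}) e" by (simp add: continuous_within)
  qed
  then obtain l where l: "(e \<longlongrightarrow> l) (at_left S)" using ext[OF S0 S(2) _ elift] by blast
  have atS: "at S within {0..S} = at_left S" by (rule at_within_nhd[of _ "{0<..}"]) (use S0 in auto)
  have "(\<gamma> \<longlongrightarrow> \<gamma> S) (at S within {0..1})" using \<gamma> S by (auto simp: continuous_on_def)
  then have "(\<gamma> \<longlongrightarrow> \<gamma> S) (at S within {0..S})" by (rule tendsto_within_subset) (use S in auto)
  moreover have "((\<lambda>t. f (e t)) \<longlongrightarrow> f l) (at_left S)"
   by (rule continuous_on_tendsto_compose[OF cont l]) auto
  moreover have "\<forall>\<^sub>F t in at_left S. f (e t) = \<gamma> t" unfolding eventually_at_left[OF S0] using elift by (intro exI[of _ 0]) (use S0 in auto)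
  ultimately have fl: "f l = \<gamma> S"
   unfolding atS using tendsto_unique[OF trivial_limit_at_left_real] Lim_transform_eventually by metis
  \<comment> \<open>The limit \<open>l\<close> serves as the value at \<open>S\<close>.\<close>
  have "L S (e(S := l))" unfolding L_def
  proof (intro conjI ballI)
   show "continuous_on {0..S} (e(S := l))" unfolding continuous_on_eq_continuous_within
   proof
    fix t assume t: "t \<in> {0..S}"
    show "continuous (at t within {0..S}) (e(S := l))"
    proof (cases "t = S")
     case True
     have "((e(S := l)) \<longlongrightarrow> l) (at_left S)"
      by (rule Lim_transform_eventually[OF l]) (auto simp: eventually_at_filter)
     then show ?thesis using True by (simp add: continuous_within atS)
    next
     case False
     define T where "T = (t + S) / 2"
     have T: "t < T" "T < S" using t False by (auto simp: T_def)
     obtain \<eta> where l': "L T \<eta>" using ex[OF T(2)] by blast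
     have "continuous_on {0..T} (e(S := l))"
      by (rule continuous_on_eq[of _ \<eta>]) (use l' T e[OF l' T(2)] in \<open>auto simp: L_def\<close>)
     then have "continuous (at t within {0..T}) (e(S := l))" using t T by (simp add: continuous_on_eq_continuous_within del: fun_upd_apply)
     moreover have "at t within {0..T} = at t within {0..S}"
      by (rule at_within_nhd[of _ "{..<T}"]) (use t T in auto)
     ultimately show ?thesis by (simp add: continuous_within)
    qed
   qed
   show "(e(S := l)) 0 = v" using S0 e[of 0 _ 0] ex[OF S0] by (auto simp: L_def)
   show "f ((e(S := l)) t) = \<gamma> t" if "t \<in> {0..S}" for t using that elift fl by auto
  qed
  then show ?thesis by blast
 qed
 have "S = 1"
 proof (rule ccontr)
  assume "S \<noteq> 1"
  then have "S < 1" using S by simp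
  then obtain T' \<eta>' where "S < T'" "T' \<le> 1" "L T' \<eta>'" using extend[OF S(1)] LS by metis
  then have "T' \<in> A" using S by (auto simp: A_def)
  then show False using cSup_upper[OF _ bdd] \<open>S < T'\<close> unfolding S_def by fastforce
 qed
 then show ?thesis using that LS by (auto simp: L_def)
qed

text \<open>Continuity in the parameter is propagated along the time interval by connectedness: for
  times near \<open>t0\<close> and parameters near \<open>y0\<close> the lift is a local inverse of
  \<open>f\<close> applied to \<open>H\<close>, so that continuity at one of these times gives
  continuity at the others.\<close>

lemma lift_endpoint_continuous:
 fixes H :: "'z::t2_space \<Rightarrow> real \<Rightarrow> 'y"
 assumes N: "open N" and H: "continuous_on (N \<times> {0..1}) (\<lambda>(y, t). H y t)"
  and \<eta>: "\<And>y. y \<in> N \<Longrightarrow> continuous_on {0..1} (\<eta> y)" "\<And>y t. y \<in> N \<Longrightarrow> t \<in> {0..1} \<Longrightarrow> f (\<eta> y t) = H y t"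
  and 0: "continuous_on N (\<lambda>y. \<eta> y 0)" and t: "t \<in> {0..1}"
 shows "continuous_on N (\<lambda>y. \<eta> y t)"
proof -
 have "\<exists>N'. open N' \<and> y0 \<in> N' \<and> N' \<subseteq> N \<and> continuous_on N' (\<lambda>y. \<eta> y t)" if y0: "y0 \<in> N" for y0
 proof (rule connected_induction_simple[of "{0..1}" 0 t "\<lambda>t. \<exists>N'. open N' \<and> y0 \<in> N' \<and> N' \<subseteq> N \<and> continuous_on N' (\<lambda>y. \<eta> y t)"])
  fix t0 :: real assume t0: "t0 \<in> {0..1}"
  obtain U g where U: "open U" "\<eta> y0 t0 \<in> U" "open (f ` U)" "continuous_on (f ` U) g" "\<And>u. u \<in> U \<Longrightarrow> g (f u) = u" using loc[of "\<eta> y0 t0"] by auto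
  have "H y0 t0 \<in> f ` U" using \<eta>(2)[OF y0 t0] U(2) by (metis imageI)
  moreover have "openin (top_of_set (N \<times> {0..1})) ((N \<times> {0..1}) \<inter> (\<lambda>(y, t). H y t) -` (f ` U))"
   by (rule continuous_openin_preimage_gen[OF H U(3)])
  then obtain Q where Q: "open Q" "(N \<times> {0..1}) \<inter> (\<lambda>(y, t). H y t) -` (f ` U) = (N \<times> {0..1}) \<inter> Q" by (auto simp: openin_open)
  ultimately have "(y0, t0) \<in> Q" using y0 t0 by auto
  then obtain A B where AB: "open A" "open B" "y0 \<in> A" "t0 \<in> B" "A \<times> B \<subseteq> Q" by (rule open_prod_elim[OF Q(1)]) auto
  have HU: "H y t \<in> f ` U" if "y \<in> A" "y \<in> N" "t \<in> B" "t \<in> {0..1}" for y t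
  proof -
   have "(y, t) \<in> (N \<times> {0..1}) \<inter> (\<lambda>(y, t). H y t) -` (f ` U)" unfolding Q(2) using that AB(5) by blast
   then show ?thesis by simp
  qed
  have "openin (top_of_set {0..1}) ({0..1} \<inter> \<eta> y0 -` U)" by (rule continuous_openin_preimage_gen[OF \<eta>(1)[OF y0] U(1)])
  then obtain Q' where Q': "open Q'" "{0..1} \<inter> \<eta> y0 -` U = {0..1} \<inter> Q'" by (auto simp: openin_open)
  have "t0 \<in> {0..1} \<inter> Q'" unfolding Q'(2)[symmetric] using t0 U(2) by simp
  then have "open (B \<inter> Q')" "t0 \<in> B \<inter> Q'" using AB(2,4) Q'(1) by auto
  then obtain d where d: "0 < d" "ball t0 d \<subseteq> B \<inter> Q'" using open_contains_ball by metis
  let ?T = "{0..1} \<inter> ball t0 d"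
  have conn: "connected ?T" by (intro convex_connected convex_Int) auto
  show "\<exists>T. openin (top_of_set {0..1}) T \<and> t0 \<in> T \<and> (\<forall>x\<in>T. \<forall>y\<in>T. (\<exists>N'. open N' \<and> y0 \<in> N' \<and> N' \<subseteq> N \<and> continuous_on N' (\<lambda>y. \<eta> y x)) \<longrightarrow>
     (\<exists>N'. open N' \<and> y0 \<in> N' \<and> N' \<subseteq> N \<and> continuous_on N' (\<lambda>z. \<eta> z y)))"
  proof (intro exI[of _ ?T] conjI ballI impI)
   fix r s assume r: "r \<in> ?T" and s: "s \<in> ?T" and "\<exists>N'. open N' \<and> y0 \<in> N' \<and> N' \<subseteq> N \<and> continuous_on N' (\<lambda>y. \<eta> y r)"
   then obtain N' where N': "open N'" "y0 \<in> N'" "N' \<subseteq> N" "continuous_on N' (\<lambda>y. \<eta> y r)" by blast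
   define N'' where "N'' = A \<inter> (N' \<inter> (\<lambda>y. \<eta> y r) -` U)"
   have N'': "open N''" unfolding N''_def by (intro open_Int AB(1) continuous_open_preimage N' U(1))
   have "r \<in> {0..1} \<inter> \<eta> y0 -` U" unfolding Q'(2) using r d(2) by blast
   then have "\<eta> y0 r \<in> U" by simp
   then have y0: "y0 \<in> N''" using AB(3) N'(2) by (auto simp: N''_def)
   \<comment> \<open>Both sides lift \<open>H y\<close> on the short interval \<open>?T\<close> and
     agree at time \<open>r\<close>, where \<open>\<eta> y r\<close> lies in
     \<open>U\<close>.\<close>
   have eq: "\<eta> y s = g (H y s)" if y: "y \<in> N''" for y
   proof (rule lift_unique[OF conn r s])
    have yN: "y \<in> N" "y \<in> A" using y N' by (auto simp: N''_def)
    have HT: "H y t \<in> f ` U" if "t \<in> ?T" for t using HU[OF yN(2,1)] that d(2) by auto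
    show "continuous_on ?T (\<eta> y)" by (rule continuous_on_subset[OF \<eta>(1)[OF yN(1)]]) auto
    have cH: "continuous_on ?T (H y)"
     using continuous_on_compose2[OF H continuous_on_Pair[OF continuous_on_const continuous_on_id], of y ?T] yN(1) by auto
    show "continuous_on ?T (\<lambda>t. g (H y t))"
     by (rule continuous_on_compose2[OF U(4) cH]) (use HT in auto)
    show "f (\<eta> y t) = f (g (H y t))" if "t \<in> ?T" for t using \<eta>(2)[OF yN(1), of t] HT[OF that] U(5) that by auto
    have "\<eta> y r \<in> U" using y by (auto simp: N''_def)
    then show "\<eta> y r = g (H y r)" using \<eta>(2)[OF yN(1), of r] U(5)[of "\<eta> y r"] r by auto
   qed
   have Nsub: "N'' \<subseteq> N" "N'' \<subseteq> A" using N' by (auto simp: N''_def)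
   have "continuous_on N'' (\<lambda>y. H y s)"
    using continuous_on_compose2[OF H continuous_on_Pair[OF continuous_on_id continuous_on_const], of s N''] Nsub(1) s by (auto simp: image_subset_iff subset_iff)
   then have "continuous_on N'' (\<lambda>y. g (H y s))"
    by (rule continuous_on_compose2[OF U(4)]) (use HU Nsub s d(2) in blast)
   then have "continuous_on N'' (\<lambda>y. \<eta> y s)" by (rule continuous_on_eq) (use eq in simp)
   then show "\<exists>N'. open N' \<and> y0 \<in> N' \<and> N' \<subseteq> N \<and> continuous_on N' (\<lambda>z. \<eta> z s)" using N'' y0 Nsub by blast
  qed (use t0 d in \<open>auto simp: openin_open\<close>)
 qed (use 0 N y0 t in \<open>auto intro!: exI[of _ N]\<close>)
 then show ?thesis unfolding continuous_on_eq_continuous_at[OF N] by (meson continuous_on_eq_continuous_at)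
qed

end

section \<open>The covering argument for the exponential map\<close>

context exp_map
begin

text \<open>The differential is injective by \<open>expo_expanding\<close>, hence invertible since
  both dimensions are equal, and the inverse function theorem applies.\<close>

lemma expo_local_inverse:
 obtains C U V g E' g' where "C \<in> atlas M" "open U" "\<xi> \<in> U" "open V" "homeomorphism U V (chart_map C \<circ> expo) g"
  "\<And>\<eta>. \<eta> \<in> U \<Longrightarrow> expo \<eta> \<in> chart_dom C" "\<And>\<eta>. \<eta> \<in> U \<Longrightarrow> isCont expo \<eta>"
  "\<And>\<eta>. \<eta> \<in> U \<Longrightarrow> (chart_map C \<circ> expo has_derivative E' \<eta>) (at \<eta>)"
  "\<And>y. y \<in> V \<Longrightarrow> (g has_derivative g' y) (at y)" "\<And>y h. y \<in> V \<Longrightarrow> E' (g y) (g' y h) = h"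
proof -
 obtain C N E' where C: "C \<in> atlas M" "open N" "\<xi> \<in> N" "\<And>\<eta>. \<eta> \<in> N \<Longrightarrow> expo \<eta> \<in> chart_dom C"
  "\<And>\<eta>. \<eta> \<in> N \<Longrightarrow> (chart_map C \<circ> expo has_derivative blinfun_apply (E' \<eta>)) (at \<eta>)" "continuous_on N E'"
  "\<And>\<eta>. \<eta> \<in> N \<Longrightarrow> continuous (at \<eta>) expo" by (fact expo_C1[of \<xi>])
 note p = C(4)[OF C(3)] C(7)[OF C(3)] C(5)[OF C(3)]
 have inj: "w = 0" if "E' \<xi> w = 0" for w
  using expo_expanding[of w \<xi>] pullback_metric_chart[where H=expo, OF C(1) p, of w w] that by (simp add: ginner_linear)
 have lin: "linear (E' \<xi>)" by (rule bounded_linear.linear[OF blinfun.bounded_linear_right])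
 have "inj (E' \<xi>)" using linear_injective_0[OF lin] inj by blast
 then obtain B where B: "linear B" "B \<circ> E' \<xi> = id" using linear_injective_left_inverse[OF lin] by blast
 have "Blinfun B o\<^sub>L E' \<xi> = id_blinfun"
  using B(2) bounded_linear_Blinfun_apply[of B] linear_conv_bounded_linear[THEN iffD1, OF B(1)]
  by (intro blinfun_eqI) (simp add: fun_eq_iff)
 from inverse_function_theorem[OF C(2,5,6,3) this]
 obtain U V g g' where g: "open U" "U \<subseteq> N" "\<xi> \<in> U" "open V" "(chart_map C \<circ> expo) \<xi> \<in> V" "homeomorphism U V (chart_map C \<circ> expo) g"
  "\<And>y. y \<in> V \<Longrightarrow> (g has_derivative (g' y)) (at y)"
  "\<And>y. y \<in> V \<Longrightarrow> g' y = inv (blinfun_apply (E' (g y)))" "\<And>y. y \<in> V \<Longrightarrow> bij (blinfun_apply (E' (g y)))" by metis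
 have inv: "E' (g y) (g' y h) = h" if "y \<in> V" for y h
  unfolding g(8)[OF that] by (rule surj_f_inv_f[OF bij_is_surj[OF g(9)[OF that]]])
 show ?thesis
  by (rule that[of C U V g "\<lambda>\<eta>. blinfun_apply (E' \<eta>)" g']) (use C g inv in auto)
qed

sublocale expo: local_homeo expo
proof
 show "continuous_on UNIV expo" unfolding continuous_on_eq_continuous_at[OF open_UNIV]
 proof
  fix \<xi> show "isCont expo \<xi>" by (rule expo_local_inverse[of \<xi>]) auto
 qed
 fix \<xi>
 obtain C E' U V g g' where g: "C \<in> atlas M" "open U" "\<xi> \<in> U" "open V" "homeomorphism U V (chart_map C \<circ> expo) g"
  "\<And>\<eta>. \<eta> \<in> U \<Longrightarrow> expo \<eta> \<in> chart_dom C" "\<And>\<eta>. \<eta> \<in> U \<Longrightarrow> isCont expo \<eta>"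
  "\<And>\<eta>. \<eta> \<in> U \<Longrightarrow> (chart_map C \<circ> expo has_derivative E' \<eta>) (at \<eta>)"
  "\<And>y. y \<in> V \<Longrightarrow> (g has_derivative g' y) (at y)" "\<And>y h. y \<in> V \<Longrightarrow> E' (g y) (g' y h) = h"
  by (fact expo_local_inverse[of \<xi>])
 have V: "V = (\<lambda>\<eta>. chart_map C (expo \<eta>)) ` U" using homeomorphism_image1[OF g(5)] by (auto simp: o_def)
 have eU: "expo ` U = chart_inv C ` V" unfolding V image_image using chartD(5)[OF g(1) g(6)] by auto
 have Vimg: "V \<subseteq> chart_img C" unfolding V using chartD(8)[OF g(1) g(6)] by auto
 show "\<exists>U g. open U \<and> \<xi> \<in> U \<and> open (expo ` U) \<and> continuous_on (expo ` U) g \<and> (\<forall>u\<in>U. g (expo u) = u)"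
 proof (intro exI conjI ballI)
  show "open (expo ` U)" unfolding eU by (rule open_chart_image[OF g(1,4) Vimg])
  show "continuous_on (expo ` U) (\<lambda>p. g (chart_map C p))"
   by (rule continuous_on_compose2[OF homeomorphism_cont2[OF g(5)] continuous_on_subset[OF chartD(3)[OF g(1)]]]) (use g(6) V in auto)
  show "g (chart_map C (expo u)) = u" if "u \<in> U" for u using homeomorphism_apply1[OF g(5) that] by simp
 qed (rule g)+
qed

text \<open>Near \<open>t\<close> the lift is a local inverse of \<open>expo\<close> applied to the
  curve, hence differentiable. As \<open>expo\<close> maps its velocity to that of the curve and
  expands lengths, the bound follows.\<close>

lemma lift_velocity:
 assumes C: "C \<in> atlas M" "y t \<in> chart_img C" and y: "(y has_vector_derivative h) (at t)" and \<eta>: "isCont \<eta> t"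
  and ev: "\<forall>\<^sub>F s in nhds t. expo (\<eta> s) = chart_inv C (y s)"
 obtains d where "(\<eta> has_vector_derivative d) (at t)" "norm d \<le> sqrt (ginner M C (y t) h h)"
proof -
 obtain D E' U V g g' where g: "D \<in> atlas M" "open U" "\<eta> t \<in> U" "open V" "homeomorphism U V (chart_map D \<circ> expo) g"
  "\<And>\<xi>. \<xi> \<in> U \<Longrightarrow> expo \<xi> \<in> chart_dom D" "\<And>\<xi>. \<xi> \<in> U \<Longrightarrow> isCont expo \<xi>"
  "\<And>\<xi>. \<xi> \<in> U \<Longrightarrow> (chart_map D \<circ> expo has_derivative E' \<xi>) (at \<xi>)"
  "\<And>y. y \<in> V \<Longrightarrow> (g has_derivative g' y) (at y)" "\<And>y h. y \<in> V \<Longrightarrow> E' (g y) (g' y h) = h"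
  by (fact expo_local_inverse[of "\<eta> t"])
 have et: "expo (\<eta> t) = chart_inv C (y t)" using eventually_nhds_x_imp_x[OF ev] .
 have dom: "chart_inv C (y t) \<in> chart_dom C \<inter> chart_dom D" using chartD(7)[OF C] g(6)[OF g(3)] et by simp
 have x: "y t \<in> chart_map C ` (chart_dom C \<inter> chart_dom D)" using dom chartD(6)[OF C] by (metis imageI)
 let ?T = "frechet_derivative (transition C D) (at (y t))"
 have td: "(transition C D has_derivative ?T) (at (y t))" by (rule transition_has_derivative[OF C(1) g(1) x])
 have t1: "transition C D (y t) = chart_map D (expo (\<eta> t))" using transition_map[OF C(1), of "chart_inv C (y t)" D] dom et chartD(6)[OF C] by simp
 have v: "transition C D (y t) \<in> V" and gt: "g (transition C D (y t)) = \<eta> t"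
  unfolding t1 using homeomorphism_image1[OF g(5)] homeomorphism_apply1[OF g(5,3)] g(3) by auto
 have y': "(y has_derivative (\<lambda>r. r *\<^sub>R h)) (at t)" using y unfolding has_vector_derivative_def .
 have d: "(g \<circ> (transition C D \<circ> y) has_derivative g' (transition C D (y t)) \<circ> (?T \<circ> (\<lambda>r. r *\<^sub>R h))) (at t)"
  by (rule diff_chain_at[OF diff_chain_at[OF y' td]]) (use g(9)[OF v] in simp)
 have evU: "\<forall>\<^sub>F s in nhds t. \<eta> s \<in> U"
  using \<eta>[unfolded continuous_at_open] g(2,3) unfolding eventually_nhds by blast
 have evy: "\<forall>\<^sub>F s in nhds t. y s \<in> chart_img C"
  using has_vector_derivative_continuous[OF y, unfolded continuous_at_open] chartD(2)[OF C(1)] C(2) unfolding eventually_nhds by blast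
 have "\<forall>\<^sub>F s in nhds t. (g \<circ> (transition C D \<circ> y)) s = \<eta> s"
  using ev evU evy
 proof eventually_elim
  case (elim s)
  have "transition C D (y s) = chart_map D (expo (\<eta> s))"
   using transition_map[OF C(1), of "chart_inv C (y s)" D] chartD(6,7)[OF C(1) elim(3)] elim(1) by simp
  then show ?case using homeomorphism_apply1[OF g(5) elim(2)] by simp
 qed
 then obtain W where W: "open W" "t \<in> W" "\<And>s. s \<in> W \<Longrightarrow> (g \<circ> (transition C D \<circ> y)) s = \<eta> s" unfolding eventually_nhds by blast
 define e where "e = g' (transition C D (y t)) (?T h)"
 have "linear (g' (transition C D (y t)))" "linear ?T"
  using g(9)[OF v] td has_derivative_linear by blast+
 then have "g' (transition C D (y t)) \<circ> (?T \<circ> (\<lambda>r. r *\<^sub>R h)) = (\<lambda>r. r *\<^sub>R e)" by (simp add: fun_eq_iff e_def linear_cmul)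
 from d[unfolded this] have "(\<eta> has_vector_derivative e) (at t)" unfolding has_vector_derivative_def
  by (rule has_derivative_transform_within_open[OF _ W])
 moreover have "norm e \<le> sqrt (ginner M C (y t) h h)"
 proof (rule real_le_rsqrt)
  have "E' (\<eta> t) e = ?T h" using g(10)[OF v, of "?T h"] gt by (simp add: e_def)
  then have "pullback_metric M expo (\<eta> t) e e = ginner M D (chart_map D (expo (\<eta> t))) (?T h) (?T h)"
   using pullback_metric_chart[where H=expo, OF g(1) g(6)[OF g(3)] g(7)[OF g(3)] g(8)[OF g(3)], of e e] by simp
  then show "(norm e)\<^sup>2 \<le> ginner M C (y t) h h"
   using expo_expanding[of e "\<eta> t"] ginner_transition[OF C(1) g(1) x, of h h] t1 by simp
 qed
 ultimately show ?thesis using that by blast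
qed

text \<open>The coordinate segments from the centre are lifted. Their speed is bounded on the
  compact ball, so by \<open>lift_velocity\<close> the lifts are Lipschitz and have limits; their
  end points form the section. Since a continuous path need not have a speed,
  \<open>expo_path_lift\<close> works with these sections.\<close>

lemma expo_section:
 assumes C: "C \<in> atlas M" "expo v \<in> chart_dom C" and R: "0 < R" "cball (chart_map C (expo v)) R \<subseteq> chart_img C"
 obtains s where "continuous_on (ball (chart_map C (expo v)) R) s" "s (chart_map C (expo v)) = v"
  "\<And>y. y \<in> ball (chart_map C (expo v)) R \<Longrightarrow> expo (s y) = chart_inv C y"
proof -
 define y0 where "y0 = chart_map C (expo v)"
 define l where "l y t = y0 + t *\<^sub>R (y - y0)" for y :: "real^'n" and t :: real
 have l: "l y t \<in> cball y0 R" if "y \<in> ball y0 R" "t \<in> {0..1}" for y t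
 proof -
  have "\<bar>t\<bar> * norm (y - y0) \<le> 1 * R" by (rule mult_mono) (use that in \<open>auto simp: dist_norm norm_minus_commute\<close>)
  then show ?thesis by (simp add: l_def dist_norm)
 qed
 have R': "cball y0 R \<subseteq> chart_img C" using R(2) by (simp add: y0_def)
 obtain \<kappa> K where K: "0 < K" "\<And>x v. x \<in> cball y0 R \<Longrightarrow> sqrt (ginner M C x v v) \<le> K * norm v"
  using ginner_bounds[OF C(1) compact_cball R'] by metis
 have "\<exists>\<eta>. continuous_on {0..1} \<eta> \<and> \<eta> 0 = v \<and> (\<forall>t\<in>{0..1}. expo (\<eta> t) = chart_inv C (l y t))" if y: "y \<in> ball y0 R" for y
 proof (rule expo.lift_exists[of "\<lambda>t. chart_inv C (l y t)" v])
  show "continuous_on {0..1} (\<lambda>t. chart_inv C (l y t))"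
   by (rule continuous_on_compose2[OF chartD(4)[OF C(1)]]) (use l[OF y] R' in \<open>auto simp: l_def intro!: continuous_intros\<close>)
  show "expo v = chart_inv C (l y 0)" using chartD(5)[OF C] by (simp add: l_def y0_def)
 next
  fix T and \<eta> :: "real \<Rightarrow> real^'n" assume T: "0 < T" "T \<le> 1" and \<eta>: "continuous_on {0..<T} \<eta>" "\<And>t. t \<in> {0..<T} \<Longrightarrow> expo (\<eta> t) = chart_inv C (l y t)"
  have "\<exists>d. (\<eta> has_vector_derivative d) (at t) \<and> norm d \<le> K * norm (y - y0)" if t: "t \<in> {0<..<T}" for t
  proof (rule lift_velocity[of C "l y" t "y - y0" \<eta>])
   show "l y t \<in> chart_img C" using l[OF y, of t] R' t T by auto
   show "(l y has_vector_derivative y - y0) (at t)" unfolding l_def by (auto intro!: derivative_eq_intros)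
   show "isCont \<eta> t" using continuous_on_interior[OF \<eta>(1)] t by simp
   show "\<forall>\<^sub>F s in nhds t. expo (\<eta> s) = chart_inv C (l y s)"
    unfolding eventually_nhds using \<eta>(2) t by (intro exI[of _ "{0<..<T}"]) auto
   fix d assume "(\<eta> has_vector_derivative d) (at t)" "norm d \<le> sqrt (ginner M C (l y t) (y - y0) (y - y0))"
   then show ?thesis using K(2)[OF l[OF y], of t "y - y0"] t T by force
  qed (rule C)
  then obtain d where d: "\<And>t. t \<in> {0<..<T} \<Longrightarrow> (\<eta> has_vector_derivative d t) (at t)" "\<And>t. t \<in> {0<..<T} \<Longrightarrow> norm (d t) \<le> K * norm (y - y0)"
   by metis
  have on: "onorm (\<lambda>r. r *\<^sub>R d t) \<le> K * norm (y - y0)" if "t \<in> {0<..<T}" for t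
   by (rule onorm_bound) (use d(2)[OF that] K(1) in \<open>auto simp: mult.commute intro!: mult_left_mono\<close>)
  have "norm (\<eta> a - \<eta> b) \<le> K * norm (y - y0) * norm (a - b)" if "a \<in> {0<..<T}" "b \<in> {0<..<T}" for a b
   by (rule differentiable_bound[OF convex_real_interval(8) _ on that])
     (use d(1) in \<open>auto simp: has_vector_derivative_def intro: has_derivative_at_withinI\<close>)
  then have "(K * norm (y - y0))-lipschitz_on {0<..<T} \<eta>"
   using K(1) by (intro lipschitz_onI) (auto simp: dist_norm)
  then have uc: "uniformly_continuous_on {0<..<T} \<eta>" by (rule lipschitz_on_uniformly_continuous)
  obtain w where "(\<eta> \<longlongrightarrow> w) (at T within {0<..<T})"
   by (rule uniformly_continuous_on_extension_at_closure[OF uc, of T]) (use T in auto)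
  moreover have "at T within {0<..<T} = at_left T" by (rule at_within_nhd[of _ "{0<..}"]) (use T in auto)
  ultimately show "\<exists>w. (\<eta> \<longlongrightarrow> w) (at_left T)" by auto
 qed blast
 then obtain \<eta> where \<eta>: "\<And>y. y \<in> ball y0 R \<Longrightarrow> continuous_on {0..1} (\<eta> y)" "\<And>y. y \<in> ball y0 R \<Longrightarrow> \<eta> y 0 = v"
  "\<And>y t. y \<in> ball y0 R \<Longrightarrow> t \<in> {0..1} \<Longrightarrow> expo (\<eta> y t) = chart_inv C (l y t)" by metis
 have cs: "continuous_on (ball y0 R) (\<lambda>y. \<eta> y 1)"
 proof (rule expo.lift_endpoint_continuous[OF open_ball, of _ _ "\<lambda>y t. chart_inv C (l y t)"])
  have 1: "continuous_on (ball y0 R \<times> {0..1}) (\<lambda>z. l (fst z) (snd z))" unfolding l_def by (intro continuous_intros)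
  have "continuous_on (ball y0 R \<times> {0..1}) (\<lambda>z. chart_inv C (l (fst z) (snd z)))"
   by (rule continuous_on_compose2[OF chartD(4)[OF C(1)] 1]) (use l R' in fastforce)
  then show "continuous_on (ball y0 R \<times> {0..1}) (\<lambda>(y, t). chart_inv C (l y t))" by (simp add: case_prod_unfold)
  show "continuous_on (ball y0 R) (\<lambda>y. \<eta> y 0)" by (rule continuous_on_eq[OF continuous_on_const[of _ v]]) (use \<eta>(2) in auto)
 qed (use \<eta> in auto)
 have "\<eta> y0 1 = v"
 proof -
  have "\<eta> y0 1 = (\<lambda>t. v) 1"
   by (rule expo.lift_unique[of "{0..1}" 0 1 "\<eta> y0" "\<lambda>_. v"]) (use \<eta>[of y0] R chartD(5)[OF C] in \<open>auto simp: l_def y0_def\<close>)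
  then show ?thesis .
 qed
 then show ?thesis
  using that[of "\<lambda>y. \<eta> y 1"] cs \<eta>(3)[of _ 1] unfolding y0_def[symmetric] by (simp add: l_def)
qed

text \<open>Shortly before \<open>T\<close> the path enters a coordinate ball that carries a section
  through the current point of the lift. The lift follows this section, which is continuous up to
  \<open>T\<close>, so it has a limit there.\<close>

lemma expo_path_lift:
 assumes \<gamma>: "continuous_on {0..1::real} \<gamma>" and v: "expo v = \<gamma> 0"
 obtains \<eta> where "continuous_on {0..1} \<eta>" "\<eta> 0 = v" "\<And>t. t \<in> {0..1} \<Longrightarrow> expo (\<eta> t) = \<gamma> t"
proof (rule expo.lift_exists[OF \<gamma> v])
 fix T and \<eta> :: "real \<Rightarrow> real^'n" assume T: "0 < T" "T \<le> 1" and \<eta>: "continuous_on {0..<T} \<eta>" "\<And>t. t \<in> {0..<T} \<Longrightarrow> expo (\<eta> t) = \<gamma> t"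
 define C where "C = chart_at M (\<gamma> T)"
 have C: "C \<in> atlas M" "\<gamma> T \<in> chart_dom C" by (simp_all add: C_def chart_at)
 obtain r where r: "0 < r" "cball (chart_map C (\<gamma> T)) r \<subseteq> chart_img C"
  using chart_ball[OF open_UNIV UNIV_I, of "\<gamma> T"] unfolding C_def by metis
 \<comment> \<open>A quarter of the radius: the ball of radius \<open>r / 2\<close> about the
   position at \<open>t0\<close> then lies in the image of the chart and contains all positions from
   \<open>t0\<close> to \<open>T\<close>.\<close>
 define B where "B = chart_dom C \<inter> chart_map C -` ball (chart_map C (\<gamma> T)) (r / 4)"
 have B: "open B" unfolding B_def by (rule continuous_open_preimage[OF chartD(3)[OF C(1)] chartD(1)[OF C(1)] open_ball])
 have "\<gamma> T \<in> B" using C r by (simp add: B_def)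
 have "openin (top_of_set {0..1}) ({0..1} \<inter> \<gamma> -` B)" by (rule continuous_openin_preimage_gen[OF \<gamma> B])
 moreover have "T \<in> {0..1} \<inter> \<gamma> -` B" using T \<open>\<gamma> T \<in> B\<close> by simp
 ultimately obtain e where e: "0 < e" "ball T e \<inter> {0..1} \<subseteq> {0..1} \<inter> \<gamma> -` B" unfolding openin_contains_ball by blast
 define t0 where "t0 = max 0 (T - e / 2)"
 have t0: "0 \<le> t0" "t0 < T" using T e by (auto simp: t0_def)
 have gB: "\<gamma> t \<in> B" if "t \<in> {t0..T}" for t
 proof -
  have "t \<in> ball T e \<inter> {0..1}" using that T e(1) by (auto simp: t0_def dist_real_def)
  then show ?thesis using e(2) by blast
 qed
 define y0 where "y0 = chart_map C (\<gamma> t0)"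
 have e0: "expo (\<eta> t0) = \<gamma> t0" using \<eta>(2)[of t0] t0 by simp
 have y0: "dist (chart_map C (\<gamma> T)) y0 < r / 4" using gB[of t0] t0 by (simp add: B_def y0_def)
 have sub: "cball y0 (r / 2) \<subseteq> chart_img C"
 proof
  fix z assume "z \<in> cball y0 (r / 2)"
  then have "dist (chart_map C (\<gamma> T)) z \<le> r" using y0 r(1) dist_triangle[of "chart_map C (\<gamma> T)" z y0] by simp
  then show "z \<in> chart_img C" using r(2) by auto
 qed
 obtain s where s: "continuous_on (ball y0 (r / 2)) s" "s y0 = \<eta> t0" "\<And>y. y \<in> ball y0 (r / 2) \<Longrightarrow> expo (s y) = chart_inv C y"
  using expo_section[OF C(1), of "\<eta> t0" "r / 2"] gB[of t0] t0 r(1) sub unfolding e0 y0_def[symmetric] B_def by auto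
 have by0: "chart_map C (\<gamma> t) \<in> ball y0 (r / 2)" if "t \<in> {t0..T}" for t
 proof -
  have "dist (chart_map C (\<gamma> T)) (chart_map C (\<gamma> t)) < r / 4" using gB[OF that] by (simp add: B_def)
  then show ?thesis using y0 dist_triangle[of y0 "chart_map C (\<gamma> t)" "chart_map C (\<gamma> T)"] by (simp add: dist_commute)
 qed
 have cg: "continuous_on {t0..T} (\<lambda>t. chart_map C (\<gamma> t))"
  by (rule continuous_on_compose2[OF chartD(3)[OF C(1)] continuous_on_subset[OF \<gamma>]]) (use gB t0 T in \<open>auto simp: B_def\<close>)
 have cs: "continuous_on {t0..T} (\<lambda>t. s (chart_map C (\<gamma> t)))"
  by (rule continuous_on_compose2[OF s(1) cg]) (use by0 in blast)
 have eq: "s (chart_map C (\<gamma> t)) = \<eta> t" if t: "t \<in> {t0..<T}" for t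
 proof (rule expo.lift_unique[of "{t0..<T}" t0 t])
  show "continuous_on {t0..<T} (\<lambda>t. s (chart_map C (\<gamma> t)))" by (rule continuous_on_subset[OF cs]) auto
  show "continuous_on {t0..<T} \<eta>" by (rule continuous_on_subset[OF \<eta>(1)]) (use t0 in auto)
  fix r assume r: "r \<in> {t0..<T}"
  then show "expo (s (chart_map C (\<gamma> r))) = expo (\<eta> r)"
   using s(3)[OF by0, of r] gB[of r] chartD(5)[OF C(1)] \<eta>(2)[of r] t0 by (simp add: B_def)
 qed (use t t0 s(2) in \<open>auto simp: y0_def\<close>)
 have "((\<lambda>t. s (chart_map C (\<gamma> t))) \<longlongrightarrow> s (chart_map C (\<gamma> T))) (at T within {t0..T})"
  using cs t0 by (auto simp: continuous_on_def)
 moreover have "at T within {t0..T} = at_left T" by (rule at_within_nhd[of _ "{t0<..}"]) (use t0 in auto)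
 moreover have "\<forall>\<^sub>F t in at_left T. s (chart_map C (\<gamma> t)) = \<eta> t"
  unfolding eventually_at_left[OF t0(2)] using eq t0 by (intro exI[of _ t0]) auto
 ultimately show "\<exists>l. (\<eta> \<longlongrightarrow> l) (at_left T)" using Lim_transform_eventually by metis
qed (rule that)

text \<open>The segment from \<open>v\<close> to \<open>w\<close> is mapped to a loop, which is
  freely homotopic to a constant loop. Each loop of the homotopy is lifted, starting on a lift
  \<open>b\<close> of the path of base points. The lift of the constant loop is closed; the end
  points of the lifts and \<open>b\<close> lift the same path, so all lifts are closed. One of them
  is the segment.\<close>

lemma expo_inj:
 assumes sc: "simply_connected (UNIV :: 'a set)"
 shows "inj expo"
proof (rule injI)
 fix v w assume vw: "expo v = expo w"
 have cl: "continuous_on {0..1} (linepath v w)" by (rule continuous_on_linepath)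
 have cp: "path (expo \<circ> linepath v w)"
  unfolding path_def by (rule continuous_on_compose[OF cl continuous_on_subset[OF expo.cont]]) simp
 have "homotopic_loops UNIV (expo \<circ> linepath v w) (\<lambda>_. expo v)"
  using sc cp vw unfolding simply_connected_def by (auto simp: path_def pathstart_def pathfinish_def linepath_def)
 then obtain h where h: "continuous_on ({0..1::real} \<times> {0..1}) h" "\<And>x. x \<in> {0..1} \<Longrightarrow> h (0, x) = expo (linepath v w x)"
  "\<And>x. x \<in> {0..1} \<Longrightarrow> h (1, x) = expo v" "\<And>t. t \<in> {0..1} \<Longrightarrow> h (t, 1) = h (t, 0)"
  unfolding homotopic_loops by (auto simp: pathfinish_def pathstart_def)
 \<comment> \<open>Clamps the homotopy parameter, so that it ranges over the whole line, an open set
   as in \<open>lift_endpoint_continuous\<close>.\<close>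
 define k where "k s = max 0 (min 1 s)" for s :: real
 have k: "k s \<in> {0..1}" "k 0 = 0" "k 1 = 1" for s by (auto simp: k_def)
 have kc: "continuous_on A k" for A unfolding k_def[abs_def] by (intro continuous_intros)
 define H where "H s t = h (k s, t)" for s t
 have Hc: "continuous_on (UNIV \<times> {0..1}) (\<lambda>(s, t). H s t)" unfolding H_def case_prod_unfold
  by (rule continuous_on_compose2[OF h(1)], intro continuous_on_Pair continuous_on_compose2[OF kc[of UNIV]] continuous_intros) (use k in auto)
 have Hs: "continuous_on S (\<lambda>s. H s t)" if "t \<in> {0..1}" for t S
  unfolding H_def by (rule continuous_on_compose2[OF h(1) continuous_on_Pair[OF kc continuous_on_const]]) (use k that in auto)
 have Ht: "continuous_on {0..1} (H s)" for s
  unfolding H_def by (rule continuous_on_compose2[OF h(1) continuous_on_Pair[OF continuous_on_const continuous_on_id]]) (use k in auto)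
 have "expo v = H 0 0" using h(2)[of 0] by (simp add: H_def k linepath_def)
 then obtain b0 where b0: "continuous_on {0..1} b0" "b0 0 = v" "\<And>s. s \<in> {0..1} \<Longrightarrow> expo (b0 s) = H s 0"
  using expo_path_lift[OF Hs[of 0]] by (metis atLeastAtMost_iff order_refl zero_le_one)
 define b where "b s = b0 (k s)" for s
 have bc: "continuous_on UNIV b" unfolding b_def by (rule continuous_on_compose2[OF b0(1) kc]) (use k in auto)
 have bl: "expo (b s) = H s 0" for s using b0(3)[OF k(1)] k by (simp add: b_def H_def k_def)
 have "\<exists>\<eta>. continuous_on {0..1} \<eta> \<and> \<eta> 0 = b s \<and> (\<forall>t\<in>{0..1}. expo (\<eta> t) = H s t)" for s
  by (rule expo_path_lift[OF Ht bl]) blast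
 then obtain \<eta> where \<eta>: "\<And>s. continuous_on {0..1} (\<eta> s)" "\<And>s. \<eta> s 0 = b s" "\<And>s t. t \<in> {0..1} \<Longrightarrow> expo (\<eta> s t) = H s t" by metis
 have c1: "continuous_on UNIV (\<lambda>s. \<eta> s 1)"
  by (rule expo.lift_endpoint_continuous[OF open_UNIV Hc]) (use \<eta> bc in auto)
 have "\<eta> 1 1 = \<eta> 1 0"
  using expo.lift_unique[of "{0..1}" 0 1 "\<eta> 1" "\<lambda>_. \<eta> 1 0"] \<eta>(1,3) h(3) by (auto simp: H_def k)
 then have 11: "\<eta> 1 1 = b 1" using \<eta>(2) by simp
 \<comment> \<open>Closedness of the lift is carried from the constant loop at parameter 1 back to
   the original loop at parameter 0.\<close>
 have "\<eta> 0 1 = b 0"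
  by (rule expo.lift_unique[of UNIV 1 0 "\<lambda>s. \<eta> s 1" b]) (use c1 bc 11 \<eta>(3) bl h(4) k in \<open>auto simp: H_def\<close>)
 moreover have "\<eta> 0 1 = linepath v w 1"
  by (rule expo.lift_unique[of "{0..1}" 0 1]) (use \<eta> cl h(2) b0(2) in \<open>auto simp: H_def k b_def linepath_def\<close>)
 ultimately show "v = w" using b0(2) by (simp add: b_def k linepath_def)
qed

end

section \<open>Determinants and change of variables\<close>

text \<open>Gram-Schmidt for the form \<open>B\<close>, one vector at a time; \<open>u\<close> sends
  the standard basis to the resulting one. It is applied to the tangent space at \<open>q\<close>
  and to the metric pulled back by \<open>expo\<close>.\<close>

lemma orthonormal_frame_exists:
 fixes B :: "real^'n \<Rightarrow> real^'n \<Rightarrow> real"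
 assumes lin: "\<And>w. linear (\<lambda>v. B v w)" and sym: "\<And>v w. B v w = B w v" and pos: "\<And>v. v \<noteq> 0 \<Longrightarrow> 0 < B v v"
 obtains u :: "real^'n \<Rightarrow> real^'n" where "bounded_linear u" "\<And>\<xi> \<eta>. B (u \<xi>) (u \<eta>) = \<xi> \<bullet> \<eta>"
proof -
 have ex: "\<exists>S. finite S \<and> card S = k \<and> (\<forall>x\<in>S. \<forall>y\<in>S. B x y = (if x = y then 1 else 0))" if "k \<le> CARD('n)" for k
  using that
 proof (induction k)
  case 0 then show ?case by (intro exI[of _ "{}"]) auto
 next
  case (Suc k)
  then obtain S where S: "finite S" "card S = k" "\<And>x y. x \<in> S \<Longrightarrow> y \<in> S \<Longrightarrow> B x y = (if x = y then 1 else 0)" by auto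
  have "dim S < CARD('n)" using dim_le_card[of S S] S Suc.prems span_superset[of S] by (simp add: dim_le_card')
  then have "span S \<noteq> UNIV" using dim_span[of S] by (auto simp del: dim_span)
  then obtain v where v: "v \<notin> span S" by blast
  define w where "w = v - (\<Sum>x\<in>S. B v x *\<^sub>R x)"
  have w0: "w \<noteq> 0"
  proof
   assume "w = 0"
   then have "v = (\<Sum>x\<in>S. B v x *\<^sub>R x)" by (simp add: w_def)
   then show False using v by (metis (no_types, lifting) span_base span_scale span_sum)
  qed
  have orth: "B w y = 0" if y: "y \<in> S" for y
  proof -
   have "B w y = B v y - (\<Sum>x\<in>S. B v x * B x y)"
    unfolding w_def by (simp add: linear_diff[OF lin] linear_sum[OF lin] linear_cmul[OF lin])
   also have "(\<Sum>x\<in>S. B v x * B x y) = (\<Sum>x\<in>S. if x = y then B v x else 0)"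
    by (intro sum.cong refl) (use S(3) y in auto)
   also have "\<dots> = B v y" using S(1) y by simp
   finally show ?thesis by simp
  qed
  define e where "e = (1 / sqrt (B w w)) *\<^sub>R w"
  have ey: "B e y = 0" "B y e = 0" if "y \<in> S" for y
   using orth[OF that] sym[of y e] by (simp_all add: e_def linear_cmul[OF lin])
  have "B w e = (1 / sqrt (B w w)) * B w w" unfolding sym[of w e] by (simp add: e_def linear_cmul[OF lin])
  moreover have "B e e = (1 / sqrt (B w w)) * B w e" by (simp add: e_def linear_cmul[OF lin])
  ultimately have "B e e = B w w / (sqrt (B w w) * sqrt (B w w))" by simp
  then have ee: "B e e = 1" using pos[OF w0] by simp
  then have "e \<notin> S" using ey(1) by fastforce
  then show ?case using S ey ee by (intro exI[of _ "insert e S"]) auto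
 qed
 obtain S where S: "finite S" "card S = CARD('n)" "\<And>x y. x \<in> S \<Longrightarrow> y \<in> S \<Longrightarrow> B x y = (if x = y then 1 else 0)"
  using ex[OF order_refl] by auto
 obtain e where e: "bij_betw e (UNIV :: 'n set) S"
  using finite_same_card_bij[OF finite_class.finite_UNIV S(1)] S(2) by auto
 define u where "u \<xi> = (\<Sum>i\<in>UNIV. \<xi> $ i *\<^sub>R e i)" for \<xi> :: "real^'n"
 have Be: "B (e i) (e j) = (if i = j then 1 else 0)" for i j
  using S(3)[of "e i" "e j"] e by (auto simp: bij_betw_def inj_on_def)
 show ?thesis
 proof (rule that)
  have "linear u" unfolding u_def by (rule linearI) (simp_all add: scaleR_add_left sum.distrib scaleR_sum_right)
  then show "bounded_linear u" using linear_conv_bounded_linear by blast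
  have 1: "B (u \<xi>) y = (\<Sum>i\<in>UNIV. \<xi> $ i * B (e i) y)" for \<xi> y
   unfolding u_def by (simp add: linear_sum[OF lin] linear_cmul[OF lin])
  show "B (u \<xi>) (u \<eta>) = \<xi> \<bullet> \<eta>" for \<xi> \<eta>
  proof -
   have "B (e i) (u \<eta>) = \<eta> $ i" for i
    unfolding sym[of "e i"] 1 Be by (simp add: if_distrib[of "\<lambda>x. _ * x"] cong: if_cong)
   then show ?thesis unfolding 1 by (simp add: inner_vec_def)
  qed
 qed
qed

section \<open>Determinants of contractions and of radially split maps\<close>

lemma matrix_linear:
 fixes f :: "real^'n \<Rightarrow> real^'m"
 shows "linear f \<Longrightarrow> matrix f *v x = f x"
 by (rule matrix_works) (simp add: linear_matrix_vector_mul_eq)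

lemma det_le_fact:
 fixes A :: "real^'n^'n"
 assumes "\<And>i j. \<bar>A $ i $ j\<bar> \<le> 1"
 shows "\<bar>det A\<bar> \<le> fact CARD('n)"
proof -
 have "\<bar>det A\<bar> \<le> (\<Sum>p\<in>{p. p permutes (UNIV :: 'n set)}. \<bar>of_int (sign p) * (\<Prod>i\<in>UNIV. A $ i $ p i)\<bar>)"
  unfolding det_def by (rule sum_abs)
 also have "\<dots> \<le> (\<Sum>p\<in>{p. p permutes (UNIV :: 'n set)}. 1)"
  by (intro sum_mono) (auto simp: abs_mult sign_def abs_prod intro!: prod_le_1 assms)
 also have "\<dots> = fact CARD('n)" by (simp add: card_permutations)
 finally show ?thesis .
qed

text \<open>All powers of \<open>A\<close> are contractions, so their entries are at most 1 in
  absolute value and their determinants are bounded; a determinant of absolute value above 1 would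
  have unbounded powers.\<close>

lemma det_contraction:
 fixes A :: "real^'n^'n"
 assumes A: "\<And>x. norm (A *v x) \<le> norm x"
 shows "\<bar>det A\<bar> \<le> 1"
proof -
 define P where "P k = ((\<lambda>X. A ** X) ^^ k) (mat 1)" for k
 have P: "norm (P k *v x) \<le> norm x" for k x
 proof (induction k)
  case (Suc k)
  have "P (Suc k) *v x = A *v (P k *v x)" by (simp add: P_def matrix_vector_mul_assoc)
  then show ?case using A[of "P k *v x"] Suc by simp
 qed (simp add: P_def)
 have dP: "det (P k) = det A ^ k" for k by (induction k) (simp_all add: P_def det_mul)
 have "\<bar>P k $ i $ j\<bar> \<le> 1" for k i j
 proof -
  have "P k $ i $ j = (P k *v axis j 1) $ i" by (simp add: matrix_vector_mul_component inner_axis' matrix_vector_mult_basis column_def)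
  then show ?thesis using component_le_norm_cart[of "P k *v axis j 1" i] P[of k "axis j 1"] by simp
 qed
 then have bd: "\<bar>det A\<bar> ^ k \<le> fact CARD('n)" for k using det_le_fact[of "P k"] by (simp add: dP power_abs)
 show ?thesis
 proof (rule ccontr)
  assume "\<not> \<bar>det A\<bar> \<le> 1"
  then obtain k where "fact CARD('n) < \<bar>det A\<bar> ^ k" using real_arch_pow[of "\<bar>det A\<bar>" "fact CARD('n)"] by auto
  then show False using bd[of k] by simp
 qed
qed

text \<open>An orthogonal transformation that takes a coordinate vector to \<open>\<theta>\<close>
  conjugates the map to a diagonal matrix with one entry \<open>b\<close> and all others
  \<open>a\<close>.\<close>

lemma det_radial:
 fixes \<theta> :: "real^'n"
 assumes \<theta>: "norm \<theta> = 1"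
 shows "det (matrix (\<lambda>w. a *\<^sub>R (w - (\<theta> \<bullet> w) *\<^sub>R \<theta>) + (b * (\<theta> \<bullet> w)) *\<^sub>R \<theta>)) = a ^ (CARD('n) - 1) * b"
proof -
 obtain k :: 'n where True by simp
 obtain f :: "real^'n \<Rightarrow> real^'n" where f: "orthogonal_transformation f" "f (axis k 1) = \<theta>"
 proof (rule orthogonal_transformation_exists_1)
  show "norm (axis k 1 :: real^'n) = 1" by simp
 qed (use \<theta> in auto)
 define L where "L w = a *\<^sub>R (w - (\<theta> \<bullet> w) *\<^sub>R \<theta>) + (b * (\<theta> \<bullet> w)) *\<^sub>R \<theta>" for w
 define D where "D = (\<chi> i j. if i = j then (if i = k then b else a) else 0 :: real^'n^'n)"
 have lf: "linear f" using f(1) by (rule orthogonal_transformation_linear)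
 have fk: "\<theta> \<bullet> f x = x $ k" for x
  using f(1) unfolding f(2)[symmetric] orthogonal_transformation_def by (simp add: inner_axis')
 have Dx: "D *v x = a *\<^sub>R x + ((b - a) * (x $ k)) *\<^sub>R axis k 1" for x
 proof (subst vec_eq_iff, rule allI)
  fix i
  have "(D *v x) $ i = (\<Sum>j\<in>UNIV. if i = j then (if i = k then b else a) * x $ j else 0)"
   unfolding D_def matrix_vector_mult_def by (subst vec_lambda_beta, rule sum.cong) auto
  also have "\<dots> = (if i = k then b else a) * x $ i" by simp
  finally show "(D *v x) $ i = (a *\<^sub>R x + ((b - a) * (x $ k)) *\<^sub>R axis k 1) $ i"
   by (cases "i = k") (simp_all add: axis_def left_diff_distrib)
 qed
 have Lf: "L (f x) = f (D *v x)" for x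
  unfolding Dx by (simp add: L_def fk linear_diff[OF lf] linear_add[OF lf] linear_cmul[OF lf] f(2) algebra_simps)
 have lL: "linear L" unfolding L_def by (rule linearI) (simp_all add: inner_add_right algebra_simps)
 have "matrix L ** matrix f = matrix f ** D"
  unfolding matrix_eq by (simp add: matrix_linear[OF lf] matrix_linear[OF lL] Lf flip: matrix_vector_mul_assoc)
 then have "det (matrix L) * det (matrix f) = det (matrix f) * det D" by (metis det_mul)
 moreover have "det (matrix f) \<noteq> 0" using orthogonal_transformation_det[OF f(1)] by auto
 moreover have "det D = a ^ (CARD('n) - 1) * b"
 proof -
  have "det D = (\<Prod>i\<in>UNIV. if i = k then b else a)" unfolding D_def by (subst det_diagonal) auto
  also have "\<dots> = b * (\<Prod>i\<in>UNIV - {k}. a)" by (subst prod.remove[of _ k]) auto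
  finally show ?thesis by simp
 qed
 ultimately show ?thesis unfolding L_def by simp
qed

text \<open>Conjugation by \<open>\<sigma>\<close> is a bijection between the permutations of the
  two index types and preserves signs.\<close>

lemma det_reindex:
 fixes A :: "real^'n^'n" and \<sigma> :: "'k::finite \<Rightarrow> 'n::finite"
 assumes \<sigma>: "bij \<sigma>"
 shows "det (\<chi> i j. A $ \<sigma> i $ \<sigma> j :: real^'k^'k) = det A"
 unfolding det_def
proof (rule sum.reindex_bij_witness[of _ "\<lambda>p. inv \<sigma> \<circ> p \<circ> \<sigma>" "\<lambda>p. \<sigma> \<circ> p \<circ> inv \<sigma>"])
 have i: "inv \<sigma> (\<sigma> x) = x" "\<sigma> (inv \<sigma> y) = y" for x y using \<sigma> by (simp_all add: bij_is_inj surj_f_inv_f[OF bij_is_surj])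
 have bi: "bij (inv \<sigma>)" by (rule bij_imp_bij_inv[OF \<sigma>])
 fix p assume "p \<in> {p. p permutes (UNIV :: 'k set)}"
 then have p: "p permutes UNIV" by simp
 show "\<sigma> \<circ> p \<circ> inv \<sigma> \<in> {p. p permutes UNIV}" using permutes_bij[OF p] \<sigma> bi by (auto intro!: bij_imp_permutes bij_comp)
 show "inv \<sigma> \<circ> (\<sigma> \<circ> p \<circ> inv \<sigma>) \<circ> \<sigma> = p" by (simp add: fun_eq_iff i)
 have "map_permutation UNIV \<sigma> p = \<sigma> \<circ> p \<circ> inv \<sigma>"
  by (simp add: map_permutation_def bij_is_surj[OF \<sigma>] restrict_id_def fun_eq_iff)
 then have s: "sign (\<sigma> \<circ> p \<circ> inv \<sigma>) = sign p" using sign_map_permutation[OF bij_is_inj[OF \<sigma>] p] by simp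
 have "(\<Prod>i\<in>UNIV. A $ i $ (\<sigma> \<circ> p \<circ> inv \<sigma>) i) = (\<Prod>i\<in>UNIV. A $ \<sigma> i $ (\<sigma> \<circ> p \<circ> inv \<sigma>) (\<sigma> i))"
  by (rule prod.reindex_bij_betw[symmetric, of \<sigma>]) (rule \<sigma>)
 then show "of_int (sign (\<sigma> \<circ> p \<circ> inv \<sigma>)) * (\<Prod>i\<in>UNIV. A $ i $ (\<sigma> \<circ> p \<circ> inv \<sigma>) i) = of_int (sign p) * (\<Prod>i\<in>UNIV. (\<chi> i j. A $ \<sigma> i $ \<sigma> j) $ i $ p i)"
  unfolding s by (simp add: i)
next
 have i: "inv \<sigma> (\<sigma> x) = x" "\<sigma> (inv \<sigma> y) = y" for x y using \<sigma> by (simp_all add: bij_is_inj surj_f_inv_f[OF bij_is_surj])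
 have bi: "bij (inv \<sigma>)" by (rule bij_imp_bij_inv[OF \<sigma>])
 fix p assume "p \<in> {p. p permutes (UNIV :: 'n set)}"
 then have p: "p permutes UNIV" by simp
 show "inv \<sigma> \<circ> p \<circ> \<sigma> \<in> {p. p permutes UNIV}" using permutes_bij[OF p] \<sigma> bi by (auto intro!: bij_imp_permutes bij_comp)
 show "\<sigma> \<circ> (inv \<sigma> \<circ> p \<circ> \<sigma>) \<circ> inv \<sigma> = p" by (simp add: fun_eq_iff i)
qed

text \<open>\<open>B\<close> is exhausted by bounded pieces on which the Jacobian is bounded too.
  Their images have finite measure, given by the change of variables formula for integrable
  Jacobians, and both sides pass to the increasing limit.\<close>

lemma image_emeasure_wellorder:
 fixes f :: "real^'k::{finite,wellorder} \<Rightarrow> real^'k::_"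
 assumes U: "open U" and der: "\<And>x. x \<in> U \<Longrightarrow> (f has_derivative f' x) (at x)" and inj: "inj_on f U"
  and h: "h \<in> borel_measurable borel" "\<And>x. x \<in> U \<Longrightarrow> h x = \<bar>det (matrix (f' x))\<bar>" "\<And>x. 0 \<le> h x"
  and B: "B \<in> sets borel" "B \<subseteq> U"
 shows "emeasure lebesgue (f ` B) = emeasure (density lborel (\<lambda>x. ennreal (h x))) B" "f ` B \<in> sets lebesgue"
proof -
 \<comment> \<open>Both cuts at height \<open>n\<close> are needed to make the integral of
   \<open>h\<close> over the piece finite.\<close>
 define Bn where "Bn n = B \<inter> cball 0 (real n) \<inter> {x. h x \<le> real n}" for n
 have Bn: "Bn n \<in> sets borel" for n
 proof -
  have "{x \<in> space borel. h x \<le> real n} \<in> sets borel" using h(1) by measurable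
  then show ?thesis unfolding Bn_def using B(1) by (intro sets.Int) auto
 qed
 have piece: "emeasure lebesgue (f ` Bn n) = emeasure (density lborel (\<lambda>x. ennreal (h x))) (Bn n) \<and> f ` Bn n \<in> sets lebesgue" for n
 proof -
  let ?g = "\<lambda>x. if x \<in> Bn n then h x else 0"
  have m: "?g \<in> borel_measurable borel" using h(1) Bn[of n] by measurable
  have le: "(\<integral>\<^sup>+x. ennreal (?g x) \<partial>lborel) \<le> (\<integral>\<^sup>+x. ennreal (real n) * indicator (cball 0 (real n)) x \<partial>(lborel :: (real^'k::_) measure))"
   by (rule nn_integral_mono) (auto simp: Bn_def indicator_def)
  also have "\<dots> = ennreal (real n) * emeasure lborel (cball (0::real^'k::_) (real n))"
   by (subst nn_integral_cmult_indicator) auto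
  also have "\<dots> < \<infinity>" using emeasure_lborel_cball_finite[of "0::real^'k::_" "real n"] by (simp add: ennreal_mult_less_top)
  finally obtain r where r: "(\<integral>\<^sup>+x. ennreal (?g x) \<partial>lborel) = ennreal r" "0 \<le> r"
   by (cases "\<integral>\<^sup>+x. ennreal (?g x) \<partial>lborel") auto
  have "(?g has_integral r) UNIV" by (rule nn_integral_has_integral[OF m _ r]) (use h(3) in auto)
  then have I: "(h has_integral r) (Bn n)" by (simp add: has_integral_restrict_UNIV)
  have BU: "Bn n \<subseteq> U" using B by (auto simp: Bn_def)
  then have I': "((\<lambda>x. \<bar>det (matrix (f' x))\<bar>) has_integral r) (Bn n)"
   using has_integral_cong[of "Bn n" h "\<lambda>x. \<bar>det (matrix (f' x))\<bar>" r] I h(2) by auto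
  have S: "Bn n \<in> sets lebesgue" using Bn by simp
  have d: "(f has_derivative f' x) (at x within Bn n)" if "x \<in> Bn n" for x using der BU that has_derivative_at_withinI by blast
  have inj': "inj_on f (Bn n)" by (rule inj_on_subset[OF inj BU])
  have lm: "f ` Bn n \<in> lmeasurable" using measurable_differentiable_image_eq[OF S d inj'] I' by auto
  have "measure lebesgue (f ` Bn n) = r"
   using measure_differentiable_image_eq[OF S d inj'] I' integral_unique[OF I'] by auto
  then have "emeasure lebesgue (f ` Bn n) = ennreal r" using emeasure_eq_measure2[OF lm] by simp
  also have "\<dots> = emeasure (density lborel (\<lambda>x. ennreal (h x))) (Bn n)"
   unfolding r(1)[symmetric] using h(1) Bn[of n]
   by (subst emeasure_density) (auto intro!: nn_integral_cong)
  finally show ?thesis using lm by (auto simp: fmeasurableD)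
 qed
 have un: "(\<Union>n. Bn n) = B"
 proof -
  have "\<exists>n. x \<in> Bn n" if "x \<in> B" for x
  proof -
   obtain n where "max (norm x) (h x) \<le> real n" using real_arch_simple by blast
   then show ?thesis using that by (intro exI[of _ n]) (auto simp: Bn_def)
  qed
  then show ?thesis by (auto simp: Bn_def)
 qed
 have inc: "incseq Bn" by (intro incseq_SucI) (auto simp: Bn_def)
 have fBn: "f ` B = (\<Union>n. f ` Bn n)" unfolding un[symmetric] by blast
 show "f ` B \<in> sets lebesgue" unfolding fBn using piece by (intro sets.countable_UN) auto
 have "emeasure lebesgue (f ` B) = (SUP n. emeasure lebesgue (f ` Bn n))"
  unfolding fBn by (rule SUP_emeasure_incseq[symmetric]) (use piece inc in \<open>auto simp: incseq_def intro!: image_mono\<close>)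
 also have "\<dots> = (SUP n. emeasure (density lborel (\<lambda>x. ennreal (h x))) (Bn n))" using piece by simp
 also have "\<dots> = emeasure (density lborel (\<lambda>x. ennreal (h x))) B"
  unfolding un[symmetric] by (rule SUP_emeasure_incseq) (use Bn inc in auto)
 finally show "emeasure lebesgue (f ` B) = emeasure (density lborel (\<lambda>x. ennreal (h x))) B" .
qed

text \<open>The measure on \<open>U\<close> with density the absolute Jacobian is pushed forward by
  \<open>f\<close> to Lebesgue measure on the image; integrating \<open>\<phi>\<close> against both
  measures gives the formula.\<close>

lemma nn_integral_image_wellorder:
 fixes f :: "real^'k::{finite,wellorder} \<Rightarrow> real^'k::_"
 assumes U: "open U" and der: "\<And>x. x \<in> U \<Longrightarrow> (f has_derivative f' x) (at x)" and inj: "inj_on f U"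
  and det: "continuous_on U (\<lambda>x. \<bar>det (matrix (f' x))\<bar>)" and \<phi>: "\<phi> \<in> borel_measurable borel"
 shows "(\<integral>\<^sup>+y. \<phi> y * indicator (f ` U) y \<partial>lborel) = (\<integral>\<^sup>+x. \<phi> (f x) * ennreal \<bar>det (matrix (f' x))\<bar> * indicator U x \<partial>lborel)"
proof -
 \<comment> \<open>The extension by 0 outside of \<open>U\<close>, here and for \<open>F\<close>,
   gives Borel functions on the whole space.\<close>
 define h where "h x = (if x \<in> U then \<bar>det (matrix (f' x))\<bar> else 0)" for x
 define F where "F x = (if x \<in> U then f x else 0)" for x
 have cf: "continuous_on U f" using der U by (intro continuous_at_imp_continuous_on) (auto intro: has_derivative_continuous)
 have h: "h \<in> borel_measurable borel" unfolding h_def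
  by (rule borel_measurable_continuous_on_if) (use U det in auto)
 have F: "F \<in> borel_measurable borel" unfolding F_def
  by (rule borel_measurable_continuous_on_if) (use U in \<open>auto intro!: continuous_intros cf\<close>)
 have oV: "open (f ` U)" by (rule invariance_of_domain[OF cf U inj])
 have "distr (density lborel (\<lambda>x. ennreal (h x))) borel F = density lborel (indicator (f ` U))"
 proof (rule measure_eqI)
  fix Y assume "Y \<in> sets (distr (density lborel (\<lambda>x. ennreal (h x))) borel F)"
  then have Y: "Y \<in> sets borel" by simp
  let ?B = "U \<inter> F -` Y"
  have FY: "F -` Y \<in> sets borel" using measurable_sets[OF F Y] by simp
  then have B: "?B \<in> sets borel" using U by auto
  have fB: "f ` ?B = f ` U \<inter> Y" by (auto simp: F_def)
  have "emeasure (distr (density lborel (\<lambda>x. ennreal (h x))) borel F) Y = emeasure (density lborel (\<lambda>x. ennreal (h x))) (F -` Y)"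
   using F Y by (subst emeasure_distr) auto
  also have "\<dots> = emeasure (density lborel (\<lambda>x. ennreal (h x))) ?B"
  proof -
   have mh: "(\<lambda>x. ennreal (h x)) \<in> borel_measurable lborel" using h by simp
   have s: "F -` Y \<in> sets lborel" "?B \<in> sets lborel" using FY B by simp_all
   show ?thesis unfolding emeasure_density[OF mh s(1)] emeasure_density[OF mh s(2)]
    by (rule nn_integral_cong) (auto simp: h_def indicator_def)
  qed
  also have "\<dots> = emeasure lebesgue (f ` ?B)"
   by (rule image_emeasure_wellorder(1)[OF U der inj h, symmetric]) (use B in \<open>auto simp: h_def\<close>)
  also have "\<dots> = emeasure lborel (f ` U \<inter> Y)" unfolding fB using oV Y by simp
  also have "\<dots> = emeasure (density lborel (indicator (f ` U))) Y"
   using oV Y by (subst emeasure_density) (auto simp: indicator_inter_arith[symmetric] simp flip: nn_integral_indicator)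
  finally show "emeasure (distr (density lborel (\<lambda>x. ennreal (h x))) borel F) Y = emeasure (density lborel (indicator (f ` U))) Y" .
 qed simp
 then have "(\<integral>\<^sup>+y. \<phi> y \<partial>density lborel (indicator (f ` U))) = (\<integral>\<^sup>+x. \<phi> (F x) \<partial>density lborel (\<lambda>x. ennreal (h x)))"
  using nn_integral_distr[of F "density lborel (\<lambda>x. ennreal (h x))" borel \<phi>] F \<phi> by simp
 also have "\<dots> = (\<integral>\<^sup>+x. ennreal (h x) * \<phi> (F x) \<partial>lborel)"
  using h measurable_compose[OF F \<phi>] by (subst nn_integral_density) auto
 also have "\<dots> = (\<integral>\<^sup>+x. \<phi> (f x) * ennreal \<bar>det (matrix (f' x))\<bar> * indicator U x \<partial>lborel)"
  by (intro nn_integral_cong) (auto simp: h_def F_def indicator_def mult.commute)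
 finally show ?thesis using oV \<phi> by (subst (asm) nn_integral_density) (auto simp: mult.commute)
qed

text \<open>The change of variables theorem of the library needs a wellordered index type, so we pass to a
 wellordered copy of \<open>'n\<close>.\<close>
typedef ('n::finite) idx = "{..<CARD('n)}"
 by (rule exI[of _ 0]) simp

instance idx :: (finite) finite
proof
 have "(UNIV :: 'a idx set) = Abs_idx ` {..<CARD('a)}" using type_definition.univ[OF type_definition_idx] .
 then show "finite (UNIV :: 'a idx set)" by (metis finite_imageI finite_lessThan)
qed

instantiation idx :: (finite) wellorder
begin

definition less_eq_idx :: "'a idx \<Rightarrow> 'a idx \<Rightarrow> bool" where "less_eq_idx x y \<longleftrightarrow> Rep_idx x \<le> Rep_idx y"

definition less_idx :: "'a idx \<Rightarrow> 'a idx \<Rightarrow> bool" where "less_idx x y \<longleftrightarrow> Rep_idx x < Rep_idx y"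

instance
proof
 fix P :: "'a idx \<Rightarrow> bool" and a
 assume *: "\<And>x. (\<And>y. y < x \<Longrightarrow> P y) \<Longrightarrow> P x"
 show "P a" by (induction a rule: measure_induct_rule[of Rep_idx]) (rule *, simp add: less_idx_def)
qed (auto simp: less_eq_idx_def less_idx_def Rep_idx_inject)

end

lemma idx_bij: "\<exists>\<sigma> :: 'n idx \<Rightarrow> 'n::finite. bij \<sigma>"
proof -
 have "card (UNIV :: 'n idx set) = card {..<CARD('n)}" by (rule type_definition.card[OF type_definition_idx])
 then show ?thesis using finite_same_card_bij[of "UNIV :: 'n idx set" "UNIV :: 'n set"] by auto
qed

lemma prod_Basis_cart: "(\<Prod>b\<in>Basis. (v :: real^'k::finite) \<bullet> b) = (\<Prod>i\<in>UNIV. v $ i)"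
 by (rule prod.reindex_cong[of "\<lambda>i. axis i 1"]) (auto simp: inj_on_def axis_eq_axis Basis_vec_def inner_axis)

text \<open>Relabelling the coordinates by a bijection \<open>\<sigma>\<close> of the index types
  preserves Lebesgue measure, as it permutes the sides of boxes, and preserves the Jacobian by
  \<open>det_reindex\<close>.\<close>

theorem nn_integral_image:
 fixes f :: "real^'n \<Rightarrow> real^'n"
 assumes U: "open U" and der: "\<And>x. x \<in> U \<Longrightarrow> (f has_derivative f' x) (at x)" and inj: "inj_on f U"
  and det: "continuous_on U (\<lambda>x. \<bar>det (matrix (f' x))\<bar>)" and \<phi>: "\<phi> \<in> borel_measurable borel"
 shows "(\<integral>\<^sup>+y. \<phi> y * indicator (f ` U) y \<partial>lborel) = (\<integral>\<^sup>+x. \<phi> (f x) * ennreal \<bar>det (matrix (f' x))\<bar> * indicator U x \<partial>lborel)"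
proof -
 obtain \<sigma> :: "'n idx \<Rightarrow> 'n" where \<sigma>: "bij \<sigma>" using idx_bij by blast
 have i: "inv \<sigma> (\<sigma> k) = k" "\<sigma> (inv \<sigma> j) = j" for j k using \<sigma> by (simp_all add: bij_is_inj surj_f_inv_f[OF bij_is_surj])
 define T where "T x = (\<chi> k. x $ \<sigma> k)" for x :: "real^'n"
 define T' where "T' y = (\<chi> j. y $ inv \<sigma> j)" for y :: "real^'n idx"
 have TT: "T (T' y) = y" "T' (T x) = x" for x y by (simp_all add: T_def T'_def vec_eq_iff i)
 have blT: "bounded_linear T" and blT': "bounded_linear T'"
  unfolding linear_conv_bounded_linear[symmetric] by (auto intro!: linearI simp: T_def T'_def vec_eq_iff)
 have mT: "T \<in> borel_measurable borel" and mT': "T' \<in> borel_measurable borel"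
  by (intro borel_measurable_continuous_onI linear_continuous_on blT blT')+
 have distr: "lborel = distr lborel borel T"
 proof (rule lborel_eqI)
  fix l u :: "real^'n idx" assume le: "\<And>b. b \<in> Basis \<Longrightarrow> l \<bullet> b \<le> u \<bullet> b"
  then have le': "l $ k \<le> u $ k" for k using le[of "axis k 1"] by (simp add: inner_axis axis_in_Basis_iff)
  have pre: "T -` box l u = box (T' l) (T' u)"
   unfolding box_def Basis_vec_def by (auto simp: T_def T'_def inner_axis) (metis i)+
  have "emeasure (distr lborel borel T) (box l u) = emeasure lborel (box (T' l) (T' u))"
   using mT by (subst emeasure_distr) (auto simp: pre)
  also have "\<dots> = ennreal (\<Prod>b\<in>Basis. (T' u - T' l) \<bullet> b)"
   by (rule emeasure_lborel_box) (auto simp: Basis_vec_def inner_axis T'_def le')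
  also have "(\<Prod>b\<in>Basis. (T' u - T' l) \<bullet> b) = (\<Prod>j\<in>UNIV. (u - l) $ inv \<sigma> j)" unfolding prod_Basis_cart by (simp add: T'_def)
  also have "\<dots> = (\<Prod>k\<in>UNIV. (u - l) $ k)" by (rule prod.reindex_bij_betw) (rule bij_imp_bij_inv[OF \<sigma>])
  finally show "emeasure (distr lborel borel T) (box l u) = ennreal (\<Prod>b\<in>Basis. (u - l) \<bullet> b)" unfolding prod_Basis_cart .
 qed simp
 have transfer: "(\<integral>\<^sup>+y. \<psi> y \<partial>(lborel :: (real^'n idx) measure)) = (\<integral>\<^sup>+x. \<psi> (T x) \<partial>lborel)" if "\<psi> \<in> borel_measurable borel" for \<psi>
  unfolding distr by (rule nn_integral_distr) (use mT that in auto)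
 define F where "F y = T (f (T' y))" for y
 define F' where "F' y h = T (f' (T' y) (T' h))" for y h
 define V where "V = T' -` U"
 have oV: "open V" unfolding V_def by (intro open_vimage U linear_continuous_on blT')
 have VT: "T x \<in> V \<longleftrightarrow> x \<in> U" for x by (simp add: V_def TT)
 have FV: "T x \<in> F ` V \<longleftrightarrow> x \<in> f ` U" for x
  unfolding V_def F_def image_iff using TT by (metis vimage_eq)
 have dF: "(F has_derivative F' y) (at y)" if "y \<in> V" for y
  using bounded_linear.has_derivative[OF blT has_derivative_compose[OF bounded_linear_imp_has_derivative[OF blT'] der[of "T' y"]]] that
  unfolding F_def F'_def V_def by auto
 have injF: "inj_on F V" using inj unfolding inj_on_def F_def V_def by (metis TT vimage_eq)
 have detF: "det (matrix (F' y)) = det (matrix (f' (T' y)))" if "y \<in> V" for y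
 proof -
  have ax: "T' (axis k 1) = axis (\<sigma> k) 1" for k by (auto simp: T'_def vec_eq_iff axis_def i)
  have "matrix (F' y) = (\<chi> k l. matrix (f' (T' y)) $ \<sigma> k $ \<sigma> l)"
   by (simp add: matrix_def vec_eq_iff F'_def ax T_def)
  then show ?thesis by (simp add: det_reindex[OF \<sigma>])
 qed
 have cF: "continuous_on V (\<lambda>y. \<bar>det (matrix (F' y))\<bar>)"
 proof (rule continuous_on_eq)
  show "continuous_on V (\<lambda>y. \<bar>det (matrix (f' (T' y)))\<bar>)"
   by (rule continuous_on_compose2[OF det linear_continuous_on[OF blT']]) (auto simp: V_def)
 qed (simp add: detF)
 have oFV: "open (F ` V)"
  by (rule invariance_of_domain[OF _ oV injF]) (use dF oV in \<open>auto intro!: continuous_at_imp_continuous_on has_derivative_continuous\<close>)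
 have [measurable]: "F ` V \<in> sets borel" using oFV by simp
 have m\<phi>: "(\<lambda>y. \<phi> (T' y)) \<in> borel_measurable borel" by (rule measurable_compose[OF mT' \<phi>])
 have mJ: "(\<lambda>y. \<phi> (T' (F y)) * ennreal \<bar>det (matrix (F' y))\<bar> * indicator V y) \<in> borel_measurable borel"
 proof -
  have 1: "(\<lambda>y. if y \<in> V then F y else 0) \<in> borel_measurable borel"
   by (rule borel_measurable_continuous_on_if) (use oV dF in \<open>auto intro!: continuous_intros continuous_at_imp_continuous_on has_derivative_continuous\<close>)
  have [measurable]: "V \<in> sets borel" using oV by simp
  have 2: "(\<lambda>y. if y \<in> V then \<bar>det (matrix (F' y))\<bar> else 0) \<in> borel_measurable borel"
   by (rule borel_measurable_continuous_on_if) (use oV cF in auto)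
  have "(\<lambda>y. \<phi> (T' (if y \<in> V then F y else 0)) * ennreal (if y \<in> V then \<bar>det (matrix (F' y))\<bar> else 0) * indicator V y) \<in> borel_measurable borel"
   using measurable_compose[OF 1 m\<phi>] 2 by measurable
  then show ?thesis by (rule measurable_cong[THEN iffD1, rotated]) (auto simp: indicator_def)
 qed
 have "(\<integral>\<^sup>+y. \<phi> y * indicator (f ` U) y \<partial>lborel) = (\<integral>\<^sup>+x. \<phi> (T' (T x)) * indicator (F ` V) (T x) \<partial>lborel)"
  by (intro nn_integral_cong) (auto simp: TT FV indicator_def)
 also have "\<dots> = (\<integral>\<^sup>+y. \<phi> (T' y) * indicator (F ` V) y \<partial>lborel)"
  by (rule transfer[symmetric]) (use m\<phi> oFV in measurable)
 also have "\<dots> = (\<integral>\<^sup>+y. \<phi> (T' (F y)) * ennreal \<bar>det (matrix (F' y))\<bar> * indicator V y \<partial>lborel)"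
  by (rule nn_integral_image_wellorder[OF oV dF injF cF m\<phi>])
 also have "\<dots> = (\<integral>\<^sup>+x. \<phi> (T' (F (T x))) * ennreal \<bar>det (matrix (F' (T x)))\<bar> * indicator V (T x) \<partial>lborel)"
  by (rule transfer[OF mJ])
 also have "\<dots> = (\<integral>\<^sup>+x. \<phi> (f x) * ennreal \<bar>det (matrix (f' x))\<bar> * indicator U x \<partial>lborel)"
  by (intro nn_integral_cong) (auto simp: F_def TT detF VT indicator_def)
 finally show ?thesis .
qed

section \<open>The Riemannian measure in exponential coordinates\<close>

lemma continuous_on_det_matrix:
 fixes A :: "'x::topological_space \<Rightarrow> real^'n^'n"
 assumes "\<And>i j. continuous_on S (\<lambda>x. A x $ i $ j)"
 shows "continuous_on S (\<lambda>x. det (A x))"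
 unfolding det_def by (intro continuous_intros assms)

lemma gram_matrix:
 fixes L :: "real^'n \<Rightarrow> real^'n" and G :: "real^'n^'n"
 assumes L: "linear L"
 shows "(\<chi> i j. L (axis i 1) \<bullet> (G *v L (axis j 1))) = transpose (matrix L) ** (G ** matrix L)"
  "v \<bullet> ((transpose (matrix L) ** (G ** matrix L)) *v w) = L v \<bullet> (G *v L w)"
proof -
 show 1: "v \<bullet> ((transpose (matrix L) ** (G ** matrix L)) *v w) = L v \<bullet> (G *v L w)" for v w
  by (metis L dot_lmul_matrix inner_commute matrix_vector_mul_assoc matrix_linear transpose_matrix_vector)
 have e: "B $ i $ j = axis i 1 \<bullet> (B *v axis j 1)" for B :: "real^'n^'n" and i j
  by (simp add: inner_axis' matrix_vector_mult_basis column_def)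
 show "(\<chi> i j. L (axis i 1) \<bullet> (G *v L (axis j 1))) = transpose (matrix L) ** (G ** matrix L)"
  by (simp add: vec_eq_iff) (metis 1 e)
qed

section \<open>The Jacobian of the exponential map and the Riemannian measure\<close>

locale hadamard_exp = exp_map M q u c
 for M :: "('a::{t2_space,second_countable_topology}, 'n::finite) riemannian" and q :: 'a and u :: "real^'n \<Rightarrow> real^'n" and c :: real +
 assumes sc: "simply_connected (UNIV :: 'a set)"
begin

definition gram :: "real^'n \<Rightarrow> real^'n^'n" where
 "gram \<xi> = (\<chi> i j. pullback_metric M expo \<xi> (axis i 1) (axis j 1))"

text \<open>The Jacobian of \<open>expo\<close> between Lebesgue measure and the Riemannian
  measure.\<close>

definition jac :: "real^'n \<Rightarrow> real" where "jac \<xi> = sqrt (det (gram \<xi>))"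

lemma expo_isCont: "isCont expo \<xi>"
 using expo.cont continuous_on_eq_continuous_at[OF open_UNIV] by blast

lemma gram_chart:
 assumes C: "C \<in> atlas M" "expo \<xi> \<in> chart_dom C" and L: "(chart_map C \<circ> expo has_derivative L) (at \<xi>)"
 shows "gram \<xi> = transpose (matrix L) ** (gmat M C (chart_map C (expo \<xi>)) ** matrix L)"
 unfolding gram_def pullback_metric_chart[where H=expo, OF C expo_isCont L] ginner_def
 by (rule gram_matrix(1)[OF has_derivative_linear[OF L]])

lemma pullback_gram: "pullback_metric M expo \<xi> v w = v \<bullet> (gram \<xi> *v w)"
proof -
 obtain C N E' where C: "C \<in> atlas M" "open N" "\<xi> \<in> N" "\<And>\<eta>. \<eta> \<in> N \<Longrightarrow> expo \<eta> \<in> chart_dom C"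
  "\<And>\<eta>. \<eta> \<in> N \<Longrightarrow> (chart_map C \<circ> expo has_derivative blinfun_apply (E' \<eta>)) (at \<eta>)" "continuous_on N E'"
  "\<And>\<eta>. \<eta> \<in> N \<Longrightarrow> continuous (at \<eta>) expo" by (fact expo_C1[of \<xi>])
 note p = C(4)[OF C(3)] C(5)[OF C(3)]
 show ?thesis
  unfolding gram_chart[OF C(1) p] gram_matrix(2)[OF has_derivative_linear[OF p(2)]]
   pullback_metric_chart[where H=expo, OF C(1) p(1) expo_isCont p(2)] ginner_def ..
qed

lemma jac_chart:
 assumes "C \<in> atlas M" "expo \<xi> \<in> chart_dom C" "(chart_map C \<circ> expo has_derivative L) (at \<xi>)"
 shows "jac \<xi> = \<bar>det (matrix L)\<bar> * sqrt (det (gmat M C (chart_map C (expo \<xi>))))"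
proof -
 have "det (gram \<xi>) = (det (matrix L))\<^sup>2 * det (gmat M C (chart_map C (expo \<xi>)))"
  unfolding gram_chart[OF assms] by (simp add: det_mul det_transpose power2_eq_square)
 then show ?thesis by (simp add: jac_def real_sqrt_mult)
qed

lemma continuous_on_gmat: "C \<in> atlas M \<Longrightarrow> continuous_on (chart_img C) (gmat M C)"
proof -
 assume "C \<in> atlas M"
 then have "Ck_on 0 (chart_img C) (gmat M C)" using riem unfolding riemannian_manifold_def smooth_fun_on_def by blast
 then show ?thesis by simp
qed

lemma continuous_on_sqrt_det: "C \<in> atlas M \<Longrightarrow> continuous_on (chart_img C) (\<lambda>x. sqrt (det (gmat M C x)))"
 by (intro continuous_on_real_sqrt continuous_on_det_matrix continuous_on_component continuous_on_gmat)

lemma continuous_jac: "continuous_on UNIV jac"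
 unfolding continuous_on_eq_continuous_at[OF open_UNIV]
proof
 fix \<xi>
 obtain C N E' where C: "C \<in> atlas M" "open N" "\<xi> \<in> N" "\<And>\<eta>. \<eta> \<in> N \<Longrightarrow> expo \<eta> \<in> chart_dom C"
  "\<And>\<eta>. \<eta> \<in> N \<Longrightarrow> (chart_map C \<circ> expo has_derivative blinfun_apply (E' \<eta>)) (at \<eta>)" "continuous_on N E'"
  "\<And>\<eta>. \<eta> \<in> N \<Longrightarrow> continuous (at \<eta>) expo" by (fact expo_C1[of \<xi>])
 have 1: "continuous_on N (\<lambda>\<eta>. det (matrix (blinfun_apply (E' \<eta>))))"
  by (intro continuous_on_det_matrix) (simp add: matrix_def continuous_on_component blinfun.continuous_on C(6) continuous_on_const)
 have c: "continuous_on N (\<lambda>\<eta>. chart_map C (expo \<eta>))"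
  by (rule continuous_on_compose2[OF chartD(3)[OF C(1)] continuous_on_subset[OF expo.cont]]) (use C(4) in auto)
 have 2: "continuous_on N (\<lambda>\<eta>. sqrt (det (gmat M C (chart_map C (expo \<eta>)))))"
  by (rule continuous_on_compose2[OF continuous_on_sqrt_det[OF C(1)] c]) (use C(4) chartD(8)[OF C(1)] in auto)
 have "continuous_on N jac"
 proof (rule continuous_on_eq)
  show "continuous_on N (\<lambda>\<eta>. \<bar>det (matrix (blinfun_apply (E' \<eta>)))\<bar> * sqrt (det (gmat M C (chart_map C (expo \<eta>)))))"
   by (intro continuous_on_mult continuous_on_rabs 1 2)
 qed (use jac_chart[OF C(1) C(4) C(5)] in simp)
 then show "isCont jac \<xi>" using continuous_on_eq_continuous_at[OF C(2)] C(3) by blast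
qed

lemma expo_0: "expo 0 = q"
 using expo_rdist[of 0] rdist_nonneg[of q "expo 0"] rdist_eq_0_iff[of q "expo 0"] by simp

text \<open>A path from \<open>q\<close> to \<open>p\<close> is lifted, starting at 0; the end of
  the lift is sent to \<open>p\<close>.\<close>

lemma expo_surj: "\<exists>\<xi>. expo \<xi> = p"
proof -
 obtain \<gamma> where g: "piecewise_C1_curve M \<gamma>" "pathstart \<gamma> = q" "pathfinish \<gamma> = p"
  using finite_length_curve[of q p] by metis
 then have "continuous_on {0..1} \<gamma>" "expo 0 = \<gamma> 0" using expo_0 by (auto simp: piecewise_C1_curve_def path_def pathstart_def)
 then obtain \<eta> where "\<And>t. t \<in> {0..1} \<Longrightarrow> expo (\<eta> t) = \<gamma> t" by (rule expo_path_lift) blast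
 from this[of 1] show ?thesis using g(3) by (auto simp: pathfinish_def)
qed

text \<open>Turns out to be the Riemannian measure; being an image measure, it brings integrals over
  the manifold into exponential coordinates at once.\<close>

definition vol :: "'a measure" where "vol = distr (density lborel (\<lambda>\<xi>. ennreal (jac \<xi>))) borel expo"

lemma expo_measurable: "expo \<in> borel_measurable borel"
 by (rule borel_measurable_continuous_onI[OF expo.cont])

lemma jac_measurable: "jac \<in> borel_measurable borel"
 by (rule borel_measurable_continuous_onI[OF continuous_jac])

lemma chart_det_nz: "C \<in> atlas M \<Longrightarrow> x \<in> chart_img C \<Longrightarrow> sqrt (det (gmat M C x)) \<noteq> 0"
 using det_gmat_nz by simp

text \<open>The change of variables formula for the coordinate map after \<open>expo\<close>, which
  is a bijection from the open set over the chart domain onto the image of the chart.\<close>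

lemma vol_chart:
 assumes C: "C \<in> atlas M" and A: "A \<in> sets borel" "A \<subseteq> chart_dom C"
 shows "emeasure vol A = (\<integral>\<^sup>+ x \<in> chart_map C ` A. ennreal (sqrt (det (gmat M C x))) \<partial>lborel)"
proof -
 define U where "U = expo -` chart_dom C"
 define f where "f = chart_map C \<circ> expo"
 have U: "open U" unfolding U_def by (rule open_vimage[OF chartD(1)[OF C] expo.cont])
 have "\<exists>L. (f has_derivative L) (at \<xi>)" if \<xi>: "\<xi> \<in> U" for \<xi>
 proof -
  obtain D N E' where D: "D \<in> atlas M" "open N" "\<xi> \<in> N" "\<And>\<eta>. \<eta> \<in> N \<Longrightarrow> expo \<eta> \<in> chart_dom D"
   "\<And>\<eta>. \<eta> \<in> N \<Longrightarrow> (chart_map D \<circ> expo has_derivative blinfun_apply (E' \<eta>)) (at \<eta>)" "continuous_on N E'"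
   "\<And>\<eta>. \<eta> \<in> N \<Longrightarrow> continuous (at \<eta>) expo" by (fact expo_C1[of \<xi>])
  show ?thesis unfolding f_def
   using has_derivative_chart_change(1)[OF D(1) D(4)[OF D(3)] C _ expo_isCont D(5)[OF D(3)]] \<xi> unfolding U_def by blast
 qed
 then obtain f' where f': "\<And>\<xi>. \<xi> \<in> U \<Longrightarrow> (f has_derivative f' \<xi>) (at \<xi>)" by metis
 have J: "jac \<xi> = \<bar>det (matrix (f' \<xi>))\<bar> * sqrt (det (gmat M C (f \<xi>)))" if "\<xi> \<in> U" for \<xi>
  using jac_chart[OF C _ f'[OF that, unfolded f_def]] that by (simp add: U_def f_def)
 have fimg: "f \<xi> \<in> chart_img C" if "\<xi> \<in> U" for \<xi> using that chartD(8)[OF C] by (simp add: f_def U_def)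
 have cf: "continuous_on U f" using U f' by (intro continuous_at_imp_continuous_on) (auto intro: has_derivative_continuous)
 have cdet: "continuous_on U (\<lambda>\<xi>. \<bar>det (matrix (f' \<xi>))\<bar>)"
 proof (rule continuous_on_eq)
  show "continuous_on U (\<lambda>\<xi>. jac \<xi> / sqrt (det (gmat M C (f \<xi>))))"
   by (intro continuous_on_divide continuous_on_subset[OF continuous_jac] continuous_on_compose2[OF continuous_on_sqrt_det[OF C] cf])
     (use fimg chart_det_nz[OF C] in auto)
  show "jac \<xi> / sqrt (det (gmat M C (f \<xi>))) = \<bar>det (matrix (f' \<xi>))\<bar>" if "\<xi> \<in> U" for \<xi>
   using J[OF that] chart_det_nz[OF C fimg[OF that]] by simp
 qed
 have injf: "inj_on f U"
 proof (rule inj_onI)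
  fix \<xi> \<eta> assume "\<xi> \<in> U" "\<eta> \<in> U" "f \<xi> = f \<eta>"
  then have "expo \<xi> = expo \<eta>" using chartD(5)[OF C] unfolding f_def U_def by (metis comp_apply vimage_eq)
  then show "\<xi> = \<eta>" using expo_inj[OF sc] by (simp add: inj_eq)
 qed
 have fU: "f ` U = chart_img C"
 proof
  show "chart_img C \<subseteq> f ` U"
  proof
   fix x assume x: "x \<in> chart_img C"
   obtain \<xi> where "expo \<xi> = chart_inv C x" using expo_surj by blast
   then have "\<xi> \<in> U" "f \<xi> = x" using chartD(6,7)[OF C x] by (simp_all add: U_def f_def)
   then show "x \<in> f ` U" by blast
  qed
 qed (use fimg in auto)
 define g where "g x = (if x \<in> chart_img C then sqrt (det (gmat M C x)) else 0)" for x
 have gm: "g \<in> borel_measurable borel" unfolding g_def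
  by (rule borel_measurable_continuous_on_if) (use chartD(2)[OF C] continuous_on_sqrt_det[OF C] in auto)
 \<comment> \<open>The inverse chart, extended by a constant to a Borel map on the whole space. The
   coordinate image of \<open>A\<close> is the part of the preimage under \<open>k\<close> in the
   chart image, hence Borel.\<close>
 define k where "k x = (if x \<in> chart_img C then chart_inv C x else q)" for x
 have km: "k \<in> borel_measurable borel" unfolding k_def
  by (rule borel_measurable_continuous_on_if) (use chartD(2,4)[OF C] in auto)
 have cA: "chart_map C ` A = chart_img C \<inter> k -` A"
 proof
  show "chart_map C ` A \<subseteq> chart_img C \<inter> k -` A"
  proof
   fix x assume "x \<in> chart_map C ` A"
   then obtain p where p: "p \<in> A" "x = chart_map C p" by blast
   then have "p \<in> chart_dom C" using A(2) by blast
   then show "x \<in> chart_img C \<inter> k -` A" using p chartD(5,8)[OF C] by (simp add: k_def)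
  qed
  show "chart_img C \<inter> k -` A \<subseteq> chart_map C ` A"
  proof
   fix x assume x: "x \<in> chart_img C \<inter> k -` A"
   then have "chart_inv C x \<in> A" "chart_map C (chart_inv C x) = x" using chartD(6)[OF C] by (auto simp: k_def)
   then show "x \<in> chart_map C ` A" by (metis imageI)
  qed
 qed
 have cAb: "chart_map C ` A \<in> sets borel"
  unfolding cA using measurable_sets[OF km A(1)] chartD(2)[OF C] by auto
 have fA: "f \<xi> \<in> chart_map C ` A \<longleftrightarrow> expo \<xi> \<in> A" if "\<xi> \<in> U" for \<xi>
  unfolding cA using fimg[OF that] that chartD(5)[OF C] by (simp add: k_def f_def U_def)
 define \<phi> where "\<phi> y = ennreal (g y) * indicator (chart_map C ` A) y" for y
 have \<phi>: "\<phi> \<in> borel_measurable borel" unfolding \<phi>_def using gm cAb by measurable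
 have eA: "expo -` A \<in> sets borel" using measurable_sets[OF expo_measurable A(1)] by simp
 have "emeasure vol A = emeasure (density lborel (\<lambda>\<xi>. ennreal (jac \<xi>))) (expo -` A)"
  unfolding vol_def using expo_measurable A(1) by (subst emeasure_distr) auto
 also have "\<dots> = (\<integral>\<^sup>+\<xi>. ennreal (jac \<xi>) * indicator (expo -` A) \<xi> \<partial>lborel)"
  by (rule emeasure_density) (use jac_measurable eA in auto)
 also have "\<dots> = (\<integral>\<^sup>+\<xi>. \<phi> (f \<xi>) * ennreal \<bar>det (matrix (f' \<xi>))\<bar> * indicator U \<xi> \<partial>lborel)"
 proof (rule nn_integral_cong)
  fix \<xi>
  show "ennreal (jac \<xi>) * indicator (expo -` A) \<xi> = \<phi> (f \<xi>) * ennreal \<bar>det (matrix (f' \<xi>))\<bar> * indicator U \<xi>"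
  proof (cases "\<xi> \<in> U")
   case True
   have "ennreal (jac \<xi>) = ennreal (g (f \<xi>)) * ennreal \<bar>det (matrix (f' \<xi>))\<bar>"
    unfolding J[OF True] using fimg[OF True] by (simp add: g_def ennreal_mult' mult.commute)
   then show ?thesis using True fA[OF True] by (auto simp: \<phi>_def indicator_def)
  next
   case False
   then have "expo \<xi> \<notin> A" using A(2) by (auto simp: U_def)
   then show ?thesis using False by simp
  qed
 qed
 also have "\<dots> = (\<integral>\<^sup>+y. \<phi> y * indicator (f ` U) y \<partial>lborel)"
  by (rule nn_integral_image[OF U f' injf cdet \<phi>, symmetric])
 also have "\<dots> = (\<integral>\<^sup>+ x \<in> chart_map C ` A. ennreal (sqrt (det (gmat M C x))) \<partial>lborel)"
  by (rule nn_integral_cong) (auto simp: fU \<phi>_def g_def cA indicator_def)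
 finally show ?thesis .
qed

text \<open>For the uniqueness in the definite description, countably many chart domains cover the
  space by Lindelof's theorem; a Borel set is cut into countably many disjoint pieces, each inside
  one chart domain, where both measures are prescribed.\<close>

lemma riemannian_measure_vol: "riemannian_measure M = vol"
 unfolding riemannian_measure_def
proof (rule the_equality)
 show "sets vol = sets borel \<and> (\<forall>C\<in>atlas M. \<forall>A\<in>sets borel. A \<subseteq> chart_dom C \<longrightarrow>
   emeasure vol A = (\<integral>\<^sup>+ x \<in> chart_map C ` A. ennreal (sqrt (det (gmat M C x))) \<partial>lborel))"
  using vol_chart by (simp add: vol_def)
next
 fix \<nu> :: "'a measure"
 assume \<nu>: "sets \<nu> = sets borel \<and> (\<forall>C\<in>atlas M. \<forall>A\<in>sets borel. A \<subseteq> chart_dom C \<longrightarrow>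
   emeasure \<nu> A = (\<integral>\<^sup>+ x \<in> chart_map C ` A. ennreal (sqrt (det (gmat M C x))) \<partial>lborel))"
 have sv: "sets vol = sets borel" by (simp add: vol_def)
 obtain F' where F': "F' \<subseteq> chart_dom ` atlas M" "countable F'" "\<Union>F' = \<Union>(chart_dom ` atlas M)"
  by (rule Lindelof[of "chart_dom ` atlas M"]) (use chartD(1) in auto)
 have un: "\<Union>F' = UNIV" unfolding F'(3) using chart_at by blast
 then have ne: "F' \<noteq> {}" by auto
 define D where "D = from_nat_into F'"
 have rD: "range D = F'" unfolding D_def by (rule range_from_nat_into[OF ne F'(2)])
 have D: "\<exists>C\<in>atlas M. D n = chart_dom C" for n using F'(1) rD by blast
 have Db: "D n \<in> sets borel" for n using D[of n] chartD(1) by auto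
 have dD: "disjointed D n \<in> sets borel" for n using sets.range_disjointed_sets[of D borel] Db by auto
 show "\<nu> = vol"
 proof (rule measure_eqI)
  fix A assume "A \<in> sets \<nu>"
  then have A: "A \<in> sets borel" using \<nu> by simp
  have An: "A \<inter> disjointed D n \<in> sets borel" for n using A dD by auto
  have split: "A = (\<Union>n. A \<inter> disjointed D n)" using UN_disjointed_eq[of D] rD un by auto
  have disj: "disjoint_family (\<lambda>n. A \<inter> disjointed D n)" using disjoint_family_disjointed[of D] by (auto simp: disjoint_family_on_def)
  have eq: "emeasure \<nu> (A \<inter> disjointed D n) = emeasure vol (A \<inter> disjointed D n)" for n
  proof -
   obtain C where C: "C \<in> atlas M" "D n = chart_dom C" using D by blast
   have "A \<inter> disjointed D n \<subseteq> chart_dom C" using disjointed_subset[of D n] C(2) by auto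
   then show ?thesis using \<nu> vol_chart[OF C(1) An] C(1) An by auto
  qed
  have "emeasure \<nu> A = (\<Sum>n. emeasure \<nu> (A \<inter> disjointed D n))"
   using suminf_emeasure[of "\<lambda>n. A \<inter> disjointed D n" \<nu>] An disj \<nu> split by (metis (no_types, lifting) image_subset_iff)
  also have "\<dots> = (\<Sum>n. emeasure vol (A \<inter> disjointed D n))" using eq by simp
  also have "\<dots> = emeasure vol A"
   using suminf_emeasure[of "\<lambda>n. A \<inter> disjointed D n" vol] An disj sv split by (metis (no_types, lifting) image_subset_iff)
  finally show "emeasure \<nu> A = emeasure vol A" .
 qed (use \<nu> sv in simp)
qed

text \<open>In an orthonormal frame \<open>v\<close> of the pulled-back metric the Gram matrix
  becomes the identity; taking determinants shows that \<open>jac\<close> is the reciprocal of the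
  volume of the frame.\<close>

lemma expo_frame:
 obtains v :: "real^'n \<Rightarrow> real^'n" where "bounded_linear v" "\<And>\<eta> \<zeta>. pullback_metric M expo \<xi> (v \<eta>) (v \<zeta>) = \<eta> \<bullet> \<zeta>" "\<bar>det (matrix v)\<bar> * jac \<xi> = 1"
proof -
 obtain C x A where A: "C \<in> atlas M" "x \<in> chart_img C" "bounded_linear A" "\<And>v w. pullback_metric M expo \<xi> v w = ginner M C x (A v) (A w)"
  by (fact expo_pullback[of \<xi>])
 obtain v :: "real^'n \<Rightarrow> real^'n" where v: "bounded_linear v" "\<And>\<eta> \<zeta>. pullback_metric M expo \<xi> (v \<eta>) (v \<zeta>) = \<eta> \<bullet> \<zeta>"
 proof (rule orthonormal_frame_exists[of "pullback_metric M expo \<xi>"])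
  show "linear (\<lambda>v. pullback_metric M expo \<xi> v w)" for w
   unfolding pullback_gram by (rule linearI) (simp_all add: inner_add_left)
  show "pullback_metric M expo \<xi> v w = pullback_metric M expo \<xi> w v" for v w unfolding A(4) by (rule ginner_sym[OF A(1,2)])
  show "0 < pullback_metric M expo \<xi> v v" if "v \<noteq> 0" for v
   using expo_expanding[of v \<xi>] that by (smt (verit) zero_less_norm_iff zero_less_power2)
 qed blast
 have lv: "linear v" by (rule bounded_linear.linear[OF v(1)])
 have "transpose (matrix v) ** (gram \<xi> ** matrix v) = mat 1"
  unfolding gram_matrix(1)[OF lv, symmetric] pullback_gram[symmetric] v(2) by (simp add: mat_def vec_eq_iff inner_axis_axis)
 then have "det (transpose (matrix v) ** (gram \<xi> ** matrix v)) = 1" by simp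
 then have "(det (matrix v))\<^sup>2 * det (gram \<xi>) = 1" by (simp add: det_mul det_transpose power2_eq_square mult_ac)
 then have "sqrt ((det (matrix v))\<^sup>2 * det (gram \<xi>)) = 1" by simp
 then have "\<bar>det (matrix v)\<bar> * jac \<xi> = 1" by (simp add: jac_def real_sqrt_mult)
 then show ?thesis using that v by blast
qed

lemma jac_pos: "0 < jac \<xi>"
proof -
 obtain v :: "real^'n \<Rightarrow> real^'n" where v: "\<bar>det (matrix v)\<bar> * jac \<xi> = 1" using expo_frame[of \<xi>] by metis
 show ?thesis
 proof (rule ccontr)
  assume "\<not> 0 < jac \<xi>"
  then have "\<bar>det (matrix v)\<bar> * jac \<xi> \<le> 0" by (intro mult_nonneg_nonpos) auto
  then show False using v by simp
 qed
qed

text \<open>By \<open>expo_growth\<close> the map \<open>L\<close> does not increase lengths from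
  the pulled-back metric at \<open>t1 *\<^sub>R \<theta>\<close> to the one at
  \<open>t0 *\<^sub>R \<theta>\<close>. Written in orthonormal frames of the two metrics it is a
  contraction \<open>K\<close> of Euclidean space, so \<open>det_contraction\<close> bounds the
  determinant of \<open>L\<close>, known from \<open>det_radial\<close>, by the ratio of the
  Jacobians.\<close>

lemma jac_growth:
 assumes \<theta>: "norm \<theta> = 1" and t: "0 < t0" "t0 \<le> t1"
 shows "(t0 / t1 * exp (c * (t1 - t0))) ^ (CARD('n) - 1) * jac (t0 *\<^sub>R \<theta>) \<le> jac (t1 *\<^sub>R \<theta>)"
proof -
 obtain v0 :: "real^'n \<Rightarrow> real^'n" where v0: "bounded_linear v0" "\<And>\<eta> \<zeta>. pullback_metric M expo (t0 *\<^sub>R \<theta>) (v0 \<eta>) (v0 \<zeta>) = \<eta> \<bullet> \<zeta>" "\<bar>det (matrix v0)\<bar> * jac (t0 *\<^sub>R \<theta>) = 1"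
  by (fact expo_frame[of "t0 *\<^sub>R \<theta>"])
 obtain v1 :: "real^'n \<Rightarrow> real^'n" where v1: "bounded_linear v1" "\<And>\<eta> \<zeta>. pullback_metric M expo (t1 *\<^sub>R \<theta>) (v1 \<eta>) (v1 \<zeta>) = \<eta> \<bullet> \<zeta>" "\<bar>det (matrix v1)\<bar> * jac (t1 *\<^sub>R \<theta>) = 1"
  by (fact expo_frame[of "t1 *\<^sub>R \<theta>"])
 have l0: "linear v0" and l1: "linear v1" using v0(1) v1(1) bounded_linear.linear by auto
 define e where "e = exp (c * (t1 - t0))"
 \<comment> \<open>The map of \<open>expo_growth\<close>, multiplied by \<open>t0 / t1\<close> so
   that its radial factor is 1.\<close>
 define L where "L w = (t0 / t1 * e) *\<^sub>R (w - (\<theta> \<bullet> w) *\<^sub>R \<theta>) + (1 * (\<theta> \<bullet> w)) *\<^sub>R \<theta>" for w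
 have lL: "linear L" unfolding L_def by (rule linearI) (simp_all add: inner_add_right algebra_simps)
 have LL: "L w = (t0 / t1) *\<^sub>R (e *\<^sub>R (w - (\<theta> \<bullet> w) *\<^sub>R \<theta>) + (t1 / t0 * (\<theta> \<bullet> w)) *\<^sub>R \<theta>)" for w
  using t by (simp add: L_def scaleR_add_right)
 have d0: "det (matrix v0) \<noteq> 0" using v0(3) by auto
 then obtain B where inv0: "matrix v0 ** B = mat 1" using invertible_det_nz[of "matrix v0"] unfolding invertible_def by blast
 define K where "K = B ** (matrix L ** matrix v1)"
 have "norm (K *v x) \<le> norm x" for x
 proof -
  have "v0 (K *v x) = L (v1 x)"
  proof -
   have "v0 (K *v x) = (matrix v0 ** K) *v x" unfolding matrix_linear[OF l0, of "K *v x", symmetric] by (rule matrix_vector_mul_assoc)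
   also have "matrix v0 ** K = matrix L ** matrix v1" unfolding K_def by (simp add: matrix_mul_assoc inv0)
   finally show ?thesis using matrix_linear[OF lL] matrix_linear[OF l1] by (simp flip: matrix_vector_mul_assoc)
  qed
  then have "(norm (K *v x))\<^sup>2 = pullback_metric M expo (t0 *\<^sub>R \<theta>) (L (v1 x)) (L (v1 x))"
   using v0(2)[of "K *v x" "K *v x"] by (simp add: power2_norm_eq_inner)
  also have "\<dots> = (t0 / t1)\<^sup>2 * pullback_metric M expo (t0 *\<^sub>R \<theta>) (e *\<^sub>R (v1 x - (\<theta> \<bullet> v1 x) *\<^sub>R \<theta>) + (t1 / t0 * (\<theta> \<bullet> v1 x)) *\<^sub>R \<theta>)
    (e *\<^sub>R (v1 x - (\<theta> \<bullet> v1 x) *\<^sub>R \<theta>) + (t1 / t0 * (\<theta> \<bullet> v1 x)) *\<^sub>R \<theta>)"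
   unfolding LL pullback_gram inner_scaleR_left matrix_vector_mult_scaleR inner_scaleR_right by (simp add: power2_eq_square)
  also have "\<dots> \<le> (1 / t1\<^sup>2) * (t1\<^sup>2 * pullback_metric M expo (t1 *\<^sub>R \<theta>) (v1 x) (v1 x))"
   using mult_left_mono[OF expo_growth[OF \<theta> t, of "v1 x", folded e_def], of "1 / t1\<^sup>2"] by (simp add: power_divide)
  also have "\<dots> = (norm x)\<^sup>2" using t v1(2)[of x x] by (simp add: power2_norm_eq_inner)
  finally show ?thesis by (rule power2_le_imp_le) simp
 qed
 then have "\<bar>det K\<bar> \<le> 1" by (rule det_contraction)
 moreover have "det (matrix v0) * det K = det (matrix L) * det (matrix v1)"
 proof -
  have "matrix v0 ** K = matrix L ** matrix v1" unfolding K_def by (simp add: matrix_mul_assoc inv0)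
  then show ?thesis by (metis det_mul)
 qed
 then have "\<bar>det (matrix v0)\<bar> * \<bar>det K\<bar> = \<bar>det (matrix L)\<bar> * \<bar>det (matrix v1)\<bar>" by (metis abs_mult)
 ultimately have 1: "\<bar>det (matrix L)\<bar> * \<bar>det (matrix v1)\<bar> \<le> \<bar>det (matrix v0)\<bar>"
  using mult_left_mono[of "\<bar>det K\<bar>" 1 "\<bar>det (matrix v0)\<bar>"] by simp
 have "\<bar>det (matrix L)\<bar> = (t0 / t1 * e) ^ (CARD('n) - 1)"
  unfolding L_def det_radial[OF \<theta>] using t by (simp add: e_def power_abs abs_mult)
 with 1 have "(t0 / t1 * e) ^ (CARD('n) - 1) * \<bar>det (matrix v1)\<bar> * (jac (t0 *\<^sub>R \<theta>) * jac (t1 *\<^sub>R \<theta>)) \<le> \<bar>det (matrix v0)\<bar> * (jac (t0 *\<^sub>R \<theta>) * jac (t1 *\<^sub>R \<theta>))"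
  using jac_pos[of "t0 *\<^sub>R \<theta>"] jac_pos[of "t1 *\<^sub>R \<theta>"] by (intro mult_right_mono) auto
 also have "\<dots> = (\<bar>det (matrix v0)\<bar> * jac (t0 *\<^sub>R \<theta>)) * jac (t1 *\<^sub>R \<theta>)" by simp
 also have "\<dots> = jac (t1 *\<^sub>R \<theta>)" unfolding v0(3) by simp
 also have "(t0 / t1 * e) ^ (CARD('n) - 1) * \<bar>det (matrix v1)\<bar> * (jac (t0 *\<^sub>R \<theta>) * jac (t1 *\<^sub>R \<theta>))
   = (t0 / t1 * e) ^ (CARD('n) - 1) * jac (t0 *\<^sub>R \<theta>) * (\<bar>det (matrix v1)\<bar> * jac (t1 *\<^sub>R \<theta>))" by (simp only: mult_ac)
 finally show ?thesis unfolding v1(3) e_def by simp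
qed

end

section \<open>Growth along rays\<close>

context riemannian_mfd
begin

lemma C1_function_continuous:
 assumes f: "C1_function M f"
 shows "continuous_on UNIV f"
 unfolding continuous_on_eq_continuous_at[OF open_UNIV]
proof
 fix p
 let ?C = "chart_at M p"
 note C = chartD[OF chart_at(1)[of p]]
 have "Ck_on (Suc 0) (chart_img ?C) (f \<circ> chart_inv ?C)" using f chart_at(1)[of p] by (simp add: C1_function_def)
 then have "continuous_on (chart_img ?C) (f \<circ> chart_inv ?C)"
  using C(2) by (intro continuous_at_imp_continuous_on ballI differentiable_imp_continuous_within) simp
 then have "continuous_on (chart_dom ?C) (\<lambda>p. (f \<circ> chart_inv ?C) (chart_map ?C p))"
  by (rule continuous_on_compose2[OF _ C(3)]) (use C(8) in auto)
 then have "continuous_on (chart_dom ?C) f" by (rule continuous_on_eq) (simp add: C(5))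
 then show "isCont f p" using continuous_on_eq_continuous_at[OF C(1)] chart_at(2) by blast
qed

text \<open>The derivative is the product of the gradient with the velocity, so Cauchy-Schwarz for
  the metric applies.\<close>

lemma gradient_bound:
 assumes f: "C1_function M f" and \<gamma>: "C1_at M \<gamma> t"
 obtains D where "((\<lambda>s. f (\<gamma> s)) has_real_derivative D) (at t)" "\<bar>D\<bar> \<le> gradient_norm M f (\<gamma> t) * speed M \<gamma> t"
proof -
 define C where "C = chart_at M (\<gamma> t)"
 have C: "C \<in> atlas M" "\<gamma> t \<in> chart_dom C" by (simp_all add: C_def chart_at)
 define x where "x = chart_map C (\<gamma> t)"
 have x: "x \<in> chart_img C" using chartD(8)[OF C] by (simp add: x_def)
 obtain d V where V: "0 < d" "\<And>s. \<bar>s - t\<bar> < d \<Longrightarrow> \<gamma> s \<in> chart_dom C"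
  "\<And>s. \<bar>s - t\<bar> < d \<Longrightarrow> ((chart_map C \<circ> \<gamma>) has_vector_derivative V s) (at s)" "\<And>s. \<bar>s - t\<bar> < d \<Longrightarrow> continuous (at s) \<gamma>"
  using C1_at_chart[OF \<gamma> C] by metis
 define w where "w = V t"
 have w: "((chart_map C \<circ> \<gamma>) has_vector_derivative w) (at t)" "continuous (at t) \<gamma>" using V(3,4)[of t] V(1) by (simp_all add: w_def)
 define p where "p = (\<chi> j. partial_deriv j (f \<circ> chart_inv C) x)"
 have "Ck_on (Suc 0) (chart_img C) (f \<circ> chart_inv C)" using f C(1) by (simp add: C1_function_def)
 then have "f \<circ> chart_inv C differentiable at x" using x by simp
 from has_derivative_partial[OF this]
 have df: "(f \<circ> chart_inv C has_derivative (\<lambda>h. p \<bullet> h)) (at ((chart_map C \<circ> \<gamma>) t))"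
  by (simp add: p_def inner_vec_def x_def mult.commute)
 have "((f \<circ> chart_inv C) \<circ> (chart_map C \<circ> \<gamma>) has_derivative (\<lambda>h. p \<bullet> h) \<circ> (\<lambda>r. r *\<^sub>R w)) (at t)"
  by (rule diff_chain_at[OF w(1)[unfolded has_vector_derivative_def] df])
 then have "((\<lambda>s. f (\<gamma> s)) has_derivative (\<lambda>h. p \<bullet> h) \<circ> (\<lambda>r. r *\<^sub>R w)) (at t)"
  by (rule has_derivative_transform_within_open[of _ _ _ _ "ball t d"])
    (use V(1,2) chartD(5)[OF C(1)] in \<open>auto simp: ball_real_abs simp del: mem_ball\<close>)
 then have D: "((\<lambda>s. f (\<gamma> s)) has_real_derivative p \<bullet> w) (at t)"
  unfolding has_field_derivative_def o_def by (simp add: mult.commute[of _ "p \<bullet> w"])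
 define v where "v = gradient M C f x"
 have "det (gmat M C x) \<noteq> 0" by (rule det_gmat_nz[OF C(1) x])
 then have "gmat M C x ** matrix_inv (gmat M C x) = mat 1" using invertible_det_nz matrix_mul_matrix_inv by blast
 then have "gmat M C x *v v = p" by (simp add: v_def gradient_def p_def matrix_vector_mul_assoc)
 then have "ginner M C x w v = p \<bullet> w" by (simp add: ginner_def inner_commute)
 then have "(p \<bullet> w)\<^sup>2 \<le> ginner M C x w w * ginner M C x v v" using ginner_cauchy_schwarz[OF C(1) x, of w v] by simp
 then have "\<bar>p \<bullet> w\<bar> \<le> sqrt (ginner M C x w w * ginner M C x v v)" by (metis real_sqrt_abs real_sqrt_le_iff)
 moreover have "gradient_norm M f (\<gamma> t) = sqrt (ginner M C x v v)"
  by (simp add: gradient_norm_def Let_def C_def[symmetric] x_def[symmetric] v_def[symmetric])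
 moreover have "speed M \<gamma> t = sqrt (ginner M C x w w)"
  unfolding x_def by (rule speed_chart[OF C w(2,1)])
 ultimately show ?thesis using that[OF D] by (simp add: real_sqrt_mult mult.commute)
qed

end

context exp_map
begin

text \<open>Along a ray of unit speed the derivative of \<open>f\<close> is at most
  \<open>\<kappa> * f\<close> in absolute value. Hence \<open>f\<close> times
  \<open>exp (\<kappa> * r)\<close> is nondecreasing and \<open>f\<close> times
  \<open>exp (- \<kappa> * r)\<close> is nonincreasing.\<close>

lemma ray_estimate:
 assumes f: "C1_function M f" "\<And>x. 0 \<le> f x" "\<And>x. gradient_norm M f x \<le> \<kappa> * f x"
  and \<theta>: "norm \<theta> = 1" and st: "0 \<le> s" "s \<le> t"
 shows "exp (- \<kappa> * (t - s)) * f (expo (s *\<^sub>R \<theta>)) \<le> f (expo (t *\<^sub>R \<theta>))" "f (expo (t *\<^sub>R \<theta>)) \<le> exp (\<kappa> * (t - s)) * f (expo (s *\<^sub>R \<theta>))"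
proof -
 define \<phi> where "\<phi> r = f (expo (r *\<^sub>R \<theta>))" for r
 have c: "continuous_on {s..t} \<phi>" unfolding \<phi>_def
  by (rule continuous_on_compose2[OF C1_function_continuous[OF f(1)] continuous_on_compose2[OF expo.cont]]) (auto intro!: continuous_intros)
 have D: "\<exists>D. (\<phi> has_real_derivative D) (at r) \<and> \<bar>D\<bar> \<le> \<kappa> * \<phi> r" if r: "0 < r" for r
 proof -
  obtain D where D: "((\<lambda>r. f (expo (r *\<^sub>R \<theta>))) has_real_derivative D) (at r)"
    "\<bar>D\<bar> \<le> gradient_norm M f (expo (r *\<^sub>R \<theta>)) * speed M (\<lambda>r. expo (r *\<^sub>R \<theta>)) r"
   by (rule gradient_bound[OF f(1) expo_ray_C1(1)[OF r, of \<theta>]])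
  then show ?thesis using f(3)[of "expo (r *\<^sub>R \<theta>)"] expo_ray_C1(2)[OF r, of \<theta>] \<theta> unfolding \<phi>_def[abs_def] by (intro exI[of _ D]) auto
 qed
 have "exp (\<kappa> * s) * \<phi> s \<le> exp (\<kappa> * t) * \<phi> t"
 \<comment> \<open>The derivative is available at positive times, whereas \<open>s\<close> may be 0;
   continuity covers the end points.\<close>
 proof (rule DERIV_nonneg_imp_increasing_open[OF st(2)])
  show "continuous_on {s..t} (\<lambda>r. exp (\<kappa> * r) * \<phi> r)" by (intro continuous_intros c)
  fix r assume r: "s < r" "r < t"
  then have "0 < r" using st by simp
  then obtain D where D: "(\<phi> has_real_derivative D) (at r)" "\<bar>D\<bar> \<le> \<kappa> * \<phi> r" using D by blast
  have "((\<lambda>r. exp (\<kappa> * r) * \<phi> r) has_real_derivative exp (\<kappa> * r) * (\<kappa> * \<phi> r + D)) (at r)"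
   by (auto intro!: derivative_eq_intros D(1) simp: algebra_simps)
  moreover have "0 \<le> exp (\<kappa> * r) * (\<kappa> * \<phi> r + D)" using D(2) by (intro mult_nonneg_nonneg) auto
  ultimately show "\<exists>y. ((\<lambda>r. exp (\<kappa> * r) * \<phi> r) has_real_derivative y) (at r) \<and> 0 \<le> y" by blast
 qed
 then have "exp (- (\<kappa> * t)) * (exp (\<kappa> * s) * \<phi> s) \<le> exp (- (\<kappa> * t)) * (exp (\<kappa> * t) * \<phi> t)" by (rule mult_left_mono) simp
 then show "exp (- \<kappa> * (t - s)) * f (expo (s *\<^sub>R \<theta>)) \<le> f (expo (t *\<^sub>R \<theta>))"
  unfolding \<phi>_def mult.assoc[symmetric] exp_add[symmetric] by (simp add: algebra_simps)
 have "exp (- \<kappa> * t) * \<phi> t \<le> exp (- \<kappa> * s) * \<phi> s"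
 proof (rule DERIV_nonpos_imp_decreasing_open[OF st(2)])
  show "continuous_on {s..t} (\<lambda>r. exp (- \<kappa> * r) * \<phi> r)" by (intro continuous_intros c)
  fix r assume r: "s < r" "r < t"
  then have "0 < r" using st by simp
  then obtain D where D: "(\<phi> has_real_derivative D) (at r)" "\<bar>D\<bar> \<le> \<kappa> * \<phi> r" using D by blast
  have "((\<lambda>r. exp (- \<kappa> * r) * \<phi> r) has_real_derivative exp (- \<kappa> * r) * (D - \<kappa> * \<phi> r)) (at r)"
   by (auto intro!: derivative_eq_intros D(1) simp: algebra_simps)
  moreover have "exp (- \<kappa> * r) * (D - \<kappa> * \<phi> r) \<le> 0" using D(2) by (intro mult_nonneg_nonpos) auto
  ultimately show "\<exists>y. ((\<lambda>r. exp (- \<kappa> * r) * \<phi> r) has_real_derivative y) (at r) \<and> y \<le> 0" by blast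
 qed
 then have "exp (\<kappa> * t) * (exp (- \<kappa> * t) * \<phi> t) \<le> exp (\<kappa> * t) * (exp (- \<kappa> * s) * \<phi> s)" by (rule mult_left_mono) simp
 then show "f (expo (t *\<^sub>R \<theta>)) \<le> exp (\<kappa> * (t - s)) * f (expo (s *\<^sub>R \<theta>))"
  unfolding \<phi>_def mult.assoc[symmetric] exp_add[symmetric] by (simp add: algebra_simps)
qed

end

section \<open>Monotonicity of the weighted Jacobian and growth of the mass\<close>

context hadamard_exp
begin

text \<open>Every point lies on a ray from \<open>q\<close>, and the upper bound of
  \<open>ray_estimate\<close> along it starts from the value 0.\<close>

lemma zero_spreads:
 assumes f: "C1_function M f" "\<And>x. 0 \<le> f x" "\<And>x. gradient_norm M f x \<le> \<kappa> * f x" and 0: "f q = 0"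
 shows "f x = 0"
proof -
 obtain \<xi> where \<xi>: "expo \<xi> = x" using expo_surj by blast
 show ?thesis
 proof (cases "\<xi> = 0")
  case True then show ?thesis using \<xi> 0 expo_0 by simp
 next
  case False
  then show ?thesis
   using ray_estimate(2)[OF f, of "\<xi> /\<^sub>R norm \<xi>" 0 "norm \<xi>"] f(2)[of x] 0 \<xi> by (simp add: expo_0)
 qed
qed

lemma expo_open: "open W \<Longrightarrow> open (expo ` W)"
proof (subst open_subopen, intro ballI)
 fix y assume W: "open W" and "y \<in> expo ` W"
 then obtain x where x: "x \<in> W" "y = expo x" by blast
 obtain U g where U: "open U" "x \<in> U" "open (expo ` U)" "continuous_on (expo ` U) g" "\<And>u. u \<in> U \<Longrightarrow> g (expo u) = u" using expo.loc[of x] by auto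
 have "open (expo ` U \<inter> g -` W)" by (rule continuous_open_preimage[OF U(4,3) W])
 moreover have "expo ` U \<inter> g -` W \<subseteq> expo ` W" using U(5) by auto
 moreover have "y \<in> expo ` U \<inter> g -` W" using x U(2,5) by auto
 ultimately show "\<exists>T. open T \<and> y \<in> T \<and> T \<subseteq> expo ` W" by blast
qed

text \<open>Phrased as a scaling of \<open>\<xi>\<close> by \<open>a\<close>, so that it can be
  integrated in Cartesian coordinates. With \<open>m = CARD('n) - 1\<close> and
  \<open>\<Delta>\<close> the increase of the radius, the Jacobian gains the factor
  \<open>exp (real m * c * \<Delta>) / a ^ m\<close>, and the power of \<open>f\<close> loses at
  most \<open>exp (- (real m * c * \<Delta>))\<close>.\<close>

lemma weighted_jac_growth:
 assumes f: "C1_function M f" "\<And>x. 0 < f x" "\<And>x. gradient_norm M f x \<le> (real CARD('n) - 1) * c / p * f x"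
  and sp: "1 \<le> s" "s \<le> p" and a: "1 \<le> a"
 shows "f (expo \<xi>) powr s * jac \<xi> \<le> a ^ (CARD('n) - 1) * (f (expo (a *\<^sub>R \<xi>)) powr s * jac (a *\<^sub>R \<xi>))"
proof (cases "\<xi> = 0")
 case True
 have "1 * (f (expo 0) powr s * jac 0) \<le> a ^ (CARD('n) - 1) * (f (expo 0) powr s * jac 0)"
  by (rule mult_right_mono) (use a jac_pos[of 0] in \<open>auto intro!: one_le_power mult_nonneg_nonneg\<close>)
 then show ?thesis using True by simp
next
 case False
 define \<theta> where "\<theta> = \<xi> /\<^sub>R norm \<xi>"
 define t where "t = norm \<xi>"
 have \<theta>: "norm \<theta> = 1" "\<xi> = t *\<^sub>R \<theta>" "a *\<^sub>R \<xi> = (a * t) *\<^sub>R \<theta>" and t: "0 < t" using False by (simp_all add: \<theta>_def t_def)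
 have tt: "t \<le> a * t" using a t by simp
 define m where "m = CARD('n) - 1"
 have CARD: "real CARD('n) - 1 = real m" unfolding m_def by (simp add: of_nat_diff Suc_leI)
 define \<kappa> where "\<kappa> = real m * c / p"
 define \<Delta> where "\<Delta> = a * t - t"
 have \<Delta>: "0 \<le> \<Delta>" using tt by (simp add: \<Delta>_def)
 have f0: "0 \<le> f x" for x using f(2)[of x] by simp
 have "exp (- \<kappa> * \<Delta>) * f (expo \<xi>) \<le> f (expo (a *\<^sub>R \<xi>))"
  using ray_estimate(1)[OF f(1) f0 f(3)[unfolded CARD] \<theta>(1) less_imp_le[OF t] tt] unfolding \<theta>(2,3)[symmetric] by (simp add: \<kappa>_def \<Delta>_def)
 then have "(exp (- \<kappa> * \<Delta>) * f (expo \<xi>)) powr s \<le> f (expo (a *\<^sub>R \<xi>)) powr s"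
  by (rule powr_mono2[rotated 2]) (use sp f0 in auto)
 moreover have "(exp (- \<kappa> * \<Delta>) * f (expo \<xi>)) powr s = exp (- \<kappa> * \<Delta> * s) * f (expo \<xi>) powr s"
  using f0 by (simp add: powr_mult exp_powr_real)
 moreover have "exp (- (real m * c * \<Delta>)) * f (expo \<xi>) powr s \<le> exp (- \<kappa> * \<Delta> * s) * f (expo \<xi>) powr s"
 proof (rule mult_right_mono)
  \<comment> \<open>Here the restriction \<open>s \<le> p\<close> enters.\<close>
  have "\<kappa> * s \<le> real m * c"
  proof -
   have "real m * c * s \<le> real m * c * p" by (rule mult_left_mono) (use sp c in auto)
   then show ?thesis using sp by (simp add: \<kappa>_def divide_le_eq)
  qed
  then have "\<kappa> * s * \<Delta> \<le> real m * c * \<Delta>" using \<Delta> by (rule mult_right_mono)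
  then show "exp (- (real m * c * \<Delta>)) \<le> exp (- \<kappa> * \<Delta> * s)" by (simp add: mult.commute mult.left_commute)
 qed simp
 ultimately have 1: "exp (- (real m * c * \<Delta>)) * f (expo \<xi>) powr s \<le> f (expo (a *\<^sub>R \<xi>)) powr s" by linarith
 have "(t / (a * t) * exp (c * \<Delta>)) ^ m * jac \<xi> \<le> jac (a *\<^sub>R \<xi>)"
  using jac_growth[OF \<theta>(1) t tt] unfolding \<theta>(2,3)[symmetric] m_def \<Delta>_def .
 moreover have "(t / (a * t) * exp (c * \<Delta>)) ^ m = exp (real m * c * \<Delta>) / a ^ m"
  using t a by (simp add: power_mult_distrib power_divide exp_of_nat_mult[symmetric] mult.assoc)
 ultimately have 2: "exp (real m * c * \<Delta>) / a ^ m * jac \<xi> \<le> jac (a *\<^sub>R \<xi>)" by simp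
 have "f (expo \<xi>) powr s * jac \<xi> = a ^ m * ((exp (- (real m * c * \<Delta>)) * f (expo \<xi>) powr s) * (exp (real m * c * \<Delta>) / a ^ m * jac \<xi>))"
 proof -
  have "exp (- (real m * c * \<Delta>)) * exp (real m * c * \<Delta>) = 1" by (simp add: exp_minus)
  moreover have "a ^ m \<noteq> 0" using a by simp
  ultimately show ?thesis by (simp add: field_simps)
 qed
 also have "\<dots> \<le> a ^ m * (f (expo (a *\<^sub>R \<xi>)) powr s * jac (a *\<^sub>R \<xi>))"
  by (intro mult_left_mono mult_mono 1 2) (use a jac_pos[of \<xi>] in auto)
 finally show ?thesis unfolding m_def .
qed

text \<open>Scaling the ball of radius \<open>a\<close> to the unit ball contributes
  \<open>a ^ CARD('n)\<close>; by \<open>weighted_jac_growth\<close> all but one of these factors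
  are used up, which leaves \<open>a\<close>. The constant \<open>K\<close> is the mass over the
  unit ball in exponential coordinates, positive because the integrand is.\<close>

lemma mass_growth:
 assumes f: "C1_function M f" "\<And>x. 0 < f x" "\<And>x. gradient_norm M f x \<le> (real CARD('n) - 1) * c / p * f x"
  and sp: "1 \<le> s" "s \<le> p"
 obtains K :: ennreal where "0 < K" "\<And>r. 1 \<le> r \<Longrightarrow> ennreal r * K \<le> (\<integral>\<^sup>+ x \<in> gball M q r. ennreal (f x powr s) \<partial>riemannian_measure M)"
proof -
 define \<Phi> where "\<Phi> \<xi> = f (expo \<xi>) powr s * jac \<xi>" for \<xi>
 have cf: "continuous_on UNIV f" by (rule C1_function_continuous[OF f(1)])
 have "continuous_on UNIV \<Phi>" unfolding \<Phi>_def
  by (intro continuous_on_mult continuous_jac continuous_on_powr continuous_on_compose2[OF cf expo.cont] continuous_on_const) (use f(2) in \<open>auto simp: less_imp_neq[symmetric]\<close>)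
 then have m\<Phi>: "\<Phi> \<in> borel_measurable borel" by (rule borel_measurable_continuous_onI)
 have \<Phi>pos: "0 < \<Phi> \<xi>" for \<xi> using f(2)[of "expo \<xi>"] jac_pos[of \<xi>] by (simp add: \<Phi>_def)
 define G where "G r = (\<integral>\<^sup>+\<xi>. ennreal (\<Phi> \<xi>) * indicator (ball 0 r) \<xi> \<partial>lborel)" for r
 have mG: "(\<lambda>\<xi>. ennreal (\<Phi> \<xi>) * indicator (ball 0 r) \<xi>) \<in> borel_measurable lborel" for r
 proof -
  have [measurable]: "ball (0 :: real^'n) r \<in> sets borel" by simp
  show ?thesis using m\<Phi> by measurable
 qed
 have grow: "ennreal a * G 1 \<le> G a" if a: "1 \<le> a" for a
 proof -
  have L: "(lborel :: (real^'n) measure) = density (distr lborel borel (\<lambda>x. 0 + a *\<^sub>R x)) (\<lambda>_. \<bar>a\<bar> ^ DIM(real^'n))"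
   by (rule lborel_affine) (use a in simp)
  let ?h = "\<lambda>\<xi>. ennreal (\<Phi> \<xi>) * indicator (ball 0 a) \<xi>"
  have mh: "?h \<in> borel_measurable borel" using mG by simp
  have sc: "(\<lambda>x. a *\<^sub>R x) \<in> borel_measurable (borel :: (real^'n) measure)" by simp
  have "G a = (\<integral>\<^sup>+\<xi>. ?h \<xi> \<partial>density (distr lborel borel (\<lambda>x. 0 + a *\<^sub>R x)) (\<lambda>_. \<bar>a\<bar> ^ DIM(real^'n)))"
   unfolding G_def using arg_cong[OF L, of "\<lambda>M. integral\<^sup>N M ?h"] .
  also have "\<dots> = (\<integral>\<^sup>+\<xi>. ennreal (\<bar>a\<bar> ^ DIM(real^'n)) * ?h \<xi> \<partial>distr lborel borel (\<lambda>x. 0 + a *\<^sub>R x))"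
   by (rule nn_integral_density) (use mh in auto)
  also have "\<dots> = (\<integral>\<^sup>+\<xi>. ennreal (\<bar>a\<bar> ^ DIM(real^'n)) * ?h (0 + a *\<^sub>R \<xi>) \<partial>lborel)"
   by (rule nn_integral_distr) (use mh sc in auto)
  also have "\<dots> \<ge> (\<integral>\<^sup>+\<xi>. ennreal a * (ennreal (\<Phi> \<xi>) * indicator (ball 0 1) \<xi>) \<partial>lborel)"
  proof (rule nn_integral_mono)
   fix \<xi> :: "real^'n"
   have ball: "a *\<^sub>R \<xi> \<in> ball 0 a \<longleftrightarrow> \<xi> \<in> ball 0 1" using a by simp
   have "a * \<Phi> \<xi> \<le> a * (a ^ (CARD('n) - 1) * \<Phi> (a *\<^sub>R \<xi>))"
    unfolding \<Phi>_def by (rule mult_left_mono[OF weighted_jac_growth[OF f sp a]]) (use a in simp)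
   also have "\<dots> = \<bar>a\<bar> ^ DIM(real^'n) * \<Phi> (a *\<^sub>R \<xi>)"
    using a power_Suc[of a "CARD('n) - 1"] by (simp add: mult.assoc[symmetric])
   finally have "ennreal (a * \<Phi> \<xi>) \<le> ennreal (\<bar>a\<bar> ^ DIM(real^'n) * \<Phi> (a *\<^sub>R \<xi>))" by (rule ennreal_leI)
   then have "ennreal a * ennreal (\<Phi> \<xi>) \<le> ennreal (\<bar>a\<bar> ^ DIM(real^'n)) * ennreal (\<Phi> (a *\<^sub>R \<xi>))"
    using a by (simp add: ennreal_mult')
   then show "ennreal a * (ennreal (\<Phi> \<xi>) * indicator (ball 0 1) \<xi>) \<le> ennreal (\<bar>a\<bar> ^ DIM(real^'n)) * ?h (0 + a *\<^sub>R \<xi>)"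
    using ball by (cases "\<xi> \<in> ball 0 1") (simp_all add: indicator_def del: mem_ball)
  qed
  also have "(\<integral>\<^sup>+\<xi>. ennreal a * (ennreal (\<Phi> \<xi>) * indicator (ball 0 1) \<xi>) \<partial>lborel) = ennreal a * G 1"
   unfolding G_def by (rule nn_integral_cmult[OF mG])
  finally show ?thesis .
 qed
 have "0 < G 1"
 proof (rule ccontr)
  assume "\<not> 0 < G 1"
  then have "G 1 = 0" by (simp add: zero_less_iff_neq_zero)
  then have "emeasure lborel {\<xi> \<in> space lborel. ennreal (\<Phi> \<xi>) * indicator (ball 0 1) \<xi> \<noteq> 0} = 0"
   unfolding G_def by (subst (asm) nn_integral_0_iff[OF mG])
  moreover have "{\<xi> \<in> space lborel. ennreal (\<Phi> \<xi>) * indicator (ball 0 1) \<xi> \<noteq> 0} = ball 0 1"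
   using \<Phi>pos by (auto simp: indicator_def ennreal_eq_0_iff not_le)
  ultimately have "ball (0::real^'n) 1 \<in> null_sets lborel" by (auto simp: null_sets_def)
  then have "negligible (ball (0::real^'n) 1)" by (simp add: negligible_iff_null_sets null_sets_completionI)
  then show False using open_not_negligible[of "ball (0::real^'n) 1"] by simp
 qed
 moreover have "ennreal r * G 1 \<le> (\<integral>\<^sup>+ x \<in> gball M q r. ennreal (f x powr s) \<partial>riemannian_measure M)" if r: "1 \<le> r" for r
 proof -
  \<comment> \<open>A radial geodesic has length \<open>norm \<xi>\<close>, so Euclidean balls are
    mapped into geodesic balls of the same radius; this inclusion gives the lower bound for the
    mass.\<close>
  have sub: "expo ` ball 0 r \<subseteq> gball M q r" using expo_rdist order_le_less_trans by (fastforce simp: gball_def)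
  have mf: "(\<lambda>x. ennreal (f x powr s) * indicator (expo ` ball 0 r) x) \<in> borel_measurable borel"
  proof -
   have [measurable]: "f \<in> borel_measurable borel" by (rule borel_measurable_continuous_onI[OF cf])
   have [measurable]: "expo ` ball 0 r \<in> sets borel" using expo_open[OF open_ball, of 0 r] by simp
   show ?thesis by measurable
  qed
  have ind: "indicator (expo ` ball 0 r) (expo \<xi>) = (indicator (ball 0 r) \<xi> :: ennreal)" for \<xi>
   using expo_inj[OF sc] by (auto simp: indicator_def inj_eq simp del: mem_ball)
  have "G r = (\<integral>\<^sup>+\<xi>. ennreal (jac \<xi>) * (ennreal (f (expo \<xi>) powr s) * indicator (expo ` ball 0 r) (expo \<xi>)) \<partial>lborel)"
   unfolding G_def ind
   by (rule nn_integral_cong) (simp add: \<Phi>_def ennreal_mult' mult.assoc[symmetric] mult.commute[of "ennreal (jac _)"])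
  also have "\<dots> = (\<integral>\<^sup>+\<xi>. ennreal (f (expo \<xi>) powr s) * indicator (expo ` ball 0 r) (expo \<xi>) \<partial>density lborel (\<lambda>\<xi>. ennreal (jac \<xi>)))"
   by (rule nn_integral_density[symmetric]) (use jac_measurable measurable_compose[OF expo_measurable mf] in auto)
  also have "\<dots> = (\<integral>\<^sup>+x. ennreal (f x powr s) * indicator (expo ` ball 0 r) x \<partial>vol)"
   unfolding vol_def by (rule nn_integral_distr[symmetric]) (use expo_measurable mf in auto)
  also have "\<dots> \<le> (\<integral>\<^sup>+x. ennreal (f x powr s) * indicator (gball M q r) x \<partial>vol)"
   by (rule nn_integral_mono) (use sub in \<open>auto simp: indicator_def\<close>)
  finally show ?thesis using grow[OF r] unfolding riemannian_measure_vol by simp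
 qed
 ultimately show ?thesis using that by blast
qed

end

text \<open>Since \<open>(r - d) / r\<close> tends to 1, a shift of the radius by \<open>d\<close>
  does not change the rate relative to \<open>r\<close>. The strict gap between \<open>y\<close> and
  an intermediate \<open>y'\<close> absorbs this factor for large \<open>r\<close>.\<close>

lemma Liminf_shift:
 fixes F F' :: "real \<Rightarrow> ennreal"
 assumes le: "\<And>r. F r \<le> F' (r + d)" and d: "0 \<le> d"
 shows "Liminf at_top (\<lambda>r. ennreal (inverse r) * F r) \<le> Liminf at_top (\<lambda>r. ennreal (inverse r) * F' r)"
 unfolding le_Liminf_iff
proof (intro allI impI)
 fix y assume "y < Liminf at_top (\<lambda>r. ennreal (inverse r) * F r)"
 then obtain y' where y': "y < y'" "y' < Liminf at_top (\<lambda>r. ennreal (inverse r) * F r)" using dense by blast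
 obtain b where b: "y' = ennreal b" "0 \<le> b" using y'(2) by (cases y') auto
 obtain a where a: "y = ennreal a" "0 \<le> a" "a < b" using y'(1) b by (cases y) (auto simp: ennreal_less_iff)
 obtain r0 where r0: "\<And>r. r0 \<le> r \<Longrightarrow> y' < ennreal (inverse r) * F r"
  using less_LiminfD[OF y'(2)] unfolding eventually_at_top_linorder by blast
 show "\<forall>\<^sub>F r in at_top. y < ennreal (inverse r) * F' r"
  \<comment> \<open>The last threshold is equivalent to \<open>a < (r - d) / r * b\<close> for
    positive \<open>r\<close>.\<close>
  using eventually_gt_at_top[of "r0 + d"] eventually_gt_at_top[of d] eventually_gt_at_top[of "d * b / (b - a)"]
 proof eventually_elim
  case (elim r)
  have r: "0 < r" "0 < r - d" using elim d by auto
  have "d * b < r * (b - a)" using elim(3) a(3) by (simp add: pos_divide_less_eq)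
  then have "a * r < (r - d) * b" by (simp add: algebra_simps)
  then have "a < (r - d) / r * b" using r by (simp add: pos_less_divide_eq)
  then have "y < ennreal ((r - d) / r) * y'"
   using a b r by (simp add: ennreal_mult'[symmetric] ennreal_lessI)
  also have "\<dots> \<le> ennreal ((r - d) / r) * (ennreal (inverse (r - d)) * F (r - d))"
   by (rule mult_left_mono) (use r0[of "r - d"] elim in auto)
  also have "\<dots> = ennreal ((r - d) / r * inverse (r - d)) * F (r - d)" using r by (subst ennreal_mult') (simp_all add: mult.assoc)
  also have "(r - d) / r * inverse (r - d) = inverse r" using r by (simp add: field_simps)
  also have "ennreal (inverse r) * F (r - d) \<le> ennreal (inverse r) * F' r"
   by (rule mult_left_mono) (use le[of "r - d"] in auto)
  finally show ?case .
 qed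
qed

text \<open>Two constant loops are freely homotopic, and the image of the homotopy is a connected
  set that contains both points.\<close>

lemma simply_connected_imp_connected_UNIV:
 assumes "simply_connected (UNIV :: 'a::topological_space set)"
 shows "connected (UNIV :: 'a set)"
proof (subst connected_iff_connected_component, intro ballI)
 fix x y :: 'a
 have "homotopic_loops UNIV (\<lambda>_. x) (\<lambda>_. y)"
  by (rule assms[unfolded simply_connected_def, rule_format]) (simp add: path_def pathstart_def pathfinish_def)
 then obtain h :: "real \<times> real \<Rightarrow> 'a" where h: "continuous_on ({0..1} \<times> {0..1}) h" "h (0, 0) = x" "h (1, 0) = y"
  unfolding homotopic_loops by auto
 have "connected (h ` ({0..1} \<times> {0..1}))"
  by (intro connected_continuous_image h(1) connected_Times) simp_all
 moreover have "x \<in> h ` ({0..1} \<times> {0..1})" "y \<in> h ` ({0..1} \<times> {0..1})"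
  using imageI[of "(0, 0)" "{0..1} \<times> {0..1}" h] imageI[of "(1, 0)" "{0..1} \<times> {0..1}" h] h(2,3) by simp_all
 ultimately show "connected_component UNIV x y" unfolding connected_component_def by blast
qed

text \<open>The independence of \<open>q\<close> concerns the growth rate of the integrals over
  balls; the normalizing factor \<open>lam q powr s\<close> itself varies with
  \<open>q\<close>.\<close>

theorem corollary1p4:
 fixes M :: "('a::{t2_space,second_countable_topology}, 'n::finite) riemannian"
  and lam :: "'a \<Rightarrow> real" and c p :: real
 assumes "hadamard_manifold M"
  and "c \<ge> 0"
  and "sectional_curvature_le M (- (c\<^sup>2))"
  and "p \<ge> 1"
  and "C1_function M lam"
  and "\<And>x. lam x \<ge> 0"
  and "\<And>x. gradient_norm M lam x \<le> (real CARD('n) - 1) * c / p * lam x"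
 shows "((\<forall>x. lam x = 0) \<or>
   (\<forall>s. 1 \<le> s \<and> s \<le> p \<longrightarrow>
    (\<forall>q. Liminf at_top (\<lambda>r::real. ennreal (inverse r / lam q powr s) *
        (\<integral>\<^sup>+ x \<in> gball M q r. ennreal (lam x powr s) \<partial>riemannian_measure M)) > 0) \<and>
    (\<forall>q q'. Liminf at_top (\<lambda>r::real. ennreal (inverse r) *
        (\<integral>\<^sup>+ x \<in> gball M q r. ennreal (lam x powr s) \<partial>riemannian_measure M)) =
       Liminf at_top (\<lambda>r::real. ennreal (inverse r) *
        (\<integral>\<^sup>+ x \<in> gball M q' r. ennreal (lam x powr s) \<partial>riemannian_measure M))))) \<and>
  ((\<forall>x. lam x = 0) \<or>
   (\<forall>s. 1 \<le> s \<and> s \<le> p \<longrightarrow>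
    (\<integral>\<^sup>+ x. ennreal (lam x powr s) \<partial>riemannian_measure M) = \<infinity>))"
proof (cases "\<forall>x. lam x = 0")
 case False
 have h: "riemannian_manifold M" "complete_riemannian M" "simply_connected (UNIV :: 'a set)"
  using assms(1) unfolding hadamard_manifold_def by auto
 interpret connected_riemannian_mfd M
  by unfold_locales (rule h(1), rule simply_connected_imp_connected_UNIV[OF h(3)])
 have frame: "\<exists>u. hadamard_exp M q u c" for q
 proof -
  let ?C = "chart_at M q"
  note C = chart_at(1)[of q] chartD(8)[OF chart_at(1) chart_at(2), of q]
  obtain u :: "real^'n \<Rightarrow> real^'n" where u: "bounded_linear u" "\<And>\<xi> \<eta>. ginner M ?C (chart_map ?C q) (u \<xi>) (u \<eta>) = \<xi> \<bullet> \<eta>"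
  proof (rule orthonormal_frame_exists[of "ginner M ?C (chart_map ?C q)"])
   show "linear (\<lambda>v. ginner M ?C (chart_map ?C q) v w)" for w by (rule linearI) (simp_all add: ginner_linear)
  qed (use ginner_sym[OF C] ginner_pos[OF C] in blast)+
  have "hadamard_exp M q u c"
   by (intro hadamard_exp.intro hadamard_exp_axioms.intro exp_map.intro exp_map_axioms.intro
    connected_riemannian_mfd_axioms h(2,3) u assms(2,3))
  then show ?thesis by blast
 qed
 \<comment> \<open>A single zero would spread over the whole manifold by
   \<open>zero_spreads\<close>, taken with the exponential map at that zero.\<close>
 have pos: "0 < lam x" for x
 proof (rule ccontr)
  assume "\<not> 0 < lam x"
  then have "lam x = 0" using assms(6)[of x] by simp
  then show False using frame[of x] hadamard_exp.zero_spreads[OF _ assms(5-7)] False by blast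
 qed
 define F where "F s q r = (\<integral>\<^sup>+ x \<in> gball M q r. ennreal (lam x powr s) \<partial>riemannian_measure M)" for s q r
 have mass: "\<exists>K::ennreal. 0 < K \<and> (\<forall>r\<ge>1. ennreal r * K \<le> F s q r)" if "1 \<le> s" "s \<le> p" for s q
 proof -
  obtain u where "hadamard_exp M q u c" using frame by blast
  then show ?thesis unfolding F_def by (rule hadamard_exp.mass_growth[OF _ assms(5) pos assms(7) that]) blast
 qed
 \<comment> \<open>One inequality for all pairs of centres; exchanging them gives equality.\<close>
 have shift: "Liminf at_top (\<lambda>r. ennreal (inverse r) * F s q r) \<le> Liminf at_top (\<lambda>r. ennreal (inverse r) * F s q' r)" for s q q'
 proof (rule Liminf_shift[where d="rdist M q' q"])
  fix r
  have "gball M q r \<subseteq> gball M q' (r + rdist M q' q)"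
  proof
   fix x assume "x \<in> gball M q r"
   then show "x \<in> gball M q' (r + rdist M q' q)" using rdist_triangle[of q' x q] by (simp add: gball_def)
  qed
  then show "F s q r \<le> F s q' (r + rdist M q' q)" unfolding F_def
   by (intro nn_integral_mono) (auto simp: indicator_def)
 qed (rule rdist_nonneg)
 have lim: "0 < Liminf at_top (\<lambda>r. ennreal (inverse r / lam q powr s) * F s q r)" if s: "1 \<le> s" "s \<le> p" for s q
 proof -
  obtain K :: ennreal where K: "0 < K" "\<And>r. 1 \<le> r \<Longrightarrow> ennreal r * K \<le> F s q r" using mass[OF s, of q] by blast
  have L: "0 < lam q powr s" using pos[of q] by simp
  \<comment> \<open>In the bound of \<open>mass_growth\<close> the factor \<open>r\<close> cancels
    against \<open>inverse r\<close>, which leaves a positive constant below the limit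
    inferior.\<close>
  have "ennreal (1 / lam q powr s) * K \<le> Liminf at_top (\<lambda>r. ennreal (inverse r / lam q powr s) * F s q r)"
  proof (rule Liminf_bounded)
   show "\<forall>\<^sub>F r in at_top. ennreal (1 / lam q powr s) * K \<le> ennreal (inverse r / lam q powr s) * F s q r"
    using eventually_ge_at_top[of 1]
   proof eventually_elim
    case (elim r)
    have "inverse r / lam q powr s * r = 1 / lam q powr s" using elim by simp
    then have "ennreal (1 / lam q powr s) * K = ennreal (inverse r / lam q powr s) * (ennreal r * K)"
     using elim L by (simp add: ennreal_mult'[symmetric] mult.assoc[symmetric])
    then show ?case using mult_left_mono[OF K(2)[OF elim], of "ennreal (inverse r / lam q powr s)"] by simp
   qed
  qed
  moreover have "0 < ennreal (1 / lam q powr s) * K" using L K(1) by (simp add: ennreal_zero_less_mult_iff)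
  ultimately show ?thesis by (rule order_less_le_trans[rotated])
 qed
 have inf: "(\<integral>\<^sup>+ x. ennreal (lam x powr s) \<partial>riemannian_measure M) = \<infinity>" (is "?I = _") if s: "1 \<le> s" "s \<le> p" for s
 proof (rule ccontr)
  fix q :: 'a
  assume fin: "?I \<noteq> \<infinity>"
  obtain K :: ennreal where K: "0 < K" "\<And>r. 1 \<le> r \<Longrightarrow> ennreal r * K \<le> F s q r" using mass[OF s, of q] by blast
  have le: "ennreal r * K \<le> ?I" if "1 \<le> r" for r
   using K(2)[OF that] unfolding F_def by (rule order_trans) (auto intro!: nn_integral_mono simp: indicator_def)
  obtain i where i: "?I = ennreal i" "0 \<le> i" using fin by (cases ?I) auto
  obtain k where k: "K = ennreal k" "0 < k" using le[of 1] K(1) unfolding i(1) by (cases K) (auto simp: top_unique)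
  \<comment> \<open>A radius at which the lower bound is at least \<open>i + 1\<close>, more than
    the supposed finite value \<open>i\<close>.\<close>
  have "max 1 ((i + 1) / k) * k \<le> i"
   using le[of "max 1 ((i + 1) / k)"] i k by (simp add: ennreal_mult'[symmetric])
  moreover have "(i + 1) / k * k \<le> max 1 ((i + 1) / k) * k" by (rule mult_right_mono) (use k in auto)
  ultimately show False using k by simp
 qed
 show ?thesis
  using lim shift inf unfolding F_def by (intro conjI disjI2 allI impI) (auto intro: antisym)
qed simp

end
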